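(* Let $(D;A,B;M)_C$ be a double vector bundle with core $C$, and let $(D^\star A;A,C^*;M)_{B^*}$ be its dual over $A$ (a double vector bundle with sides $A$, $C^*$ and core $B^*$). Then the associated DVB$^*$ sequences $$0\to A^*\otimes B^*\xrightarrow{i}\mathfrak X(D)\xrightarrow{j}C^*\to0\qquad\text{and}\qquad 0\to A^*\otimes C\xrightarrow{i_1}\mathfrak X(D^\star A)\xrightarrow{j_1}B\to0$$ of $D$ and of $D^\star A$ respectively are in $A^*$-duality.
   Context: All manifolds and vector bundles are smooth, real, of finite dimension/rank. Double vector bundle: a double vector bundle $(D;A,B;M)$ consists of vector bundles $q_A:A\to M$, $q_B:B\to M$ and a manifold $D$ with two vector bundle structures $q^D_A:D\to A$ (operations $+_A,\cdot_A$, zero $\tilde0^A_a$ over $a$) and $q^D_B:D\to B$ (operations $+_B,\cdot_B$, zero $\tilde0^B_b$ over $b$), with $q_A\circ q^D_A=q_B\circ q^D_B$, such that each of the structure maps (bundle projection, zero section, addition, scalar multiplication) of each vector bundle structure on $D$ is a morphism of vector bundles with respect to the other structures. The slice at $m\in M$ is $D_m=(q^D_A)^{-1}(A_m)=(q^D_B)^{-1}(B_m)$. The core $C=\{c\in D:\exists m,\ q^D_A(c)=0^A_m,\ q^D_B(c)=0^B_m\}$ is a vector bundle over $M$ (the two linear structures of $D$ coincide on it); $c\in C$ viewed in $D$ is written $\overline c$. Dual over $A$: $D^\star A$ is the usual dual of the vector bundle $D\to A$, with projection $q^{\star A}_A:D^\star A\to A$. It is a double vector bundle $(D^\star A;A,C^*;M)_{B^*}$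 with second projection $q^{\star A}_{C^*}$ given by $\langle q^{\star A}_{C^*}(\Phi),c\rangle=\langle\Phi,\tilde0^A_a+_B\overline c\rangle$ for $\Phi$ over $a\in A_m$, $c\in C_m$; addition over $C^*$ given by $\langle\Phi+_{C^*}\Phi',d+_Bd'\rangle=\langle\Phi,d\rangle+\langle\Phi',d'\rangle$ for $\Phi,\Phi'$ over $a,a'$ with the same image in $C^*$ and $d,d'\in D$ over $a,a'$ with the same image in $B$; scalar multiplication $\langle r\cdot_{C^*}\Phi,d\rangle=r\langle\Phi,\tfrac1r\cdot_Bd\rangle$ for $r\ne0$; zero over $\chi\in C^*_m$ given by $\langle\tilde0^{\star A,C^*}_\chi,\tilde0^B_b+_A\overline c\rangle=\langle\chi,c\rangle$. The core is $B^*$: $\psi\in B^*_m$ corresponds to $\overline\psi$ with $\langle\overline\psi,\tilde0^B_b+_A\overline c\rangle=\langle\psi,b\rangle$. Associated DVB$^*$ sequence: a function $\sigma:D_m\to\mathbb R$ is double-linear if $\sigma(d_1+_Ad_2)=\sigma(d_1)+\sigma(d_2)$ whenever $q^D_A(d_1)=q^D_A(d_2)$, $\sigma(d_3+_Bd_4)=\sigma(d_3)+\sigma(d_4)$ whenever $q^D_B(d_3)=q^D_B(d_4)$, and $\sigma(r\cdot_Ad)=\sigma(r\cdot_Bd)=r\sigma(d)$. $\mathfrak X(D)_m$ is the space of double-linear functions on $D_m$ and $\mathfrak X(D)=\bigcup_m\mathfrak X(D)_m$. The associated DVB$^*$ sequence of $(D;A,B;M)_C$ is the exact sequence $0\to A^*\otimes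 B^*\xrightarrow{i}\mathfrak X(D)\xrightarrow{j}C^*\to0$, with $i(\theta)(d)=\langle\theta,q^D_A(d)\otimes q^D_B(d)\rangle$ and $\langle j(\sigma),c\rangle=\sigma(\overline c)$. The maps $i_1,j_1$ are the corresponding maps for the double vector bundle $D^\star A$ (using $(C^* )^*=C$, $(B^* )^*=B$). Duality: sequences $0\to U\otimes V\xrightarrow{i}\Pi\xrightarrow{j}K\to0$ and $0\to U\otimes K^*\xrightarrow{e}\Delta\xrightarrow{p}V^*\to0$ of vector bundles over $M$ are in $U$-duality if there is a bilinear pairing $\{\cdot,\cdot\}_U:\Delta\times_M\Pi\to U$ with $\{\epsilon,i(\theta)\}_U=p(\epsilon)\lrcorner\,\theta$ for $\epsilon\in\Delta,\theta\in U\otimes V$, and $\{e(\kappa),\sigma\}_U=j(\sigma)\lrcorner\,\kappa$ for $\sigma\in\Pi,\kappa\in U\otimes K^*$, where $\lrcorner$ is contraction. Here $U=A^*$, $V=B^*$, $K=C^*$. *)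

theory Defs
  imports "HOL-Analysis.Analysis"
begin

section \<open>Smooth functions on open subsets of Euclidean space\<close>

text \<open>A point of n-dimensional Euclidean space is a point of the library space
  \<open>Euclidean_space n\<close>: a sequence vanishing from index \<open>n\<close> on.  In this way the dimension is a
  natural number, and the value 0 is allowed.\<close>

type_synonym coord = "nat \<Rightarrow> real"

primrec Ck_on :: "nat \<Rightarrow> nat \<Rightarrow> coord set \<Rightarrow> (coord \<Rightarrow> real) \<Rightarrow> bool" where
  "Ck_on n 0 S f \<longleftrightarrow> continuous_map (subtopology (Euclidean_space n) S) euclideanreal f"
| "Ck_on n (Suc k) S f \<longleftrightarrow>
     continuous_map (subtopology (Euclidean_space n) S) euclideanreal f \<and>
     (\<forall>i<n. \<exists>g. Ck_on n k S g \<and>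
        (\<forall>u\<in>S. ((\<lambda>t. f (u(i := t))) has_real_derivative g u) (at (u i))))"

definition coord_smooth :: "nat \<Rightarrow> coord set \<Rightarrow> (coord \<Rightarrow> coord) \<Rightarrow> bool" where
  "coord_smooth n S f \<longleftrightarrow> (\<forall>k j. Ck_on n k S (\<lambda>u. f u j))"


section \<open>Smooth manifolds and smooth maps\<close>

text \<open>A manifold is given by an atlas; a chart \<open>(U, n, x)\<close> has domain \<open>U\<close> and maps it by \<open>x\<close>
  onto an open subset of \<open>Euclidean_space n\<close>.  The atlas need not be maximal.  The
  dimension is recorded chart by chart, so it is constant on connected components only.\<close>

type_synonym 'a atlas = "('a set \<times> nat \<times> ('a \<Rightarrow> coord)) set"

definition pts :: "'a atlas \<Rightarrow> 'a set" where
  "pts M = \<Union> (fst ` M)"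

definition mtop :: "'a atlas \<Rightarrow> 'a topology" where
  "mtop M = topology (\<lambda>W. W \<subseteq> pts M \<and>
     (\<forall>(U, n, x) \<in> M. openin (Euclidean_space n) (x ` (U \<inter> W))))"

definition second_countable_top :: "'a topology \<Rightarrow> bool" where
  "second_countable_top X \<longleftrightarrow> (\<exists>\<B>. countable \<B> \<and> (\<forall>V\<in>\<B>. openin X V) \<and>
     (\<forall>W p. openin X W \<and> p \<in> W \<longrightarrow> (\<exists>V\<in>\<B>. p \<in> V \<and> V \<subseteq> W)))"

definition smooth_manifold :: "'a atlas \<Rightarrow> bool" where
  "smooth_manifold M \<longleftrightarrow>
     (\<forall>(U, n, x) \<in> M. inj_on x U \<and> openin (Euclidean_space n) (x ` U)) \<and>
     (\<forall>(U, n, x) \<in> M. \<forall>(V, k, y) \<in> M.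
        openin (Euclidean_space n) (x ` (U \<inter> V)) \<and>
        coord_smooth n (x ` (U \<inter> V)) (\<lambda>u. y (inv_into U x u))) \<and>
     Hausdorff_space (mtop M) \<and> second_countable_top (mtop M)"

definition smooth_at :: "'a atlas \<Rightarrow> ('a \<Rightarrow> 'b) \<Rightarrow> 'b atlas \<Rightarrow> 'a \<Rightarrow> bool" where
  "smooth_at M f N p \<longleftrightarrow>
     (\<exists>(U, n, x) \<in> M. \<exists>(V, k, y) \<in> N. \<exists>W. openin (mtop M) W \<and> p \<in> W \<and> W \<subseteq> U \<and> f ` W \<subseteq> V \<and>
        coord_smooth n (x ` W) (\<lambda>u. y (f (inv_into U x u))))"

text \<open>Smoothness on an arbitrary subset: local extendability to a smooth map.  For open
  subsets this is ordinary smoothness; it is also applied to embedded submanifolds such as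
  fibre products.\<close>

definition smooth_on :: "'a atlas \<Rightarrow> 'a set \<Rightarrow> ('a \<Rightarrow> 'b) \<Rightarrow> 'b atlas \<Rightarrow> bool" where
  "smooth_on M S f N \<longleftrightarrow>
     (\<forall>p\<in>S. \<exists>F W. smooth_at M F N p \<and> openin (mtop M) W \<and> p \<in> W \<and> (\<forall>q \<in> S \<inter> W. F q = f q))"

definition coord_append :: "nat \<Rightarrow> coord \<Rightarrow> coord \<Rightarrow> coord" where
  "coord_append n u v = (\<lambda>i. if i < n then u i else v (i - n))"

definition prod_manifold :: "'a atlas \<Rightarrow> 'b atlas \<Rightarrow> ('a \<times> 'b) atlas" where
  "prod_manifold M N =
     {(U \<times> V, n + k, \<lambda>(p, q). coord_append n (x p) (y q)) | U n x V k y.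
        (U, n, x) \<in> M \<and> (V, k, y) \<in> N}"

definition coord_space :: "nat \<Rightarrow> coord atlas" where
  "coord_space n = {(topspace (Euclidean_space n), n, \<lambda>u. u)}"

definition real_line :: "real atlas" where
  "real_line = {(UNIV, 1, \<lambda>t i. if i = 0 then t else 0)}"

definition diffeo_on :: "'a atlas \<Rightarrow> 'a set \<Rightarrow> ('a \<Rightarrow> 'b) \<Rightarrow> 'b atlas \<Rightarrow> 'b set \<Rightarrow> bool" where
  "diffeo_on M S f N T \<longleftrightarrow>
     bij_betw f S T \<and> smooth_on M S f N \<and> smooth_on N T (inv_into S f) M"


section \<open>Vector bundles\<close>

definition vector_space_laws ::
    "'e set \<Rightarrow> ('e \<Rightarrow> 'e \<Rightarrow> 'e) \<Rightarrow> (real \<Rightarrow> 'e \<Rightarrow> 'e) \<Rightarrow> 'e \<Rightarrow> bool" where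
  "vector_space_laws V pl sc z \<longleftrightarrow>
     z \<in> V \<and> (\<forall>x\<in>V. \<forall>y\<in>V. pl x y \<in> V) \<and> (\<forall>r. \<forall>x\<in>V. sc r x \<in> V) \<and>
     (\<forall>x\<in>V. \<forall>y\<in>V. \<forall>w\<in>V. pl (pl x y) w = pl x (pl y w)) \<and>
     (\<forall>x\<in>V. \<forall>y\<in>V. pl x y = pl y x) \<and>
     (\<forall>x\<in>V. pl z x = x) \<and> (\<forall>x\<in>V. pl x (sc (- 1) x) = z) \<and>
     (\<forall>x\<in>V. sc 1 x = x) \<and> (\<forall>r s. \<forall>x\<in>V. sc r (sc s x) = sc (r * s) x) \<and>
     (\<forall>r s. \<forall>x\<in>V. sc (r + s) x = pl (sc r x) (sc s x)) \<and>
     (\<forall>r. \<forall>x\<in>V. \<forall>y\<in>V. sc r (pl x y) = pl (sc r x) (sc r y))"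

record ('e, 'm) vbundle =
  tot :: "'e atlas"
  base :: "'m atlas"
  proj :: "'e \<Rightarrow> 'm"
  add :: "'e \<Rightarrow> 'e \<Rightarrow> 'e"
  scl :: "real \<Rightarrow> 'e \<Rightarrow> 'e"
  zer :: "'m \<Rightarrow> 'e"

definition fibre :: "('e, 'm) vbundle \<Rightarrow> 'm \<Rightarrow> 'e set" where
  "fibre E m = {e \<in> pts (tot E). proj E e = m}"

definition over_set :: "('e, 'm) vbundle \<Rightarrow> 'm set \<Rightarrow> 'e set" where
  "over_set E W = {e \<in> pts (tot E). proj E e \<in> W}"

definition local_trivialisation ::
    "('e, 'm) vbundle \<Rightarrow> 'm set \<Rightarrow> nat \<Rightarrow> ('e \<Rightarrow> coord) \<Rightarrow> bool" where
  "local_trivialisation E W k T \<longleftrightarrow>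
     openin (mtop (base E)) W \<and>
     diffeo_on (tot E) (over_set E W) (\<lambda>e. (proj E e, T e))
       (prod_manifold (base E) (coord_space k)) (W \<times> topspace (Euclidean_space k)) \<and>
     (\<forall>m\<in>W. \<forall>e \<in> fibre E m. \<forall>e' \<in> fibre E m. T (add E e e') = (\<lambda>i. T e i + T e' i)) \<and>
     (\<forall>m\<in>W. \<forall>e \<in> fibre E m. \<forall>r. T (scl E r e) = (\<lambda>i. r * T e i))"

definition vector_bundle :: "('e, 'm) vbundle \<Rightarrow> bool" where
  "vector_bundle E \<longleftrightarrow>
     smooth_manifold (base E) \<and> smooth_manifold (tot E) \<and>
     smooth_on (tot E) (pts (tot E)) (proj E) (base E) \<and>
     (\<forall>m \<in> pts (base E). vector_space_laws (fibre E m) (add E) (scl E) (zer E m)) \<and>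
     (\<forall>m \<in> pts (base E). \<exists>W k T. m \<in> W \<and> local_trivialisation E W k T)"

definition vb_morphism ::
    "('e, 'm) vbundle \<Rightarrow> ('f, 'n) vbundle \<Rightarrow> ('e \<Rightarrow> 'f) \<Rightarrow> ('m \<Rightarrow> 'n) \<Rightarrow> bool" where
  "vb_morphism E F \<Phi> f \<longleftrightarrow>
     smooth_on (tot E) (pts (tot E)) \<Phi> (tot F) \<and> smooth_on (base E) (pts (base E)) f (base F) \<and>
     (\<forall>e \<in> pts (tot E). proj F (\<Phi> e) = f (proj E e)) \<and>
     (\<forall>m \<in> pts (base E). \<forall>e \<in> fibre E m. \<forall>e' \<in> fibre E m.
        \<Phi> (add E e e') = add F (\<Phi> e) (\<Phi> e')) \<and>
     (\<forall>e \<in> pts (tot E). \<forall>r. \<Phi> (scl E r e) = scl F r (\<Phi> e))"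

definition short_exact ::
    "('e, 'm) vbundle \<Rightarrow> ('f, 'm) vbundle \<Rightarrow> ('g, 'm) vbundle \<Rightarrow> ('e \<Rightarrow> 'f) \<Rightarrow> ('f \<Rightarrow> 'g) \<Rightarrow> bool"
  where
  "short_exact E F G i j \<longleftrightarrow>
     vector_bundle E \<and> vector_bundle F \<and> vector_bundle G \<and> base E = base F \<and> base F = base G \<and>
     vb_morphism E F i (\<lambda>m. m) \<and> vb_morphism F G j (\<lambda>m. m) \<and>
     inj_on i (pts (tot E)) \<and>
     i ` pts (tot E) = {\<sigma> \<in> pts (tot F). j \<sigma> = zer G (proj F \<sigma>)} \<and>
     j ` pts (tot F) = pts (tot G)"


section \<open>Bundles determined by their smooth local sections\<close>

text \<open>Given a set \<open>P\<close> fibred in vector spaces over \<open>M\<close> and a notion \<open>sec W s\<close> of smooth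
  section over an open set, the smooth structure on \<open>P\<close> is the one for which the local
  frames of smooth sections give the local trivialisations: its charts send \<open>e\<close> to the
  coordinates of the base point followed by the coefficients of \<open>e\<close> in the frame.\<close>

primrec lin_comb ::
    "('e \<Rightarrow> 'e \<Rightarrow> 'e) \<Rightarrow> (real \<Rightarrow> 'e \<Rightarrow> 'e) \<Rightarrow> 'e \<Rightarrow> nat \<Rightarrow> coord \<Rightarrow> (nat \<Rightarrow> 'e) \<Rightarrow> 'e" where
  "lin_comb pl sc z 0 c s = z"
| "lin_comb pl sc z (Suc k) c s = pl (lin_comb pl sc z k c s) (sc (c k) (s k))"

definition local_frame ::
    "'m atlas \<Rightarrow> 'e set \<Rightarrow> ('e \<Rightarrow> 'm) \<Rightarrow> ('e \<Rightarrow> 'e \<Rightarrow> 'e) \<Rightarrow> (real \<Rightarrow> 'e \<Rightarrow> 'e) \<Rightarrow> ('m \<Rightarrow> 'e) \<Rightarrow>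
     ('m set \<Rightarrow> ('m \<Rightarrow> 'e) \<Rightarrow> bool) \<Rightarrow> 'm set \<Rightarrow> nat \<Rightarrow> (nat \<Rightarrow> 'm \<Rightarrow> 'e) \<Rightarrow> bool" where
  "local_frame M P q pl sc z sec W k s \<longleftrightarrow>
     openin (mtop M) W \<and>
     (\<forall>i<k. sec W (s i) \<and> (\<forall>m\<in>W. s i m \<in> P \<and> q (s i m) = m)) \<and>
     (\<forall>e\<in>P. q e \<in> W \<longrightarrow>
        (\<exists>!c. c \<in> topspace (Euclidean_space k) \<and>
              e = lin_comb pl sc (z (q e)) k c (\<lambda>i. s i (q e))))"

definition frame_atlas ::
    "'m atlas \<Rightarrow> 'e set \<Rightarrow> ('e \<Rightarrow> 'm) \<Rightarrow> ('e \<Rightarrow> 'e \<Rightarrow> 'e) \<Rightarrow> (real \<Rightarrow> 'e \<Rightarrow> 'e) \<Rightarrow> ('m \<Rightarrow> 'e) \<Rightarrow>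
     ('m set \<Rightarrow> ('m \<Rightarrow> 'e) \<Rightarrow> bool) \<Rightarrow> 'e atlas" where
  "frame_atlas M P q pl sc z sec =
     {({e \<in> P. q e \<in> U \<inter> W}, n + k,
       \<lambda>e. coord_append n (x (q e))
             (THE c. c \<in> topspace (Euclidean_space k) \<and>
                     e = lin_comb pl sc (z (q e)) k c (\<lambda>i. s i (q e))))
      | U n x W k s. (U, n, x) \<in> M \<and> local_frame M P q pl sc z sec W k s}"

definition frame_bundle ::
    "'m atlas \<Rightarrow> 'e set \<Rightarrow> ('e \<Rightarrow> 'm) \<Rightarrow> ('e \<Rightarrow> 'e \<Rightarrow> 'e) \<Rightarrow> (real \<Rightarrow> 'e \<Rightarrow> 'e) \<Rightarrow> ('m \<Rightarrow> 'e) \<Rightarrow>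
     ('m set \<Rightarrow> ('m \<Rightarrow> 'e) \<Rightarrow> bool) \<Rightarrow> ('e, 'm) vbundle" where
  "frame_bundle M P q pl sc z sec =
     \<lparr>tot = frame_atlas M P q pl sc z sec, base = M, proj = q, add = pl, scl = sc, zer = z\<rparr>"

text \<open>Bundles whose fibre over \<open>m\<close> is a space \<open>\<F> m\<close> of real functions on the fibre over \<open>m\<close> of
  \<open>\<pi> : S \<rightarrow> M\<close>, where \<open>S\<close> is a subset of a manifold \<open>N\<close>.  An element is a pair \<open>(m, \<phi>)\<close> with \<open>\<phi>\<close>
  set to 0 off its domain.  A section is smooth if the function on (a part of) \<open>S\<close> that it
  defines is smooth.\<close>

definition fun_bundle ::
    "'m atlas \<Rightarrow> 'x atlas \<Rightarrow> 'x set \<Rightarrow> ('x \<Rightarrow> 'm) \<Rightarrow> ('m \<Rightarrow> ('x \<Rightarrow> real) set) \<Rightarrow>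
     ('m \<times> ('x \<Rightarrow> real), 'm) vbundle" where
  "fun_bundle M N S \<pi> \<F> =
     frame_bundle M
       {(m, \<phi>). m \<in> pts M \<and> \<phi> \<in> \<F> m \<and> (\<forall>x. x \<notin> S \<or> \<pi> x \<noteq> m \<longrightarrow> \<phi> x = 0)}
       fst
       (\<lambda>p p'. (fst p, \<lambda>x. snd p x + snd p' x))
       (\<lambda>r p. (fst p, \<lambda>x. r * snd p x))
       (\<lambda>m. (m, \<lambda>x. 0))
       (\<lambda>W s. smooth_on N {x \<in> S. \<pi> x \<in> W} (\<lambda>x. snd (s (\<pi> x)) x) real_line)"

definition dual :: "('e, 'm) vbundle \<Rightarrow> ('m \<times> ('e \<Rightarrow> real), 'm) vbundle" where
  "dual E = fun_bundle (base E) (tot E) (pts (tot E)) (proj E)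
     (\<lambda>m. {\<phi>. (\<forall>e \<in> fibre E m. \<forall>e' \<in> fibre E m. \<phi> (add E e e') = \<phi> e + \<phi> e') \<and>
              (\<forall>e \<in> fibre E m. \<forall>r. \<phi> (scl E r e) = r * \<phi> e)})"

definition bidual_map :: "('e, 'm) vbundle \<Rightarrow> 'e \<Rightarrow> 'm \<times> ('m \<times> ('e \<Rightarrow> real) \<Rightarrow> real)" where
  "bidual_map E e =
     (proj E e, \<lambda>\<omega>. if \<omega> \<in> fibre (dual E) (proj E e) then snd \<omega> e else 0)"

definition fibre_product :: "('e, 'm) vbundle \<Rightarrow> ('f, 'm) vbundle \<Rightarrow> ('e \<times> 'f) set" where
  "fibre_product E F = {(e, f). e \<in> pts (tot E) \<and> f \<in> pts (tot F) \<and> proj E e = proj F f}"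

text \<open>The tensor product of \<open>U\<close> and \<open>V\<close>, with fibres the bilinear forms on the fibres of
  \<open>dual U\<close> and \<open>dual V\<close>; the tensor of \<open>u\<close> and \<open>v\<close> is the form that sends \<open>(\<omega>, \<eta>)\<close> to
  \<open>\<omega> u * \<eta> v\<close>.\<close>

definition tensor ::
    "('u, 'm) vbundle \<Rightarrow> ('v, 'm) vbundle \<Rightarrow>
     ('m \<times> (('m \<times> ('u \<Rightarrow> real)) \<times> ('m \<times> ('v \<Rightarrow> real)) \<Rightarrow> real), 'm) vbundle" where
  "tensor U V =
     fun_bundle (base U) (prod_manifold (tot (dual U)) (tot (dual V)))
       (fibre_product (dual U) (dual V)) (\<lambda>p. fst (fst p))
       (\<lambda>m. {\<theta>.
          (\<forall>\<omega> \<in> fibre (dual U) m. \<forall>\<omega>' \<in> fibre (dual U) m. \<forall>\<eta> \<in> fibre (dual V) m.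
             \<theta> (add (dual U) \<omega> \<omega>', \<eta>) = \<theta> (\<omega>, \<eta>) + \<theta> (\<omega>', \<eta>)) \<and>
          (\<forall>\<omega> \<in> fibre (dual U) m. \<forall>\<eta> \<in> fibre (dual V) m. \<forall>\<eta>' \<in> fibre (dual V) m.
             \<theta> (\<omega>, add (dual V) \<eta> \<eta>') = \<theta> (\<omega>, \<eta>) + \<theta> (\<omega>, \<eta>')) \<and>
          (\<forall>\<omega> \<in> fibre (dual U) m. \<forall>\<eta> \<in> fibre (dual V) m. \<forall>r.
             \<theta> (scl (dual U) r \<omega>, \<eta>) = r * \<theta> (\<omega>, \<eta>) \<and>
             \<theta> (\<omega>, scl (dual V) r \<eta>) = r * \<theta> (\<omega>, \<eta>))})"

text \<open>Contraction of \<open>\<theta>\<close> in \<open>tensor U V\<close> with \<open>v\<close> in \<open>dual V\<close>; the result is in \<open>U\<close>.\<close>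

definition contract ::
    "('u, 'm) vbundle \<Rightarrow> 'm \<times> ('v \<Rightarrow> real) \<Rightarrow>
     'm \<times> (('m \<times> ('u \<Rightarrow> real)) \<times> ('m \<times> ('v \<Rightarrow> real)) \<Rightarrow> real) \<Rightarrow> 'u" where
  "contract U v \<theta> =
     (THE u. u \<in> fibre U (fst \<theta>) \<and> (\<forall>\<omega> \<in> fibre (dual U) (fst \<theta>). snd \<omega> u = snd \<theta> (\<omega>, v)))"


section \<open>Sequences in duality\<close>

definition bilinear_pairing ::
    "('e, 'm) vbundle \<Rightarrow> ('f, 'm) vbundle \<Rightarrow> ('u, 'm) vbundle \<Rightarrow> ('e \<Rightarrow> 'f \<Rightarrow> 'u) \<Rightarrow> bool" where
  "bilinear_pairing Y X U \<beta> \<longleftrightarrow>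
     smooth_on (prod_manifold (tot Y) (tot X)) (fibre_product Y X) (\<lambda>(\<epsilon>, \<sigma>). \<beta> \<epsilon> \<sigma>) (tot U) \<and>
     (\<forall>m \<in> pts (base U). \<forall>\<epsilon> \<in> fibre Y m. \<forall>\<sigma> \<in> fibre X m.
        \<beta> \<epsilon> \<sigma> \<in> fibre U m \<and>
        (\<forall>\<epsilon>' \<in> fibre Y m. \<beta> (add Y \<epsilon> \<epsilon>') \<sigma> = add U (\<beta> \<epsilon> \<sigma>) (\<beta> \<epsilon>' \<sigma>)) \<and>
        (\<forall>\<sigma>' \<in> fibre X m. \<beta> \<epsilon> (add X \<sigma> \<sigma>') = add U (\<beta> \<epsilon> \<sigma>) (\<beta> \<epsilon> \<sigma>')) \<and>
        (\<forall>r. \<beta> (scl Y r \<epsilon>) \<sigma> = scl U r (\<beta> \<epsilon> \<sigma>) \<and> \<beta> \<epsilon> (scl X r \<sigma>) = scl U r (\<beta> \<epsilon> \<sigma>)))"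

text \<open>The first sequence ends in \<open>K\<close>, the second one starts with the tensor product of \<open>U\<close> and
  \<open>dual K\<close>; to contract an element of the latter with an element of \<open>K\<close>, the element of \<open>K\<close> is
  viewed in \<open>dual (dual K)\<close>.\<close>

definition in_duality ::
    "('u, 'm) vbundle \<Rightarrow> ('v, 'm) vbundle \<Rightarrow> ('k, 'm) vbundle \<Rightarrow>
     ('x, 'm) vbundle \<Rightarrow>
     ('m \<times> (('m \<times> ('u \<Rightarrow> real)) \<times> ('m \<times> ('v \<Rightarrow> real)) \<Rightarrow> real) \<Rightarrow> 'x) \<Rightarrow> ('x \<Rightarrow> 'k) \<Rightarrow>
     ('y, 'm) vbundle \<Rightarrow>
     ('m \<times> (('m \<times> ('u \<Rightarrow> real)) \<times> ('m \<times> ('m \<times> ('k \<Rightarrow> real) \<Rightarrow> real)) \<Rightarrow> real) \<Rightarrow> 'y) \<Rightarrow>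
     ('y \<Rightarrow> 'm \<times> ('v \<Rightarrow> real)) \<Rightarrow> bool" where
  "in_duality U V K X i j Y e p \<longleftrightarrow>
     vector_bundle U \<and> vector_bundle V \<and> vector_bundle K \<and>
     base V = base U \<and> base K = base U \<and>
     short_exact (tensor U V) X K i j \<and>
     short_exact (tensor U (dual K)) Y (dual V) e p \<and>
     (\<exists>\<beta>. bilinear_pairing Y X U \<beta> \<and>
        (\<forall>m \<in> pts (base U).
           (\<forall>\<epsilon> \<in> fibre Y m. \<forall>\<theta> \<in> fibre (tensor U V) m. \<beta> \<epsilon> (i \<theta>) = contract U (p \<epsilon>) \<theta>) \<and>
           (\<forall>\<kappa> \<in> fibre (tensor U (dual K)) m. \<forall>\<sigma> \<in> fibre X m.
              \<beta> (e \<kappa>) \<sigma> = contract U (bidual_map K (j \<sigma>)) \<kappa>)))"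


section \<open>Double vector bundles\<close>

record ('d, 'a, 'b, 'm) dvb =
  over_A :: "('d, 'a) vbundle"
  over_B :: "('d, 'b) vbundle"
  side_A :: "('a, 'm) vbundle"
  side_B :: "('b, 'm) vbundle"

abbreviation total :: "('d, 'a, 'b, 'm) dvb \<Rightarrow> 'd set" where
  "total D \<equiv> pts (tot (over_A D))"

abbreviation dvb_base :: "('d, 'a, 'b, 'm) dvb \<Rightarrow> 'm atlas" where
  "dvb_base D \<equiv> base (side_A D)"

text \<open>\<open>structure_morphisms DA DB A B\<close>: projection, zero section, scalar multiplications and
  addition of \<open>D \<rightarrow> A\<close> are morphisms for the vector bundle structures \<open>D \<rightarrow> B\<close> and \<open>A \<rightarrow> M\<close>, over
  the corresponding maps of \<open>B \<rightarrow> M\<close>.  For the addition, a map from the fibre product of two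
  copies of \<open>D\<close> over \<open>A\<close>, being a morphism is written out; the first condition is that it
  covers the addition of \<open>B\<close>, the second one is the interchange law.  Its smoothness
  is automatic for a vector bundle.\<close>

definition structure_morphisms ::
    "('d, 'a) vbundle \<Rightarrow> ('d, 'b) vbundle \<Rightarrow> ('a, 'm) vbundle \<Rightarrow> ('b, 'm) vbundle \<Rightarrow> bool" where
  "structure_morphisms DA DB A B \<longleftrightarrow>
     vb_morphism DB A (proj DA) (proj B) \<and>
     vb_morphism A DB (zer DA) (zer B) \<and>
     (\<forall>r. vb_morphism DB DB (scl DA r) (scl B r)) \<and>
     (\<forall>d \<in> pts (tot DA). \<forall>d' \<in> pts (tot DA). proj DA d = proj DA d' \<longrightarrow>
        proj DB (add DA d d') = add B (proj DB d) (proj DB d') \<and>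
        (\<forall>r. scl DB r (add DA d d') = add DA (scl DB r d) (scl DB r d'))) \<and>
     (\<forall>d1 \<in> pts (tot DA). \<forall>d2 \<in> pts (tot DA). \<forall>d3 \<in> pts (tot DA). \<forall>d4 \<in> pts (tot DA).
        proj DA d1 = proj DA d2 \<and> proj DA d3 = proj DA d4 \<and>
        proj DB d1 = proj DB d3 \<and> proj DB d2 = proj DB d4 \<longrightarrow>
        add DB (add DA d1 d2) (add DA d3 d4) = add DA (add DB d1 d3) (add DB d2 d4))"

definition double_vector_bundle :: "('d, 'a, 'b, 'm) dvb \<Rightarrow> bool" where
  "double_vector_bundle D \<longleftrightarrow>
     vector_bundle (over_A D) \<and> vector_bundle (over_B D) \<and>
     vector_bundle (side_A D) \<and> vector_bundle (side_B D) \<and>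
     tot (over_A D) = tot (over_B D) \<and>
     base (over_A D) = tot (side_A D) \<and> base (over_B D) = tot (side_B D) \<and>
     base (side_A D) = base (side_B D) \<and>
     (\<forall>d \<in> total D. proj (side_A D) (proj (over_A D) d) = proj (side_B D) (proj (over_B D) d)) \<and>
     structure_morphisms (over_A D) (over_B D) (side_A D) (side_B D) \<and>
     structure_morphisms (over_B D) (over_A D) (side_B D) (side_A D)"

definition dvb_proj :: "('d, 'a, 'b, 'm) dvb \<Rightarrow> 'd \<Rightarrow> 'm" where
  "dvb_proj D d = proj (side_A D) (proj (over_A D) d)"

definition slice :: "('d, 'a, 'b, 'm) dvb \<Rightarrow> 'm \<Rightarrow> 'd set" where
  "slice D m = {d \<in> total D. dvb_proj D d = m}"

text \<open>On the core the linear structures of \<open>D \<rightarrow> A\<close> and \<open>D \<rightarrow> B\<close> coincide, so either may be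
  used to define the vector bundle structure of the core.\<close>

definition core_set :: "('d, 'a, 'b, 'm) dvb \<Rightarrow> 'd set" where
  "core_set D = {c \<in> total D. \<exists>m \<in> pts (dvb_base D).
     proj (over_A D) c = zer (side_A D) m \<and> proj (over_B D) c = zer (side_B D) m}"

definition core :: "('d, 'a, 'b, 'm) dvb \<Rightarrow> ('d, 'm) vbundle" where
  "core D = frame_bundle (dvb_base D) (core_set D) (dvb_proj D)
     (add (over_A D)) (scl (over_A D)) (\<lambda>m. zer (over_A D) (zer (side_A D) m))
     (\<lambda>W s. smooth_on (dvb_base D) W s (tot (over_A D)))"


section \<open>The associated sequence of a double vector bundle\<close>

definition double_linear :: "('d, 'a, 'b, 'm) dvb \<Rightarrow> 'm \<Rightarrow> ('d \<Rightarrow> real) \<Rightarrow> bool" where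
  "double_linear D m \<sigma> \<longleftrightarrow>
     (\<forall>d1 \<in> slice D m. \<forall>d2 \<in> slice D m. proj (over_A D) d1 = proj (over_A D) d2 \<longrightarrow>
        \<sigma> (add (over_A D) d1 d2) = \<sigma> d1 + \<sigma> d2) \<and>
     (\<forall>d3 \<in> slice D m. \<forall>d4 \<in> slice D m. proj (over_B D) d3 = proj (over_B D) d4 \<longrightarrow>
        \<sigma> (add (over_B D) d3 d4) = \<sigma> d3 + \<sigma> d4) \<and>
     (\<forall>d \<in> slice D m. \<forall>r. \<sigma> (scl (over_A D) r d) = r * \<sigma> d \<and> \<sigma> (scl (over_B D) r d) = r * \<sigma> d)"

definition double_linear_bundle ::
    "('d, 'a, 'b, 'm) dvb \<Rightarrow> ('m \<times> ('d \<Rightarrow> real), 'm) vbundle" where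
  "double_linear_bundle D =
     fun_bundle (dvb_base D) (tot (over_A D)) (total D) (dvb_proj D) (\<lambda>m. {\<sigma>. double_linear D m \<sigma>})"

text \<open>The pairing of \<open>\<theta>\<close> with the tensor of \<open>a\<close> and \<open>b\<close> is the value of the bilinear form \<open>\<theta>\<close>
  at the images of \<open>a\<close> and \<open>b\<close> in the biduals.\<close>

definition seq_i ::
    "('d, 'a, 'b, 'm) dvb \<Rightarrow>
     'm \<times> (('m \<times> ('m \<times> ('a \<Rightarrow> real) \<Rightarrow> real)) \<times> ('m \<times> ('m \<times> ('b \<Rightarrow> real) \<Rightarrow> real)) \<Rightarrow> real) \<Rightarrow>
     'm \<times> ('d \<Rightarrow> real)" where
  "seq_i D \<theta> = (fst \<theta>, \<lambda>d. if d \<in> slice D (fst \<theta>)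
     then snd \<theta> (bidual_map (side_A D) (proj (over_A D) d), bidual_map (side_B D) (proj (over_B D) d))
     else 0)"

text \<open>The core enters through a bundle \<open>C\<close> and its inclusion \<open>c \<mapsto> bar c\<close> into \<open>D\<close>, since
  for the dual double vector bundle the core is only identified with a dual bundle.\<close>

definition seq_j ::
    "('c, 'm) vbundle \<Rightarrow> ('c \<Rightarrow> 'd) \<Rightarrow> 'm \<times> ('d \<Rightarrow> real) \<Rightarrow> 'm \<times> ('c \<Rightarrow> real)" where
  "seq_j C bar \<sigma> = (fst \<sigma>, \<lambda>c. if c \<in> fibre C (fst \<sigma>) then snd \<sigma> (bar c) else 0)"


section \<open>The dual over A\<close>

text \<open>An element of the dual over \<open>A\<close> is a pair \<open>(a, \<phi>)\<close> with \<open>\<phi>\<close> a linear form on the fibre of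
  \<open>D \<rightarrow> A\<close> over \<open>a\<close>.\<close>

definition dual_projC ::
    "('d, 'a, 'b, 'm) dvb \<Rightarrow> 'a \<times> ('d \<Rightarrow> real) \<Rightarrow> 'm \<times> ('d \<Rightarrow> real)" where
  "dual_projC D \<Phi> =
     (let a = fst \<Phi>; m = proj (side_A D) a in
      (m, \<lambda>c. if c \<in> fibre (core D) m then snd \<Phi> (add (over_B D) (zer (over_A D) a) c) else 0))"

definition dual_addC ::
    "('d, 'a, 'b, 'm) dvb \<Rightarrow> 'a \<times> ('d \<Rightarrow> real) \<Rightarrow> 'a \<times> ('d \<Rightarrow> real) \<Rightarrow> 'a \<times> ('d \<Rightarrow> real)" where
  "dual_addC D \<Phi> \<Phi>' =
     (THE \<Psi>. \<Psi> \<in> fibre (dual (over_A D)) (add (side_A D) (fst \<Phi>) (fst \<Phi>')) \<and>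
        (\<forall>d \<in> fibre (over_A D) (fst \<Phi>). \<forall>d' \<in> fibre (over_A D) (fst \<Phi>').
           proj (over_B D) d = proj (over_B D) d' \<longrightarrow>
           snd \<Psi> (add (over_B D) d d') = snd \<Phi> d + snd \<Phi>' d'))"

definition dual_zeroC :: "('d, 'a, 'b, 'm) dvb \<Rightarrow> 'm \<times> ('d \<Rightarrow> real) \<Rightarrow> 'a \<times> ('d \<Rightarrow> real)" where
  "dual_zeroC D \<gamma> =
     (THE \<Psi>. \<Psi> \<in> fibre (dual (over_A D)) (zer (side_A D) (fst \<gamma>)) \<and>
        (\<forall>b \<in> fibre (side_B D) (fst \<gamma>). \<forall>c \<in> fibre (core D) (fst \<gamma>).
           snd \<Psi> (add (over_A D) (zer (over_B D) b) c) = snd \<gamma> c))"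

definition dual_sclC ::
    "('d, 'a, 'b, 'm) dvb \<Rightarrow> real \<Rightarrow> 'a \<times> ('d \<Rightarrow> real) \<Rightarrow> 'a \<times> ('d \<Rightarrow> real)" where
  "dual_sclC D r \<Phi> =
     (if r = 0 then dual_zeroC D (dual_projC D \<Phi>)
      else let a = scl (side_A D) r (fst \<Phi>) in
        (a, \<lambda>d. if d \<in> fibre (over_A D) a then r * snd \<Phi> (scl (over_B D) (1 / r) d) else 0))"

definition dual_dvb ::
    "('d, 'a, 'b, 'm) dvb \<Rightarrow> ('a \<times> ('d \<Rightarrow> real), 'a, 'm \<times> ('d \<Rightarrow> real), 'm) dvb" where
  "dual_dvb D =
     \<lparr>over_A = dual (over_A D),
      over_B = \<lparr>tot = tot (dual (over_A D)), base = tot (dual (core D)), proj = dual_projC D,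
                add = dual_addC D, scl = dual_sclC D, zer = dual_zeroC D\<rparr>,
      side_A = side_A D,
      side_B = dual (core D)\<rparr>"

text \<open>The identification of \<open>dual (side_B D)\<close> with the core of \<open>dual_dvb D\<close>.\<close>

definition dual_core :: "('d, 'a, 'b, 'm) dvb \<Rightarrow> 'm \<times> ('b \<Rightarrow> real) \<Rightarrow> 'a \<times> ('d \<Rightarrow> real)" where
  "dual_core D \<psi> =
     (THE \<Psi>. \<Psi> \<in> fibre (dual (over_A D)) (zer (side_A D) (fst \<psi>)) \<and>
        (\<forall>b \<in> fibre (side_B D) (fst \<psi>). \<forall>c \<in> fibre (core D) (fst \<psi>).
           snd \<Psi> (add (over_A D) (zer (over_B D) b) c) = snd \<psi> b))"

end

theory Submission
 imports Defs "Jordan_Normal_Form.Determinant"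
begin

text \<open>A double-linear function \<open>\<sigma>\<close> restricts to a linear form on every fibre of \<open>D \<rightarrow> A\<close>, that is, to a point
\<open>(a, \<sigma>|D_a)\<close> of the dual over \<open>A\<close>.  All these points lie over the same element \<open>j(\<sigma>)\<close> of the dual of the core
(\<open>restr_projC\<close>), and they depend linearly on \<open>a\<close> for the linear structure over it (\<open>restr_add\<close>, \<open>restr_scl\<close>).  So if
\<open>\<epsilon>\<close> is double-linear on the dual over \<open>A\<close>, then \<open>a \<mapsto> \<epsilon>(a, \<sigma>|D_a)\<close> is a linear form on the fibre of \<open>A\<close>; this is the
pairing.  If \<open>\<sigma> = i(\<theta>)\<close>, then \<open>\<sigma>|D_a\<close> is a zero plus the core element \<open>\<theta>(a, -)\<close>, and \<open>\<epsilon>\<close> takes on it the value of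
\<open>j\<^sub>1(\<epsilon>)\<close> at \<open>\<theta>(a, -)\<close> (\<open>pairing_i\<close>).  If \<open>\<epsilon> = i\<^sub>1(\<kappa>)\<close>, then the value is \<open>\<kappa>(a, j(\<sigma>))\<close> (\<open>pairing_e\<close>).

Exactness is local.  Over a small open set \<open>D\<close> is isomorphic to the fibre product of \<open>A\<close>, \<open>B\<close> and the core
(\<open>decomposition_exists\<close>).  The point is to find elements of \<open>D\<close> over all pairs of frame vectors: the zero section of
\<open>D \<rightarrow> A\<close> provides them over zero vectors of \<open>B\<close>, a perturbation provides them over small vectors (\<open>lifts_near_zero\<close>),
and scaling over all (\<open>frame_lifts\<close>).  In a decomposition the double-linear functions are the sums of a bilinear form on
\<open>A\<close> and \<open>B\<close> and a linear form on the core, which yields the exact sequence (\<open>short_exact_X\<close>).  A decomposition of \<open>D\<close>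
induces one of the dual over \<open>A\<close> (\<open>dual_decomposition\<close>), so both sequences are instances of the same result.

The bundles are defined by their smooth local sections.  Such data form a vector bundle if near every point
there is a frame in which all smooth sections have smooth coefficients (\<open>vector_bundle_FB\<close>).  For bundles of
functions on fibres, smoothness of a map into the bundle is equivalent to smoothness of evaluations (\<open>smooth_eval\<close>,
\<open>smooth_into_fun\<close>); this reduces the smoothness of \<open>i\<close>, \<open>j\<close> and of the pairing to compositions of smooth maps.\<close>

section \<open>Calculus on open subsets of Euclidean space\<close>

abbreviation espace :: "nat => coord set" where
 "espace n \<equiv> topspace (Euclidean_space n)"

lemma espaceI: "(!!i. n \<le> i ==> u i = 0) ==> u \<in> espace n"
 by (simp add: topspace_Euclidean_space)

lemma espaceD: "u \<in> espace n ==> n \<le> i ==> u i = 0"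
 by (simp add: topspace_Euclidean_space)

lemma espace_trunc [simp]: "(%j. if j < n then f j else 0) \<in> espace n"
 by (rule espaceI) simp

lemma espace_eqI: "u \<in> espace n ==> v \<in> espace n ==> (!!i. i < n ==> u i = v i) ==> u = v"
 by (rule ext) (metis espaceD not_less)

lemma espace_eq_trunc: "u \<in> espace n ==> (%j. if j < n then u j else 0) = u"
 by (rule espace_eqI[of _ n]) auto

lemma espace_upd: "u \<in> espace n ==> i < n ==> u(i := t) \<in> espace n"
 by (auto simp: topspace_Euclidean_space)

lemma subtopology_Euclidean_space:
 "S \<subseteq> espace n ==> subtopology (Euclidean_space n) S = top_of_set S"
 by (simp add: Euclidean_space_def euclidean_product_topology subtopology_subtopology Int_absorb1)

lemma openin_Euclidean_space: "openin (Euclidean_space n) S \<longleftrightarrow> (\<exists>O'. open O' \<and> S = espace n \<inter> O')"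
proof -
 have "Euclidean_space n = top_of_set (espace n)"
  using subtopology_Euclidean_space[OF subset_refl, of n] by (simp only: subtopology_topspace)
 then have "openin (Euclidean_space n) S \<longleftrightarrow> openin (top_of_set (espace n)) S" by (rule arg_cong)
 then show ?thesis by (simp only: openin_open)
qed

lemma openin_Euclidean_space_trans:
 "openin (Euclidean_space n) S ==> openin (top_of_set S) T ==> openin (Euclidean_space n) T"
 unfolding openin_Euclidean_space openin_open by (metis inf.assoc open_Int)

lemma openin_espace_subset: "openin (Euclidean_space n) S ==> S \<subseteq> espace n"
 by (rule openin_subset)

lemma openin_preimage:
 fixes f :: "coord => 'b::topological_space"
 assumes "openin (Euclidean_space n) S" "continuous_on S f" "open B"
 shows "openin (Euclidean_space n) {v \<in> S. f v \<in> B}"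
proof -
 have "openin (top_of_set S) (S \<inter> f -` B)"
  using assms by (simp add: continuous_openin_preimage_gen)
 moreover have "S \<inter> f -` B = {v \<in> S. f v \<in> B}" by auto
 ultimately show ?thesis
  using openin_Euclidean_space_trans[OF assms(1)] by metis
qed

lemma openin_espace_box:
 assumes "openin (Euclidean_space n) S" "w \<in> S"
 obtains \<delta> where "0 < \<delta>" "!!v. v \<in> espace n ==> (!!j. j < n ==> \<bar>v j - w j\<bar> < \<delta>) ==> v \<in> S"
proof -
 obtain O' where O': "open O'" "S = espace n \<inter> O'"
  using assms(1) unfolding openin_Euclidean_space by auto
 have "openin (product_topology (%i. euclidean) UNIV) O'"
  using O'(1) by (simp add: euclidean_product_topology)
 then obtain X where X: "w \<in> (\<Pi>\<^sub>E i\<in>UNIV. X i)" "!!i. open (X i)" "(\<Pi>\<^sub>E i\<in>UNIV. X i) \<subseteq> O'"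
  using product_topology_open_contains_basis[of "%i. euclidean" UNIV O' w] assms(2) O'(2)
  by (auto simp: open_openin[symmetric])
 have "\<forall>i. \<exists>d>0. ball (w i) d \<subseteq> X i"
  using X(1,2) by (metis PiE_E UNIV_I open_contains_ball)
 then obtain d where d: "!!i. d i > 0" "!!i. ball (w i) (d i) \<subseteq> X i" by metis
 define \<delta> where "\<delta> = Min (insert 1 (d ` {..<n}))"
 have "\<delta> > 0" unfolding \<delta>_def using d(1) by (subst Min_gr_iff) auto
 moreover have "v \<in> S" if v: "v \<in> espace n" "!!j. j < n ==> \<bar>v j - w j\<bar> < \<delta>" for v
 proof -
  have "v j \<in> X j" for j
  proof (cases "j < n")
   case True
   have "\<delta> \<le> d j" unfolding \<delta>_def using True by (intro Min_le) auto
   then have "v j \<in> ball (w j) (d j)" using v(2)[OF True] by (simp add: dist_real_def abs_minus_commute)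
   then show ?thesis using d(2) by blast
  next
   case False
   then have "v j = w j" using v(1) assms(2) O'(2) by (metis IntD1 espaceD not_less)
   then show ?thesis using X(1) by auto
  qed
  then have "v \<in> O'" using X(3) by auto
  then show ?thesis using v(1) O'(2) by auto
 qed
 ultimately show ?thesis using that by blast
qed

text \<open>The partial derivative of \<open>f\<close> in direction \<open>i\<close> at \<open>u\<close> is \<open>d\<close>.\<close>

abbreviation has_partial :: "(coord => real) => nat => coord => real => bool" where
 "has_partial f i u d \<equiv> ((%t. f (u(i := t))) has_real_derivative d) (at (u i))"

lemma eventually_line:
 assumes "openin (Euclidean_space n) S" "u \<in> S" "i < n"
 shows "\<forall>\<^sub>F t in nhds (u i). u(i := t) \<in> S"
proof -
 obtain \<delta> where \<delta>: "0 < \<delta>" "!!v. v \<in> espace n ==> (!!j. j < n ==> \<bar>v j - u j\<bar> < \<delta>) ==> v \<in> S"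
  using openin_espace_box[OF assms(1,2)] by blast
 have "u \<in> espace n" using assms openin_espace_subset by blast
 then have "u(i := t) \<in> S" if "\<bar>t - u i\<bar> < \<delta>" for t
  using that \<delta>(1) assms(3) by (intro \<delta>(2)) (auto intro: espace_upd)
 then show ?thesis
  using \<delta>(1) unfolding eventually_nhds_metric by (auto simp: dist_real_def)
qed

lemma DERIV_line_cong:
 assumes "openin (Euclidean_space n) S" "u \<in> S" "i < n" "!!v. v \<in> S ==> f v = g v"
  "has_partial f i u d"
 shows "has_partial g i u d"
proof -
 have "\<forall>\<^sub>F t in nhds (u i). f (u(i := t)) = g (u(i := t))"
  using eventually_line[OF assms(1-3)] by eventually_elim (rule assms(4))
 then show ?thesis using assms(5) by (simp add: DERIV_cong_ev)
qed

lemma Ck_0: "S \<subseteq> espace n ==> Ck_on n 0 S f \<longleftrightarrow> continuous_on S f"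
 by (simp add: subtopology_Euclidean_space)

lemma Ck_Suc:
 "S \<subseteq> espace n ==> Ck_on n (Suc k) S f \<longleftrightarrow> continuous_on S f \<and>
   (\<forall>i<n. \<exists>g. Ck_on n k S g \<and>
    (\<forall>u\<in>S. has_partial f i u (g u)))"
 by (simp add: subtopology_Euclidean_space)

declare Ck_on.simps [simp del]

lemma Ck_SucE:
 assumes "Ck_on n (Suc k) S f" "i < n"
 obtains g where "Ck_on n k S g" "!!u. u \<in> S ==> has_partial f i u (g u)"
 using assms by (auto simp: Ck_on.simps)

lemma Ck_continuous: "S \<subseteq> espace n ==> Ck_on n k S f ==> continuous_on S f"
 by (cases k) (auto simp: Ck_0 Ck_Suc)

lemma Ck_cong:
 assumes "openin (Euclidean_space n) S" "!!v. v \<in> S ==> f v = g v" "Ck_on n k S f"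
 shows "Ck_on n k S g"
proof -
 note S = openin_espace_subset[OF assms(1)]
 have c: "continuous_on S g"
  using Ck_continuous[OF S assms(3)] assms(2) by (simp cong: continuous_on_cong)
 show ?thesis
 proof (cases k)
  case 0
  then show ?thesis using c S by (simp add: Ck_0)
 next
  case (Suc l)
  have "\<exists>h. Ck_on n l S h \<and> (\<forall>u\<in>S. has_partial g i u (h u))"
   if i: "i < n" for i
  proof -
   obtain h where h: "Ck_on n l S h"
    "!!u. u \<in> S ==> has_partial f i u (h u)"
    using Ck_SucE[OF assms(3)[unfolded Suc] i] by blast
   have "has_partial g i u (h u)" if "u \<in> S" for u
    by (rule DERIV_line_cong[OF assms(1) that i assms(2) h(2)[OF that]])
   then show ?thesis using h by blast
  qed
  then show ?thesis unfolding Suc Ck_Suc[OF S] using c by blast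
 qed
qed

lemma Ck_subset: "S' \<subseteq> S ==> S \<subseteq> espace n ==> Ck_on n k S f ==> Ck_on n k S' f"
proof (induction k arbitrary: f)
 case 0
 then show ?case by (metis Ck_0 continuous_on_subset subset_trans)
next
 case (Suc k)
 then have "S' \<subseteq> espace n" by blast
 with Suc show ?case by (simp add: Ck_Suc) (meson continuous_on_subset subsetD)
qed

lemma Ck_Suc_imp: "S \<subseteq> espace n ==> Ck_on n (Suc k) S f ==> Ck_on n k S f"
proof (induction k arbitrary: f)
 case 0
 then show ?case by (simp add: Ck_0 Ck_Suc)
next
 case (Suc k)
 show ?case
  unfolding Ck_Suc[OF Suc.prems(1)]
 proof (intro conjI allI impI)
  show "continuous_on S f" by (rule Ck_continuous[OF Suc.prems])
  fix i assume "i < n"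
  then obtain g where "Ck_on n (Suc k) S g"
   "!!u. u \<in> S ==> has_partial f i u (g u)"
   using Ck_SucE[OF Suc.prems(2)] by blast
  with Suc.IH[OF Suc.prems(1)]
  show "\<exists>g. Ck_on n k S g \<and> (\<forall>u\<in>S. has_partial f i u (g u))"
   by blast
 qed
qed

text \<open>The derivative on \<open>S\<close> is obtained by gluing: the local derivatives agree, being unique.\<close>

lemma Ck_local:
 assumes "S \<subseteq> espace n"
  "!!w. w \<in> S ==> \<exists>T. openin (Euclidean_space n) T \<and> w \<in> T \<and> T \<subseteq> S \<and> Ck_on n k T f"
 shows "Ck_on n k S f"
 using assms(2)
proof (induction k arbitrary: f)
 case 0
 have "isCont_on": "continuous (at w within S) f" if w: "w \<in> S" for w
 proof -
  obtain T where T: "openin (Euclidean_space n) T" "w \<in> T" "T \<subseteq> S" "continuous_on T f"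
   using 0[OF w] by (metis Ck_0 openin_espace_subset)
  obtain O' where O': "open O'" "T = espace n \<inter> O'"
   using T(1) unfolding openin_Euclidean_space by auto
  have "continuous (at w within T) f" using T by (simp add: continuous_on_eq_continuous_within)
  moreover have "S \<inter> O' = T \<inter> O'" using O' T(3) assms(1) by auto
  moreover have "w \<in> O'" using T(2) O'(2) by auto
  ultimately show ?thesis
   unfolding continuous_within using at_within_nhd[OF _ O'(1), of w S T] by auto
 qed
 then show ?case using assms(1) by (simp add: Ck_0 continuous_on_eq_continuous_within)
next
 case (Suc k)
 have c: "Ck_on n k S f"
  using Suc.prems by (intro Suc.IH) (metis Ck_Suc_imp openin_espace_subset)
 have "\<exists>g. Ck_on n k S g \<and> (\<forall>u\<in>S. has_partial f i u (g u))"
  if i: "i < n" for i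
 proof -
  define g where "g u = (THE d. has_partial f i u d)" for u
  have g: "g u = d" if "has_partial f i u d" for u d
   unfolding g_def using that by (intro the_equality) (auto intro: DERIV_unique)
  have 1: "\<exists>T. openin (Euclidean_space n) T \<and> w \<in> T \<and> T \<subseteq> S \<and> Ck_on n k T g \<and>
    (\<forall>u\<in>T. has_partial f i u (g u))" if w: "w \<in> S" for w
  proof -
   obtain T where T: "openin (Euclidean_space n) T" "w \<in> T" "T \<subseteq> S" "Ck_on n (Suc k) T f"
    using Suc.prems[OF w] by blast
   obtain h where h: "Ck_on n k T h"
    "!!u. u \<in> T ==> has_partial f i u (h u)"
    using Ck_SucE[OF T(4) i] by blast
   have hg: "h u = g u" if "u \<in> T" for u using g[OF h(2)[OF that]] by simp
   have "Ck_on n k T g" by (rule Ck_cong[OF T(1) hg h(1)])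
   moreover have "has_partial f i u (g u)" if "u \<in> T" for u
    using h(2)[OF that] hg[OF that] by simp
   ultimately show ?thesis using T(1-3) by blast
  qed
  then have "Ck_on n k S g" by (intro Suc.IH) blast
  with 1 show ?thesis by blast
 qed
 then show ?case using Ck_continuous[OF assms(1) c] by (simp add: Ck_Suc[OF assms(1)])
qed

lemma Ck_const: "S \<subseteq> espace n ==> Ck_on n k S (%u. c)"
proof (induction k arbitrary: c)
 case (Suc k)
 then show ?case by (auto simp: Ck_Suc intro!: exI[of _ "%u. 0"])
qed (simp add: Ck_0)

lemma Ck_coord: "S \<subseteq> espace n ==> Ck_on n k S (%u. u i)"
proof (cases k)
 case (Suc l)
 assume S: "S \<subseteq> espace n"
 have "continuous_on S (%u. u i)" by (rule continuous_on_subset[OF continuous_on_product_coordinates]) simp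
 moreover have "\<exists>g. Ck_on n l S g \<and> (\<forall>u\<in>S. ((%t. (u(j := t)) i) has_real_derivative g u) (at (u j)))" for j
  using Ck_const[OF S] by (intro exI[of _ "%u. if i = j then 1 else 0"]) auto
 ultimately show ?thesis using S by (simp add: Ck_Suc Suc)
next
 case 0
 assume S: "S \<subseteq> espace n"
 have "continuous_on S (%u. u i)" by (rule continuous_on_subset[OF continuous_on_product_coordinates]) simp
 then show ?thesis using S by (simp add: Ck_0 0)
qed

lemma Ck_add: "S \<subseteq> espace n ==> Ck_on n k S f ==> Ck_on n k S g ==> Ck_on n k S (%u. f u + g u)"
proof (induction k arbitrary: f g)
 case (Suc k)
 have "\<exists>h. Ck_on n k S h \<and> (\<forall>u\<in>S. ((%t. f (u(i := t)) + g (u(i := t))) has_real_derivative h u) (at (u i)))"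
  if "i < n" for i
 proof -
  obtain f' g' where *: "Ck_on n k S f'" "!!u. u \<in> S ==> has_partial f i u (f' u)"
   "Ck_on n k S g'" "!!u. u \<in> S ==> has_partial g i u (g' u)"
   using Ck_SucE[OF Suc.prems(2) \<open>i < n\<close>] Ck_SucE[OF Suc.prems(3) \<open>i < n\<close>] by metis
  then show ?thesis
   using Suc.IH[OF Suc.prems(1) *(1,3)] by (intro exI[of _ "%u. f' u + g' u"]) (auto intro: DERIV_add)
 qed
 then show ?case using Suc.prems by (simp add: Ck_Suc continuous_on_add)
qed (simp add: Ck_0 continuous_on_add)

lemma Ck_mult: "S \<subseteq> espace n ==> Ck_on n k S f ==> Ck_on n k S g ==> Ck_on n k S (%u. f u * g u)"
proof (induction k arbitrary: f g)
 case (Suc k)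
 have "\<exists>h. Ck_on n k S h \<and> (\<forall>u\<in>S. ((%t. f (u(i := t)) * g (u(i := t))) has_real_derivative h u) (at (u i)))"
  if "i < n" for i
 proof -
  obtain f' g' where *: "Ck_on n k S f'" "!!u. u \<in> S ==> has_partial f i u (f' u)"
   "Ck_on n k S g'" "!!u. u \<in> S ==> has_partial g i u (g' u)"
   using Ck_SucE[OF Suc.prems(2) \<open>i < n\<close>] Ck_SucE[OF Suc.prems(3) \<open>i < n\<close>] by metis
  have "((%t. f (u(i := t)) * g (u(i := t))) has_real_derivative f' u * g u + g' u * f u) (at (u i))"
   if "u \<in> S" for u
   using DERIV_mult[of "%t. f (u(i := t))" _ "u i" UNIV "%t. g (u(i := t))"] * that by auto
  moreover have "Ck_on n k S (%u. f' u * g u + g' u * f u)"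
   using Suc.prems * by (intro Ck_add Suc.IH) (auto intro: Ck_Suc_imp)
  ultimately show ?thesis by blast
 qed
 then show ?case using Suc.prems by (simp add: Ck_Suc continuous_on_mult)
qed (simp add: Ck_0 continuous_on_mult)

lemma Ck_inverse:
 "S \<subseteq> espace n ==> (!!u. u \<in> S ==> f u \<noteq> 0) ==> Ck_on n k S f ==> Ck_on n k S (%u. inverse (f u))"
proof (induction k)
 case (Suc k)
 have "\<exists>h. Ck_on n k S h \<and> (\<forall>u\<in>S. ((%t. inverse (f (u(i := t)))) has_real_derivative h u) (at (u i)))"
  if "i < n" for i
 proof -
  obtain f' where *: "Ck_on n k S f'" "!!u. u \<in> S ==> has_partial f i u (f' u)"
   using Ck_SucE[OF Suc.prems(3) \<open>i < n\<close>] by blast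
  have "((%t. inverse (f (u(i := t)))) has_real_derivative - 1 * f' u * (inverse (f u) * inverse (f u))) (at (u i))"
   if "u \<in> S" for u
   using DERIV_inverse_fun[of "%t. f (u(i := t))" _ "u i" UNIV] * that Suc.prems(2)
   by (simp add: numeral_2_eq_2)
  moreover have "Ck_on n k S (%u. inverse (f u))"
   using Suc by (intro Suc.IH) (auto intro: Ck_Suc_imp)
  then have "Ck_on n k S (%u. - 1 * f' u * (inverse (f u) * inverse (f u)))"
   using Suc.prems(1) * by (intro Ck_mult Ck_const) auto
  ultimately show ?thesis by blast
 qed
 then show ?case using Suc.prems by (simp add: Ck_Suc continuous_on_inverse)
qed (simp add: Ck_0 continuous_on_inverse)

lemma Ck_sum:
 "S \<subseteq> espace n ==> (!!i. i \<in> I ==> Ck_on n k S (f i)) ==> Ck_on n k S (%u. \<Sum>i\<in>I. f i u)"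
 by (induction I rule: infinite_finite_induct) (auto intro: Ck_const Ck_add)

text \<open>The chain rule along a curve: only continuity of the partial derivatives is used, by changing
 one coordinate of the argument at a time.\<close>

lemma chain_rule_curve:
 fixes f :: "coord => real"
 assumes T: "openin (Euclidean_space p) T"
  and P: "!!j. j < p ==> continuous_on T (P j)"
  "!!j u. j < p ==> u \<in> T ==> ((%t. f (u(j := t))) has_real_derivative P j u) (at (u j))"
  and h: "\<forall>\<^sub>F t in nhds t0. h t \<in> T"
  and h': "!!j. j < p ==> ((%t. h t j) has_real_derivative h' j) (at t0)"
 shows "((%t. f (h t)) has_real_derivative (\<Sum>j<p. P j (h t0) * h' j)) (at t0)"
proof -
 define w where "w = h t0"
 have w: "w \<in> T" using eventually_nhds_x_imp_x[OF h] by (simp add: w_def)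
 then have wE: "w \<in> espace p" using T openin_espace_subset by blast
 define H where "H s t = (%j. if j < s then h t j else w j)" for s :: nat and t
 have step: "((%t. f (H (Suc s) t) - f (H s t)) has_real_derivative P s w * h' s) (at t0)"
  if s: "s < p" for s
 proof -
  define q where "q t = (if h t s = w s then P s w
   else (f (H (Suc s) t) - f (H s t)) / (h t s - w s))" for t
  have upd: "(H s t)(s := h t s) = H (Suc s) t" "(H s t)(s := w s) = H s t" for t
   by (auto simp: H_def)
  have q: "q t * (h t s - w s) = f (H (Suc s) t) - f (H s t)" for t
   using upd[of t] by (auto simp: q_def)
  have "(q \<longlongrightarrow> P s w) (at t0)"
  proof (rule tendstoI)
   fix e :: real assume "e > 0"
   define T' where "T' = {v \<in> T. P s v \<in> ball (P s w) (e/2)}"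
   have "openin (Euclidean_space p) T'" "w \<in> T'"
    unfolding T'_def using w \<open>e > 0\<close> by (auto intro: openin_preimage[OF T P(1)[OF s] open_ball] simp del: mem_ball)
   then obtain \<delta> where \<delta>: "0 < \<delta>"
    "!!v. v \<in> espace p ==> (!!j. j < p ==> \<bar>v j - w j\<bar> < \<delta>) ==> v \<in> T'"
    by (rule openin_espace_box) blast
   have "\<forall>\<^sub>F t in at t0. \<forall>j\<in>{..<p}. \<bar>h t j - w j\<bar> < \<delta>"
   proof (rule eventually_ball_finite)
    show "\<forall>j\<in>{..<p}. \<forall>\<^sub>F t in at t0. \<bar>h t j - w j\<bar> < \<delta>"
    proof
     fix j assume "j \<in> {..<p}"
     then have "((%t. h t j) \<longlongrightarrow> w j) (at t0)"
      using h'[of j] DERIV_isCont unfolding w_def isCont_def by blast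
     from tendstoD[OF this \<delta>(1)] show "\<forall>\<^sub>F t in at t0. \<bar>h t j - w j\<bar> < \<delta>"
      by (simp add: dist_real_def)
    qed
   qed simp
   then show "\<forall>\<^sub>F t in at t0. dist (q t) (P s w) < e"
   proof eventually_elim
    case (elim t)
    have inT: "(H s t)(s := \<xi>) \<in> T'" if "\<xi> \<in> ball (w s) \<delta>" for \<xi>
    proof (rule \<delta>(2))
     show "(H s t)(s := \<xi>) \<in> espace p"
      by (rule espaceI) (use s wE in \<open>auto simp: H_def espaceD\<close>)
     show "\<bar>((H s t)(s := \<xi>)) j - w j\<bar> < \<delta>" if "j < p" for j
      using \<open>\<xi> \<in> _\<close> elim that \<delta>(1) by (auto simp: H_def dist_real_def abs_minus_commute)
    qed
    have "norm ((f ((H s t)(s := h t s)) - P s w * h t s) - (f ((H s t)(s := w s)) - P s w * w s))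
     \<le> e/2 * norm (h t s - w s)"
    proof (rule field_differentiable_bound[of "ball (w s) \<delta>" "%\<xi>. f ((H s t)(s := \<xi>)) - P s w * \<xi>"
       "%\<xi>. P s ((H s t)(s := \<xi>)) - P s w"])
     fix \<xi> assume \<xi>: "\<xi> \<in> ball (w s) \<delta>"
     have "((%t'. f (((H s t)(s := \<xi>))(s := t'))) has_real_derivative P s ((H s t)(s := \<xi>)))
       (at (((H s t)(s := \<xi>)) s))"
      using inT[OF \<xi>] s by (intro P(2)) (auto simp: T'_def)
     then have "((%\<xi>. f ((H s t)(s := \<xi>))) has_real_derivative P s ((H s t)(s := \<xi>))) (at \<xi>)"
      by simp
     from DERIV_diff[OF this DERIV_cmult_Id[of "P s w"]]
     show "((%\<xi>. f ((H s t)(s := \<xi>)) - P s w * \<xi>) has_field_derivative P s ((H s t)(s := \<xi>)) - P s w)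
       (at \<xi> within ball (w s) \<delta>)"
      by (rule has_field_derivative_at_within)
     show "norm (P s ((H s t)(s := \<xi>)) - P s w) \<le> e/2"
      using inT[OF \<xi>] by (auto simp: T'_def dist_real_def abs_minus_commute)
    qed (use elim s \<delta>(1) in \<open>auto simp: dist_real_def abs_minus_commute\<close>)
    moreover have "f (H (Suc s) t) = f (H s t) + q t * (h t s - w s)" using q[of t] by simp
    ultimately have "\<bar>(q t - P s w) * (h t s - w s)\<bar> \<le> e/2 * \<bar>h t s - w s\<bar>"
     unfolding upd by (simp add: algebra_simps)
    then have "\<bar>q t - P s w\<bar> \<le> e/2"
     using \<open>e > 0\<close> by (cases "h t s = w s") (auto simp: abs_mult q_def)
    then show ?case using \<open>e > 0\<close> by (simp add: dist_real_def)
   qed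
  qed
  moreover have "((%t. (h t s - w s) / (t - t0)) \<longlongrightarrow> h' s) (at t0)"
   using h'[OF s] by (simp add: has_field_derivative_iff w_def)
  ultimately have "((%t. q t * ((h t s - w s) / (t - t0))) \<longlongrightarrow> P s w * h' s) (at t0)"
   by (rule tendsto_mult)
  moreover have "H s t0 = w" "H (Suc s) t0 = w" by (auto simp: H_def w_def)
  ultimately show ?thesis by (simp add: has_field_derivative_iff q)
 qed
 have "s \<le> p ==> ((%t. f (H s t)) has_real_derivative (\<Sum>j<s. P j w * h' j)) (at t0)" for s
 proof (induction s)
  case 0
  then show ?case by (simp add: H_def)
 next
  case (Suc s)
  from DERIV_add[OF Suc.IH step[of s]] Suc.prems show ?case by simp
 qed
 from this[of p] have "((%t. f (H p t)) has_real_derivative (\<Sum>j<p. P j w * h' j)) (at t0)" by simp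
 moreover have "\<forall>\<^sub>F t in nhds t0. f (H p t) = f (h t)"
  using h
 proof eventually_elim
  case (elim t)
  then have "h t \<in> espace p" using T openin_espace_subset by blast
  have "H p t = h t"
  proof (rule ext)
   fix j show "H p t j = h t j"
    using espaceD[OF wE, of j] espaceD[OF \<open>h t \<in> espace p\<close>, of j] by (simp add: H_def)
  qed
  then show ?case by simp
 qed
 ultimately show ?thesis by (simp add: DERIV_cong_ev w_def)
qed

lemma Ck_compose:
 assumes S: "openin (Euclidean_space n) S" and T: "openin (Euclidean_space p) T"
  and gT: "!!u. u \<in> S ==> g u \<in> T"
 shows "Ck_on p k T f ==> (!!j. j < p ==> Ck_on n k S (%u. g u j)) ==> Ck_on n k S (%u. f (g u))"
proof (induction k arbitrary: f)
 note SE = openin_espace_subset[OF S] and TE = openin_espace_subset[OF T]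
 have cont: "continuous_on S g" if "!!j. j < p ==> continuous_on S (%u. g u j)"
 proof (rule continuous_on_coordinatewise_then_product)
  fix i show "continuous_on S (%u. g u i)"
  proof (cases "i < p")
   case False
   then have "!!u. u \<in> S ==> g u i = 0" using gT TE espaceD by (metis not_less subsetD)
   then show ?thesis by (simp cong: continuous_on_cong)
  qed (use that in auto)
 qed
 have comp: "continuous_on S (%u. f (g u))"
  if "continuous_on T f" "!!j. j < p ==> continuous_on S (%u. g u j)" for f :: "coord => real"
  using continuous_on_compose2[OF that(1) cont] that(2) gT by blast
 {
  case 0
  then show ?case using comp by (simp add: Ck_0 SE TE)
 next
  case (Suc k)
  have "\<forall>j. \<exists>q. j < p \<longrightarrow> Ck_on p k T q \<and>
    (\<forall>u\<in>T. has_partial f j u (q u))"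
   using Suc.prems(1) unfolding Ck_Suc[OF TE] by blast
  from choice[OF this] obtain P where P: "!!j. j < p ==> Ck_on p k T (P j)"
    "!!j u. j < p ==> u \<in> T ==> ((%t. f (u(j := t))) has_real_derivative P j u) (at (u j))"
   by blast
  have "\<exists>h. Ck_on n k S h \<and> (\<forall>u\<in>S. ((%t. f (g (u(i := t)))) has_real_derivative h u) (at (u i)))"
   if i: "i < n" for i
  proof -
   have "\<forall>j. \<exists>q. j < p \<longrightarrow> Ck_on n k S q \<and>
     (\<forall>u\<in>S. ((%t. g (u(i := t)) j) has_real_derivative q u) (at (u i)))"
    using Suc.prems(2) i unfolding Ck_Suc[OF SE] by blast
   from choice[OF this] obtain Q where Q: "!!j. j < p ==> Ck_on n k S (Q j)"
    "!!j u. j < p ==> u \<in> S ==> ((%t. g (u(i := t)) j) has_real_derivative Q j u) (at (u i))"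
    by blast
   have "((%t. f (g (u(i := t)))) has_real_derivative (\<Sum>j<p. P j (g u) * Q j u)) (at (u i))"
    if u: "u \<in> S" for u
   proof -
    have ev: "\<forall>\<^sub>F t in nhds (u i). g (u(i := t)) \<in> T"
     using eventually_line[OF S u i] by eventually_elim (rule gT)
    have "((%t. f (g (u(i := t)))) has_real_derivative
      (\<Sum>j<p. P j (g (u(i := u i))) * Q j u)) (at (u i))"
     by (rule chain_rule_curve[OF T Ck_continuous[OF TE P(1)] P(2) ev Q(2)[OF _ u]])
    then show ?thesis by simp
   qed
   moreover have "Ck_on n k S (%u. \<Sum>j<p. P j (g u) * Q j u)"
    proof (rule Ck_sum[OF SE])
    fix j assume "j \<in> {..<p}"
    then have j: "j < p" by simp
    have "Ck_on n k S (%u. P j (g u))"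
     by (rule Suc.IH[OF P(1)[OF j]]) (rule Ck_Suc_imp[OF SE Suc.prems(2)])
    then show "Ck_on n k S (%u. P j (g u) * Q j u)" by (rule Ck_mult[OF SE _ Q(1)[OF j]])
   qed
   ultimately show ?thesis by blast
  qed
  moreover have "continuous_on S (%u. f (g u))"
   by (rule comp[OF Ck_continuous[OF TE Suc.prems(1)] Ck_continuous[OF SE Suc.prems(2)]])
  ultimately show ?case by (simp add: Ck_Suc[OF SE])
 }
qed

section \<open>Manifolds and smooth maps on subsets\<close>

text \<open>An atlas with smooth transition maps; Hausdorff separation and second countability
 are not needed for the calculus of smooth maps.\<close>

definition pre_manifold :: "'a atlas => bool" where
 "pre_manifold M \<longleftrightarrow>
   (\<forall>(U, n, x) \<in> M. inj_on x U \<and> openin (Euclidean_space n) (x ` U)) \<and>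
   (\<forall>(U, n, x) \<in> M. \<forall>(V, k, y) \<in> M.
    openin (Euclidean_space n) (x ` (U \<inter> V)) \<and>
    coord_smooth n (x ` (U \<inter> V)) (%u. y (inv_into U x u)))"

lemma smooth_manifold_iff:
 "smooth_manifold M \<longleftrightarrow> pre_manifold M \<and> Hausdorff_space (mtop M) \<and> second_countable_top (mtop M)"
 by (auto simp: smooth_manifold_def pre_manifold_def)

lemma pre_manifoldI:
 assumes "!!U n x. (U, n, x) \<in> M ==> inj_on x U"
  "!!U n x V k y. (U, n, x) \<in> M ==> (V, k, y) \<in> M ==> openin (Euclidean_space n) (x ` (U \<inter> V))"
  "!!U n x V k y l j. (U, n, x) \<in> M ==> (V, k, y) \<in> M ==>
    Ck_on n l (x ` (U \<inter> V)) (%u. y (inv_into U x u) j)"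
 shows "pre_manifold M"
proof -
 have "openin (Euclidean_space n) (x ` U)" if "(U, n, x) \<in> M" for U n x
  using assms(2)[OF that that] by simp
 then show ?thesis using assms unfolding pre_manifold_def coord_smooth_def by blast
qed

context
 fixes M :: "'a atlas"
 assumes M: "pre_manifold M"
begin

lemma chart_inj: "(U, n, x) \<in> M ==> inj_on x U"
 using M unfolding pre_manifold_def by blast

lemma chart_image_open: "(U, n, x) \<in> M ==> openin (Euclidean_space n) (x ` U)"
 using M unfolding pre_manifold_def by blast

lemma chart_in_espace: "(U, n, x) \<in> M ==> p \<in> U ==> x p \<in> espace n"
 using chart_image_open openin_espace_subset by blast

lemma chart_Int_open:
 "(U, n, x) \<in> M ==> (V, k, y) \<in> M ==> openin (Euclidean_space n) (x ` (U \<inter> V))"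
 using M unfolding pre_manifold_def by blast

lemma chart_transition:
 "(U, n, x) \<in> M ==> (V, k, y) \<in> M ==> Ck_on n l (x ` (U \<inter> V)) (%u. y (inv_into U x u) j)"
proof -
 assume c: "(U, n, x) \<in> M" "(V, k, y) \<in> M"
 have "\<forall>(U, n, x) \<in> M. \<forall>(V, k, y) \<in> M. openin (Euclidean_space n) (x ` (U \<inter> V)) \<and>
   coord_smooth n (x ` (U \<inter> V)) (%u. y (inv_into U x u))"
  using M unfolding pre_manifold_def by (rule conjunct2)
 from bspec[OF bspec[OF this c(1), unfolded prod.case] c(2), unfolded prod.case]
 have "coord_smooth n (x ` (U \<inter> V)) (%u. y (inv_into U x u))" by (rule conjunct2)
 from this[unfolded coord_smooth_def, THEN spec[of _ l], THEN spec[of _ j]] show ?thesis .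
qed

lemma chart_subset_pts: "(U, n, x) \<in> M ==> U \<subseteq> pts M"
 unfolding pts_def by force

lemma pts_chartE:
 assumes "p \<in> pts M" obtains U n x where "(U, n, x) \<in> M" "p \<in> U"
proof -
 obtain c where "c \<in> M" "p \<in> fst c" using assms unfolding pts_def by blast
 then show ?thesis using that[of "fst c" "fst (snd c)" "snd (snd c)"] by simp
qed

lemma openin_mtop:
 "openin (mtop M) W \<longleftrightarrow> W \<subseteq> pts M \<and> (\<forall>(U, n, x) \<in> M. openin (Euclidean_space n) (x ` (U \<inter> W)))"
proof -
 let ?L = "%W. W \<subseteq> pts M \<and> (\<forall>(U, n, x) \<in> M. openin (Euclidean_space n) (x ` (U \<inter> W)))"
 have "istopology ?L"
  unfolding istopology_def
 proof (rule conjI; intro allI impI)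
  fix S T assume ST: "?L S" "?L T"
  have "openin (Euclidean_space n) (x ` (U \<inter> (S \<inter> T)))" if c: "(U, n, x) \<in> M" for U n x
  proof -
   have "x ` (U \<inter> (S \<inter> T)) = x ` (U \<inter> S) \<inter> x ` (U \<inter> T)"
    using chart_inj[OF c] by (auto simp: inj_on_def)
   then show ?thesis using ST c by (metis (no_types, lifting) case_prodD openin_Int)
  qed
  then show "?L (S \<inter> T)" using ST by auto
 next
  fix K assume K: "\<forall>S\<in>K. ?L S"
  have "openin (Euclidean_space n) (x ` (U \<inter> \<Union> K))" if c: "(U, n, x) \<in> M" for U n x
  proof -
   have "x ` (U \<inter> \<Union> K) = \<Union> ((%S. x ` (U \<inter> S)) ` K)" by auto
   moreover have "openin (Euclidean_space n) (\<Union> ((%S. x ` (U \<inter> S)) ` K))"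
    using K c by (intro openin_Union) auto
   ultimately show ?thesis by simp
  qed
  then show "?L (\<Union> K)" using K by auto
 qed
 then show ?thesis unfolding mtop_def by (simp add: topology_inverse')
qed

lemma openin_mtop_subset: "openin (mtop M) W ==> W \<subseteq> pts M"
 by (simp add: openin_mtop)

lemma openin_mtop_chart:
 "openin (mtop M) W ==> (U, n, x) \<in> M ==> openin (Euclidean_space n) (x ` (U \<inter> W))"
 unfolding openin_mtop by blast

lemma chart_open: "(U, n, x) \<in> M ==> openin (mtop M) U"
 unfolding openin_mtop using chart_subset_pts chart_Int_open by blast

lemma openin_mtop_pts: "openin (mtop M) (pts M)"
 unfolding openin_mtop using chart_image_open chart_subset_pts by (auto simp: Int_absorb2)

lemma topspace_mtop: "topspace (mtop M) = pts M"
 using openin_mtop_pts openin_mtop_subset by (meson openin_subset openin_topspace subset_antisym)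

lemma chart_inv_into: "(U, n, x) \<in> M ==> p \<in> U ==> inv_into U x (x p) = p"
 using chart_inj inv_into_f_f by metis

lemma chart_transition_continuous:
 assumes "(U, n, x) \<in> M" "(V, k, y) \<in> M"
 shows "continuous_on (x ` (U \<inter> V)) (%u. y (inv_into U x u))"
 by (rule continuous_on_coordinatewise_then_product)
  (rule Ck_continuous[OF openin_espace_subset[OF chart_Int_open[OF assms]] chart_transition[OF assms, of 0]])

lemma openin_mtopI_chart:
 assumes c: "(U, n, x) \<in> M" and W: "W \<subseteq> U" "openin (Euclidean_space n) (x ` W)"
 shows "openin (mtop M) W"
 unfolding openin_mtop
proof (intro conjI ballI, safe)
 show "p \<in> pts M" if "p \<in> W" for p using that W(1) chart_subset_pts[OF c] by blast
 fix V k y assume d: "(V, k, y) \<in> M"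
 obtain O' where O': "open O'" "x ` W = espace n \<inter> O'"
  using W(2) unfolding openin_Euclidean_space by blast
 have "y ` (V \<inter> W) = {v \<in> y ` (V \<inter> U). x (inv_into V y v) \<in> O'}"
 proof (rule subset_antisym[OF subsetI subsetI])
  fix v assume "v \<in> y ` (V \<inter> W)"
  then obtain p where p: "p \<in> V" "p \<in> W" "v = y p" by blast
  then show "v \<in> {v \<in> y ` (V \<inter> U). x (inv_into V y v) \<in> O'}"
   using W(1) chart_inv_into[OF d] O'(2) by auto
 next
  fix v assume "v \<in> {v \<in> y ` (V \<inter> U). x (inv_into V y v) \<in> O'}"
  then obtain p where p: "p \<in> V" "p \<in> U" "v = y p" "x p \<in> O'"
   using chart_inv_into[OF d] by auto
  then have "x p \<in> x ` W" using O'(2) chart_in_espace[OF c] by blast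
  then have "p \<in> W" using p(2) W(1) chart_inj[OF c] by (auto simp: inj_on_def)
  then show "v \<in> y ` (V \<inter> W)" using p by blast
 qed
 then show "openin (Euclidean_space k) (y ` (V \<inter> W))"
  using openin_preimage[OF chart_Int_open[OF d c] chart_transition_continuous[OF d c] O'(1)] by simp
qed

lemma chart_change:
 assumes c: "(U, n, x) \<in> M" "(V, m, y) \<in> M" and W: "openin (mtop M) W" "W \<subseteq> U"
  and F: "Ck_on n k (x ` W) (%u. F (inv_into U x u))"
 shows "Ck_on m k (y ` (V \<inter> W)) (%u. F (inv_into V y u))"
proof (rule Ck_cong)
 show o: "openin (Euclidean_space m) (y ` (V \<inter> W))" by (rule openin_mtop_chart[OF W(1) c(2)])
 have sub: "y ` (V \<inter> W) \<subseteq> y ` (V \<inter> U)" using W by auto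
 show "Ck_on m k (y ` (V \<inter> W)) (%u. F (inv_into U x (x (inv_into V y u))))"
 proof (rule Ck_compose[OF o _ _ F])
  show "openin (Euclidean_space n) (x ` W)"
   using openin_mtop_chart[OF W(1) c(1)] W(2) by (simp add: Int_absorb1)
  show "x (inv_into V y u) \<in> x ` W" if "u \<in> y ` (V \<inter> W)" for u
   using that chart_inv_into[OF c(2)] by auto
  show "Ck_on m k (y ` (V \<inter> W)) (%u. x (inv_into V y u) j)" for j
   by (rule Ck_subset[OF sub openin_espace_subset[OF chart_Int_open[OF c(2,1)]] chart_transition[OF c(2,1)]])
 qed
 show "F (inv_into U x (x (inv_into V y u))) = F (inv_into V y u)" if "u \<in> y ` (V \<inter> W)" for u
  using that W(2) chart_inv_into[OF c(2)] chart_inv_into[OF c(1)] by auto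
qed

end

text \<open>Near \<open>p\<close>, \<open>f\<close> extends from \<open>S\<close> to a function that is smooth in a chart.\<close>

abbreviation smooth_rep :: "'a atlas => 'a set => ('a => real) => 'a => bool" where
 "smooth_rep M S f p \<equiv> \<exists>U n x W F. (U, n, x) \<in> M \<and> openin (mtop M) W \<and> p \<in> W \<and> W \<subseteq> U \<and>
  (\<forall>k. Ck_on n k (x ` W) (%u. F (inv_into U x u))) \<and> (\<forall>q\<in>S \<inter> W. F q = f q)"

text \<open>Smooth real functions on an arbitrary subset of a manifold, by local extension.\<close>

definition smooth_real :: "'a atlas => 'a set => ('a => real) => bool" where
 "smooth_real M S f \<longleftrightarrow> (\<forall>p\<in>S. smooth_rep M S f p)"

lemma smooth_realI:
 assumes "!!p. p \<in> S ==> smooth_rep M S f p"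
 shows "smooth_real M S f"
 using assms unfolding smooth_real_def by blast

lemma smooth_real_pts: "pre_manifold M ==> smooth_real M S f ==> S \<subseteq> pts M"
 unfolding smooth_real_def using openin_mtop_subset by blast

lemma smooth_real_cong_subset:
 assumes "smooth_real M S f" "S' \<subseteq> S" "!!p. p \<in> S' ==> f p = g p"
 shows "smooth_real M S' g"
proof (rule smooth_realI)
 fix p assume "p \<in> S'"
 then have "p \<in> S" using assms(2) by blast
 from assms(1)[unfolded smooth_real_def, THEN bspec, OF this]
 obtain U n x W F where "(U, n, x) \<in> M" "openin (mtop M) W" "p \<in> W" "W \<subseteq> U"
  "\<forall>k. Ck_on n k (x ` W) (%u. F (inv_into U x u))" "\<forall>q\<in>S \<inter> W. F q = f q"
  by blast
 moreover have "\<forall>q\<in>S' \<inter> W. F q = g q" using calculation(6) assms(2,3) by auto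
 ultimately show "smooth_rep M S' g p" by blast
qed

lemma smooth_real_subset: "smooth_real M S f ==> S' \<subseteq> S ==> smooth_real M S' f"
 by (rule smooth_real_cong_subset) auto

lemma smooth_real_cong: "smooth_real M S f ==> (!!p. p \<in> S ==> f p = g p) ==> smooth_real M S g"
 by (rule smooth_real_cong_subset[of M S f]) auto

lemma smooth_real_chartE:
 assumes M: "pre_manifold M" and f: "smooth_real M S f" "p \<in> S" and d: "(V, m, y) \<in> M" "p \<in> V"
 obtains W F where "openin (mtop M) W" "p \<in> W" "W \<subseteq> V"
  "!!k. Ck_on m k (y ` W) (%u. F (inv_into V y u))" "!!q. q \<in> S ==> q \<in> W ==> F q = f q"
proof -
 obtain U n x W F where *: "(U, n, x) \<in> M" "openin (mtop M) W" "p \<in> W" "W \<subseteq> U"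
  "!!k. Ck_on n k (x ` W) (%u. F (inv_into U x u))" "!!q. q \<in> S \<inter> W ==> F q = f q"
  using f unfolding smooth_real_def by metis
 show ?thesis
 proof (rule that[of "V \<inter> W" F])
  show "openin (mtop M) (V \<inter> W)" using chart_open[OF M d(1)] *(2) by (rule openin_Int)
  show "Ck_on m k (y ` (V \<inter> W)) (%u. F (inv_into V y u))" for k
   by (rule chart_change[OF M *(1) d(1) *(2,4,5)])
 qed (use * d in auto)
qed

lemma smooth_real_local:
 assumes M: "pre_manifold M"
  and "!!p. p \<in> S ==> \<exists>W. openin (mtop M) W \<and> p \<in> W \<and> smooth_real M (S \<inter> W) f"
 shows "smooth_real M S f"
proof (rule smooth_realI)
 fix p assume p: "p \<in> S"
 then obtain W where W: "openin (mtop M) W" "p \<in> W" "smooth_real M (S \<inter> W) f"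
  using assms(2) by blast
 obtain U n x where c: "(U, n, x) \<in> M" "p \<in> U"
  using W openin_mtop_subset[OF M] pts_chartE[OF M] by (metis subsetD)
 obtain W' F where F: "openin (mtop M) W'" "p \<in> W'" "W' \<subseteq> U"
  "!!k. Ck_on n k (x ` W') (%u. F (inv_into U x u))" "!!q. q \<in> S \<inter> W ==> q \<in> W' ==> F q = f q"
  by (rule smooth_real_chartE[OF M W(3) _ c]) (use p W in auto)
 have sub: "x ` (W \<inter> W') \<subseteq> x ` W'" "x ` W' \<subseteq> espace n"
  using chart_in_espace[OF M c(1)] F(3) by auto
 show "smooth_rep M S f p"
 proof (rule exI[of _ U], rule exI[of _ n], rule exI[of _ x], rule exI[of _ "W \<inter> W'"], rule exI[of _ F],
   intro conjI allI ballI)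
  show "openin (mtop M) (W \<inter> W')" using W F by (blast intro: openin_Int)
  show "Ck_on n k (x ` (W \<inter> W')) (%u. F (inv_into U x u))" for k
   by (rule Ck_subset[OF sub F(4)])
 qed (use c W F in auto)
qed

lemma smooth_real_family:
 assumes M: "pre_manifold M" and "!!j. j < (m::nat) ==> smooth_real M S (g j)"
  and p: "p \<in> S" and c: "(U, n, x) \<in> M" "p \<in> U"
 obtains W G where "openin (mtop M) W" "p \<in> W" "W \<subseteq> U"
  "!!j k. j < m ==> Ck_on n k (x ` W) (%u. G j (inv_into U x u))"
  "!!j q. j < m ==> q \<in> S ==> q \<in> W ==> G j q = g j q"
proof -
 have "\<exists>W G. openin (mtop M) W \<and> p \<in> W \<and> W \<subseteq> U \<and>
  (\<forall>j<m. (\<forall>k. Ck_on n k (x ` W) (%u. G j (inv_into U x u))) \<and> (\<forall>q\<in>S \<inter> W. G j q = g j q))"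
  using assms(2)
 proof (induction m)
  case 0
  then show ?case using chart_open[OF M c(1)] c(2) by blast
 next
  case (Suc m)
  have "\<exists>W G. openin (mtop M) W \<and> p \<in> W \<and> W \<subseteq> U \<and>
   (\<forall>j<m. (\<forall>k. Ck_on n k (x ` W) (%u. G j (inv_into U x u))) \<and> (\<forall>q\<in>S \<inter> W. G j q = g j q))"
   by (rule Suc.IH) (use Suc.prems in simp)
  then obtain W G where 1: "openin (mtop M) W" "p \<in> W" "W \<subseteq> U"
   "!!j k. j < m ==> Ck_on n k (x ` W) (%u. G j (inv_into U x u))"
   "!!j q. j < m ==> q \<in> S \<inter> W ==> G j q = g j q" by blast
  obtain W' F where 2: "openin (mtop M) W'" "p \<in> W'" "W' \<subseteq> U"
   "!!k. Ck_on n k (x ` W') (%u. F (inv_into U x u))" "!!q. q \<in> S ==> q \<in> W' ==> F q = g m q"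
   by (rule smooth_real_chartE[OF M Suc.prems[OF lessI] p c]) blast
  have sub: "x ` (W \<inter> W') \<subseteq> x ` W" "x ` (W \<inter> W') \<subseteq> x ` W'" "x ` W \<subseteq> espace n" "x ` W' \<subseteq> espace n"
   using chart_in_espace[OF M c(1)] 1(3) 2(3) by auto
  define G' where "G' j = (if j = m then F else G j)" for j
  have a: "Ck_on n k (x ` (W \<inter> W')) (%u. G' j (inv_into U x u))" if "j < Suc m" for j k
  proof (cases "j = m")
   case True
   show ?thesis unfolding G'_def True using Ck_subset[OF sub(2,4) 2(4)] by simp
  next
   case False
   then have "j < m" using that by simp
   show ?thesis unfolding G'_def using False Ck_subset[OF sub(1,3) 1(4)[OF \<open>j < m\<close>]] by simp
  qed
  have b: "G' j q = g j q" if "j < Suc m" "q \<in> S \<inter> (W \<inter> W')" for j q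
   using that 1(5)[of j q] 2(5) by (auto simp: G'_def)
  have o: "openin (mtop M) (W \<inter> W')" by (rule openin_Int[OF 1(1) 2(1)])
  show ?case
   by (rule exI[of _ "W \<inter> W'"], rule exI[of _ G'], intro conjI allI impI ballI)
    (use 1(2,3) 2(2) in \<open>auto intro: a b o\<close>)
 qed
 then show ?thesis using that by blast
qed

lemma continuous_on_trunc:
 assumes "S \<subseteq> espace n" "!!j. j < m ==> Ck_on n k S (g j)"
 shows "continuous_on S (%u j. if j < m then g j u else 0)"
proof (rule continuous_on_coordinatewise_then_product)
 fix j show "continuous_on S (%u. if j < m then g j u else 0)"
  using Ck_continuous[OF assms(1) assms(2)] by (cases "j < m") auto
qed

lemma tuple_preimage_open:
 assumes M: "pre_manifold M" and c: "(U, n, x) \<in> M" and W: "openin (mtop M) W" "W \<subseteq> U"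
  and G: "!!j. j < m ==> Ck_on n 0 (x ` W) (%u. G j (inv_into U x u))"
  and T: "openin (Euclidean_space m) T"
 shows "openin (mtop M) {q \<in> W. (%j. if j < m then G j q else 0) \<in> T}" (is "openin _ ?W'")
proof (rule openin_mtopI_chart[OF M c])
 obtain O' where O': "open O'" "T = espace m \<inter> O'"
  using T unfolding openin_Euclidean_space by blast
 have oW: "openin (Euclidean_space n) (x ` W)"
  using openin_mtop_chart[OF M W(1) c] W(2) by (simp add: Int_absorb1)
 have "x ` ?W' = {v \<in> x ` W. (%j. if j < m then G j (inv_into U x v) else 0) \<in> O'}"
 proof (rule subset_antisym[OF subsetI subsetI])
  fix v assume "v \<in> x ` ?W'"
  then obtain q where "q \<in> W" "(%j. if j < m then G j q else 0) \<in> T" "v = x q" by blast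
  then show "v \<in> {v \<in> x ` W. (%j. if j < m then G j (inv_into U x v) else 0) \<in> O'}"
   using chart_inv_into[OF M c subsetD[OF W(2)], of q] O'(2) by (auto cong: if_cong)
 next
  fix v assume "v \<in> {v \<in> x ` W. (%j. if j < m then G j (inv_into U x v) else 0) \<in> O'}"
  then obtain q where q: "q \<in> W" "v = x q" "(%j. if j < m then G j (inv_into U x v) else 0) \<in> O'"
   by blast
  moreover have "inv_into U x v = q" using chart_inv_into[OF M c, of q] W(2) q by auto
  ultimately show "v \<in> x ` ?W'" using O'(2) by (auto cong: if_cong)
 qed
 moreover have "openin (Euclidean_space n) {v \<in> x ` W. (%j. if j < m then G j (inv_into U x v) else 0) \<in> O'}"
  by (rule openin_preimage[OF oW continuous_on_trunc[OF openin_espace_subset[OF oW] G] O'(1)])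
 ultimately show "openin (Euclidean_space n) (x ` ?W')" by simp
qed (use W in auto)

lemma smooth_real_tuple:
 assumes M: "pre_manifold M" and SM: "S \<subseteq> pts M" and g: "!!j. j < m ==> smooth_real M S (g j)"
  and T: "openin (Euclidean_space m) T" and f: "!!k. Ck_on m k T f"
  and gT: "!!p. p \<in> S ==> (%j. if j < m then g j p else 0) \<in> T"
 shows "smooth_real M S (%p. f (%j. if j < m then g j p else 0))"
proof (rule smooth_realI)
 fix p assume p: "p \<in> S"
 then obtain U n x where c: "(U, n, x) \<in> M" "p \<in> U" using pts_chartE[OF M] SM by (metis subsetD)
 obtain W G where G: "openin (mtop M) W" "p \<in> W" "W \<subseteq> U"
  "!!j k. j < m ==> Ck_on n k (x ` W) (%u. G j (inv_into U x u))"
  "!!j q. j < m ==> q \<in> S ==> q \<in> W ==> G j q = g j q"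
  by (rule smooth_real_family[of M m S g p, OF M g p c]) auto
 define W' where "W' = {q \<in> W. (%j. if j < m then G j q else 0) \<in> T}"
 have eq: "(%j. if j < m then G j q else 0) = (%j. if j < m then g j q else 0)" if "q \<in> S" "q \<in> W" for q
  using G(5)[OF _ that] by auto
 have oW': "openin (mtop M) W'"
  unfolding W'_def by (rule tuple_preimage_open[OF M c(1) G(1,3,4) T])
 have "W' \<subseteq> U" using G(3) by (auto simp: W'_def)
 then have oW: "openin (Euclidean_space n) (x ` W)" "openin (Euclidean_space n) (x ` W')"
  using openin_mtop_chart[OF M G(1) c(1)] G(3) openin_mtop_chart[OF M oW' c(1)]
  by (simp_all add: Int_absorb1)
 have "Ck_on n k (x ` W') (%u. f (%j. if j < m then G j (inv_into U x u) else 0))" for k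
 proof (rule Ck_compose[OF oW(2) T _ f])
  show "(%j. if j < m then G j (inv_into U x u) else 0) \<in> T" if "u \<in> x ` W'" for u
   using that chart_inv_into[OF M c(1) subsetD[OF G(3)]] by (auto simp: W'_def cong: if_cong)
  fix j assume j: "j < m"
  have "Ck_on n k (x ` W') (%u. G j (inv_into U x u))"
   by (rule Ck_subset[OF _ openin_espace_subset[OF oW(1)] G(4)[OF j]]) (auto simp: W'_def)
  then show "Ck_on n k (x ` W') (%u. if j < m then G j (inv_into U x u) else 0)" using j by simp
 qed
 moreover have "p \<in> W'" "W' \<subseteq> U" using G(2,3) eq[OF p G(2)] gT[OF p] by (auto simp: W'_def)
 moreover have "\<forall>q\<in>S \<inter> W'. f (%j. if j < m then G j q else 0) = f (%j. if j < m then g j q else 0)"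
  using eq by (auto simp: W'_def)
 ultimately show "smooth_rep M S (%q. f (%j. if j < m then g j q else 0)) p"
  using oW' c(1) by (intro exI[of _ U] exI[of _ n] exI[of _ x] exI[of _ W']
    exI[of _ "%q. f (%j. if j < m then G j q else 0)"]) auto
qed

lemma openin_espace: "openin (Euclidean_space n) (espace n)"
 by simp

lemma smooth_real_const: "pre_manifold M ==> S \<subseteq> pts M ==> smooth_real M S (%p. c)"
 using smooth_real_tuple[of M S 0 "%j p. 0" "espace 0" "%u. c", OF _ _ _ openin_espace Ck_const[OF subset_refl]]
 by (simp add: topspace_Euclidean_space)

lemma smooth_real_add:
 assumes "pre_manifold M" "smooth_real M S f" "smooth_real M S g"
 shows "smooth_real M S (%p. f p + g p)"
proof -
 have "smooth_real M S (%p. (%u. u 0 + u (Suc 0))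
   (%j. if j < 2 then (if j = 0 then f else g) p else 0))"
  by (rule smooth_real_tuple[OF assms(1) smooth_real_pts[OF assms(1,2)] _ openin_espace])
   (use assms in \<open>auto intro!: Ck_add Ck_coord\<close>)
 then show ?thesis by simp
qed

lemma smooth_real_mult:
 assumes "pre_manifold M" "smooth_real M S f" "smooth_real M S g"
 shows "smooth_real M S (%p. f p * g p)"
proof -
 have "smooth_real M S (%p. (%u. u 0 * u (Suc 0))
   (%j. if j < 2 then (if j = 0 then f else g) p else 0))"
  by (rule smooth_real_tuple[OF assms(1) smooth_real_pts[OF assms(1,2)] _ openin_espace])
   (use assms in \<open>auto intro!: Ck_mult Ck_coord\<close>)
 then show ?thesis by simp
qed

lemma openin_coord_preimage: "open B ==> openin (Euclidean_space n) {u \<in> espace n. u i \<in> B}"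
 by (rule openin_preimage[OF openin_espace continuous_on_subset[OF continuous_on_product_coordinates]]) auto

lemma smooth_real_inverse:
 assumes "pre_manifold M" "smooth_real M S f" "!!p. p \<in> S ==> f p \<noteq> 0"
 shows "smooth_real M S (%p. inverse (f p))"
proof -
 let ?T = "{u \<in> espace 1. u 0 \<in> - {0}}"
 have T: "openin (Euclidean_space 1) ?T" by (rule openin_coord_preimage) auto
 have inv: "Ck_on 1 k ?T (%u. inverse (u 0))" for k
  by (rule Ck_inverse[OF openin_espace_subset[OF T] _ Ck_coord[OF openin_espace_subset[OF T]]]) auto
 have "(%j. if j < 1 then f p else 0) \<in> ?T" if "p \<in> S" for p
  using espace_trunc[of 1 "%_. f p"] assms(3)[OF that] by simp
 from smooth_real_tuple[OF assms(1) smooth_real_pts[OF assms(1,2)] assms(2) T inv this]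
 show ?thesis by simp
qed

lemma smooth_real_sum:
 assumes "pre_manifold M" "S \<subseteq> pts M" "!!i. i \<in> I ==> smooth_real M S (f i)"
 shows "smooth_real M S (%p. \<Sum>i\<in>I. f i p)"
 using assms(3) smooth_real_const[OF assms(1,2)] by (induction I rule: infinite_finite_induct)
  (auto intro: smooth_real_add assms)

lemma smooth_real_prod:
 assumes "pre_manifold M" "S \<subseteq> pts M" "!!i. i \<in> I ==> smooth_real M S (f i)"
 shows "smooth_real M S (%p. \<Prod>i\<in>I. f i p)"
 using assms(3) smooth_real_const[OF assms(1,2)] by (induction I rule: infinite_finite_induct)
  (auto intro: smooth_real_mult assms)

lemma smooth_real_chart:
 assumes M: "pre_manifold M" and c: "(V, k, y) \<in> M"
 shows "smooth_real M V (%q. y q j)"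
proof (rule smooth_realI)
 fix p assume p: "p \<in> V"
 have "Ck_on k l (y ` V) (%u. y (inv_into V y u) j)" for l
  using chart_transition[OF M c c, of l j] by simp
 then show "smooth_rep M V (%q. y q j) p"
  using c chart_open[OF M c] p
  by (intro exI[of _ V] exI[of _ k] exI[of _ y] exI[of _ V] exI[of _ "%q. y q j"]) auto
qed


subsection \<open>Maps between manifolds\<close>

text \<open>In a chart around \<open>f p\<close> the components of \<open>f\<close> are smooth near \<open>p\<close>.\<close>

abbreviation smooth_near :: "'a atlas => 'a set => ('a => 'b) => 'b atlas => 'a => bool" where
 "smooth_near M S f N p \<equiv> \<exists>V k y W. (V, k, y) \<in> N \<and> openin (mtop M) W \<and> p \<in> W \<and> f ` (S \<inter> W) \<subseteq> V \<and>
  (\<forall>j<k. smooth_real M (S \<inter> W) (%q. y (f q) j))"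

lemma smooth_onI:
 assumes M: "pre_manifold M" and N: "pre_manifold N"
  and *: "!!p. p \<in> S ==> smooth_near M S f N p"
 shows "smooth_on M S f N"
 unfolding smooth_on_def
proof
 fix p assume p: "p \<in> S"
 then obtain V k y W where y: "(V, k, y) \<in> N" and W: "openin (mtop M) W" "p \<in> W" "f ` (S \<inter> W) \<subseteq> V"
  and s: "!!j. j < k ==> smooth_real M (S \<inter> W) (%q. y (f q) j)"
  using * by metis
 obtain U n x where c: "(U, n, x) \<in> M" "p \<in> U"
  using W openin_mtop_subset[OF M] pts_chartE[OF M] by (metis subsetD)
 obtain W1 G where G: "openin (mtop M) W1" "p \<in> W1" "W1 \<subseteq> U"
  "!!j l. j < k ==> Ck_on n l (x ` W1) (%u. G j (inv_into U x u))"
  "!!j q. j < k ==> q \<in> S \<inter> W ==> q \<in> W1 ==> G j q = y (f q) j"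
  by (rule smooth_real_family[of M k "S \<inter> W" "%j q. y (f q) j" p, OF M s _ c]) (use p W in auto)
 define g where "g q = (%j. if j < k then G j q else 0)" for q
 define W2 where "W2 = W \<inter> {q \<in> W1. g q \<in> y ` V}"
 define F where "F q = inv_into V y (g q)" for q
 have gf: "g q = y (f q)" if "q \<in> S" "q \<in> W" "q \<in> W1" for q
 proof -
  have "y (f q) \<in> espace k" using that W(3) chart_in_espace[OF N y] by blast
  moreover have "g q = (%j. if j < k then y (f q) j else 0)"
   unfolding g_def using G(5) that by (intro ext) auto
  ultimately show ?thesis using espace_eq_trunc by metis
 qed
 have "openin (mtop M) {q \<in> W1. g q \<in> y ` V}"
  unfolding g_def by (rule tuple_preimage_open[OF M c(1) G(1,3,4) chart_image_open[OF N y]])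
 then have oW2: "openin (mtop M) W2" unfolding W2_def using W(1) by (rule openin_Int[rotated])
 have pW2: "p \<in> W2" unfolding W2_def using gf[OF p W(2) G(2)] W G p by auto
 have W2U: "W2 \<subseteq> U" using G(3) by (auto simp: W2_def)
 have Ff: "F q = f q" if "q \<in> S" "q \<in> W2" for q
  using gf[of q] that chart_inv_into[OF N y] W(3) by (auto simp: W2_def F_def)
 have yF: "y (F q) = g q" if "q \<in> W2" for q
  using that by (auto simp: W2_def F_def f_inv_into_f)
 have xo: "openin (Euclidean_space n) (x ` W2)" "openin (Euclidean_space n) (x ` W1)"
  using openin_mtop_chart[OF M oW2 c(1)] openin_mtop_chart[OF M G(1) c(1)] W2U G(3)
  by (simp_all add: Int_absorb1)
 have "coord_smooth n (x ` W2) (%u. y (F (inv_into U x u)))"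
  unfolding coord_smooth_def
 proof (intro allI)
  fix l j
  have "Ck_on n l (x ` W2) (%u. g (inv_into U x u) j)"
  proof (cases "j < k")
   case True
   have "Ck_on n l (x ` W2) (%u. G j (inv_into U x u))"
    by (rule Ck_subset[OF _ openin_espace_subset[OF xo(2)] G(4)[OF True]]) (auto simp: W2_def)
   then show ?thesis using True by (simp add: g_def)
  next
   case False
   then show ?thesis using Ck_const[OF openin_espace_subset[OF xo(1)]] by (simp add: g_def)
  qed
  then show "Ck_on n l (x ` W2) (%u. y (F (inv_into U x u)) j)"
   by (rule Ck_cong[OF xo(1), rotated]) (use yF chart_inv_into[OF M c(1)] W2U in auto)
 qed
 moreover have "F ` W2 \<subseteq> V"
 proof
  fix z assume "z \<in> F ` W2"
  then obtain q where "q \<in> W2" "z = F q" by blast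
  then show "z \<in> V" unfolding F_def W2_def by (auto intro: inv_into_into)
 qed
 ultimately have "smooth_at M F N p"
  unfolding smooth_at_def using c(1) y oW2 pW2 W2U by blast
 then show "\<exists>F W. smooth_at M F N p \<and> openin (mtop M) W \<and> p \<in> W \<and> (\<forall>q\<in>S \<inter> W. F q = f q)"
  using oW2 pW2 Ff by blast
qed

lemma smooth_onE:
 assumes M: "pre_manifold M" and f: "smooth_on M S f N" and p: "p \<in> S"
 obtains V k y W where "(V, k, y) \<in> N" "openin (mtop M) W" "p \<in> W" "f ` (S \<inter> W) \<subseteq> V"
  "!!j. smooth_real M (S \<inter> W) (%q. y (f q) j)"
proof -
 obtain F W where F: "smooth_at M F N p" "openin (mtop M) W" "p \<in> W" "!!q. q \<in> S \<inter> W ==> F q = f q"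
  using f p unfolding smooth_on_def by metis
 from F(1) obtain U n x V k y W0 where c: "(U, n, x) \<in> M" and y: "(V, k, y) \<in> N"
  and W0: "openin (mtop M) W0" "p \<in> W0" "W0 \<subseteq> U" "F ` W0 \<subseteq> V"
  and sm: "coord_smooth n (x ` W0) (%u. y (F (inv_into U x u)))"
  unfolding smooth_at_def by auto
 have oW: "openin (mtop M) (W \<inter> W0)" using F(2) W0(1) by (rule openin_Int)
 have sub: "x ` (W \<inter> W0) \<subseteq> x ` W0" "x ` W0 \<subseteq> espace n"
  using chart_in_espace[OF M c] W0(3) by auto
 show ?thesis
 proof (rule that[OF y oW])
  show "p \<in> W \<inter> W0" using F W0 by blast
  show "f ` (S \<inter> (W \<inter> W0)) \<subseteq> V" using F(4) W0(4) by fastforce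
  fix j
  have "Ck_on n l (x ` (W \<inter> W0)) (%u. y (F (inv_into U x u)) j)" for l
   by (rule Ck_subset[OF sub]) (use sm in \<open>auto simp: coord_smooth_def\<close>)
  then show "smooth_real M (S \<inter> (W \<inter> W0)) (%q. y (f q) j)"
   using F(4) c oW W0(3)
   by (intro smooth_realI exI[of _ U] exI[of _ n] exI[of _ x] exI[of _ "W \<inter> W0"]
     exI[of _ "%q. y (F q) j"]) auto
 qed
qed

lemma smooth_on_pts: "pre_manifold M ==> smooth_on M S f N ==> S \<subseteq> pts M"
 unfolding smooth_on_def using openin_mtop_subset by blast

lemma smooth_on_image_pts: "pre_manifold M ==> smooth_on M S f N ==> p \<in> S ==> f p \<in> pts N"
 by (erule (2) smooth_onE) (force simp: pts_def)

lemma smooth_on_cong_subset: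
 assumes "smooth_on M S f N" "S' \<subseteq> S" "!!p. p \<in> S' ==> f p = g p"
 shows "smooth_on M S' g N"
 unfolding smooth_on_def
proof
 fix p assume "p \<in> S'"
 then obtain F W where *: "smooth_at M F N p" "openin (mtop M) W" "p \<in> W" "\<forall>q \<in> S \<inter> W. F q = f q"
  using assms(1,2) unfolding smooth_on_def by blast
 then have "\<forall>q \<in> S' \<inter> W. F q = g q" using assms(2,3) by auto
 then show "\<exists>F W. smooth_at M F N p \<and> openin (mtop M) W \<and> p \<in> W \<and> (\<forall>q\<in>S' \<inter> W. F q = g q)"
  using * by blast
qed

lemma smooth_on_subset: "smooth_on M S f N ==> S' \<subseteq> S ==> smooth_on M S' f N"
 by (rule smooth_on_cong_subset) auto

lemma smooth_on_cong: "smooth_on M S f N ==> (!!p. p \<in> S ==> f p = g p) ==> smooth_on M S g N"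
 by (rule smooth_on_cong_subset[of M S f]) auto

lemma smooth_on_local:
 assumes M: "pre_manifold M" and N: "pre_manifold N"
  and "!!p. p \<in> S ==> \<exists>W. openin (mtop M) W \<and> p \<in> W \<and> smooth_on M (S \<inter> W) f N"
 shows "smooth_on M S f N"
proof (rule smooth_onI[OF M N])
 fix p assume p: "p \<in> S"
 then obtain W where W: "openin (mtop M) W" "p \<in> W" "smooth_on M (S \<inter> W) f N"
  using assms(3) by blast
 obtain V k y W' where *: "(V, k, y) \<in> N" "openin (mtop M) W'" "p \<in> W'" "f ` ((S \<inter> W) \<inter> W') \<subseteq> V"
  "!!j. smooth_real M ((S \<inter> W) \<inter> W') (%q. y (f q) j)"
  by (rule smooth_onE[OF M W(3)]) (use p W in auto)
 then show "smooth_near M S f N p"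
  using W by (intro exI[of _ V] exI[of _ k] exI[of _ y] exI[of _ "W \<inter> W'"]) (auto simp: Int_assoc)
qed

lemma smooth_on_preimage:
 assumes M: "pre_manifold M" and N: "pre_manifold N" and f: "smooth_on M S f N"
  and p: "p \<in> S" and W: "openin (mtop N) W" "f p \<in> W"
 obtains W' where "openin (mtop M) W'" "p \<in> W'" "f ` (S \<inter> W') \<subseteq> W"
proof -
 obtain V k y W1 where y: "(V, k, y) \<in> N" and W1: "openin (mtop M) W1" "p \<in> W1" "f ` (S \<inter> W1) \<subseteq> V"
  and s: "!!j. smooth_real M (S \<inter> W1) (%q. y (f q) j)"
  by (rule smooth_onE[OF M f p]) blast
 obtain U n x where c: "(U, n, x) \<in> M" "p \<in> U"
  using W1 openin_mtop_subset[OF M] pts_chartE[OF M] by (metis subsetD)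
 obtain W2 G where G: "openin (mtop M) W2" "p \<in> W2" "W2 \<subseteq> U"
  "!!j l. j < k ==> Ck_on n l (x ` W2) (%u. G j (inv_into U x u))"
  "!!j q. j < k ==> q \<in> S \<inter> W1 ==> q \<in> W2 ==> G j q = y (f q) j"
  by (rule smooth_real_family[of M k "S \<inter> W1" "%j q. y (f q) j" p, OF M s _ c]) (use p W1 in auto)
 define g where "g q = (%j. if j < k then G j q else 0)" for q
 have gf: "g q = y (f q)" if "q \<in> S" "q \<in> W1" "q \<in> W2" for q
 proof -
  have "y (f q) \<in> espace k" using that W1(3) chart_in_espace[OF N y] by blast
  moreover have "g q = (%j. if j < k then y (f q) j else 0)"
   unfolding g_def using G(5) that by (intro ext) auto
  ultimately show ?thesis using espace_eq_trunc by metis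
 qed
 have o: "openin (mtop M) {q \<in> W2. g q \<in> y ` (V \<inter> W)}"
  unfolding g_def by (rule tuple_preimage_open[OF M c(1) G(1,3,4) openin_mtop_chart[OF N W(1) y]])
 show ?thesis
 proof (rule that[of "W1 \<inter> {q \<in> W2. g q \<in> y ` (V \<inter> W)}"])
  show "openin (mtop M) (W1 \<inter> {q \<in> W2. g q \<in> y ` (V \<inter> W)})" using W1(1) o by (rule openin_Int)
  show "p \<in> W1 \<inter> {q \<in> W2. g q \<in> y ` (V \<inter> W)}" using gf[of p] p W1 G W by auto
  show "f ` (S \<inter> (W1 \<inter> {q \<in> W2. g q \<in> y ` (V \<inter> W)})) \<subseteq> W"
  proof clarify
   fix q v assume q: "q \<in> S" "q \<in> W1" "q \<in> W2" "g q = y v" "v \<in> V" "v \<in> W"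
   then have "y (f q) = y v" "f q \<in> V" using gf W1(3) by auto
   then have "f q = v" using q chart_inj[OF N y] by (auto simp: inj_on_def)
   then show "f q \<in> W" using q by simp
  qed
 qed
qed

lemma smooth_real_compose:
 assumes M: "pre_manifold M" and N: "pre_manifold N" and g: "smooth_real N T g"
  and f: "smooth_on M S f N" and fT: "!!p. p \<in> S ==> f p \<in> T"
 shows "smooth_real M S (%p. g (f p))"
proof (rule smooth_real_local[OF M])
 fix p assume p: "p \<in> S"
 obtain V k y W1 where y: "(V, k, y) \<in> N" and W1: "openin (mtop M) W1" "p \<in> W1" "f ` (S \<inter> W1) \<subseteq> V"
  and s: "!!j. smooth_real M (S \<inter> W1) (%q. y (f q) j)"
  by (rule smooth_onE[OF M f p]) blast
 obtain W F where F: "openin (mtop N) W" "f p \<in> W" "W \<subseteq> V"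
  "!!l. Ck_on k l (y ` W) (%u. F (inv_into V y u))" "!!q. q \<in> T ==> q \<in> W ==> F q = g q"
  by (rule smooth_real_chartE[OF N g fT[OF p] y]) (use p W1 in auto)
 obtain W2 where W2: "openin (mtop M) W2" "p \<in> W2" "f ` (S \<inter> W2) \<subseteq> W"
  by (rule smooth_on_preimage[OF M N f p F(1,2)])
 let ?W = "W1 \<inter> W2"
 have o: "openin (mtop M) ?W" using W1 W2 by (blast intro: openin_Int)
 have eq: "(%j. if j < k then y (f q) j else 0) = y (f q)" if "q \<in> S \<inter> ?W" for q
  using that W1(3) chart_in_espace[OF N y] by (intro espace_eq_trunc) auto
 have "smooth_real M (S \<inter> ?W) (%q. (%u. F (inv_into V y u)) (%j. if j < k then y (f q) j else 0))"
 proof (rule smooth_real_tuple[OF M _ _ _ F(4)])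
  show "S \<inter> ?W \<subseteq> pts M" using o openin_mtop_subset[OF M] by blast
  show "smooth_real M (S \<inter> ?W) (%q. y (f q) j)" for j by (rule smooth_real_subset[OF s]) auto
  show "openin (Euclidean_space k) (y ` W)"
   using openin_mtop_chart[OF N F(1) y] F(3) by (simp add: Int_absorb1)
  show "(%j. if j < k then y (f q) j else 0) \<in> y ` W" if "q \<in> S \<inter> ?W" for q
   unfolding eq[OF that] using that W2 by auto
 qed
 moreover have "(%u. F (inv_into V y u)) (%j. if j < k then y (f q) j else 0) = g (f q)"
  if "q \<in> S \<inter> ?W" for q
 proof -
  have "f q \<in> V" "f q \<in> W" "f q \<in> T" using that W1(3) W2(3) fT by auto
  then show ?thesis unfolding eq[OF that] using F(5) chart_inv_into[OF N y] by simp
 qed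
 ultimately have "smooth_real M (S \<inter> ?W) (%p. g (f p))" by (rule smooth_real_cong)
 then show "\<exists>W. openin (mtop M) W \<and> p \<in> W \<and> smooth_real M (S \<inter> W) (%p. g (f p))"
  using o W1 W2 by blast
qed

lemma smooth_on_compose:
 assumes M: "pre_manifold M" and N: "pre_manifold N" and Q: "pre_manifold Q"
  and g: "smooth_on N T g Q" and f: "smooth_on M S f N" and fT: "!!p. p \<in> S ==> f p \<in> T"
 shows "smooth_on M S (%p. g (f p)) Q"
proof (rule smooth_onI[OF M Q])
 fix p assume p: "p \<in> S"
 obtain V k y W where *: "(V, k, y) \<in> Q" "openin (mtop N) W" "f p \<in> W" "g ` (T \<inter> W) \<subseteq> V"
  "!!j. smooth_real N (T \<inter> W) (%q. y (g q) j)"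
  by (rule smooth_onE[OF N g fT[OF p]]) blast
 obtain W2 where W2: "openin (mtop M) W2" "p \<in> W2" "f ` (S \<inter> W2) \<subseteq> W"
  by (rule smooth_on_preimage[OF M N f p *(2,3)])
 have "smooth_real M (S \<inter> W2) (%q. y (g (f q)) j)" for j
  by (rule smooth_real_compose[OF M N *(5) smooth_on_subset[OF f]]) (use W2 fT in auto)
 then show "smooth_near M S (%p. g (f p)) Q p"
  using *(1) W2 fT subsetD[OF *(4)] by (intro exI[of _ V] exI[of _ k] exI[of _ y] exI[of _ W2]) auto
qed

lemma smooth_on_id:
 assumes M: "pre_manifold M" "S \<subseteq> pts M" shows "smooth_on M S (%p. p) M"
proof (rule smooth_onI[OF M(1) M(1)])
 fix p assume "p \<in> S"
 then obtain U n x where c: "(U, n, x) \<in> M" "p \<in> U" using pts_chartE[OF M(1)] M(2) by (metis subsetD)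
 have "smooth_real M (S \<inter> U) (%q. x q j)" for j
  by (rule smooth_real_subset[OF smooth_real_chart[OF M(1) c(1)]]) auto
 then show "smooth_near M S (%p. p) M p"
  using c chart_open[OF M(1) c(1)] by (intro exI[of _ U] exI[of _ n] exI[of _ x] exI[of _ U]) auto
qed


lemma smooth_on_const:
 assumes M: "pre_manifold M" "S \<subseteq> pts M" and N: "pre_manifold N" and c: "c \<in> pts N"
 shows "smooth_on M S (%p. c) N"
proof (rule smooth_onI[OF M(1) N])
 fix p assume "p \<in> S"
 obtain V k y where y: "(V, k, y) \<in> N" "c \<in> V" by (rule pts_chartE[OF N c])
 show "smooth_near M S (%p. c) N p"
  using y openin_mtop_pts[OF M(1)] smooth_real_const[OF M(1)] M(2) \<open>p \<in> S\<close>
  by (intro exI[of _ V] exI[of _ k] exI[of _ y] exI[of _ "pts M"]) (auto simp: Int_absorb2)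
qed


subsection \<open>Euclidean space, the line and products as manifolds\<close>

lemma pre_manifold_coord_space: "pre_manifold (coord_space n)"
proof (rule pre_manifoldI)
 fix U k x V l y i j
 assume c: "(U, k, x) \<in> coord_space n" "(V, l, y) \<in> coord_space n"
 then have e: "x = (%u. u)" "y = (%u. u)" "U = espace n" "V = espace n" "k = n"
  by (auto simp: coord_space_def)
 show "openin (Euclidean_space k) (x ` (U \<inter> V))" using openin_espace by (simp add: e)
 have "Ck_on n i (espace n) (%u. inv_into (espace n) (%u. u) u j)"
  by (rule Ck_cong[OF openin_espace _ Ck_coord[OF subset_refl]])
   (simp add: inv_into_f_f[of "%u. u" "espace n", OF inj_on_id2])
 then show "Ck_on k i (x ` (U \<inter> V)) (%u. y (inv_into U x u) j)" by (simp add: e)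
qed (auto simp: coord_space_def)

lemma pts_coord_space [simp]: "pts (coord_space n) = espace n"
 by (simp add: pts_def coord_space_def)

lemma smooth_on_coord_spaceI:
 assumes M: "pre_manifold M" "S \<subseteq> pts M" and "!!p. p \<in> S ==> f p \<in> espace n"
  "!!j. j < n ==> smooth_real M S (%p. f p j)"
 shows "smooth_on M S f (coord_space n)"
proof (rule smooth_onI[OF M(1) pre_manifold_coord_space])
 fix p assume "p \<in> S"
 then show "smooth_near M S f (coord_space n) p"
  using assms openin_mtop_pts[OF M(1)]
  by (intro exI[of _ "espace n"] exI[of _ n] exI[of _ "%u. u"] exI[of _ "pts M"])
   (auto simp: coord_space_def Int_absorb2)
qed

lemma smooth_real_coord: "S \<subseteq> espace n ==> smooth_real (coord_space n) S (%u. u j)"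
 by (rule smooth_real_subset[OF smooth_real_chart[OF pre_manifold_coord_space]])
  (auto simp: coord_space_def)

lemma openin_coord_space: "openin (mtop (coord_space n)) S \<longleftrightarrow> openin (Euclidean_space n) S"
 unfolding openin_mtop[OF pre_manifold_coord_space]
 using openin_espace_subset[of n S]
 by (auto simp: coord_space_def pts_def Int_absorb1)

lemma real_line_chart: "(UNIV, 1, %t i. if i = 0 then t else 0) \<in> real_line"
 by (simp add: real_line_def)

lemma real_line_image: "range (%(t::real) i. if i = 0 then t else 0) = espace 1"
proof (rule subset_antisym[OF subsetI subsetI])
 fix u assume "u \<in> espace 1"
 then have "u = (%i. if i = 0 then u 0 else 0)" by (auto simp: topspace_Euclidean_space)
 then show "u \<in> range (%t i. if i = 0 then t else 0)" by (rule range_eqI)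
qed (auto simp: topspace_Euclidean_space)

lemma inj_real_line: "inj (%(t::real) i::nat. if i = 0 then t else 0)"
 by (rule injI) (metis (mono_tags))

lemma pre_manifold_real_line: "pre_manifold real_line"
proof (rule pre_manifoldI)
 fix U k x V l y i j
 assume c: "(U, k, x) \<in> real_line" "(V, l, y) \<in> real_line"
 show "inj_on x U" using c inj_real_line by (simp add: real_line_def)
 show "openin (Euclidean_space k) (x ` (U \<inter> V))"
  using c openin_espace[of 1] by (simp add: real_line_def real_line_image)
 let ?x = "%(t::real) i::nat. if i = 0 then t else 0"
 have inv: "?x (inv_into UNIV ?x u) = u" if "u \<in> espace 1" for u
  using that by (intro f_inv_into_f) (simp add: real_line_image)
 have "u j = ?x (inv_into UNIV ?x u) j" if "u \<in> espace 1" for u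
  using fun_cong[OF inv[OF that], of j] by (rule sym)
 then have "Ck_on 1 i (espace 1) (%u. ?x (inv_into UNIV ?x u) j)"
  by (rule Ck_cong[OF openin_espace _ Ck_coord[OF subset_refl]])
 then show "Ck_on k i (x ` (U \<inter> V)) (%u. y (inv_into U x u) j)"
  using c by (simp add: real_line_def real_line_image)
qed

lemma smooth_on_real_iff:
 assumes M: "pre_manifold M"
 shows "smooth_on M S f real_line \<longleftrightarrow> smooth_real M S f"
proof
 assume f: "smooth_on M S f real_line"
 have "smooth_real real_line UNIV (%t. if (0::nat) = 0 then t else 0)"
  by (rule smooth_real_chart[OF pre_manifold_real_line real_line_chart])
 from smooth_real_compose[OF M pre_manifold_real_line this f] show "smooth_real M S f" by simp
next
 assume f: "smooth_real M S f"
 show "smooth_on M S f real_line"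
 proof (rule smooth_onI[OF M pre_manifold_real_line])
  fix p assume "p \<in> S"
  then show "smooth_near M S f real_line p"
   using f openin_mtop_pts[OF M] smooth_real_pts[OF M f]
   by (intro exI[of _ UNIV] exI[of _ 1] exI[of _ "%t i. if i = 0 then t else 0"] exI[of _ "pts M"])
    (auto simp: real_line_def Int_absorb2)
 qed
qed

text \<open>The two parts of the coordinates in a product chart.  The first one is cut off at \<open>n\<close> to be a
 point of \<open>espace n\<close>.\<close>

abbreviation coord_take :: "nat => coord => coord" where
 "coord_take n w \<equiv> (%i. if i < n then w i else 0)"

abbreviation coord_drop :: "nat => coord => coord" where
 "coord_drop n w \<equiv> (%i. w (i + n))"

lemma coord_append_in: "v \<in> espace k ==> coord_append n u v \<in> espace (n + k)"
 by (auto simp: coord_append_def topspace_Euclidean_space)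

lemma coord_drop_in: "w \<in> espace (n + k) ==> coord_drop n w \<in> espace k"
 by (auto simp: topspace_Euclidean_space)

lemma coord_take_append: "u \<in> espace n ==> coord_take n (coord_append n u v) = u"
 by (auto simp: coord_append_def topspace_Euclidean_space)

lemma coord_drop_append: "coord_drop n (coord_append n u v) = v"
 by (auto simp: coord_append_def)

lemma coord_append_take_drop: "coord_append n (coord_take n w) (coord_drop n w) = w"
 by (auto simp: coord_append_def)

lemma openin_append:
 assumes "openin (Euclidean_space n) A" "openin (Euclidean_space k) B"
 shows "openin (Euclidean_space (n + k)) {w \<in> espace (n + k). coord_take n w \<in> A \<and> coord_drop n w \<in> B}"
proof -
 obtain A' B' where *: "open A'" "A = espace n \<inter> A'" "open B'" "B = espace k \<inter> B'"
  using assms unfolding openin_Euclidean_space by blast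
 have 1: "continuous_on (espace (n + k)) (coord_take n)"
  by (rule continuous_on_trunc[of _ "n + k" _ 0]) (auto intro: Ck_coord)
 have 2: "continuous_on (espace (n + k)) (coord_drop n)"
  by (rule continuous_on_coordinatewise_then_product)
   (rule continuous_on_subset[OF continuous_on_product_coordinates], simp)
 have "{w \<in> espace (n + k). coord_take n w \<in> A \<and> coord_drop n w \<in> B} =
  {w \<in> espace (n + k). coord_take n w \<in> A'} \<inter> {w \<in> espace (n + k). coord_drop n w \<in> B'}"
  using * coord_drop_in by auto
 then show ?thesis
  using openin_preimage[OF openin_espace 1 *(1)] openin_preimage[OF openin_espace 2 *(3)]
  by (simp add: openin_Int)
qed

lemma append_image:
 assumes "x ` A \<subseteq> espace n" "y ` B \<subseteq> espace k"
 shows "(%(p, q). coord_append n (x p) (y q)) ` (A \<times> B) =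
  {w \<in> espace (n + k). coord_take n w \<in> x ` A \<and> coord_drop n w \<in> y ` B}"
proof (rule subset_antisym[OF subsetI subsetI])
 fix w assume "w \<in> (%(p, q). coord_append n (x p) (y q)) ` (A \<times> B)"
 then obtain p q where pq: "p \<in> A" "q \<in> B" "w = coord_append n (x p) (y q)" by auto
 then show "w \<in> {w \<in> espace (n + k). coord_take n w \<in> x ` A \<and> coord_drop n w \<in> y ` B}"
  using coord_take_append[of "x p" n "y q"] coord_drop_append[of n "x p" "y q"] assms
   coord_append_in[of "y q" k n "x p"] by auto
next
 fix w assume "w \<in> {w \<in> espace (n + k). coord_take n w \<in> x ` A \<and> coord_drop n w \<in> y ` B}"
 then obtain p q where pq: "p \<in> A" "q \<in> B" "coord_take n w = x p" "coord_drop n w = y q" by blast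
 then have "w = coord_append n (x p) (y q)" using coord_append_take_drop by metis
 then show "w \<in> (%(p, q). coord_append n (x p) (y q)) ` (A \<times> B)" using pq by auto
qed

lemma prod_manifold_chartE:
 assumes "(P, l, z) \<in> prod_manifold M N"
 obtains U n x V k y where "(U, n, x) \<in> M" "(V, k, y) \<in> N" "P = U \<times> V" "l = n + k"
  "z = (%(p, q). coord_append n (x p) (y q))"
 using assms unfolding prod_manifold_def by blast

lemma prod_manifold_chartI:
 "(U, n, x) \<in> M ==> (V, k, y) \<in> N ==>
  (U \<times> V, n + k, %(p, q). coord_append n (x p) (y q)) \<in> prod_manifold M N"
 unfolding prod_manifold_def by blast

lemma pts_prod_manifold [simp]: "pts (prod_manifold M N) = pts M \<times> pts N"
proof (rule subset_antisym[OF subsetI subsetI])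
 fix r assume "r \<in> pts (prod_manifold M N)"
 then obtain c where "c \<in> prod_manifold M N" "r \<in> fst c" unfolding pts_def by blast
 moreover obtain P l z where "c = (P, l, z)" by (cases c)
 ultimately show "r \<in> pts M \<times> pts N" by (auto elim!: prod_manifold_chartE simp: pts_def)
next
 fix r assume "r \<in> pts M \<times> pts N"
 then obtain c d where "c \<in> M" "fst r \<in> fst c" "d \<in> N" "snd r \<in> fst d" unfolding pts_def by auto
 moreover obtain U n x V k y where "c = (U, n, x)" "d = (V, k, y)" by (cases c, cases d)
 ultimately have "r \<in> U \<times> V" "(U, n, x) \<in> M" "(V, k, y) \<in> N" by (auto simp: mem_Times_iff)
 with prod_manifold_chartI[OF this(2,3)] show "r \<in> pts (prod_manifold M N)"
  unfolding pts_def by force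
qed

lemma pre_manifold_prod:
 assumes M: "pre_manifold M" and N: "pre_manifold N"
 shows "pre_manifold (prod_manifold M N)"
proof (rule pre_manifoldI)
 fix P l z assume "(P, l, z) \<in> prod_manifold M N"
 then obtain U n x V k y where c: "(U, n, x) \<in> M" "(V, k, y) \<in> N" "P = U \<times> V" "l = n + k"
  "z = (%(p, q). coord_append n (x p) (y q))" by (rule prod_manifold_chartE)
 show inj: "inj_on z P"
 proof (rule inj_onI)
  fix r r' assume r: "r \<in> P" "r' \<in> P" "z r = z r'"
  obtain p q p' q' where e: "r = (p, q)" "r' = (p', q')" by fastforce
  have "x p = x p'"
  proof -
   have "coord_append n (x p) (y q) = coord_append n (x p') (y q')" using r c e by simp
   then have "coord_take n (coord_append n (x p) (y q)) = coord_take n (coord_append n (x p') (y q'))"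
    by (simp only:)
   moreover have "x p \<in> espace n" "x p' \<in> espace n" using r c e chart_in_espace[OF M c(1)] by auto
   ultimately show ?thesis by (simp only: coord_take_append)
  qed
  moreover have "y q = y q'"
   using r c e coord_drop_append[of n "x p" "y q"] coord_drop_append[of n "x p'" "y q'"] by auto
  ultimately show "r = r'"
   using r c e chart_inj[OF M c(1)] chart_inj[OF N c(2)] by (auto simp: inj_on_def)
 qed
 fix P' l' z' assume "(P', l', z') \<in> prod_manifold M N"
 then obtain U' n' x' V' k' y' where d: "(U', n', x') \<in> M" "(V', k', y') \<in> N" "P' = U' \<times> V'" "l' = n' + k'"
  "z' = (%(p, q). coord_append n' (x' p) (y' q))" by (rule prod_manifold_chartE)
 have PP: "P \<inter> P' = (U \<inter> U') \<times> (V \<inter> V')" using c d by auto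
 have im: "z ` (P \<inter> P') = {w \<in> espace (n + k). coord_take n w \<in> x ` (U \<inter> U') \<and> coord_drop n w \<in> y ` (V \<inter> V')}"
  unfolding PP c(5) using chart_in_espace[OF M c(1)] chart_in_espace[OF N c(2)] by (intro append_image) auto
 show o: "openin (Euclidean_space l) (z ` (P \<inter> P'))"
  unfolding im c(4) by (rule openin_append[OF chart_Int_open[OF M c(1) d(1)] chart_Int_open[OF N c(2) d(2)]])
 fix i j
 let ?a = "%w. x' (inv_into U x (coord_take n w))" and ?b = "%w. y' (inv_into V y (coord_drop n w))"
 have a: "Ck_on l i (z ` (P \<inter> P')) (%w. ?a w j)" for j
 proof (rule Ck_compose[OF o chart_Int_open[OF M c(1) d(1)] _ chart_transition[OF M c(1) d(1)]])
  show "coord_take n w \<in> x ` (U \<inter> U')" if "w \<in> z ` (P \<inter> P')" for w using that unfolding im by blast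
  show "Ck_on l i (z ` (P \<inter> P')) (%w. coord_take n w j)" for j
   using Ck_coord[OF openin_espace_subset[OF o]] Ck_const[OF openin_espace_subset[OF o]] by (cases "j < n") auto
 qed
 have b: "Ck_on l i (z ` (P \<inter> P')) (%w. ?b w j)" for j
 proof (rule Ck_compose[OF o chart_Int_open[OF N c(2) d(2)] _ chart_transition[OF N c(2) d(2)]])
  show "coord_drop n w \<in> y ` (V \<inter> V')" if "w \<in> z ` (P \<inter> P')" for w using that unfolding im by blast
  show "Ck_on l i (z ` (P \<inter> P')) (%w. coord_drop n w j)" for j
   by (rule Ck_coord[OF openin_espace_subset[OF o]])
 qed
 have "Ck_on l i (z ` (P \<inter> P')) (%w. coord_append n' (?a w) (?b w) j)"
  unfolding coord_append_def using a[of j] b[of "j - n'"] by (cases "j < n'") auto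
 then show "Ck_on l i (z ` (P \<inter> P')) (%w. z' (inv_into P z w) j)"
 proof (rule Ck_cong[OF o, rotated])
  fix w assume "w \<in> z ` (P \<inter> P')"
  then obtain p q where pq: "(p, q) \<in> P" "(p, q) \<in> P'" "w = z (p, q)" by auto
  have "inv_into P z w = (p, q)" unfolding pq(3) by (rule inv_into_f_f[OF inj pq(1)])
  moreover have "inv_into U x (coord_take n w) = p"
   using pq c coord_take_append[of "x p" n "y q"] chart_in_espace[OF M c(1), of p]
    chart_inv_into[OF M c(1), of p] by auto
  moreover have "inv_into V y (coord_drop n w) = q"
   using pq c coord_drop_append[of n "x p" "y q"] chart_inv_into[OF N c(2), of q] by auto
  ultimately show "coord_append n' (?a w) (?b w) j = z' (inv_into P z w) j" by (simp add: d(5))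
 qed
qed

lemma smooth_on_fst:
 assumes M: "pre_manifold M" and N: "pre_manifold N" and S: "S \<subseteq> pts M \<times> pts N"
 shows "smooth_on (prod_manifold M N) S fst M"
proof (rule smooth_onI[OF pre_manifold_prod[OF M N] M])
 fix r assume r: "r \<in> S"
 then have "fst r \<in> pts M" "snd r \<in> pts N" using S by auto
 then obtain U n x V k y where c: "(U, n, x) \<in> M" "fst r \<in> U" "(V, k, y) \<in> N" "snd r \<in> V"
  by (metis pts_chartE[OF M] pts_chartE[OF N])
 note C = prod_manifold_chartI[OF c(1,3)]
 have "smooth_real (prod_manifold M N) (S \<inter> (U \<times> V)) (%z. x (fst z) j)" if "j < n" for j
 proof (rule smooth_real_cong)
  show "smooth_real (prod_manifold M N) (S \<inter> (U \<times> V)) (%z. (%(p, q). coord_append n (x p) (y q)) z j)"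
   by (rule smooth_real_subset[OF smooth_real_chart[OF pre_manifold_prod[OF M N] C]]) auto
 qed (use that in \<open>auto simp: coord_append_def\<close>)
 then show "smooth_near (prod_manifold M N) S fst M r"
  using c chart_open[OF pre_manifold_prod[OF M N] C]
  by (intro exI[of _ U] exI[of _ n] exI[of _ x] exI[of _ "U \<times> V"]) (auto simp: mem_Times_iff)
qed

lemma smooth_on_snd:
 assumes M: "pre_manifold M" and N: "pre_manifold N" and S: "S \<subseteq> pts M \<times> pts N"
 shows "smooth_on (prod_manifold M N) S snd N"
proof (rule smooth_onI[OF pre_manifold_prod[OF M N] N])
 fix r assume r: "r \<in> S"
 then have "fst r \<in> pts M" "snd r \<in> pts N" using S by auto
 then obtain U n x V k y where c: "(U, n, x) \<in> M" "fst r \<in> U" "(V, k, y) \<in> N" "snd r \<in> V"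
  by (metis pts_chartE[OF M] pts_chartE[OF N])
 note C = prod_manifold_chartI[OF c(1,3)]
 have "smooth_real (prod_manifold M N) (S \<inter> (U \<times> V)) (%z. y (snd z) j)" if "j < k" for j
 proof (rule smooth_real_cong)
  show "smooth_real (prod_manifold M N) (S \<inter> (U \<times> V)) (%z. (%(p, q). coord_append n (x p) (y q)) z (n + j))"
   by (rule smooth_real_subset[OF smooth_real_chart[OF pre_manifold_prod[OF M N] C]]) auto
 qed (auto simp: coord_append_def)
 then show "smooth_near (prod_manifold M N) S snd N r"
  using c chart_open[OF pre_manifold_prod[OF M N] C]
  by (intro exI[of _ V] exI[of _ k] exI[of _ y] exI[of _ "U \<times> V"]) (auto simp: mem_Times_iff)
qed

lemma smooth_on_Pair:
 assumes L: "pre_manifold L" and M: "pre_manifold M" and N: "pre_manifold N"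
  and f: "smooth_on L S f M" and g: "smooth_on L S g N"
 shows "smooth_on L S (%s. (f s, g s)) (prod_manifold M N)"
proof (rule smooth_onI[OF L pre_manifold_prod[OF M N]])
 fix s assume s: "s \<in> S"
 obtain U n x W where x: "(U, n, x) \<in> M" "openin (mtop L) W" "s \<in> W" "f ` (S \<inter> W) \<subseteq> U"
  "!!j. smooth_real L (S \<inter> W) (%q. x (f q) j)" by (rule smooth_onE[OF L f s]) blast
 obtain V k y W' where y: "(V, k, y) \<in> N" "openin (mtop L) W'" "s \<in> W'" "g ` (S \<inter> W') \<subseteq> V"
  "!!j. smooth_real L (S \<inter> W') (%q. y (g q) j)" by (rule smooth_onE[OF L g s]) blast
 have "smooth_real L (S \<inter> (W \<inter> W')) (%q. coord_append n (x (f q)) (y (g q)) j)" for j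
  using smooth_real_subset[OF x(5), of "S \<inter> (W \<inter> W')" j]
   smooth_real_subset[OF y(5), of "S \<inter> (W \<inter> W')" "j - n"]
  by (cases "j < n") (auto simp: coord_append_def)
 moreover have "openin (mtop L) (W \<inter> W')" using x y by (blast intro: openin_Int)
 ultimately show "smooth_near L S (%s. (f s, g s)) (prod_manifold M N) s"
  using prod_manifold_chartI[OF x(1) y(1)] x y
  by (intro exI[of _ "U \<times> V"] exI[of _ "n + k"] exI[of _ "%(p, q). coord_append n (x p) (y q)"]
    exI[of _ "W \<inter> W'"]) auto
qed

text \<open>The three components of a map into a triple product.\<close>

lemma smooth_triple:
 assumes A: "pre_manifold A" and B: "pre_manifold B" and C: "pre_manifold C"
  and S: "S \<subseteq> pts A \<times> (pts B \<times> pts C)"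
 shows "smooth_on (prod_manifold A (prod_manifold B C)) S fst A"
  and "smooth_on (prod_manifold A (prod_manifold B C)) S (%p. fst (snd p)) B"
  and "smooth_on (prod_manifold A (prod_manifold B C)) S (%p. snd (snd p)) C"
proof -
 note BC = pre_manifold_prod[OF B C]
 note N = pre_manifold_prod[OF A BC]
 have S': "S \<subseteq> pts A \<times> pts (prod_manifold B C)" using S by simp
 have T: "snd p \<in> pts B \<times> pts C" if "p \<in> S" for p using S that by (auto simp: mem_Times_iff)
 show "smooth_on (prod_manifold A (prod_manifold B C)) S fst A" by (rule smooth_on_fst[OF A BC S'])
 note s = smooth_on_snd[OF A BC S']
 show "smooth_on (prod_manifold A (prod_manifold B C)) S (%p. fst (snd p)) B"
  by (rule smooth_on_compose[OF N BC B smooth_on_fst[OF B C subset_refl] s T])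
 show "smooth_on (prod_manifold A (prod_manifold B C)) S (%p. snd (snd p)) C"
  by (rule smooth_on_compose[OF N BC C smooth_on_snd[OF B C subset_refl] s T])
qed

section \<open>Inverting smooth families of matrices\<close>

text \<open>\<open>b\<close> is a right inverse of the \<open>k\<close> by \<open>k\<close> matrix \<open>a\<close>; entries with larger indices are irrelevant.\<close>

definition mat_inv :: "nat => (nat => nat => real) => (nat => nat => real) => bool" where
 "mat_inv k a b \<longleftrightarrow> (\<forall>i<k. \<forall>l<k. (\<Sum>j<k. a i j * b j l) = (if i = l then 1 else 0))"

lemma mat_inv_iff:
 "mat_inv k a b \<longleftrightarrow> mat k k (%(i, j). a i j) * mat k k (%(i, j). b i j) = 1\<^sub>m k" (is "_ \<longleftrightarrow> ?A * ?B = _")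
proof -
 have entry: "(?A * ?B) $$ (i, l) = (\<Sum>j<k. a i j * b j l)" if "i < k" "l < k" for i l
  using that by (simp add: times_mat_def scalar_prod_def lessThan_atLeast0)
 show ?thesis
 proof
  assume "mat_inv k a b"
  then show "?A * ?B = 1\<^sub>m k" by (intro eq_matI) (simp_all add: entry mat_inv_def del: index_mult_mat(1))
 next
  assume "?A * ?B = 1\<^sub>m k"
  then show "mat_inv k a b" unfolding mat_inv_def by (simp add: entry[symmetric] del: index_mult_mat(1))
 qed
qed

lemma mat_inv_sym: "mat_inv k a b ==> mat_inv k b a"
 unfolding mat_inv_iff by (rule mat_mult_left_right_inverse) auto

lemma mat_inv_det: "mat_inv k a b ==> det (mat k k (%(i, j). a i j)) \<noteq> 0"
 unfolding mat_inv_iff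
 by (metis det_mult det_one mat_carrier mult_zero_left zero_neq_one)

lemma det_mat_inv:
 assumes "det (mat k k (%(i, j). a i j)) \<noteq> 0" (is "det ?A \<noteq> 0")
 shows "mat_inv k a (%i j. adj_mat ?A $$ (i, j) * inverse (det ?A))"
proof -
 have A: "?A \<in> carrier_mat k k" by simp
 have "(?A * adj_mat ?A) $$ (i, l) = (\<Sum>j<k. a i j * adj_mat ?A $$ (j, l))" if "i < k" "l < k" for i l
  using that adj_mat(1)[OF A] by (simp add: times_mat_def scalar_prod_def lessThan_atLeast0)
 then have "(\<Sum>j<k. a i j * adj_mat ?A $$ (j, l)) = det ?A * (if i = l then 1 else 0)"
  if "i < k" "l < k" for i l
  using that adj_mat(2)[OF A] by simp
 then show ?thesis
  using assms unfolding mat_inv_def by (simp add: mult.assoc[symmetric] sum_distrib_right[symmetric])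
qed

lemma smooth_real_det:
 assumes M: "pre_manifold M" "S \<subseteq> pts M"
  and a: "!!i j. i < k ==> j < k ==> smooth_real M S (a i j)"
 shows "smooth_real M S (%p. det (mat k k (%(i, j). a i j p)))"
proof -
 have "smooth_real M S (%p. \<Sum>\<pi> | \<pi> permutes {0..<k}. signof \<pi> * (\<Prod>i = 0..<k. a i (\<pi> i) p))"
 proof (intro smooth_real_sum[OF M] smooth_real_mult[OF M(1)] smooth_real_prod[OF M] smooth_real_const[OF M])
  fix \<pi> i assume "\<pi> \<in> {\<pi>. \<pi> permutes {0..<k}}" "i \<in> {0..<k}"
  then show "smooth_real M S (a i (\<pi> i))"
   using permutes_in_image[of \<pi> "{0..<k}" i] by (intro a) auto
 qed
 then show ?thesis
 proof (rule smooth_real_cong)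
  fix p
  have "(\<Prod>i = 0..<k. mat k k (%(i, j). a i j p) $$ (i, \<pi> i)) = (\<Prod>i = 0..<k. a i (\<pi> i) p)"
   if "\<pi> permutes {0..<k}" for \<pi>
   using that permutes_in_image[of \<pi> "{0..<k}"] by (intro prod.cong) auto
  then show "(\<Sum>\<pi> | \<pi> permutes {0..<k}. signof \<pi> * (\<Prod>i = 0..<k. a i (\<pi> i) p)) =
    det (mat k k (%(i, j). a i j p))"
   by (subst det_def'[of _ k]) (auto intro!: sum.cong)
 qed
qed

lemma smooth_matrix_inverse:
 assumes M: "pre_manifold M" "S \<subseteq> pts M"
  and a: "!!i j. i < k ==> j < k ==> smooth_real M S (a i j)"
  and inv: "!!p. p \<in> S ==> \<exists>b. mat_inv k (%i j. a i j p) b"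
 obtains b where "!!i j. i < k ==> j < k ==> smooth_real M S (b i j)"
  "!!p. p \<in> S ==> mat_inv k (%i j. a i j p) (%i j. b i j p)"
proof -
 define A where "A p = mat k k (%(i, j). a i j p)" for p
 define b where "b i j p = adj_mat (A p) $$ (i, j) * inverse (det (A p))" for i j p
 have d: "det (A p) \<noteq> 0" if "p \<in> S" for p
  using inv[OF that] mat_inv_det unfolding A_def by blast
 have "smooth_real M S (b i j)" if ij: "i < k" "j < k" for i j
 proof -
  let ?r = "%l. if l < j then l else Suc l" and ?c = "%l. if l < i then l else Suc l"
  have "smooth_real M S (%p. (-1) ^ (j + i) * det (mat (k - 1) (k - 1) (%(i', j'). a (?r i') (?c j') p)))"
   using ij by (intro smooth_real_mult[OF M(1)] smooth_real_const[OF M] smooth_real_det[OF M] a) auto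
  then have "smooth_real M S (%p. adj_mat (A p) $$ (i, j))"
  proof (rule smooth_real_cong)
   fix p
   have "mat_delete (A p) j i = mat (k - 1) (k - 1) (%(i', j'). a (?r i') (?c j') p)"
    unfolding mat_delete_def A_def using ij by (intro eq_matI) auto
   then show "(-1) ^ (j + i) * det (mat (k - 1) (k - 1) (%(i', j'). a (?r i') (?c j') p)) =
    adj_mat (A p) $$ (i, j)"
    using ij by (simp add: adj_mat_def cofactor_def A_def)
  qed
  moreover have "smooth_real M S (%p. inverse (det (A p)))"
   using d by (intro smooth_real_inverse[OF M(1)]) (auto simp: A_def intro!: smooth_real_det[OF M] a)
  ultimately show ?thesis unfolding b_def by (intro smooth_real_mult[OF M(1)])
 qed
 moreover have "mat_inv k (%i j. a i j p) (%i j. b i j p)" if "p \<in> S" for p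
  using det_mat_inv[OF d[OF that, unfolded A_def]] unfolding b_def A_def .
 ultimately show ?thesis using that by blast
qed

lemma openin_real_line: "open B ==> openin (mtop real_line) B"
proof -
 assume "open B"
 have "(%t i. if i = 0 then t else 0) ` B = {u \<in> espace 1. u 0 \<in> B}"
 proof (rule subset_antisym[OF subsetI subsetI])
  fix u assume u: "u \<in> {u \<in> espace 1. u 0 \<in> B}"
  then have "u = (%i. if i = 0 then u 0 else 0)" by (auto simp: topspace_Euclidean_space)
  then show "u \<in> (%t i. if i = 0 then t else 0) ` B" using u by blast
 qed (auto simp: topspace_Euclidean_space)
 then show ?thesis
  using openin_coord_preimage[OF \<open>open B\<close>, of 1 0]
  by (intro openin_mtopI_chart[OF pre_manifold_real_line real_line_chart]) auto
qed

lemma smooth_real_nonzero_near: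
 assumes M: "pre_manifold M" and d: "smooth_real M S d" "p \<in> S" "d p \<noteq> 0"
 obtains W where "openin (mtop M) W" "p \<in> W" "!!q. q \<in> S ==> q \<in> W ==> d q \<noteq> 0"
proof -
 have "openin (mtop real_line) (- {0})" by (rule openin_real_line) auto
 then obtain W where "openin (mtop M) W" "p \<in> W" "d ` (S \<inter> W) \<subseteq> - {0}"
  using smooth_on_preimage[OF M pre_manifold_real_line, of S d p "- {0}"] d
  by (auto simp: smooth_on_real_iff[OF M])
 then show ?thesis using that by blast
qed

lemma matrix_invertible_near:
 assumes M: "pre_manifold M" "S \<subseteq> pts M"
  and a: "!!i j. i < k ==> j < k ==> smooth_real M S (a i j)"
  and p: "p \<in> S" "mat_inv k (%i j. a i j p) b"
 obtains W where "openin (mtop M) W" "p \<in> W" "!!q. q \<in> S ==> q \<in> W ==> \<exists>b. mat_inv k (%i j. a i j q) b"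
proof -
 obtain W where W: "openin (mtop M) W" "p \<in> W"
  "!!q. q \<in> S ==> q \<in> W ==> det (mat k k (%(i, j). a i j q)) \<noteq> 0"
  using smooth_real_nonzero_near[OF M(1) smooth_real_det[OF M a] p(1) mat_inv_det[OF p(2)]] by blast
 show ?thesis
 proof (rule that[OF W(1,2)])
  fix q assume "q \<in> S" "q \<in> W"
  from W(3)[OF this] have "det (mat k k (%(i, j). (%i j. a i j q) i j)) \<noteq> 0" .
  from det_mat_inv[OF this] show "\<exists>b. mat_inv k (%i j. a i j q) b" by (rule exI[of "mat_inv k (%i j. a i j q)"])
 qed
qed

text \<open>Comparing traces: mutually inverse rectangular matrices are square.\<close>

lemma mat_inv_square:
 fixes a b :: "nat => nat => real"
 assumes "!!i. i < k ==> (\<Sum>j<l. a i j * b j i) = 1" "!!j. j < l ==> (\<Sum>i<k. b j i * a i j) = 1"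
 shows "k = l"
proof -
 have "real k = (\<Sum>i<k. \<Sum>j<l. a i j * b j i)" using assms(1) by simp
 also have "\<dots> = (\<Sum>j<l. \<Sum>i<k. b j i * a i j)" by (subst sum.swap) (simp add: mult.commute)
 also have "\<dots> = real l" using assms(2) by simp
 finally show ?thesis by simp
qed


section \<open>Linear combinations in the fibres\<close>

text \<open>A real vector space carried by a set, such as a fibre of a vector bundle.\<close>

locale fibre_space =
 fixes V :: "'e set" and pl :: "'e => 'e => 'e" and sc :: "real => 'e => 'e" and z :: 'e
 assumes laws: "vector_space_laws V pl sc z"
begin

lemma z_in: "z \<in> V"
 and pl_in: "x \<in> V ==> y \<in> V ==> pl x y \<in> V"
 and sc_in: "x \<in> V ==> sc r x \<in> V"
 and pl_assoc: "x \<in> V ==> y \<in> V ==> w \<in> V ==> pl (pl x y) w = pl x (pl y w)"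
 and pl_comm: "x \<in> V ==> y \<in> V ==> pl x y = pl y x"
 and z_pl: "x \<in> V ==> pl z x = x"
 and pl_neg: "x \<in> V ==> pl x (sc (- 1) x) = z"
 and sc_one: "x \<in> V ==> sc 1 x = x"
 and sc_sc: "x \<in> V ==> sc r (sc s x) = sc (r * s) x"
 and sc_add: "x \<in> V ==> sc (r + s) x = pl (sc r x) (sc s x)"
 and sc_pl: "x \<in> V ==> y \<in> V ==> sc r (pl x y) = pl (sc r x) (sc r y)"
 by (insert laws[unfolded vector_space_laws_def]) metis+

lemma pl_z: "x \<in> V ==> pl x z = x"
 using z_pl pl_comm z_in by simp

lemma pl_cancel: "x \<in> V ==> y \<in> V ==> w \<in> V ==> pl x y = pl x w ==> y = w"
 by (metis pl_assoc pl_comm pl_neg sc_in z_pl)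

lemma pl_diff_eq: "x \<in> V ==> y \<in> V ==> pl y (pl x (sc (- 1) y)) = x"
 by (metis pl_assoc pl_comm pl_neg sc_in z_pl pl_in)

lemma diff_pl_eq: "x \<in> V ==> y \<in> V ==> pl (pl y x) (sc (- 1) y) = x"
 by (metis pl_assoc pl_comm pl_neg sc_in z_pl pl_in)

lemma sc_zero: "x \<in> V ==> sc 0 x = z"
 by (metis add_cancel_right_right pl_cancel pl_z sc_add sc_in z_in)

lemma sc_z: "sc r z = z"
 by (metis mult_zero_right sc_sc sc_zero z_in)

lemma pl_swap4:
 "a \<in> V ==> b \<in> V ==> c \<in> V ==> d \<in> V ==> pl (pl a b) (pl c d) = pl (pl a c) (pl b d)"
 by (metis pl_assoc pl_comm pl_in)

abbreviation lc :: "nat => coord => (nat => 'e) => 'e" where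
 "lc k c s \<equiv> lin_comb pl sc z k c s"

lemma lc_in: "(!!i. i < k ==> s i \<in> V) ==> lc k c s \<in> V"
 by (induction k) (auto intro: z_in pl_in sc_in)

lemma lc_add: "(!!i. i < k ==> s i \<in> V) ==> lc k (%i. c i + c' i) s = pl (lc k c s) (lc k c' s)"
proof (induction k)
 case (Suc k)
 then have "lc k c s \<in> V" "lc k c' s \<in> V" "s k \<in> V" by (auto intro: lc_in)
 then show ?case using Suc by (simp add: sc_add pl_swap4 sc_in)
qed (simp add: z_pl z_in)

lemma lc_scale: "(!!i. i < k ==> s i \<in> V) ==> lc k (%i. r * c i) s = sc r (lc k c s)"
proof (induction k)
 case (Suc k)
 then have "lc k c s \<in> V" "s k \<in> V" by (auto intro: lc_in)
 then show ?case using Suc by (simp add: sc_pl sc_sc sc_in)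
qed (simp add: sc_z)

lemma lc_zero: "(!!i. i < k ==> s i \<in> V) ==> lc k (%i. 0) s = z"
 using lc_scale[of k s 0 "%i. 0"] lc_in[of k s] by (simp add: sc_zero)

end

lemma lin_comb_cong:
 "(!!i. i < k ==> c i = c' i) ==> (!!i. i < k ==> s i = s' i) ==>
  lin_comb pl sc z k c s = lin_comb pl sc z k c' s'"
 by (induction k) auto

text \<open>The coefficients of a vector in a basis \<open>s\<close> of \<open>k\<close> vectors, 0 from index \<open>k\<close> on.\<close>

definition lin_coeffs ::
  "('e => 'e => 'e) => (real => 'e => 'e) => 'e => nat => (nat => 'e) => 'e => coord" where
 "lin_coeffs pl sc z k s e = (THE c. c \<in> espace k \<and> e = lin_comb pl sc z k c s)"

context fibre_space
begin

lemma lc_delta: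
 assumes "!!i. i < k ==> s i \<in> V" "j < k"
 shows "lc k (%i. if i = j then 1 else 0) s = s j"
 using assms
proof (induction k)
 case (Suc k)
 show ?case
 proof (cases "j = k")
  case True
  have "lc k (%i. if i = j then 1 else 0) s = lc k (%i. 0) s"
   using True by (intro lin_comb_cong) auto
  then show ?thesis using True Suc.prems lc_zero[of k s] by (simp add: sc_one z_pl)
 next
  case False
  then have "lc k (%i. if i = j then 1 else 0) s = s j" using Suc by simp
  then show ?thesis using False Suc.prems by (simp add: sc_zero pl_z)
 qed
qed simp

lemma lc_lc:
 assumes "!!i. i < l ==> s i \<in> V"
 shows "lc k c (%i. lc l (a i) s) = lc l (%j. \<Sum>i<k. c i * a i j) s"
 using assms
 by (induction k) (simp_all add: lc_zero lc_add lc_scale)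

lemma lc_map:
 assumes "fibre_space V' pl' sc' z'" "!!x. x \<in> V ==> f x \<in> V'"
  "!!x y. x \<in> V ==> y \<in> V ==> f (pl x y) = pl' (f x) (f y)"
  "!!x r. x \<in> V ==> f (sc r x) = sc' r (f x)"
  "!!i. i < k ==> s i \<in> V"
 shows "f (lc k c s) = lin_comb pl' sc' z' k c (%i. f (s i))"
 using assms(5)
proof (induction k)
 case 0
 have "f z = f (sc 0 z)" by (simp add: sc_z)
 also have "\<dots> = z'" using assms(4)[OF z_in] fibre_space.sc_zero[OF assms(1) assms(2)[OF z_in]] by simp
 finally show ?case by simp
next
 case (Suc k)
 then have "lc k c s \<in> V" "s k \<in> V" by (auto intro: lc_in)
 then show ?case using Suc by (simp add: assms(3,4) sc_in)
qed

lemma lc_real: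
 assumes "!!x y. x \<in> V ==> y \<in> V ==> f (pl x y) = f x + f y"
  "!!x r. x \<in> V ==> f (sc r x) = r * f x" "!!i. i < k ==> s i \<in> V"
 shows "f (lc k c s) = (\<Sum>i<k. c i * f (s i))"
 using assms(3)
proof (induction k)
 case 0
 have "f z = f (sc 0 z)" by (simp add: sc_z)
 then show ?case using assms(2)[OF z_in, of 0] by simp
next
 case (Suc k)
 then have "lc k c s \<in> V" "s k \<in> V" by (auto intro: lc_in)
 then show ?case using Suc by (simp add: assms(1,2) sc_in)
qed

definition basis :: "nat => (nat => 'e) => bool" where
 "basis k s \<longleftrightarrow> (\<forall>i<k. s i \<in> V) \<and> (\<forall>e\<in>V. \<exists>!c. c \<in> espace k \<and> e = lc k c s)"

abbreviation coeffs :: "nat => (nat => 'e) => 'e => coord" where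
 "coeffs \<equiv> lin_coeffs pl sc z"

lemma basis_in: "basis k s ==> i < k ==> s i \<in> V"
 unfolding basis_def by blast

lemma
 assumes "basis k s" "e \<in> V"
 shows coeffs_in: "coeffs k s e \<in> espace k" and lc_coeffs: "lc k (coeffs k s e) s = e"
proof -
 have "\<exists>!c. c \<in> espace k \<and> e = lc k c s" using assms unfolding basis_def by blast
 from theI'[OF this] show "coeffs k s e \<in> espace k" "lc k (coeffs k s e) s = e"
  unfolding lin_coeffs_def by simp_all
qed

lemma coeffs_unique:
 assumes "basis k s" "c \<in> espace k" "e = lc k c s" shows "coeffs k s e = c"
proof -
 have "e \<in> V" unfolding assms(3) by (rule lc_in) (rule basis_in[OF assms(1)])
 then have "\<exists>!c. c \<in> espace k \<and> e = lc k c s" using assms(1) unfolding basis_def by blast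
 then show ?thesis unfolding lin_coeffs_def by (rule the1_equality) (simp add: assms(2,3))
qed

lemma coeffs_lc: "basis k s ==> i < k ==> coeffs k s (lc k c s) i = c i"
proof -
 assume b: "basis k s" and i: "i < k"
 have "lc k c s = lc k (%j. if j < k then c j else 0) s" by (rule lin_comb_cong) auto
 from coeffs_unique[OF b espace_trunc this] i show ?thesis by simp
qed

lemma coeffs_add: "basis k s ==> x \<in> V ==> y \<in> V ==> coeffs k s (pl x y) i = coeffs k s x i + coeffs k s y i"
proof -
 assume b: "basis k s" and xy: "x \<in> V" "y \<in> V"
 have "coeffs k s (pl x y) = (%i. coeffs k s x i + coeffs k s y i)"
 proof (rule coeffs_unique[OF b])
  show "(%i. coeffs k s x i + coeffs k s y i) \<in> espace k"
   using coeffs_in[OF b] xy by (auto simp: topspace_Euclidean_space)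
  show "pl x y = lc k (%i. coeffs k s x i + coeffs k s y i) s"
   using lc_coeffs[OF b] xy basis_in[OF b] by (simp add: lc_add)
 qed
 then show ?thesis by simp
qed

lemma coeffs_scale: "basis k s ==> x \<in> V ==> coeffs k s (sc r x) i = r * coeffs k s x i"
proof -
 assume b: "basis k s" and x: "x \<in> V"
 have "coeffs k s (sc r x) = (%i. r * coeffs k s x i)"
 proof (rule coeffs_unique[OF b])
  show "(%i. r * coeffs k s x i) \<in> espace k"
   using coeffs_in[OF b x] by (auto simp: topspace_Euclidean_space)
  show "sc r x = lc k (%i. r * coeffs k s x i) s"
   using lc_coeffs[OF b x] basis_in[OF b] by (simp add: lc_scale)
 qed
 then show ?thesis by simp
qed

lemma coeffs_basis: "basis k s ==> j < k ==> i < k ==> coeffs k s (s j) i = (if i = j then 1 else 0)"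
 using coeffs_lc[of k s i "%i. if i = j then 1 else 0"] lc_delta[of k s j] basis_in[of k s] by simp

lemma coeffs_of_lc:
 assumes b: "basis k s" and s': "!!i. i < l ==> s' i \<in> V" and j: "j < k"
 shows "coeffs k s (lc l c s') j = (\<Sum>i<l. c i * coeffs k s (s' i) j)"
 using coeffs_add[OF b] coeffs_scale[OF b] s' by (rule lc_real)

lemma basis_change:
 assumes b: "basis k s" and b': "basis l s'" and i: "i < l" "i' < l"
 shows "(\<Sum>j<k. coeffs k s (s' i) j * coeffs l s' (s j) i') = (if i = i' then 1 else 0)"
proof -
 have "(\<Sum>j<k. coeffs k s (s' i) j * coeffs l s' (s j) i') = coeffs l s' (lc k (coeffs k s (s' i)) s) i'"
  using coeffs_of_lc[OF b' _ i(2), of k s] basis_in[OF b] by simp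
 also have "\<dots> = coeffs l s' (s' i) i'" using lc_coeffs[OF b basis_in[OF b' i(1)]] by simp
 finally show ?thesis using coeffs_basis[OF b'] i by auto
qed

lemma basis_card:
 assumes b: "basis k s" and b': "basis l s'" shows "k = l"
 by (rule mat_inv_square[where a = "%i j. coeffs l s' (s i) j" and b = "%j i. coeffs k s (s' j) i"])
  (simp_all add: basis_change[OF b' b] basis_change[OF b b'])

lemma basis_dual:
 assumes s: "!!i. i < k ==> s i \<in> V"
  and t: "!!i x y. i < k ==> x \<in> V ==> y \<in> V ==> t i (pl x y) = t i x + (t i y :: real)"
  "!!i x r. i < k ==> x \<in> V ==> t i (sc r x) = r * t i x"
  and ts: "!!i j. i < k ==> j < k ==> t i (s j) = (if i = j then 1 else 0)"
  and span: "!!e. e \<in> V ==> e = lc k (%i. t i e) s"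
 shows "basis k s" and "!!e i. e \<in> V ==> i < k ==> coeffs k s e i = t i e"
proof -
 have tc: "t i (lc k c s) = c i" if "i < k" for i c
 proof -
  have "t i (lc k c s) = (\<Sum>j<k. c j * t i (s j))" using that t s by (intro lc_real) auto
  also have "\<dots> = (\<Sum>j<k. if i = j then c j else 0)" using that ts by (intro sum.cong) auto
  finally show ?thesis using that by simp
 qed
 show b: "basis k s"
  unfolding basis_def
 proof (intro conjI allI impI ballI)
  fix e assume e: "e \<in> V"
  have "lc k (%i. if i < k then t i e else 0) s = lc k (%i. t i e) s" by (rule lin_comb_cong) auto
  then have eq: "e = lc k (%i. if i < k then t i e else 0) s" using span[OF e] by simp
  show "\<exists>!c. c \<in> espace k \<and> e = lc k c s"
  proof (rule ex1I[of _ "%i. if i < k then t i e else 0"])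
   show "(%i. if i < k then t i e else 0) \<in> espace k \<and> e = lc k (%i. if i < k then t i e else 0) s"
    using espace_trunc[of k "%i. t i e"] eq by blast
   fix c assume c: "c \<in> espace k \<and> e = lc k c s"
   show "c = (%i. if i < k then t i e else 0)"
    by (rule espace_eqI[of _ k]) (use c tc in auto)
  qed
 qed (rule s)
 fix e i assume "e \<in> V" "i < k"
 then show "coeffs k s e i = t i e" using coeffs_lc[OF b, of i "%i. t i e"] span[of e] by simp
qed

lemma basis_invertible:
 assumes b: "basis k s" and s': "!!i. i < k ==> s' i \<in> V"
  and inv: "mat_inv k (%i j. coeffs k s (s' i) j) m"
 shows "basis k s'" and "!!e i. e \<in> V ==> i < k ==> coeffs k s' e i = (\<Sum>j<k. coeffs k s e j * m j i)"
proof -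
 let ?t = "%i e. \<Sum>j<k. coeffs k s e j * m j i"
 have ss: "lc k (m j) s' = s j" if j: "j < k" for j
 proof -
  have "lc k (m j) s' = lc k (m j) (%i. lc k (coeffs k s (s' i)) s)"
   using lc_coeffs[OF b s'] by (intro lin_comb_cong) auto
  also have "\<dots> = lc k (%l. \<Sum>i<k. m j i * coeffs k s (s' i) l) s"
   by (rule lc_lc) (rule basis_in[OF b])
  also have "\<dots> = lc k (%l. if l = j then 1 else 0) s"
   using mat_inv_sym[OF inv] j unfolding mat_inv_def by (intro lin_comb_cong) auto
  also have "\<dots> = s j" using lc_delta[of k s j] j basis_in[OF b] by simp
  finally show ?thesis .
 qed
 have 1: "e = lc k (%i. ?t i e) s'" if "e \<in> V" for e
 proof -
  have "lc k (%i. ?t i e) s' = lc k (coeffs k s e) (%j. lc k (m j) s')"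
   by (rule lc_lc[symmetric]) (rule s')
  also have "\<dots> = lc k (coeffs k s e) s" using ss by (intro lin_comb_cong) auto
  also have "\<dots> = e" by (rule lc_coeffs[OF b that])
  finally show ?thesis by simp
 qed
 have 2: "?t i (pl x y) = ?t i x + ?t i y" if "x \<in> V" "y \<in> V" for i x y
  using that by (simp add: coeffs_add[OF b] sum.distrib distrib_right)
 have 3: "?t i (sc r x) = r * ?t i x" if "x \<in> V" for i x r
  using that by (simp add: coeffs_scale[OF b] sum_distrib_left mult.assoc)
 have 4: "?t i (s' j) = (if i = j then 1 else 0)" if "i < k" "j < k" for i j
  using inv that unfolding mat_inv_def by auto
 show "basis k s'" by (rule basis_dual(1)[where t = ?t, OF s' 2 3 4 1])
 show "coeffs k s' e i = ?t i e" if "e \<in> V" "i < k" for e i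
  by (rule basis_dual(2)[where t = ?t, OF s' 2 3 4 1 that])
qed

lemma extend_to_basis:
 assumes b: "basis k s" and u: "!!i. i < q ==> u i \<in> V"
  and indep: "!!c. lc q c u = z ==> \<forall>i<q. c i = 0"
 obtains l w where "q \<le> l" "!!i. i < q ==> w i = u i" "basis l w"
proof -
 have "\<exists>l w. q \<le> l \<and> (\<forall>i<q. w i = u i) \<and> (\<forall>i<l. w i \<in> V) \<and> (\<forall>c. lc l c w = z \<longrightarrow> (\<forall>i<l. c i = 0)) \<and>
   (\<forall>i<n. \<exists>c. s i = lc l c w)" if "n \<le> k" for n
  using that
 proof (induction n)
  case 0
  then show ?case using u indep by (intro exI[of _ q] exI[of _ u]) auto
 next
  case (Suc n)
  then obtain l w where w: "q \<le> l" "!!i. i < q ==> w i = u i" "!!i. i < l ==> w i \<in> V"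
   "!!c. lc l c w = z ==> \<forall>i<l. c i = 0" "!!i. i < n ==> \<exists>c. s i = lc l c w"
   by (auto simp: Suc_le_eq)
  have sn: "s n \<in> V" using Suc.prems basis_in[OF b] by simp
  show ?case
  proof (cases "\<exists>c. s n = lc l c w")
   case True
   then show ?thesis using w by (intro exI[of _ l] exI[of _ w]) (auto simp: less_Suc_eq)
  next
   case False
   define w' where "w' i = (if i = l then s n else w i)" for i
   have lcw: "lc l c w' = lc l c w" for c by (rule lin_comb_cong) (auto simp: w'_def)
   have lcV: "lc l c w \<in> V" for c by (rule lc_in) (rule w(3))
   have "\<forall>i<Suc l. c i = 0" if "lc (Suc l) c w' = z" for c
   proof -
    have e: "pl (lc l c w) (sc (c l) (s n)) = z" using that by (simp add: lcw) (simp add: w'_def)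
    have "c l = 0"
    proof (rule ccontr)
     assume c: "c l \<noteq> 0"
     have "sc (c l) (s n) = sc (- 1) (lc l c w)"
      using e lcV[of c] sn by (metis pl_cancel pl_neg sc_in)
     then have "sc (inverse (c l)) (sc (c l) (s n)) = sc (- inverse (c l)) (lc l c w)"
      using lcV[of c] by (simp add: sc_sc)
     then have "s n = lc l (%i. - inverse (c l) * c i) w"
      using c sn w(3) by (simp add: sc_sc sc_one lc_scale[symmetric])
     then show False using False by blast
    qed
    moreover have "lc l c w = z" using e \<open>c l = 0\<close> sn lcV[of c] by (simp add: sc_zero pl_z)
    ultimately show ?thesis using w(4) by (auto simp: less_Suc_eq)
   qed
   note indep' = this
   have span': "\<exists>c. s i = lc (Suc l) c w'" if i: "i < Suc n" for i
   proof (cases "i = n")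
    case True
    have "lc (Suc l) (%j. if j = l then 1 else 0) w' = w' l"
     by (rule lc_delta) (use w(3) sn in \<open>auto simp: w'_def less_Suc_eq\<close>)
    then have "s i = lc (Suc l) (%j. if j = l then 1 else 0) w'" using True by (simp add: w'_def)
    then show ?thesis by blast
   next
    case False
    then obtain c where c: "s i = lc l c w" using w(5) i by (auto simp: less_Suc_eq)
    have "lc l (%j. if j = l then 0 else c j) w' = lc l c w"
     unfolding lcw by (rule lin_comb_cong) auto
    then have "lc (Suc l) (%j. if j = l then 0 else c j) w' = lc l c w"
     using sn lcV by (simp add: w'_def sc_zero pl_z)
    then show ?thesis using c by metis
   qed
   have "q \<le> Suc l" "\<forall>i<q. w' i = u i" "\<forall>i<Suc l. w' i \<in> V"
    using w(1-3) sn by (auto simp: w'_def less_Suc_eq)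
   show ?thesis
   proof (rule exI[of _ "Suc l"], rule exI[of _ w'], intro conjI)
    show "\<forall>c. lc (Suc l) c w' = z \<longrightarrow> (\<forall>i<Suc l. c i = 0)"
     by (rule allI, rule impI) (rule indep')
    show "\<forall>i<Suc n. \<exists>c. s i = lc (Suc l) c w'"
     by (rule allI, rule impI) (rule span')
   qed fact+
  qed
 qed
 from this[OF order_refl] show ?thesis
 proof (elim exE conjE)
 fix l w assume w: "q \<le> l" "\<forall>i<q. w i = u i" "\<forall>i<l. w i \<in> V"
   "\<forall>c. lc l c w = z \<longrightarrow> (\<forall>i<l. c i = 0)" "\<forall>i<k. \<exists>c. s i = lc l c w"
 note w = w(1) w(2-5)[rule_format]
 have "basis l w"
  unfolding basis_def
 proof (intro conjI allI impI ballI)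
  fix e assume e: "e \<in> V"
  have "\<forall>i. \<exists>a. i < k \<longrightarrow> s i = lc l a w" using w(5) by blast
  from choice[OF this] obtain a where a: "!!i. i < k ==> s i = lc l (a i) w" by blast
  have "e = lc k (coeffs k s e) s" using lc_coeffs[OF b e] by simp
  also have "\<dots> = lc k (coeffs k s e) (%i. lc l (a i) w)" using a by (intro lin_comb_cong) auto
  also have "\<dots> = lc l (%j. \<Sum>i<k. coeffs k s e i * a i j) w" by (rule lc_lc) (rule w(3))
  finally obtain c where c: "e = lc l c w" by blast
  have c': "e = lc l (%i. if i < l then c i else 0) w"
   unfolding c by (rule lin_comb_cong) auto
  show "\<exists>!c. c \<in> espace l \<and> e = lc l c w"
  proof (rule ex_ex1I)
   show "\<exists>c. c \<in> espace l \<and> e = lc l c w" using c' espace_trunc by blast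
   fix c d assume cd: "c \<in> espace l \<and> e = lc l c w" "d \<in> espace l \<and> e = lc l d w"
   have "lc l (%i. c i + - 1 * d i) w = pl (lc l c w) (sc (- 1) (lc l d w))"
    using w(3) lc_add[of l w c "%i. - 1 * d i"] lc_scale[of l w "- 1" d] by simp
   also have "\<dots> = z" using cd pl_neg[OF e] by metis
   finally have "c i + - 1 * d i = 0" if "i < l" for i using w(4) that by blast
   then show "c = d" using cd by (intro espace_eqI[of _ l]) auto
  qed
 qed (rule w(3))
 then show ?thesis by (intro that[of l w] w(1) w(2))
 qed
qed

end

hide_const (open) ring.add

section \<open>Vector bundles and their smooth operations\<close>


lemma openin_smooth_real_preimage:
 assumes M: "pre_manifold M" and S: "openin (mtop M) S" and f: "smooth_real M S f" and B: "open B"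
 shows "openin (mtop M) {p \<in> S. f p \<in> B}"
proof (subst openin_subopen, intro ballI)
 fix p assume p: "p \<in> {p \<in> S. f p \<in> B}"
 obtain W where "openin (mtop M) W" "p \<in> W" "f ` (S \<inter> W) \<subseteq> B"
  using smooth_on_preimage[OF M pre_manifold_real_line, of S f p B] p f B
  by (auto simp: smooth_on_real_iff[OF M] openin_real_line)
 then show "\<exists>T. openin (mtop M) T \<and> p \<in> T \<and> T \<subseteq> {p \<in> S. f p \<in> B}"
  using openin_Int[OF S] p by (intro exI[of _ "S \<inter> W"]) auto
qed

lemma openin_smooth_preimage:
 assumes M: "pre_manifold M" and N: "pre_manifold N" and S: "openin (mtop M) S"
  and f: "smooth_on M S f N" and W: "openin (mtop N) W"
 shows "openin (mtop M) {p \<in> S. f p \<in> W}"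
proof (subst openin_subopen, intro ballI)
 fix p assume p: "p \<in> {p \<in> S. f p \<in> W}"
 obtain W' where "openin (mtop M) W'" "p \<in> W'" "f ` (S \<inter> W') \<subseteq> W"
  using smooth_on_preimage[OF M N f _ W] p by blast
 then show "\<exists>T. openin (mtop M) T \<and> p \<in> T \<and> T \<subseteq> {p \<in> S. f p \<in> W}"
  using openin_Int[OF S] p by (intro exI[of _ "S \<inter> W'"]) auto
qed

lemma fibreI: "e \<in> pts (tot E) ==> proj E e = m ==> e \<in> fibre E m"
 by (simp add: fibre_def)

lemma fibreD: "e \<in> fibre E m ==> e \<in> pts (tot E)" "e \<in> fibre E m ==> proj E e = m"
 by (simp_all add: fibre_def)

lemma over_setI: "e \<in> fibre E m ==> m \<in> W ==> e \<in> over_set E W"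
 by (simp add: fibre_def over_set_def)

text \<open>Linear combinations and coefficients in a fibre.\<close>

abbreviation "vlc E m \<equiv> lin_comb (add E) (scl E) (zer E m)"
abbreviation "vco E m \<equiv> lin_coeffs (add E) (scl E) (zer E m)"
abbreviation "vbasis E m \<equiv> fibre_space.basis (fibre E m) (add E) (scl E) (zer E m)"

text \<open>A smooth local frame \<open>s\<close> of \<open>E\<close> over \<open>W\<close> together with its dual coframe \<open>t\<close>, the
 coordinate functions on the part of \<open>E\<close> over \<open>W\<close>.\<close>

definition frame_coframe ::
 "('e, 'm) vbundle => 'm set => nat => (nat => 'm => 'e) => (nat => 'e => real) => bool" where
 "frame_coframe E W k s t \<longleftrightarrow> openin (mtop (base E)) W \<and>
   (\<forall>i<k. smooth_on (base E) W (s i) (tot E) \<and> smooth_real (tot E) (over_set E W) (t i)) \<and>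
   (\<forall>i<k. \<forall>m\<in>W. s i m \<in> fibre E m) \<and>
   (\<forall>i<k. \<forall>m\<in>W. \<forall>e\<in>fibre E m. \<forall>e'\<in>fibre E m. t i (add E e e') = t i e + t i e') \<and>
   (\<forall>i<k. \<forall>m\<in>W. \<forall>e\<in>fibre E m. \<forall>r. t i (scl E r e) = r * t i e) \<and>
   (\<forall>i<k. \<forall>j<k. \<forall>m\<in>W. t i (s j m) = (if i = j then 1 else 0)) \<and>
   (\<forall>m\<in>W. \<forall>e\<in>fibre E m. e = vlc E m k (%i. t i e) (%i. s i m))"

context
 fixes E :: "('e, 'm) vbundle"
 assumes E: "vector_bundle E"
begin

lemma vb_base_smooth: "smooth_manifold (base E)"
 using E unfolding vector_bundle_def by blast

lemma vb_base: "pre_manifold (base E)"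
 using E unfolding vector_bundle_def smooth_manifold_iff by blast

lemma vb_tot: "pre_manifold (tot E)"
 using E unfolding vector_bundle_def smooth_manifold_iff by blast

lemma vb_proj_smooth: "smooth_on (tot E) (pts (tot E)) (proj E) (base E)"
 using E unfolding vector_bundle_def by blast

lemma vb_proj_in: "e \<in> pts (tot E) ==> proj E e \<in> pts (base E)"
 by (rule smooth_on_image_pts[OF vb_tot vb_proj_smooth])

lemma vb_fibre_space: "m \<in> pts (base E) ==> fibre_space (fibre E m) (add E) (scl E) (zer E m)"
 using E unfolding vector_bundle_def by (auto intro: fibre_space.intro)

lemma vb_fibre_base: "e \<in> fibre E m ==> m \<in> pts (base E)"
 using vb_proj_in by (auto simp: fibre_def)

lemma vb_trivialisation: "m \<in> pts (base E) ==> \<exists>W k T. m \<in> W \<and> local_trivialisation E W k T"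
 using E unfolding vector_bundle_def by blast

lemma vb_add_in: "e \<in> fibre E m ==> e' \<in> fibre E m ==> add E e e' \<in> fibre E m"
 by (rule fibre_space.pl_in[OF vb_fibre_space[OF vb_fibre_base]])

lemma vb_scl_in: "e \<in> fibre E m ==> scl E r e \<in> fibre E m"
 by (rule fibre_space.sc_in[OF vb_fibre_space[OF vb_fibre_base]])

lemma vb_zer_in: "m \<in> pts (base E) ==> zer E m \<in> fibre E m"
 by (rule fibre_space.z_in[OF vb_fibre_space])

lemma vb_over_open: "openin (mtop (base E)) W ==> openin (mtop (tot E)) (over_set E W)"
 unfolding over_set_def
 by (rule openin_smooth_preimage[OF vb_tot vb_base openin_mtop_pts[OF vb_tot] vb_proj_smooth])

lemma vb_proj_smooth_compose:
 "pre_manifold N ==> smooth_on N S f (tot E) ==> smooth_on N S (%x. proj E (f x)) (base E)"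
 by (rule smooth_on_compose[OF _ vb_tot vb_base vb_proj_smooth]) (auto intro: smooth_on_image_pts)

context
 fixes W k T
 assumes T: "local_trivialisation E W k T"
begin

lemma triv_open: "openin (mtop (base E)) W"
 using T unfolding local_trivialisation_def by blast

lemma triv_W: "m \<in> W ==> m \<in> pts (base E)"
 using openin_mtop_subset[OF vb_base triv_open] by blast

lemma triv_bij: "bij_betw (%e. (proj E e, T e)) (over_set E W) (W \<times> espace k)"
 using T unfolding local_trivialisation_def diffeo_on_def by blast

lemma triv_smooth: "smooth_on (tot E) (over_set E W) (%e. (proj E e, T e))
  (prod_manifold (base E) (coord_space k))"
 using T unfolding local_trivialisation_def diffeo_on_def by blast

lemma triv_inv_smooth: "smooth_on (prod_manifold (base E) (coord_space k)) (W \<times> espace k)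
  (inv_into (over_set E W) (%e. (proj E e, T e))) (tot E)"
 using T unfolding local_trivialisation_def diffeo_on_def by blast

lemma triv_add: "m \<in> W ==> e \<in> fibre E m ==> e' \<in> fibre E m ==> T (add E e e') i = T e i + T e' i"
 using T unfolding local_trivialisation_def by metis

lemma triv_scl: "m \<in> W ==> e \<in> fibre E m ==> T (scl E r e) i = r * T e i"
 using T unfolding local_trivialisation_def by metis

lemma triv_in: "e \<in> over_set E W ==> T e \<in> espace k"
 using bij_betwE[OF triv_bij] by force

lemma triv_coord_smooth: "smooth_real (tot E) (over_set E W) (%e. T e i)"
proof -
 note P = pre_manifold_prod[OF vb_base pre_manifold_coord_space[of k]]
 have "smooth_on (tot E) (over_set E W) (%e. snd (proj E e, T e)) (coord_space k)"
  by (rule smooth_on_compose[OF vb_tot P pre_manifold_coord_space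
     smooth_on_snd[OF vb_base pre_manifold_coord_space, of "W \<times> espace k" k] triv_smooth])
   (use triv_in in \<open>auto simp: over_set_def intro: triv_W\<close>)
 then have "smooth_on (tot E) (over_set E W) T (coord_space k)" by simp
 from smooth_real_compose[OF vb_tot pre_manifold_coord_space smooth_real_coord[OF subset_refl] this triv_in]
 show ?thesis .
qed

lemma triv_smooth_into:
 assumes N: "pre_manifold N" and F: "!!x. x \<in> S ==> F x \<in> over_set E W"
  and b: "smooth_on N S (%x. proj E (F x)) (base E)"
  and c: "!!i. i < k ==> smooth_real N S (%x. T (F x) i)"
 shows "smooth_on N S F (tot E)"
proof -
 note P = pre_manifold_prod[OF vb_base pre_manifold_coord_space[of k]]
 have "smooth_on N S (%x. T (F x)) (coord_space k)"
  by (rule smooth_on_coord_spaceI[OF N smooth_on_pts[OF N b]]) (auto intro: triv_in F c)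
 from smooth_on_Pair[OF N vb_base pre_manifold_coord_space b this]
 have "smooth_on N S (%x. (proj E (F x), T (F x))) (prod_manifold (base E) (coord_space k))" .
 from smooth_on_compose[OF N P vb_tot triv_inv_smooth this]
 have "smooth_on N S (%x. inv_into (over_set E W) (%e. (proj E e, T e)) (proj E (F x), T (F x))) (tot E)"
  using F triv_in by (auto simp: over_set_def)
 then show ?thesis
 proof (rule smooth_on_cong)
  fix x assume "x \<in> S"
  from inv_into_f_f[OF bij_betw_imp_inj_on[OF triv_bij] F[OF this]]
  show "inv_into (over_set E W) (%e. (proj E e, T e)) (proj E (F x), T (F x)) = F x" .
 qed
qed

lemma triv_frame: "\<exists>s. frame_coframe E W k s (%i e. T e i)"
proof -
 let ?f = "%e. (proj E e, T e)"
 define g where "g = inv_into (over_set E W) ?f"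
 define \<delta> :: "nat => coord" where "\<delta> i = (%j. if j = i then 1 else 0)" for i
 define s where "s i m = g (m, \<delta> i)" for i m
 have \<delta>: "\<delta> i \<in> espace k" if "i < k" for i using that by (auto simp: \<delta>_def topspace_Euclidean_space)
 have g: "g (m, c) \<in> over_set E W" "proj E (g (m, c)) = m" "T (g (m, c)) = c"
  if "m \<in> W" "c \<in> espace k" for m c
 proof -
  have r: "(m, c) \<in> ?f ` over_set E W" using that bij_betw_imp_surj_on[OF triv_bij] by blast
  show "g (m, c) \<in> over_set E W" unfolding g_def by (rule inv_into_into[OF r])
  show "proj E (g (m, c)) = m" "T (g (m, c)) = c"
   using f_inv_into_f[OF r] unfolding g_def by auto
 qed
 have sW: "s i m \<in> fibre E m" "T (s i m) = \<delta> i" if "i < k" "m \<in> W" for i m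
  using g[OF that(2) \<delta>[OF that(1)]] by (auto simp: s_def fibre_def over_set_def)
 have "smooth_on (base E) W (s i) (tot E)" if i: "i < k" for i
 proof (rule triv_smooth_into[OF vb_base])
  show "s i m \<in> over_set E W" if "m \<in> W" for m by (rule over_setI[OF sW(1)[OF i that] that])
  have "W \<subseteq> pts (base E)" using triv_W by blast
  from smooth_on_id[OF vb_base this] show "smooth_on (base E) W (%x. proj E (s i x)) (base E)"
   by (rule smooth_on_cong) (use fibreD(2)[OF sW(1)[OF i]] in simp)
  fix j
  from smooth_real_const[OF vb_base \<open>W \<subseteq> pts (base E)\<close>, of "\<delta> i j"]
  show "smooth_real (base E) W (%x. T (s i x) j)"
   by (rule smooth_real_cong) (simp add: sW(2)[OF i])
 qed
 moreover have "e = vlc E m k (T e) (%i. s i m)"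
  if m: "m \<in> W" and e: "e \<in> fibre E m" for m e
 proof -
  interpret fibre_space "fibre E m" "add E" "scl E" "zer E m" by (rule vb_fibre_space[OF triv_W[OF m]])
  let ?l = "lc k (T e) (%i. s i m)"
  have l: "?l \<in> fibre E m" by (rule lc_in) (rule sW(1)[OF _ m])
  have "T ?l i = (\<Sum>j<k. T e j * T (s j m) i)" for i
   by (rule lc_real) (use triv_add[OF m] triv_scl[OF m] sW(1)[OF _ m] in auto)
  moreover have "(\<Sum>j<k. T e j * T (s j m) i) = T e i" if "i < k" for i
  proof -
   have "(\<Sum>j<k. T e j * T (s j m) i) = (\<Sum>j<k. if i = j then T e j else 0)"
    by (rule sum.cong) (auto simp: sW(2)[OF _ m] \<delta>_def)
   then show ?thesis using that by simp
  qed
  ultimately have "T ?l = T e"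
   using triv_in[OF over_setI[OF l m]] triv_in[OF over_setI[OF e m]] by (intro espace_eqI[of _ k]) auto
  then show ?thesis
   using inj_onD[OF bij_betw_imp_inj_on[OF triv_bij], of ?l e] over_setI[OF l m] over_setI[OF e m]
    fibreD(2)[OF l] fibreD(2)[OF e] by simp
 qed
 ultimately have "frame_coframe E W k s (%i e. T e i)"
  unfolding frame_coframe_def using triv_open triv_coord_smooth sW triv_add triv_scl
  by (auto simp: \<delta>_def)
 then show ?thesis by blast
qed

end

lemma vb_frame:
 assumes "m \<in> pts (base E)"
 obtains W k s t where "m \<in> W" "frame_coframe E W k s t"
 using vb_trivialisation[OF assms] triv_frame by metis

text \<open>Smoothness into a bundle may be tested in local trivialisations.\<close>

lemma vb_smooth_via_triv:
 assumes N: "pre_manifold N" and b: "smooth_on N S b (base E)"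
  and F: "!!x. x \<in> S ==> F x \<in> fibre E (b x)"
  and T: "!!W k T S' i. local_trivialisation E W k T ==> S' \<subseteq> S ==> (!!x. x \<in> S' ==> b x \<in> W) ==>
   i < k ==> smooth_real N S' (%x. T (F x) i)"
 shows "smooth_on N S F (tot E)"
proof (rule smooth_on_local[OF N vb_tot])
 fix p assume p: "p \<in> S"
 obtain W k T' where W: "b p \<in> W" "local_trivialisation E W k T'"
  using vb_trivialisation[OF vb_fibre_base[OF F[OF p]]] by blast
 obtain W' where W': "openin (mtop N) W'" "p \<in> W'" "b ` (S \<inter> W') \<subseteq> W"
  by (rule smooth_on_preimage[OF N vb_base b p triv_open[OF W(2)] W(1)])
 have "smooth_on N (S \<inter> W') F (tot E)"
 proof (rule triv_smooth_into[OF W(2) N])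
  show "F x \<in> over_set E W" if "x \<in> S \<inter> W'" for x
   using F[of x] W'(3) that by (intro over_setI[of _ _ "b x"]) auto
  show "smooth_on N (S \<inter> W') (%x. proj E (F x)) (base E)"
   by (rule smooth_on_cong_subset[OF b]) (auto simp: fibreD(2)[OF F])
  show "smooth_real N (S \<inter> W') (%x. T' (F x) i)" if "i < k" for i
   by (rule T[OF W(2) _ _ that]) (use W'(3) in auto)
 qed
 then show "\<exists>W. openin (mtop N) W \<and> p \<in> W \<and> smooth_on N (S \<inter> W) F (tot E)" using W' by blast
qed

lemma vb_triv_compose:
 assumes N: "pre_manifold N" and f: "smooth_on N S f (tot E)" and T: "local_trivialisation E W k T"
  and "S' \<subseteq> S" "!!x. x \<in> S' ==> proj E (f x) \<in> W"
 shows "smooth_real N S' (%x. T (f x) i)"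
 by (rule smooth_real_compose[OF N vb_tot triv_coord_smooth[OF T] smooth_on_subset[OF f assms(4)]])
  (use assms(4,5) smooth_on_image_pts[OF N f] in \<open>auto simp: over_set_def\<close>)

lemma vb_smooth_add:
 assumes N: "pre_manifold N" and f: "smooth_on N S f (tot E)" and g: "smooth_on N S g (tot E)"
  and fg: "!!x. x \<in> S ==> proj E (f x) = proj E (g x)"
 shows "smooth_on N S (%x. add E (f x) (g x)) (tot E)"
proof (rule vb_smooth_via_triv[OF N vb_proj_smooth_compose[OF N f]])
 have in_f: "f x \<in> fibre E (proj E (f x))" "g x \<in> fibre E (proj E (f x))" if "x \<in> S" for x
  using smooth_on_image_pts[OF N f that] smooth_on_image_pts[OF N g that] fg[OF that]
  by (auto simp: fibre_def)
 then show "add E (f x) (g x) \<in> fibre E (proj E (f x))" if "x \<in> S" for x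
  using vb_add_in that by blast
 fix W k T S' i
 assume T: "local_trivialisation E W k T" and S': "S' \<subseteq> S" "!!x. x \<in> S' ==> proj E (f x) \<in> W"
 have "smooth_real N S' (%x. T (f x) i + T (g x) i)"
  using S' fg[symmetric] by (intro smooth_real_add[OF N] vb_triv_compose[OF N f T] vb_triv_compose[OF N g T])
   (auto simp: subset_iff)
 then show "smooth_real N S' (%x. T (add E (f x) (g x)) i)"
  proof (rule smooth_real_cong)
  fix x assume x: "x \<in> S'"
  then have "x \<in> S" using S'(1) by blast
  from triv_add[OF T S'(2)[OF x] in_f[OF this]] show "T (f x) i + T (g x) i = T (add E (f x) (g x)) i" by simp
 qed
qed

lemma vb_smooth_scl:
 assumes N: "pre_manifold N" and f: "smooth_on N S f (tot E)" and r: "smooth_real N S r"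
 shows "smooth_on N S (%x. scl E (r x) (f x)) (tot E)"
proof (rule vb_smooth_via_triv[OF N vb_proj_smooth_compose[OF N f]])
 have in_f: "f x \<in> fibre E (proj E (f x))" if "x \<in> S" for x
  using smooth_on_image_pts[OF N f that] by (auto simp: fibre_def)
 then show "scl E (r x) (f x) \<in> fibre E (proj E (f x))" if "x \<in> S" for x
  using vb_scl_in that by blast
 fix W k T S' i
 assume T: "local_trivialisation E W k T" and S': "S' \<subseteq> S" "!!x. x \<in> S' ==> proj E (f x) \<in> W"
 have "smooth_real N S' (%x. r x * T (f x) i)"
  using S' by (intro smooth_real_mult[OF N] vb_triv_compose[OF N f T] smooth_real_subset[OF r]) auto
 then show "smooth_real N S' (%x. T (scl E (r x) (f x)) i)"
  proof (rule smooth_real_cong)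
  fix x assume x: "x \<in> S'"
  then have "x \<in> S" using S'(1) by blast
  from triv_scl[OF T S'(2)[OF x] in_f[OF this]] show "r x * T (f x) i = T (scl E (r x) (f x)) i" by simp
 qed
qed

lemma vb_smooth_zer:
 assumes N: "pre_manifold N" and b: "smooth_on N S b (base E)"
 shows "smooth_on N S (%x. zer E (b x)) (tot E)"
proof (rule vb_smooth_via_triv[OF N b])
 show "zer E (b x) \<in> fibre E (b x)" if "x \<in> S" for x
  using vb_zer_in smooth_on_image_pts[OF N b that] by blast
 fix W k T S' i
 assume T: "local_trivialisation E W k T" and S': "S' \<subseteq> S" "!!x. x \<in> S' ==> b x \<in> W"
 have "smooth_real N S' (%x. 0)"
  using smooth_on_pts[OF N b] S' by (intro smooth_real_const[OF N]) auto
 then show "smooth_real N S' (%x. T (zer E (b x)) i)"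
 proof (rule smooth_real_cong)
  fix x assume "x \<in> S'"
  then have m: "b x \<in> W" "b x \<in> pts (base E)" using S'(2) triv_W[OF T] by auto
  then show "0 = T (zer E (b x)) i"
   using triv_scl[OF T m(1) vb_zer_in[OF m(2)], of 0 i]
    fibre_space.sc_z[OF vb_fibre_space[OF m(2)], of 0] by simp
 qed
qed

lemma vb_smooth_lin_comb:
 assumes N: "pre_manifold N" and b: "smooth_on N S b (base E)"
  and f: "!!i. i < k ==> smooth_on N S (f i) (tot E)" "!!i x. i < k ==> x \<in> S ==> proj E (f i x) = b x"
  and c: "!!i. i < k ==> smooth_real N S (c i)"
 shows "smooth_on N S (%x. vlc E (b x) k (%i. c i x) (%i. f i x)) (tot E)"
 using f c
proof (induction k)
 case 0
 then show ?case using vb_smooth_zer[OF N b] by simp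
next
 case (Suc k)
 let ?l = "%x. vlc E (b x) k (%i. c i x) (%i. f i x)"
 have IH: "smooth_on N S ?l (tot E)"
  by (rule Suc.IH) (use Suc.prems in auto)
 have in_f: "f i x \<in> fibre E (b x)" if "i < Suc k" "x \<in> S" for i x
  using Suc.prems(2)[OF that] smooth_on_image_pts[OF N Suc.prems(1)[OF that(1)] that(2)]
  by (simp add: fibre_def)
 have pl: "proj E (?l x) = b x" if "x \<in> S" for x
  by (rule fibreD(2), rule fibre_space.lc_in[OF vb_fibre_space[OF smooth_on_image_pts[OF N b that]]])
   (use in_f[OF _ that] in auto)
 have "smooth_on N S (%x. add E (?l x) (scl E (c k x) (f k x))) (tot E)"
  by (rule vb_smooth_add[OF N IH vb_smooth_scl[OF N Suc.prems(1,3)]])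
   (use pl fibreD(2)[OF vb_scl_in[OF in_f[OF lessI]]] in auto)
 then show ?case by simp
qed

context
 fixes W k s t
 assumes fr: "frame_coframe E W k s t"
begin

lemma frame_open: "openin (mtop (base E)) W"
 and frame_smooth: "i < k ==> smooth_on (base E) W (s i) (tot E)"
 and coframe_smooth: "i < k ==> smooth_real (tot E) (over_set E W) (t i)"
 and frame_in: "i < k ==> m \<in> W ==> s i m \<in> fibre E m"
 and coframe_add: "i < k ==> m \<in> W ==> e \<in> fibre E m ==> e' \<in> fibre E m ==> t i (add E e e') = t i e + t i e'"
 and coframe_scl: "i < k ==> m \<in> W ==> e \<in> fibre E m ==> t i (scl E r e) = r * t i e"
 and coframe_frame: "i < k ==> j < k ==> m \<in> W ==> t i (s j m) = (if i = j then 1 else 0)"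
 and frame_expand: "m \<in> W ==> e \<in> fibre E m ==>
  vlc E m k (%i. t i e) (%i. s i m) = e"
 using fr unfolding frame_coframe_def by (blast, blast, blast, blast, blast, blast, blast, metis)

lemma frame_W: "m \<in> W ==> m \<in> pts (base E)"
 using openin_mtop_subset[OF vb_base frame_open] by blast

lemma frame_basis:
 assumes "m \<in> W"
 shows "vbasis E m k (%i. s i m)"
  and "!!e i. e \<in> fibre E m ==> i < k ==>
   vco E m k (%i. s i m) e i = t i e"
proof -
 interpret fibre_space "fibre E m" "add E" "scl E" "zer E m" by (rule vb_fibre_space[OF frame_W[OF assms]])
 show "basis k (%i. s i m)"
  by (rule basis_dual(1)[where t = t];
    (rule frame_in coframe_add coframe_scl coframe_frame frame_expand[symmetric])?; (assumption | rule assms))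
 show "coeffs k (%i. s i m) e i = t i e" if "e \<in> fibre E m" "i < k" for e i
  by (rule basis_dual(2)[where t = t];
    (rule frame_in coframe_add coframe_scl coframe_frame frame_expand[symmetric] that)?; (assumption | rule assms)?)
qed

lemma coframe_compose:
 assumes N: "pre_manifold N" and f: "smooth_on N S f (tot E)" and "!!x. x \<in> S ==> proj E (f x) \<in> W" "i < k"
 shows "smooth_real N S (%x. t i (f x))"
 by (rule smooth_real_compose[OF N vb_tot coframe_smooth[OF assms(4)] f])
  (use assms(3) smooth_on_image_pts[OF N f] in \<open>auto simp: over_set_def\<close>)

lemma frame_restrict:
 assumes "openin (mtop (base E)) W'" "W' \<subseteq> W"
 shows "frame_coframe E W' k s t"
proof -
 have "over_set E W' \<subseteq> over_set E W" using assms(2) by (auto simp: over_set_def)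
 then have "smooth_on (base E) W' (s i) (tot E) \<and> smooth_real (tot E) (over_set E W') (t i)" if "i < k" for i
  using smooth_on_subset[OF frame_smooth[OF that] assms(2)] smooth_real_subset[OF coframe_smooth[OF that]] by blast
 note sm = this
 show ?thesis
  unfolding frame_coframe_def
 proof (intro conjI[OF assms(1)] conjI[OF allI[OF impI[OF sm]]] conjI allI impI ballI)
  fix i m e e' r assume i: "i < k" and m: "m \<in> W'"
  note m = subsetD[OF assms(2) m]
  show "s i m \<in> fibre E m" by (rule frame_in[OF i m])
  show "t i (s j m) = (if i = j then 1 else 0)" if "j < k" for j by (rule coframe_frame[OF i that m])
  assume e: "e \<in> fibre E m"
  show "t i (scl E r e) = r * t i e" by (rule coframe_scl[OF i m e])
  show "t i (add E e e') = t i e + t i e'" if "e' \<in> fibre E m" by (rule coframe_add[OF i m e that])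
 next
  fix m e assume "m \<in> W'" "e \<in> fibre E m"
  then show "e = vlc E m k (%i. t i e) (%i. s i m)"
   using frame_expand assms(2) by (simp add: subset_iff)
 qed
qed

end

end

section \<open>Bundles given by a sheaf of smooth sections\<close>

lemma second_countable_atlas:
 assumes N: "pre_manifold N" and C: "countable C" "C \<subseteq> N" "pts N \<subseteq> \<Union> (fst ` C)"
 shows "second_countable_top (mtop N)"
proof -
 obtain B :: "coord set set" where B: "countable B" "topological_basis B"
  using ex_countable_basis by blast
 define V where "V c O' = {e \<in> fst c. snd (snd c) e \<in> O'}" for c :: "'a set \<times> nat \<times> ('a => coord)" and O'
 let ?B = "(%(c, O'). V c O') ` (C \<times> B)"
 have "countable ?B" using B(1) C(1) by blast
 moreover have "openin (mtop N) (V c O')" if c: "c \<in> C" and O': "O' \<in> B" for c O'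
 proof -
  obtain U n x where e: "c = (U, n, x)" by (cases c)
  have cN: "(U, n, x) \<in> N" using c C(2) e by blast
  have "open O'" using O' B(2) by (metis topological_basis_open)
  then have "openin (Euclidean_space n) {u \<in> x ` U. id u \<in> O'}"
   by (intro openin_preimage[OF chart_image_open[OF N cN] continuous_on_id'])
    (simp_all add: id_def)
  moreover have "x ` {e \<in> U. x e \<in> O'} = {u \<in> x ` U. id u \<in> O'}" by auto
  ultimately show ?thesis
   unfolding V_def e by (intro openin_mtopI_chart[OF N cN]) auto
 qed
 moreover have "\<exists>Y\<in>?B. p \<in> Y \<and> Y \<subseteq> W" if W: "openin (mtop N) W" "p \<in> W" for W p
 proof -
  have "p \<in> pts N" using W openin_mtop_subset[OF N] by blast
  then obtain c where c: "c \<in> C" "p \<in> fst c" using C(3) by blast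
  obtain U n x where e: "c = (U, n, x)" by (cases c)
  have cN: "(U, n, x) \<in> N" using c C(2) e by blast
  obtain O' where O': "open O'" "x ` (U \<inter> W) = espace n \<inter> O'"
   using openin_mtop_chart[OF N W(1) cN] unfolding openin_Euclidean_space by blast
  have "x p \<in> O'" using O'(2) c(2) e W(2) by auto
  then obtain O2 where O2: "O2 \<in> B" "x p \<in> O2" "O2 \<subseteq> O'"
   using topological_basisE[OF B(2) O'(1)] by metis
  have "V c O2 \<subseteq> W"
  proof
   fix q assume "q \<in> V c O2"
   then have q: "q \<in> U" "x q \<in> O2" by (auto simp: V_def e)
   then have "x q \<in> x ` (U \<inter> W)" using O'(2) O2(3) chart_in_espace[OF N cN] by blast
   then obtain q' where "q' \<in> U" "q' \<in> W" "x q = x q'" by blast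
   then show "q \<in> W" using q(1) chart_inj[OF N cN] by (auto simp: inj_on_def)
  qed
  moreover have "p \<in> V c O2" using c(2) O2(2) by (simp add: V_def e)
  ultimately show ?thesis using c(1) O2(1) by blast
 qed
 ultimately show ?thesis
  unfolding second_countable_top_def by (intro exI[of _ ?B]) auto
qed

lemma smooth_real_imp_Ck:
 assumes A: "openin (Euclidean_space n) A" and f: "smooth_real (coord_space n) A f"
 shows "Ck_on n k A f"
proof (rule Ck_local[OF openin_espace_subset[OF A]])
 fix w assume w: "w \<in> A"
 have c: "(espace n, n, %u. u) \<in> coord_space n" by (simp add: coord_space_def)
 have wE: "w \<in> espace n" using w openin_espace_subset[OF A] by blast
 obtain W F where W: "openin (mtop (coord_space n)) W" "w \<in> W" "W \<subseteq> espace n"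
  "!!k. Ck_on n k ((%u. u) ` W) (%u. F (inv_into (espace n) (%u. u) u))"
  "!!q. q \<in> A ==> q \<in> W ==> F q = f q"
  by (rule smooth_real_chartE[OF pre_manifold_coord_space f w c wE]) blast
 have o: "openin (Euclidean_space n) (A \<inter> W)"
  using A W(1) by (simp add: openin_coord_space openin_Int)
 have "Ck_on n k (A \<inter> W) (%u. F (inv_into (espace n) (%u. u) u))"
  by (rule Ck_subset[OF _ W(3) W(4)[of k, unfolded image_ident]]) auto
 then have "Ck_on n k (A \<inter> W) f"
 proof (rule Ck_cong[OF o, rotated])
  fix v assume v: "v \<in> A \<inter> W"
  then have "inv_into (espace n) (%u. u) v = v"
   using W(3) inv_into_f_f[of "%u. u" "espace n" v] by (auto simp: inj_on_def)
  then show "F (inv_into (espace n) (%u. u) v) = f v" using W(5) v by simp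
 qed
 then show "\<exists>T. openin (Euclidean_space n) T \<and> w \<in> T \<and> T \<subseteq> A \<and> Ck_on n k T f"
  using o w W(2) by blast
qed

text \<open>A set \<open>P\<close> fibred in vector spaces over \<open>M\<close>, with a notion of smooth section such that near
 every point there is a frame of smooth sections in which all smooth sections have smooth
 coefficients.\<close>

locale section_bundle =
 fixes M :: "'m atlas" and P :: "'e set" and q :: "'e => 'm" and pl sc z and
  sec :: "'m set => ('m => 'e) => bool"
 assumes M: "smooth_manifold M"
  and q_in: "!!e. e \<in> P ==> q e \<in> pts M"
  and fibre_laws: "!!m. m \<in> pts M ==> fibre_space {e \<in> P. q e = m} pl sc (z m)"
  and reference_frame: "!!m. m \<in> pts M ==> \<exists>W k s. m \<in> W \<and> local_frame M P q pl sc z sec W k s \<and>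
   (\<forall>W' t. openin (mtop M) W' \<longrightarrow> sec W' t \<longrightarrow> (\<forall>m\<in>W'. t m \<in> P \<and> q (t m) = m) \<longrightarrow>
    (\<forall>i<k. smooth_real M (W \<inter> W') (%m. lin_coeffs pl sc (z m) k (%j. s j m) (t m) i)))"
begin

abbreviation "Fib m \<equiv> {e \<in> P. q e = m}"
abbreviation "llc m \<equiv> lin_comb pl sc (z m)"
abbreviation "lco m \<equiv> lin_coeffs pl sc (z m)"
abbreviation "Fbasis m \<equiv> fibre_space.basis (Fib m) pl sc (z m)"

lemma preM: "pre_manifold M"
 using M smooth_manifold_iff by blast

text \<open>The charts of the total space, \<open>fchart\<close>, consist of a chart of the base and the coordinates \<open>cf\<close> in a
 local frame.\<close>

abbreviation FA :: "'e atlas" where "FA \<equiv> frame_atlas M P q pl sc z sec"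
abbreviation frame :: "'m set => nat => (nat => 'm => 'e) => bool" where
 "frame \<equiv> local_frame M P q pl sc z sec"
abbreviation cf :: "nat => (nat => 'm => 'e) => 'e => coord" where
 "cf k s e \<equiv> lco (q e) k (%i. s i (q e)) e"
abbreviation fchart :: "nat => ('m => coord) => nat => (nat => 'm => 'e) => 'e => coord" where
 "fchart n x k s e \<equiv> coord_append n (x (q e)) (cf k s e)"

lemma frame_open: "frame W k s ==> openin (mtop M) W"
 unfolding local_frame_def by blast

lemma frame_W: "frame W k s ==> m \<in> W ==> m \<in> pts M"
 using frame_open openin_mtop_subset[OF preM] by blast

lemma frame_in: "frame W k s ==> i < k ==> m \<in> W ==> s i m \<in> Fib m"
 unfolding local_frame_def by blast

lemma frame_sec: "frame W k s ==> i < k ==> sec W (s i)"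
 unfolding local_frame_def by blast

lemma reference_frameE:
 assumes "m \<in> pts M"
 obtains W k s where "m \<in> W" "frame W k s"
  "!!W' t i. openin (mtop M) W' ==> sec W' t ==> (!!m. m \<in> W' ==> t m \<in> P \<and> q (t m) = m) ==> i < k ==>
    smooth_real M (W \<inter> W') (%m. lco m k (%j. s j m) (t m) i)"
 using reference_frame[OF assms]
proof (elim exE conjE)
 fix W k s assume a: "m \<in> W" "frame W k s" and
  b: "\<forall>W' t. openin (mtop M) W' \<longrightarrow> sec W' t \<longrightarrow> (\<forall>m\<in>W'. t m \<in> P \<and> q (t m) = m) \<longrightarrow>
    (\<forall>i<k. smooth_real M (W \<inter> W') (%m. lco m k (%j. s j m) (t m) i))"
 show thesis
  by (rule that[OF a]) (rule b[THEN spec, THEN spec, THEN mp, THEN mp, THEN mp, THEN spec, THEN mp]; blast)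
qed

lemma frame_basis:
 assumes f: "frame W k s" and m: "m \<in> W"
 shows "Fbasis m k (%i. s i m)"
proof -
 interpret fibre_space "Fib m" pl sc "z m" by (rule fibre_laws[OF frame_W[OF f m]])
 have "\<forall>e\<in>P. q e \<in> W \<longrightarrow> (\<exists>!c. c \<in> espace k \<and> e = llc (q e) k c (%i. s i (q e)))"
  using f unfolding local_frame_def by (elim conjE)
 then have "\<exists>!c. c \<in> espace k \<and> e = lc k c (%i. s i m)" if "e \<in> Fib m" for e
  using that m by auto
 then show ?thesis unfolding basis_def using frame_in[OF f _ m] by blast
qed

lemma frame_atlasE:
 assumes "(D, N, \<phi>) \<in> FA"
 obtains U n x W k s where "(U, n, x) \<in> M" "frame W k s" "D = {e \<in> P. q e \<in> U \<inter> W}" "N = n + k"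
  "\<phi> = fchart n x k s"
 using assms unfolding frame_atlas_def lin_coeffs_def by blast

lemma fchart_in_FA:
 "(U, n, x) \<in> M ==> frame W k s ==> ({e \<in> P. q e \<in> U \<inter> W}, n + k, fchart n x k s) \<in> FA"
 unfolding frame_atlas_def lin_coeffs_def by blast

lemma cf_in: "frame W k s ==> e \<in> P ==> q e \<in> W ==> cf k s e \<in> espace k"
 by (rule fibre_space.coeffs_in[OF fibre_laws frame_basis]) (auto intro: frame_W)

lemma lc_cf:
 assumes "frame W k s" "e \<in> P" "q e \<in> W"
 shows "llc (q e) k (cf k s e) (%i. s i (q e)) = e"
 by (rule fibre_space.lc_coeffs[OF fibre_laws frame_basis[OF assms(1,3)]]) (use assms frame_W in auto)

lemma lc_in_P:
 assumes "frame W k s" "m \<in> W"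
 shows "llc m k c (%i. s i m) \<in> P" "q (llc m k c (%i. s i m)) = m"
proof -
 have "llc m k c (%i. s i m) \<in> Fib m"
  by (rule fibre_space.lc_in[OF fibre_laws[OF frame_W[OF assms]]]) (rule frame_in[OF assms(1) _ assms(2)])
 then show "llc m k c (%i. s i m) \<in> P" "q (llc m k c (%i. s i m)) = m" by auto
qed

lemma cf_lc:
 assumes "frame W k s" "m \<in> W" "c \<in> espace k"
 shows "cf k s (llc m k c (%i. s i m)) = c"
 using fibre_space.coeffs_unique[OF fibre_laws[OF frame_W[OF assms(1,2)]] frame_basis[OF assms(1,2)] assms(3) refl]
 by (simp add: lc_in_P[OF assms(1,2)])

lemma cf_inj:
 assumes f: "frame W k s" and e: "e \<in> P" "e' \<in> P" "q e = q e'" "q e' \<in> W" and c: "cf k s e = cf k s e'"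
 shows "e = e'"
proof -
 have "e = llc (q e) k (cf k s e) (%i. s i (q e))"
  by (rule lc_cf[OF f e(1), symmetric]) (simp add: e)
 also have "\<dots> = llc (q e) k (cf k s e') (%i. s i (q e))" by (simp only: c)
 also have "\<dots> = llc (q e') k (cf k s e') (%i. s i (q e'))" by (simp only: e(3))
 also have "\<dots> = e'" by (rule lc_cf[OF f e(2,4)])
 finally show ?thesis .
qed

text \<open>Any two local frames are related by a smooth matrix: compare both with a reference frame.\<close>

lemma frame_transition:
 assumes f: "frame W k s" and f': "frame W' k' s'" and ij: "i < k" "j < k'"
 shows "smooth_real M (W \<inter> W') (%m. cf k' s' (s i m) j)"
proof (rule smooth_real_local[OF preM])
 fix m0 assume m0: "m0 \<in> W \<inter> W'"
 obtain W0 k0 r where r: "m0 \<in> W0" "frame W0 k0 r" and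
  sm: "!!W' t i. openin (mtop M) W' ==> sec W' t ==> (!!m. m \<in> W' ==> t m \<in> P \<and> q (t m) = m) ==> i < k0 ==>
    smooth_real M (W0 \<inter> W') (%m. lco m k0 (%j. r j m) (t m) i)"
  by (rule reference_frameE[OF frame_W[OF f]]) (use m0 in blast)+
 let ?O = "(W \<inter> W') \<inter> W0"
 have oO: "openin (mtop M) ?O" by (intro openin_Int frame_open[OF f] frame_open[OF f'] frame_open[OF r(2)])
 have sub: "?O \<subseteq> pts M" using frame_W[OF f] by auto
 define a where "a i j m = lco m k0 (%j. r j m) (s' i m) j" for i j m
 have k': "k' = k0"
  by (rule fibre_space.basis_card[OF fibre_laws frame_basis[OF f'] frame_basis[OF r(2)], of m0])
   (use m0 r frame_W[OF f] in auto)
 have sma: "smooth_real M ?O (a i j)" if "i < k0" "j < k0" for i j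
  unfolding a_def using sm[OF frame_open[OF f'] frame_sec[OF f'] _ that(2)] that(1) frame_in[OF f'] k'
  by (intro smooth_real_subset[of M "W0 \<inter> W'" _ ?O]) auto
 have inv: "mat_inv k0 (%i j. a i j m) (%i j. lco m k' (%j. s' j m) (r i m) j)"
  if m: "m \<in> ?O" for m
  unfolding mat_inv_def a_def
  using fibre_space.basis_change[OF fibre_laws frame_basis[OF r(2)] frame_basis[OF f'], of m] m sub k' by auto
 obtain b where b: "!!i j. i < k0 ==> j < k0 ==> smooth_real M ?O (b i j)"
  "!!m. m \<in> ?O ==> mat_inv k0 (%i j. a i j m) (%i j. b i j m)"
  by (rule smooth_matrix_inverse[OF preM sub sma]) (use inv in blast)+
 have "smooth_real M ?O (%m. \<Sum>l<k0. lco m k0 (%j. r j m) (s i m) l * b l j m)"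
 proof (intro smooth_real_sum[OF preM sub] smooth_real_mult[OF preM])
  fix l assume l: "l \<in> {..<k0}"
  show "smooth_real M ?O (%m. lco m k0 (%j. r j m) (s i m) l)"
   by (rule smooth_real_subset[OF sm[OF frame_open[OF f] frame_sec[OF f ij(1)]]])
    (use l frame_in[OF f ij(1)] in auto)
  show "smooth_real M ?O (b l j)" using b(1) l ij(2) k' by auto
 qed
 then have "smooth_real M ?O (%m. cf k' s' (s i m) j)"
 proof (rule smooth_real_cong)
  fix m assume m: "m \<in> ?O"
  have mm: "m \<in> pts M" "m \<in> W0" "m \<in> W'" "m \<in> W" using m sub by auto
  show "(\<Sum>l<k0. lco m k0 (%j. r j m) (s i m) l * b l j m) = cf k' s' (s i m) j"
   using fibre_space.basis_invertible(2)[OF fibre_laws[OF mm(1)] frame_basis[OF r(2) mm(2)], of "%i. s' i m",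
     OF frame_in[OF f' _ mm(3)] b(2)[OF m, unfolded a_def] frame_in[OF f ij(1) mm(4)], of j]
    frame_in[OF f ij(1) mm(4)] ij(2) k' by simp
 qed
 then show "\<exists>Wa. openin (mtop M) Wa \<and> m0 \<in> Wa \<and> smooth_real M (W \<inter> W' \<inter> Wa) (%m. cf k' s' (s i m) j)"
  using frame_open[OF r(2)] r(1) by blast
qed

lemma fchart_image:
 assumes c: "(U, n, x) \<in> M" and f: "frame W k s" and O': "O' \<subseteq> U \<inter> W"
 shows "fchart n x k s ` {e \<in> P. q e \<in> O'} =
  {w \<in> espace (n + k). coord_take n w \<in> x ` O' \<and> coord_drop n w \<in> espace k}"
proof (rule subset_antisym[OF subsetI subsetI])
 fix w assume "w \<in> fchart n x k s ` {e \<in> P. q e \<in> O'}"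
 then obtain e where e: "e \<in> P" "q e \<in> O'" "w = fchart n x k s e" by blast
 have "cf k s e \<in> espace k" "x (q e) \<in> espace n"
  using e O' cf_in[OF f e(1)] chart_in_espace[OF preM c] by auto
 then show "w \<in> {w \<in> espace (n + k). coord_take n w \<in> x ` O' \<and> coord_drop n w \<in> espace k}"
  using e unfolding e(3) by (simp add: coord_append_in coord_take_append coord_drop_append)
next
 fix w assume w: "w \<in> {w \<in> espace (n + k). coord_take n w \<in> x ` O' \<and> coord_drop n w \<in> espace k}"
 then obtain m where m: "m \<in> O'" "coord_take n w = x m" by blast
 let ?e = "llc m k (coord_drop n w) (%i. s i m)"
 have mW: "m \<in> W" using m O' by blast
 have "cf k s ?e = coord_drop n w" using w by (intro cf_lc[OF f mW]) blast
 then have "fchart n x k s ?e = w"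
  using coord_append_take_drop[of n w] by (simp only: lc_in_P[OF f mW] m(2)[symmetric])
 then show "w \<in> fchart n x k s ` {e \<in> P. q e \<in> O'}"
  using lc_in_P[OF f mW] m(1) by (intro image_eqI[of _ _ ?e]) auto
qed

lemma fchart_inj:
 assumes c: "(U, n, x) \<in> M" and f: "frame W k s"
 shows "inj_on (fchart n x k s) {e \<in> P. q e \<in> U \<inter> W}"
proof (rule inj_onI)
 fix e e' assume e: "e \<in> {e \<in> P. q e \<in> U \<inter> W}" "e' \<in> {e \<in> P. q e \<in> U \<inter> W}"
  and eq: "fchart n x k s e = fchart n x k s e'"
 have "coord_take n (fchart n x k s e) = coord_take n (fchart n x k s e')" by (simp only: eq)
 then have "x (q e) = x (q e')"
  using e chart_in_espace[OF preM c] by (simp add: coord_take_append)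
 then have qq: "q e = q e'" using e chart_inj[OF preM c] by (auto simp: inj_on_def)
 have "coord_drop n (fchart n x k s e) = coord_drop n (fchart n x k s e')" by (simp only: eq)
 then have "cf k s e = cf k s e'" by (simp only: coord_drop_append)
 then show "e = e'" using e by (intro cf_inj[OF f _ _ qq]) auto
qed

lemma pre_manifold_FA: "pre_manifold FA"
proof (rule pre_manifoldI)
 fix D N \<phi> assume "(D, N, \<phi>) \<in> FA"
 then obtain U n x W k s where c: "(U, n, x) \<in> M" and f: "frame W k s" and
  e: "D = {e \<in> P. q e \<in> U \<inter> W}" "N = n + k" "\<phi> = fchart n x k s" by (rule frame_atlasE)
 show inj: "inj_on \<phi> D" unfolding e by (rule fchart_inj[OF c f])
 fix D' N' \<phi>' assume "(D', N', \<phi>') \<in> FA"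
 then obtain U' n' x' W' k' s' where c': "(U', n', x') \<in> M" and f': "frame W' k' s'" and
  e': "D' = {e \<in> P. q e \<in> U' \<inter> W'}" "N' = n' + k'" "\<phi>' = fchart n' x' k' s'" by (rule frame_atlasE)
 let ?O = "(U \<inter> W) \<inter> (U' \<inter> W')"
 define A where "A = \<phi> ` (D \<inter> D')"
 have DD: "D \<inter> D' = {e \<in> P. q e \<in> ?O}" unfolding e e' by auto
 have A: "A = {w \<in> espace N. coord_take n w \<in> x ` ?O \<and> coord_drop n w \<in> espace k}"
  unfolding A_def DD unfolding e by (rule fchart_image[OF c f]) auto
 have oO: "openin (mtop M) ?O"
  by (intro openin_Int frame_open[OF f] frame_open[OF f'] chart_open[OF preM c] chart_open[OF preM c'])
 have "openin (Euclidean_space n) (x ` ?O)"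
  using openin_mtop_chart[OF preM oO c] by (simp add: Int_assoc)
 from openin_append[OF this openin_espace[of k]]
 have oA: "openin (Euclidean_space N) A" unfolding A e .
 then show "openin (Euclidean_space N) (\<phi> ` (D \<inter> D'))" unfolding A_def .
 note cs = pre_manifold_coord_space[of N]
 have AE: "A \<subseteq> pts (coord_space N)" using openin_espace_subset[OF oA] by simp
 define \<mu> where "\<mu> w = inv_into U x (coord_take n w)" for w
 have \<mu>: "\<mu> w \<in> ?O" "x (\<mu> w) = coord_take n w" if "w \<in> A" for w
 proof -
  obtain m where m: "m \<in> ?O" "coord_take n w = x m" using \<open>w \<in> A\<close> unfolding A by blast
  then have "\<mu> w = m" unfolding \<mu>_def using chart_inv_into[OF preM c] by (simp only: m(2)) auto
  then show "\<mu> w \<in> ?O" "x (\<mu> w) = coord_take n w" using m by auto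
 qed
 have sm\<mu>: "smooth_on (coord_space N) A \<mu> M"
 proof (rule smooth_onI[OF cs preM])
  fix w assume w: "w \<in> A"
  have "smooth_real (coord_space N) A (%w. x (\<mu> w) j)" if "j < n" for j
   by (rule smooth_real_cong[OF smooth_real_coord[OF openin_espace_subset[OF oA], of j]])
    (simp add: \<mu>(2) that)
  then show "smooth_near (coord_space N) A \<mu> M w"
   using c oA w \<mu>(1)
   by (intro exI[of _ U] exI[of _ n] exI[of _ x] exI[of _ A]) (auto simp: openin_coord_space)
 qed
 fix l j
 define g where "g w = (if j < n' then x' (\<mu> w) j else if j - n' < k'
  then \<Sum>i<k. w (i + n) * cf k' s' (s i (\<mu> w)) (j - n') else 0)" for w
 have "smooth_real (coord_space N) A g"
 proof (cases "j < n'")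
  case True
  have "smooth_real (coord_space N) A (%w. x' (\<mu> w) j)"
   by (rule smooth_real_compose[OF cs preM smooth_real_chart[OF preM c'] sm\<mu>]) (use \<mu>(1) in blast)
  then show ?thesis unfolding g_def using True by simp
 next
  case F: False
  show ?thesis
  proof (cases "j - n' < k'")
   case True
   have "smooth_real (coord_space N) A (%w. \<Sum>i<k. w (i + n) * cf k' s' (s i (\<mu> w)) (j - n'))"
   proof (intro smooth_real_sum[OF cs AE] smooth_real_mult[OF cs])
    fix i assume i: "i \<in> {..<k}"
    show "smooth_real (coord_space N) A (%w. w (i + n))"
     by (rule smooth_real_coord[OF openin_espace_subset[OF oA]])
    show "smooth_real (coord_space N) A (%w. cf k' s' (s i (\<mu> w)) (j - n'))"
     by (rule smooth_real_compose[OF cs preM frame_transition[OF f f' _ True] sm\<mu>, of i]) (use \<mu>(1) i in auto)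
   qed
   then show ?thesis unfolding g_def using True F by simp
  next
   case False
   then show ?thesis unfolding g_def using F smooth_real_const[OF cs AE] by simp
  qed
 qed
 then have "Ck_on N l A g" by (rule smooth_real_imp_Ck[OF oA])
 then show "Ck_on N l (\<phi> ` (D \<inter> D')) (%u. \<phi>' (inv_into D \<phi> u) j)"
  unfolding A_def[symmetric]
 proof (rule Ck_cong[OF oA, rotated])
  fix w assume w: "w \<in> A"
  then obtain v where v: "v \<in> D \<inter> D'" "w = \<phi> v" unfolding A_def by blast
  have tk: "coord_take n w = x (q v)" and dr: "coord_drop n w = cf k s v"
   using v(1) chart_in_espace[OF preM c, of "q v"] coord_drop_append[of n "x (q v)" "cf k s v"]
    coord_take_append[of "x (q v)" n "cf k s v"]
   unfolding v(2) unfolding e by (simp_all only: mem_Collect_eq Int_iff)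
  have mv: "\<mu> w = q v"
   unfolding \<mu>_def tk using v(1) e(1) by (intro chart_inv_into[OF preM c]) auto
  have iv: "inv_into D \<phi> w = v" unfolding v(2) using inv_into_f_f[OF inj] v(1) by blast
  have cfg: "cf k' s' v (j - n') = g w" if "\<not> j < n'"
  proof (cases "j - n' < k'")
   case True
   have vW: "v \<in> P" "q v \<in> W" "q v \<in> W'" using v(1) e e' by auto
   have mp: "q v \<in> pts M" using q_in vW(1) .
   have "cf k' s' v (j - n') =
     lco (q v) k' (%i. s' i (q v)) (llc (q v) k (cf k s v) (%i. s i (q v))) (j - n')"
    by (simp only: lc_cf[OF f vW(1,2)])
   also have "\<dots> = (\<Sum>i<k. cf k s v i * lco (q v) k' (%i. s' i (q v)) (s i (q v)) (j - n'))"
    by (rule fibre_space.coeffs_of_lc[OF fibre_laws[OF mp] frame_basis[OF f' vW(3)] frame_in[OF f _ vW(2)] True])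
   also have "\<dots> = g w"
   proof -
    have "g w = (\<Sum>i<k. w (i + n) * cf k' s' (s i (\<mu> w)) (j - n'))" using that True by (simp add: g_def)
    also have "\<dots> = (\<Sum>i<k. cf k s v i * lco (q v) k' (%i. s' i (q v)) (s i (q v)) (j - n'))"
    proof (rule sum.cong[OF refl])
     fix i assume "i \<in> {..<k}"
     then have "q (s i (q v)) = q v" using frame_in[OF f _ vW(2)] by blast
     then show "w (i + n) * cf k' s' (s i (\<mu> w)) (j - n') =
       cf k s v i * lco (q v) k' (%i. s' i (q v)) (s i (q v)) (j - n')"
      using fun_cong[OF dr, of i] by (simp add: mv)
    qed
    finally show ?thesis by (rule sym)
   qed
   finally show ?thesis .
  next
   case False
   have "cf k' s' v \<in> espace k'" using v(1) e' by (intro cf_in[OF f']) auto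
   then show ?thesis using False that by (simp add: g_def espaceD)
  qed
  show "g w = \<phi>' (inv_into D \<phi> w) j"
  proof (cases "j < n'")
   case True
   then show ?thesis unfolding e' iv by (simp add: coord_append_def g_def mv)
  next
   case False
   then show ?thesis using cfg unfolding e' iv by (simp add: coord_append_def)
  qed
 qed
qed

lemma pts_FA: "pts FA = P"
proof (rule subset_antisym[OF subsetI subsetI])
 fix e assume "e \<in> pts FA"
 then obtain D N \<phi> where "(D, N, \<phi>) \<in> FA" "e \<in> D" by (rule pts_chartE[OF pre_manifold_FA])
 then show "e \<in> P" by (auto elim: frame_atlasE)
next
 fix e assume e: "e \<in> P"
 obtain W k s where "q e \<in> W" "frame W k s" by (rule reference_frameE[OF q_in[OF e]]) blast
 moreover obtain U n x where "(U, n, x) \<in> M" "q e \<in> U" using pts_chartE[OF preM q_in[OF e]] by blast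
 ultimately show "e \<in> pts FA" using chart_subset_pts[OF pre_manifold_FA fchart_in_FA] e by blast
qed

lemma smooth_into_FA:
 assumes N: "pre_manifold N" and f: "frame W k s" and F: "!!p. p \<in> S ==> F p \<in> P" "!!p. p \<in> S ==> q (F p) \<in> W"
  and b: "smooth_on N S (%p. q (F p)) M" and c: "!!i. i < k ==> smooth_real N S (%p. cf k s (F p) i)"
 shows "smooth_on N S F FA"
proof (rule smooth_onI[OF N pre_manifold_FA])
 fix p assume p: "p \<in> S"
 obtain U n x O' where x: "(U, n, x) \<in> M" "openin (mtop N) O'" "p \<in> O'" "(%p. q (F p)) ` (S \<inter> O') \<subseteq> U"
  "!!j. smooth_real N (S \<inter> O') (%p. x (q (F p)) j)"
  by (rule smooth_onE[OF N b p]) blast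
 have "smooth_real N (S \<inter> O') (%p. fchart n x k s (F p) j)" if j: "j < n + k" for j
 proof (cases "j < n")
  case True
  then show ?thesis using x(5) by (simp add: coord_append_def)
 next
  case False
  then show ?thesis using smooth_real_subset[OF c, of "j - n" "S \<inter> O'"] j by (simp add: coord_append_def)
 qed
 then show "smooth_near N S F FA p"
  using fchart_in_FA[OF x(1) f] x F
  by (intro exI[of _ "{e \<in> P. q e \<in> U \<inter> W}"] exI[of _ "n + k"] exI[of _ "fchart n x k s"] exI[of _ O']) auto
qed

lemma smooth_q: "smooth_on FA P q M"
proof (rule smooth_onI[OF pre_manifold_FA preM])
 fix e assume e: "e \<in> P"
 obtain W k s where f: "q e \<in> W" "frame W k s" by (rule reference_frameE[OF q_in[OF e]]) blast
 obtain U n x where c: "(U, n, x) \<in> M" "q e \<in> U" using pts_chartE[OF preM q_in[OF e]] by blast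
 let ?D = "{e \<in> P. q e \<in> U \<inter> W}"
 note ch = fchart_in_FA[OF c(1) f(2)]
 have "smooth_real FA (P \<inter> ?D) (%e. x (q e) j)" if "j < n" for j
  by (rule smooth_real_cong_subset[OF smooth_real_chart[OF pre_manifold_FA ch, of j]])
   (use that in \<open>auto simp: coord_append_def\<close>)
 then show "smooth_near FA P q M e"
  using c e f(1) chart_open[OF pre_manifold_FA ch]
  by (intro exI[of _ U] exI[of _ n] exI[of _ x] exI[of _ ?D]) auto
qed

lemma smooth_cf:
 assumes f: "frame W k s"
 shows "smooth_real FA {e \<in> P. q e \<in> W} (%e. cf k s e i)"
proof (rule smooth_real_local[OF pre_manifold_FA])
 fix e assume e: "e \<in> {e \<in> P. q e \<in> W}"
 then have eP: "e \<in> P" by simp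
 obtain U n x where c: "(U, n, x) \<in> M" "q e \<in> U" using pts_chartE[OF preM q_in[OF eP]] by blast
 let ?D = "{e \<in> P. q e \<in> U \<inter> W}"
 note ch = fchart_in_FA[OF c(1) f]
 have "smooth_real FA ({e \<in> P. q e \<in> W} \<inter> ?D) (%e. cf k s e i)"
  by (rule smooth_real_cong_subset[OF smooth_real_chart[OF pre_manifold_FA ch, of "n + i"]])
   (auto simp: coord_append_def)
 then show "\<exists>Wa. openin (mtop FA) Wa \<and> e \<in> Wa \<and> smooth_real FA ({e \<in> P. q e \<in> W} \<inter> Wa) (%e. cf k s e i)"
  using e c chart_open[OF pre_manifold_FA ch] by (intro exI[of _ ?D]) auto
qed

lemma Hausdorff_FA: "Hausdorff_space (mtop FA)"
 unfolding Hausdorff_space_def topspace_mtop[OF pre_manifold_FA] pts_FA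
proof (intro allI impI)
 fix e e' assume "e \<in> P \<and> e' \<in> P \<and> e \<noteq> e'"
 then have e: "e \<in> P" "e' \<in> P" "e \<noteq> e'" by auto
 have oP: "openin (mtop FA) P" using openin_mtop_pts[OF pre_manifold_FA] by (simp add: pts_FA)
 show "\<exists>A B. openin (mtop FA) A \<and> openin (mtop FA) B \<and> e \<in> A \<and> e' \<in> B \<and> disjnt A B"
 proof (cases "q e = q e'")
  case False
  have "Hausdorff_space (mtop M)" using M smooth_manifold_iff by blast
  then obtain A B where AB: "openin (mtop M) A" "openin (mtop M) B" "q e \<in> A" "q e' \<in> B" "disjnt A B"
   using False q_in[OF e(1)] q_in[OF e(2)] unfolding Hausdorff_space_def topspace_mtop[OF preM] by blast
  show ?thesis
   using openin_smooth_preimage[OF pre_manifold_FA preM oP smooth_q AB(1)]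
    openin_smooth_preimage[OF pre_manifold_FA preM oP smooth_q AB(2)] AB e
   by (intro exI[of _ "{p \<in> P. q p \<in> A}"] exI[of _ "{p \<in> P. q p \<in> B}"]) (auto simp: disjnt_def)
 next
  case True
  obtain W k s where f: "q e \<in> W" "frame W k s" by (rule reference_frameE[OF q_in[OF e(1)]]) blast
  have "cf k s e \<noteq> cf k s e'"
   using cf_inj[OF f(2) e(1,2) True] f(1) e(3) True by auto
  then obtain i where i: "cf k s e i \<noteq> cf k s e' i" by blast
  define D where "D = {e \<in> P. q e \<in> W}"
  have oD: "openin (mtop FA) D"
   unfolding D_def by (rule openin_smooth_preimage[OF pre_manifold_FA preM oP smooth_q frame_open[OF f(2)]])
  obtain X Y where XY: "open X" "open Y" "cf k s e i \<in> X" "cf k s e' i \<in> Y" "X \<inter> Y = {}"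
   using hausdorff[OF i] by blast
  have D: "e \<in> D" "e' \<in> D" using e f True by (auto simp: D_def)
  note sm = smooth_cf[OF f(2), of i, folded D_def]
  show ?thesis
   using openin_smooth_real_preimage[OF pre_manifold_FA oD sm XY(1)]
    openin_smooth_real_preimage[OF pre_manifold_FA oD sm XY(2)] XY(3-5) D
   by (intro exI[of _ "{p \<in> D. cf k s p i \<in> X}"] exI[of _ "{p \<in> D. cf k s p i \<in> Y}"]) (auto simp: disjnt_def)
 qed
qed

lemma second_countable_FA: "second_countable_top (mtop FA)"
proof -
 obtain \<B> where \<B>: "countable \<B>" "!!V. V \<in> \<B> ==> openin (mtop M) V"
  "!!W p. openin (mtop M) W ==> p \<in> W ==> \<exists>V\<in>\<B>. p \<in> V \<and> V \<subseteq> W"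
  using M unfolding smooth_manifold_iff second_countable_top_def by metis
 define good where "good V c \<longleftrightarrow> c \<in> FA \<and> {e \<in> P. q e \<in> V} \<subseteq> fst c" for V c
 define C where "C = (%V. SOME c. good V c) ` {V \<in> \<B>. \<exists>c. good V c}"
 have "countable C" unfolding C_def using \<B>(1) by (intro countable_image) (simp add: countable_Collect)
 moreover have gC: "good V (SOME c. good V c)" if "\<exists>c. good V c" for V using that by (rule someI_ex)
 then have "C \<subseteq> FA" unfolding C_def good_def by blast
 moreover have "pts FA \<subseteq> \<Union> (fst ` C)"
 proof
  fix e assume "e \<in> pts FA"
  then have e: "e \<in> P" by (simp add: pts_FA)
  obtain W k s where f: "q e \<in> W" "frame W k s" by (rule reference_frameE[OF q_in[OF e]]) blast
  obtain U n x where c: "(U, n, x) \<in> M" "q e \<in> U" using pts_chartE[OF preM q_in[OF e]] by blast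
  have "openin (mtop M) (U \<inter> W)" by (rule openin_Int[OF chart_open[OF preM c(1)] frame_open[OF f(2)]])
  then obtain V where V: "V \<in> \<B>" "q e \<in> V" "V \<subseteq> U \<inter> W" using \<B>(3) c f by blast
  have "good V ({e \<in> P. q e \<in> U \<inter> W}, n + k, fchart n x k s)"
   unfolding good_def using fchart_in_FA[OF c(1) f(2)] V(3) by auto
  then have ex: "\<exists>c. good V c" by blast
  have "(SOME c. good V c) \<in> C" unfolding C_def using V(1) ex by blast
  moreover have "e \<in> fst (SOME c. good V c)" using gC[OF ex] e V(2) unfolding good_def by blast
  ultimately show "e \<in> \<Union> (fst ` C)" by blast
 qed
 ultimately show ?thesis by (intro second_countable_atlas[OF pre_manifold_FA])
qed

abbreviation FB :: "('e, 'm) vbundle" where "FB \<equiv> frame_bundle M P q pl sc z sec"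

lemma FB_simps [simp]: "tot FB = FA" "base FB = M" "proj FB = q" "add FB = pl" "scl FB = sc" "zer FB = z"
 by (simp_all add: frame_bundle_def)

lemma fibre_FB: "fibre FB m = Fib m"
 by (simp add: fibre_def pts_FA)

lemma over_set_FB: "over_set FB W = {e \<in> P. q e \<in> W}"
 by (simp add: over_set_def pts_FA)

lemma FB_trivialisation:
 assumes f: "frame W k s"
 shows "local_trivialisation FB W k (cf k s)"
proof -
 let ?f = "%e. (q e, cf k s e)" and ?D = "{e \<in> P. q e \<in> W}"
 let ?N = "prod_manifold M (coord_space k)"
 note N = pre_manifold_prod[OF preM pre_manifold_coord_space[of k]]
 have bij: "bij_betw ?f ?D (W \<times> espace k)"
 proof (rule bij_betwI')
  fix e e' assume "e \<in> ?D" "e' \<in> ?D"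
  then show "?f e = ?f e' \<longleftrightarrow> e = e'" using cf_inj[OF f, of e e'] by blast
 next
  fix e assume "e \<in> ?D" then show "?f e \<in> W \<times> espace k" using cf_in[OF f] by auto
 next
  fix y assume "y \<in> W \<times> espace k"
  then obtain m c where y: "y = (m, c)" "m \<in> W" "c \<in> espace k" by blast
  show "\<exists>e\<in>?D. y = ?f e"
   using lc_in_P[OF f y(2), of c] cf_lc[OF f y(2,3)] y
   by (intro bexI[of _ "llc m k c (%i. s i m)"]) auto
 qed
 have D: "?D \<subseteq> pts FA" by (auto simp: pts_FA)
 have sm: "smooth_on FA ?D ?f ?N"
  by (intro smooth_on_Pair[OF pre_manifold_FA preM pre_manifold_coord_space] smooth_on_subset[OF smooth_q]
    smooth_on_coord_spaceI[OF pre_manifold_FA D] smooth_cf[OF f]) (auto intro: cf_in[OF f])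
 have WM: "W \<times> espace k \<subseteq> pts M \<times> pts (coord_space k)" using frame_W[OF f] by auto
 have inv: "inv_into ?D ?f y \<in> ?D" "?f (inv_into ?D ?f y) = y" if "y \<in> W \<times> espace k" for y
 proof -
  have y: "y \<in> ?f ` ?D" using that bij_betw_imp_surj_on[OF bij] by blast
  show "inv_into ?D ?f y \<in> ?D" by (rule inv_into_into[OF y])
  show "?f (inv_into ?D ?f y) = y" by (rule f_inv_into_f[OF y])
 qed
 have "smooth_on ?N (W \<times> espace k) (inv_into ?D ?f) FA"
 proof (rule smooth_into_FA[OF N f])
  show "inv_into ?D ?f y \<in> P" "q (inv_into ?D ?f y) \<in> W" if "y \<in> W \<times> espace k" for y
   using inv(1)[OF that] by auto
  show "smooth_on ?N (W \<times> espace k) (%p. q (inv_into ?D ?f p)) M"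
   by (rule smooth_on_cong[OF smooth_on_fst[OF preM pre_manifold_coord_space WM]])
    (rule arg_cong[OF inv(2), of _ fst, unfolded fst_conv, symmetric])
  show "smooth_real ?N (W \<times> espace k) (%p. cf k s (inv_into ?D ?f p) i)" for i
  proof (rule smooth_real_cong)
   show "smooth_real ?N (W \<times> espace k) (%p. snd p i)"
    by (rule smooth_real_compose[OF N pre_manifold_coord_space smooth_real_coord[OF subset_refl]
       smooth_on_snd[OF preM pre_manifold_coord_space WM]]) auto
   show "snd p i = cf k s (inv_into ?D ?f p) i" if "p \<in> W \<times> espace k" for p
    using arg_cong[OF inv(2)[OF that], of snd, unfolded snd_conv] by (rule fun_cong[OF sym])
  qed
 qed
 then have diffeo: "diffeo_on FA ?D ?f ?N (W \<times> espace k)"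
  unfolding diffeo_on_def by (intro conjI bij sm)
 have add: "cf k s (pl e e') = (%i. cf k s e i + cf k s e' i)"
  if "m \<in> W" "e \<in> Fib m" "e' \<in> Fib m" for m e e'
 proof -
  interpret fibre_space "Fib m" pl sc "z m" by (rule fibre_laws[OF frame_W[OF f that(1)]])
  show ?thesis
   using coeffs_add[OF frame_basis[OF f that(1)] that(2,3)] pl_in[OF that(2,3)] that by auto
 qed
 have scl: "cf k s (sc r e) = (%i. r * cf k s e i)"
  if "m \<in> W" "e \<in> Fib m" for m e r
 proof -
  interpret fibre_space "Fib m" pl sc "z m" by (rule fibre_laws[OF frame_W[OF f that(1)]])
  show ?thesis
   using coeffs_scale[OF frame_basis[OF f that(1)] that(2)] sc_in[OF that(2)] that by auto
 qed
 show ?thesis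
  unfolding local_trivialisation_def over_set_FB fibre_FB FB_simps
  by (intro conjI ballI allI frame_open[OF f] diffeo) (rule add scl; assumption)+
qed

theorem vector_bundle_FB: "vector_bundle FB"
 unfolding vector_bundle_def FB_simps fibre_FB
proof (intro conjI ballI)
 show "smooth_manifold FA"
  using smooth_manifold_iff pre_manifold_FA Hausdorff_FA second_countable_FA by blast
 show "smooth_on FA (pts FA) q M" using smooth_q by (simp add: pts_FA)
 show "vector_space_laws (Fib m) pl sc (z m)" if "m \<in> pts M" for m
  using fibre_laws[OF that] by (rule fibre_space.laws)
 show "\<exists>W k T. m \<in> W \<and> local_trivialisation FB W k T" if mM: "m \<in> pts M" for m
 proof -
  obtain W k s where "m \<in> W" "frame W k s" by (rule reference_frameE[OF mM]) blast
  then show ?thesis using FB_trivialisation by blast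
 qed
qed (rule M)

end

section \<open>Bundles of functions on the fibres of a map\<close>

text \<open>Functions \<open>\<phi> j\<close> on the part of \<open>S\<close> over \<open>W\<close> and smooth sections \<open>x j\<close> of \<open>\<pi>\<close> dual to each
 other, such that the \<open>\<phi> j\<close> span every \<open>\<F> m\<close>; the coefficients of a function are then its values
 at the points \<open>x j m\<close>.\<close>

definition dual_system ::
 "'m atlas => 'x atlas => 'x set => ('x => 'm) => ('m => ('x => real) set) => 'm set =>
  'j set => ('j => 'x => real) => ('j => 'm => 'x) => bool" where
 "dual_system M N S \<pi> \<F> W J \<phi> x \<longleftrightarrow> openin (mtop M) W \<and> finite J \<and>
   (\<forall>i\<in>J. smooth_real N {y \<in> S. \<pi> y \<in> W} (\<phi> i)) \<and>
   (\<forall>i\<in>J. smooth_on M W (x i) N) \<and>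
   (\<forall>i\<in>J. \<forall>m\<in>W. x i m \<in> S \<and> \<pi> (x i m) = m) \<and>
   (\<forall>i\<in>J. \<forall>j\<in>J. \<forall>m\<in>W. \<phi> i (x j m) = (if i = j then 1 else 0)) \<and>
   (\<forall>i\<in>J. \<forall>m\<in>W. (%y. if y \<in> S \<and> \<pi> y = m then \<phi> i y else 0) \<in> \<F> m) \<and>
   (\<forall>m\<in>W. \<forall>f\<in>\<F> m. \<forall>y\<in>S. \<pi> y = m \<longrightarrow> f y = (\<Sum>i\<in>J. f (x i m) * \<phi> i y))"

lemma dual_system_nat:
 assumes m: "m \<in> W" and ds: "dual_system M N S \<pi> \<F> W J \<phi> x"
 shows "\<exists>W k \<phi>' x'. m \<in> W \<and> dual_system M N S \<pi> \<F> W {..<k::nat} \<phi>' x'"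
proof -
 have "finite J" using ds unfolding dual_system_def by blast
 then obtain h where h: "bij_betw h {..<card J} J"
  using ex_bij_betw_nat_finite unfolding lessThan_atLeast0 by blast
 have hJ: "h i \<in> J" if "i \<in> {..<card J}" for i using h that by (rule bij_betw_apply)
 have hh: "h i = h j \<longleftrightarrow> i = j" if "i \<in> {..<card J}" "j \<in> {..<card J}" for i j
  using h that by (auto simp: bij_betw_def inj_on_def)
 have sum: "(\<Sum>i<card J. g (h i)) = (\<Sum>i\<in>J. g i)" for g :: "_ => real"
  by (rule sum.reindex_bij_betw[OF h])
 have "dual_system M N S \<pi> \<F> W {..<card J} (%i. \<phi> (h i)) (%i. x (h i))"
  using ds unfolding dual_system_def by (simp add: sum[of "%i. _ (x i _) * \<phi> i _"] hJ hh)
 then show ?thesis using m by blast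
qed

lemma fun_bundle_simps [simp]:
 "base (fun_bundle M N S \<pi> \<F>) = M" "proj (fun_bundle M N S \<pi> \<F>) = fst"
 "add (fun_bundle M N S \<pi> \<F>) p p' = (fst p, %x. snd p x + snd p' x)"
 "scl (fun_bundle M N S \<pi> \<F>) r p = (fst p, %x. r * snd p x)"
 "zer (fun_bundle M N S \<pi> \<F>) m = (m, %x. 0)"
 by (simp_all add: fun_bundle_def frame_bundle_def)

text \<open>The spaces \<open>\<F> m\<close> of functions on the fibres of \<open>\<pi> : S \<rightarrow> M\<close> form a bundle as soon as there are dual systems.\<close>

locale function_bundle =
 fixes M :: "'m atlas" and N :: "'x atlas" and S :: "'x set" and \<pi> :: "'x => 'm" and
  \<F> :: "'m => ('x => real) set"
 assumes M: "smooth_manifold M" and N: "pre_manifold N"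
  and zero_in: "!!m. m \<in> pts M ==> (%x. 0) \<in> \<F> m"
  and add_in: "!!m f g. m \<in> pts M ==> f \<in> \<F> m ==> g \<in> \<F> m ==> (%x. f x + g x) \<in> \<F> m"
  and scale_in: "!!m f r. m \<in> pts M ==> f \<in> \<F> m ==> (%x. r * f x) \<in> \<F> m"
  and systems: "!!m. m \<in> pts M ==> \<exists>W k \<phi> x. m \<in> W \<and> dual_system M N S \<pi> \<F> W {..<k::nat} \<phi> x"
begin

abbreviation P :: "('m \<times> ('x => real)) set" where
 "P \<equiv> {(m, \<phi>). m \<in> pts M \<and> \<phi> \<in> \<F> m \<and> (\<forall>x. x \<notin> S \<or> \<pi> x \<noteq> m \<longrightarrow> \<phi> x = 0)}"
abbreviation pl :: "'m \<times> ('x => real) => 'm \<times> ('x => real) => 'm \<times> ('x => real)" where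
 "pl \<equiv> (%p p'. (fst p, %x. snd p x + snd p' x))"
abbreviation sc :: "real => 'm \<times> ('x => real) => 'm \<times> ('x => real)" where
 "sc \<equiv> (%r p. (fst p, %x. r * snd p x))"
abbreviation ze :: "'m => 'm \<times> ('x => real)" where
 "ze \<equiv> (%m. (m, %x. 0))"
abbreviation sec :: "'m set => ('m => 'm \<times> ('x => real)) => bool" where
 "sec \<equiv> (%W s. smooth_on N {x \<in> S. \<pi> x \<in> W} (%x. snd (s (\<pi> x)) x) real_line)"

lemma fb_eq: "fun_bundle M N S \<pi> \<F> = frame_bundle M P fst pl sc ze sec"
 by (simp add: fun_bundle_def)

lemma preM: "pre_manifold M"
 using M smooth_manifold_iff by blast

lemma fibre_P: "e \<in> {e \<in> P. fst e = m} \<longleftrightarrow>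
  fst e = m \<and> m \<in> pts M \<and> snd e \<in> \<F> m \<and> (\<forall>x. x \<notin> S \<or> \<pi> x \<noteq> m \<longrightarrow> snd e x = 0)"
 by auto

lemma P_fibreI: "e \<in> P ==> fst e = m ==> e \<in> {e \<in> P. fst e = m}"
 by (rule CollectI) (rule conjI)

lemma P_fibreD: "e \<in> {e \<in> P. fst e = m} ==> e \<in> P" "e \<in> {e \<in> P. fst e = m} ==> fst e = m"
 by (drule CollectD, erule conjE, assumption)+

lemma fun_fibre_space:
 assumes m: "m \<in> pts M"
 shows "fibre_space {e \<in> P. fst e = m} pl sc (ze m)"
proof (rule fibre_space.intro, unfold vector_space_laws_def, intro conjI ballI allI)
 fix r s e e' e'' assume e: "e \<in> {e \<in> P. fst e = m}"
 show "sc r e \<in> {e \<in> P. fst e = m}" using e scale_in[OF m] unfolding fibre_P by auto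
 show "pl (ze m) e = e" "pl e (sc (- 1) e) = ze m" "sc 1 e = e" "sc r (sc s e) = sc (r * s) e"
  "sc (r + s) e = pl (sc r e) (sc s e)"
  using e unfolding fibre_P by (auto simp: algebra_simps prod_eq_iff)
 assume e': "e' \<in> {e \<in> P. fst e = m}"
 show "pl e e' \<in> {e \<in> P. fst e = m}" using e e' add_in[OF m] unfolding fibre_P by auto
 show "pl e e' = pl e' e" "sc r (pl e e') = pl (sc r e) (sc r e')" "pl (pl e e') e'' = pl e (pl e' e'')"
  using e e' unfolding fibre_P by (auto simp: algebra_simps prod_eq_iff)
next
 show "ze m \<in> {e \<in> P. fst e = m}" using zero_in[OF m] m unfolding fibre_P by auto
qed

lemma lin_comb_fun:
 "(!!i. i < k ==> fst (s i) = m) ==>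
  lin_comb pl sc (ze m) k c s = (m, %y. \<Sum>i<k. c i * snd (s i) y)"
 by (induction k) auto

context
 fixes W :: "'m set" and k :: nat and \<phi> :: "nat => 'x => real" and x :: "nat => 'm => 'x"
 assumes ds: "dual_system M N S \<pi> \<F> W {..<k} \<phi> x"
begin

lemma ds_open: "openin (mtop M) W"
 and ds_smooth: "i < k ==> smooth_real N {y \<in> S. \<pi> y \<in> W} (\<phi> i)"
 and ds_points: "i < k ==> smooth_on M W (x i) N"
 and ds_in: "i < k ==> m \<in> W ==> x i m \<in> S" "i < k ==> m \<in> W ==> \<pi> (x i m) = m"
 and ds_dual: "i < k ==> j < k ==> m \<in> W ==> \<phi> i (x j m) = (if i = j then 1 else 0)"
 and ds_mem: "i < k ==> m \<in> W ==> (%y. if y \<in> S \<and> \<pi> y = m then \<phi> i y else 0) \<in> \<F> m"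
 and ds_expand: "m \<in> W ==> f \<in> \<F> m ==> y \<in> S ==> \<pi> y = m ==> f y = (\<Sum>i<k. f (x i m) * \<phi> i y)"
 using ds unfolding dual_system_def by simp_all

text \<open>The frame formed by the functions of a dual system.\<close>

definition fr :: "nat => 'm => 'm \<times> ('x => real)" where
 "fr i m = (m, %y. if y \<in> S \<and> \<pi> y = m then \<phi> i y else 0)"

lemma ds_W: "m \<in> W ==> m \<in> pts M"
 using openin_mtop_subset[OF preM ds_open] by blast

lemma fr_in: "i < k ==> m \<in> W ==> fr i m \<in> {e \<in> P. fst e = m}"
 unfolding fibre_P using ds_mem ds_W by (auto simp: fr_def)

lemma fr_basis:
 assumes m: "m \<in> W"
 shows "fibre_space.basis {e \<in> P. fst e = m} pl sc (ze m) k (%i. fr i m)"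
  and "e \<in> {e \<in> P. fst e = m} ==> i < k ==> lin_coeffs pl sc (ze m) k (%i. fr i m) e i = snd e (x i m)"
proof -
 interpret fibre_space "{e \<in> P. fst e = m}" pl sc "ze m" by (rule fun_fibre_space[OF ds_W[OF m]])
 have d: "snd (fr j m) (x i m) = (if i = j then 1 else 0)" if "i < k" "j < k" for i j
  using ds_in[OF that(1) m] ds_dual[OF that(2,1) m] by (auto simp: fr_def)
 have sp: "e = lc k (%i. snd e (x i m)) (%i. fr i m)" if e: "e \<in> {e \<in> P. fst e = m}" for e
 proof -
  have "lc k (%i. snd e (x i m)) (%i. fr i m) = (m, %y. \<Sum>i<k. snd e (x i m) * snd (fr i m) y)"
   by (rule lin_comb_fun) (simp add: fr_def)
  also have "\<dots> = e"
  proof -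
   have e': "fst e = m" "snd e \<in> \<F> m" "!!x. x \<notin> S \<or> \<pi> x \<noteq> m ==> snd e x = 0"
    using e unfolding fibre_P by blast+
   have "(\<Sum>i<k. snd e (x i m) * snd (fr i m) y) = snd e y" for y
   proof (cases "y \<in> S \<and> \<pi> y = m")
    case True
    then show ?thesis using ds_expand[OF m e'(2), of y] by (simp add: fr_def)
   next
    case False
    then show ?thesis using e'(3)[of y] by (auto simp: fr_def)
   qed
   then show ?thesis using e'(1) by (simp add: prod_eq_iff)
  qed
  finally show ?thesis by (rule sym)
 qed
 show "basis k (%i. fr i m)"
  by (rule basis_dual(1)[where t = "%i e. snd e (x i m)"]) (use fr_in[OF _ m] d sp in \<open>auto simp del: mem_Collect_eq\<close>)
 show "lin_coeffs pl sc (ze m) k (%i. fr i m) e i = snd e (x i m)" if "e \<in> {e \<in> P. fst e = m}" "i < k"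
  by (rule basis_dual(2)[where t = "%i e. snd e (x i m)", OF _ _ _ _ _ that])
   (use fr_in[OF _ m] d sp in \<open>auto simp del: mem_Collect_eq\<close>)
qed

lemma fr_frame: "local_frame M P fst pl sc ze sec W k fr"
 unfolding local_frame_def
proof (intro conjI allI impI ballI)
 fix i assume i: "i < k"
 show "smooth_on N {x \<in> S. \<pi> x \<in> W} (%x. snd (fr i (\<pi> x)) x) real_line"
  unfolding smooth_on_real_iff[OF N]
  by (rule smooth_real_cong[OF ds_smooth[OF i]]) (simp add: fr_def)
 fix m assume "m \<in> W"
 from P_fibreD[OF fr_in[OF i this]] show "fr i m \<in> P" "fst (fr i m) = m" .
next
 fix e assume e: "e \<in> P" "fst e \<in> W"
 interpret fibre_space "{e' \<in> P. fst e' = fst e}" pl sc "ze (fst e)"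
  by (rule fun_fibre_space[OF ds_W[OF e(2)]])
 have "e \<in> {e' \<in> P. fst e' = fst e}" by (rule P_fibreI[OF e(1) refl])
 then show "\<exists>!c. c \<in> espace k \<and> e = lin_comb pl sc (ze (fst e)) k c (%i. fr i (fst e))"
  using fr_basis(1)[OF e(2)] unfolding basis_def by (elim conjE) (rule bspec)
qed (rule ds_open)

lemma fr_reference:
 assumes W': "openin (mtop M) W'" "sec W' t" and t: "\<forall>m\<in>W'. t m \<in> P \<and> fst (t m) = m" and i: "i < k"
 shows "smooth_real M (W \<inter> W') (%m. lin_coeffs pl sc (ze m) k (%j. fr j m) (t m) i)"
proof -
 have "smooth_real M (W \<inter> W') (%m. snd (t (\<pi> (x i m))) (x i m))"
  by (rule smooth_real_compose[OF preM N W'(2)[unfolded smooth_on_real_iff[OF N]]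
     smooth_on_subset[OF ds_points[OF i]]]) (use ds_in[OF i] in auto)
 then show ?thesis
 proof (rule smooth_real_cong)
  fix m assume m: "m \<in> W \<inter> W'"
  then have "t m \<in> P \<and> fst (t m) = m" using bspec[OF t] by simp
  then have "t m \<in> {e \<in> P. fst e = m}" by (intro P_fibreI) simp_all
  with m i show "snd (t (\<pi> (x i m))) (x i m) = lin_coeffs pl sc (ze m) k (%j. fr j m) (t m) i"
   using fr_basis(2)[of m "t m" i] ds_in(2)[OF i, of m] by simp
 qed
qed

end

sublocale section_bundle M P fst pl sc ze sec
proof
 fix m assume m: "m \<in> pts M"
 from systems[OF m] obtain W k \<phi> x where "m \<in> W" and ds: "dual_system M N S \<pi> \<F> W {..<k::nat} \<phi> x"
  by blast
 show "\<exists>W k s. m \<in> W \<and> local_frame M P fst pl sc ze sec W k s \<and>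
   (\<forall>W' t. openin (mtop M) W' \<longrightarrow> sec W' t \<longrightarrow> (\<forall>m\<in>W'. t m \<in> P \<and> fst (t m) = m) \<longrightarrow>
    (\<forall>i<k. smooth_real M (W \<inter> W') (%m. lin_coeffs pl sc (ze m) k (%j. s j m) (t m) i)))"
  by (rule exI[of _ W], rule exI[of _ k], rule exI[of _ "fr \<phi>"], intro conjI allI impI)
   (rule \<open>m \<in> W\<close>, rule fr_frame[OF ds], rule fr_reference[OF ds])
next
 show "vector_space_laws {e \<in> P. fst e = m} pl sc (ze m)" if "m \<in> pts M" for m
  by (rule fibre_space.laws[OF fun_fibre_space[OF that]])
qed (use M in auto)

abbreviation B where "B \<equiv> fun_bundle M N S \<pi> \<F>"

lemma vector_bundle_fun: "vector_bundle B"
 unfolding fb_eq by (rule vector_bundle_FB)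

lemma tot_fun: "tot B = FA"
 unfolding fb_eq by (rule FB_simps)

lemma pts_fun: "pts (tot B) = P"
 unfolding tot_fun by (rule pts_FA)

lemma fibre_fun_iff: "e \<in> fibre B m \<longleftrightarrow>
  fst e = m \<and> m \<in> pts M \<and> snd e \<in> \<F> m \<and> (\<forall>x. x \<notin> S \<or> \<pi> x \<noteq> m \<longrightarrow> snd e x = 0)"
 unfolding fibre_def pts_fun fun_bundle_simps by (rule fibre_P)

text \<open>Evaluation is smooth in both arguments.\<close>

lemma smooth_eval:
 assumes L: "pre_manifold L" and f: "smooth_on L Z f (tot B)" and g: "smooth_on L Z g N"
  and gf: "!!z. z \<in> Z ==> g z \<in> S \<and> \<pi> (g z) = fst (f z)"
 shows "smooth_real L Z (%z. snd (f z) (g z))"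
proof (rule smooth_real_local[OF L])
 note f = f[unfolded tot_fun]
 have fP: "f z \<in> P" if "z \<in> Z" for z using smooth_on_image_pts[OF L f that] by (simp only: pts_FA)
 have b: "smooth_on L Z (%z. fst (f z)) M"
  by (rule smooth_on_compose[OF L pre_manifold_FA preM smooth_q f fP])
 fix p assume p: "p \<in> Z"
 have "fst (f p) \<in> pts M" using fP[OF p] by auto
 from systems[OF this] obtain W k \<phi> x where W: "fst (f p) \<in> W"
  and ds: "dual_system M N S \<pi> \<F> W {..<k::nat} \<phi> x" by blast
 obtain W' where W': "openin (mtop L) W'" "p \<in> W'" "(%z. fst (f z)) ` (Z \<inter> W') \<subseteq> W"
  by (rule smooth_on_preimage[OF L preM b p ds_open[OF ds] W])
 have inW: "fst (f z) \<in> W" if "z \<in> Z \<inter> W'" for z using W'(3) that by blast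
 have Zp: "Z \<inter> W' \<subseteq> pts L" using smooth_on_pts[OF L f] by blast
 have sub: "Z \<inter> W' \<subseteq> Z" by blast
 have "smooth_real L (Z \<inter> W') (%z. \<Sum>i<k. cf k (fr \<phi>) (f z) i * \<phi> i (g z))"
 proof (intro smooth_real_sum[OF L Zp] smooth_real_mult[OF L])
  fix i assume i: "i \<in> {..<k}"
  show "smooth_real L (Z \<inter> W') (%z. cf k (fr \<phi>) (f z) i)"
   by (rule smooth_real_compose[OF L pre_manifold_FA smooth_cf[OF fr_frame[OF ds]] smooth_on_subset[OF f sub]])
    (rule CollectI, rule conjI, rule fP, blast, rule inW)
  show "smooth_real L (Z \<inter> W') (%z. \<phi> i (g z))"
   by (rule smooth_real_compose[OF L N ds_smooth[OF ds] smooth_on_subset[OF g sub]])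
    (use i gf inW in auto)
 qed
 then have "smooth_real L (Z \<inter> W') (%z. snd (f z) (g z))"
 proof (rule smooth_real_cong)
  fix z assume z: "z \<in> Z \<inter> W'"
  have e: "f z \<in> {e \<in> P. fst e = fst (f z)}" using z by (intro P_fibreI fP refl) auto
  have sF: "snd (f z) \<in> \<F> (fst (f z))" using fP[of z] z by (auto simp: case_prod_beta)
  have "(\<Sum>i<k. cf k (fr \<phi>) (f z) i * \<phi> i (g z)) = (\<Sum>i<k. snd (f z) (x i (fst (f z))) * \<phi> i (g z))"
   using fr_basis(2)[OF ds inW[OF z] e] by (intro sum.cong) auto
  also have "\<dots> = snd (f z) (g z)"
   using ds_expand[OF ds inW[OF z] sF, of "g z"] gf[of z] z by simp
  finally show "(\<Sum>i<k. cf k (fr \<phi>) (f z) i * \<phi> i (g z)) = snd (f z) (g z)" .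
 qed
 then show "\<exists>W. openin (mtop L) W \<and> p \<in> W \<and> smooth_real L (Z \<inter> W) (%z. snd (f z) (g z))"
  using W'(1,2) by blast
qed

text \<open>Conversely, a map into the bundle is smooth if its evaluations along smooth local sections of
 \<open>\<pi>\<close> are.\<close>

lemma smooth_into_fun:
 assumes L: "pre_manifold L" and f: "!!z. z \<in> Z ==> f z \<in> fibre B (b z)" and b: "smooth_on L Z b M"
  and ev: "!!W x. openin (mtop M) W ==> smooth_on M W x N ==> (!!m. m \<in> W ==> x m \<in> S \<and> \<pi> (x m) = m) ==>
   smooth_real L {z \<in> Z. b z \<in> W} (%z. snd (f z) (x (b z)))"
 shows "smooth_on L Z f (tot B)"
 unfolding tot_fun
proof (rule smooth_on_local[OF L pre_manifold_FA])
 have fP: "f z \<in> P" "fst (f z) = b z" "b z \<in> pts M" if "z \<in> Z" for z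
  using f[OF that] unfolding fibre_def pts_fun fun_bundle_simps by auto
 fix p assume p: "p \<in> Z"
 from systems[OF fP(3)[OF p]] obtain W k \<phi> x where W: "b p \<in> W"
  and ds: "dual_system M N S \<pi> \<F> W {..<k::nat} \<phi> x" by blast
 obtain W' where W': "openin (mtop L) W'" "p \<in> W'" "b ` (Z \<inter> W') \<subseteq> W"
  by (rule smooth_on_preimage[OF L preM b p ds_open[OF ds] W])
 have inW: "b z \<in> W" if "z \<in> Z \<inter> W'" for z using W'(3) that by blast
 have "smooth_on L (Z \<inter> W') f FA"
 proof (rule smooth_into_FA[OF L fr_frame[OF ds]])
  show "f z \<in> P" "fst (f z) \<in> W" if "z \<in> Z \<inter> W'" for z using fP[of z] inW[OF that] that by auto
  show "smooth_on L (Z \<inter> W') (%p. fst (f p)) M"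
   by (rule smooth_on_cong_subset[OF b]) (auto simp: fP(2))
  fix i assume i: "i < k"
  have "smooth_real L {z \<in> Z. b z \<in> W} (%z. snd (f z) (x i (b z)))"
   by (rule ev[OF ds_open[OF ds] ds_points[OF ds i]]) (use ds_in[OF ds i] in blast)
  then show "smooth_real L (Z \<inter> W') (%p. cf k (fr \<phi>) (f p) i)"
  proof (rule smooth_real_cong_subset)
   show "Z \<inter> W' \<subseteq> {z \<in> Z. b z \<in> W}" using inW by blast
   fix z assume z: "z \<in> Z \<inter> W'"
   have "f z \<in> {e \<in> P. fst e = b z}" using z by (intro P_fibreI fP) auto
   from fr_basis(2)[OF ds inW[OF z] this i] show "snd (f z) (x i (b z)) = cf k (fr \<phi>) (f z) i"
    using fP(2)[of z] z by simp
  qed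
 qed
 then show "\<exists>W. openin (mtop L) W \<and> p \<in> W \<and> smooth_on L (Z \<inter> W) f FA" using W'(1,2) by blast
qed

end


section \<open>Dual bundles\<close>

text \<open>Linear forms on a fibre; their values off the fibre are not restricted.\<close>

abbreviation lin_forms :: "('e, 'm) vbundle => 'm => ('e => real) set" where
 "lin_forms E m \<equiv> {\<phi>. (\<forall>e \<in> fibre E m. \<forall>e' \<in> fibre E m. \<phi> (add E e e') = \<phi> e + \<phi> e') \<and>
       (\<forall>e \<in> fibre E m. \<forall>r. \<phi> (scl E r e) = r * \<phi> e)}"

lemma dual_simps [simp]:
 "base (dual E) = base E" "proj (dual E) = fst"
 "add (dual E) p p' = (fst p, %x. snd p x + snd p' x)"
 "scl (dual E) r p = (fst p, %x. r * snd p x)"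
 "zer (dual E) m = (m, %x. 0)"
 by (simp_all add: dual_def)

lemma form_expand:
 assumes E: "vector_bundle E" and fr: "frame_coframe E W k s t" and m: "m \<in> W"
  and f: "f \<in> lin_forms E m" and e: "e \<in> fibre E m"
 shows "f e = (\<Sum>i<k. f (s i m) * t i e)"
proof -
 have "f e = f (vlc E m k (%i. t i e) (%i. s i m))"
  by (simp only: frame_expand[OF E fr m e])
 also have "\<dots> = (\<Sum>i<k. t i e * f (s i m))"
  by (rule fibre_space.lc_real[OF vb_fibre_space[OF E frame_W[OF E fr m]]])
   (use f frame_in[OF E fr _ m] in auto)
 finally show ?thesis by (simp add: mult.commute)
qed

lemma dual_dual_system:
 assumes E: "vector_bundle E" and fr: "frame_coframe E W k s t"
 shows "dual_system (base E) (tot E) (pts (tot E)) (proj E) (lin_forms E) W {..<k} t s"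
 unfolding dual_system_def
proof (intro conjI ballI impI)
 have "{y \<in> pts (tot E). proj E y \<in> W} = over_set E W" by (auto simp: over_set_def)
 then show "smooth_real (tot E) {y \<in> pts (tot E). proj E y \<in> W} (t i)" if "i \<in> {..<k}" for i
  using coframe_smooth[OF E fr, of i] that by simp
 show "f y = (\<Sum>i<k. f (s i m) * t i y)"
  if "m \<in> W" "f \<in> lin_forms E m" "y \<in> pts (tot E)" "proj E y = m" for m f y
  using form_expand[OF E fr that(1,2) fibreI[OF that(3,4)]] .
 show "(%y. if y \<in> pts (tot E) \<and> proj E y = m then t i y else 0) \<in> lin_forms E m"
  if "i \<in> {..<k}" "m \<in> W" for i m
 proof -
  have i: "i < k" using that by simp
  have 1: "(if y \<in> pts (tot E) \<and> proj E y = m then t i y else 0) = t i y" if "y \<in> fibre E m" for y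
   using that by (simp add: fibre_def)
  show ?thesis
   using coframe_add[OF E fr i that(2)] coframe_scl[OF E fr i that(2)]
   by (simp add: 1 vb_add_in[OF E] vb_scl_in[OF E])
 qed
 show "s i m \<in> pts (tot E)" "proj E (s i m) = m" if "i \<in> {..<k}" "m \<in> W" for i m
  using fibreD[OF frame_in[OF E fr _ that(2), of i]] that(1) by auto
 show "smooth_on (base E) W (s i) (tot E)" if "i \<in> {..<k}" for i
  using frame_smooth[OF E fr, of i] that by simp
 show "t i (s j m) = (if i = j then 1 else 0)" if "i \<in> {..<k}" "j \<in> {..<k}" "m \<in> W" for i j m
  using coframe_frame[OF E fr, of i j m] that by simp
qed (simp_all add: frame_open[OF E fr])

context
 fixes E :: "('e, 'm) vbundle"
 assumes E: "vector_bundle E"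
begin

lemma dual_function_bundle:
 "function_bundle (base E) (tot E) (pts (tot E)) (proj E) (lin_forms E)"
proof
 show "smooth_manifold (base E)" by (rule vb_base_smooth[OF E])
 show "pre_manifold (tot E)" by (rule vb_tot[OF E])
 show "\<exists>W k \<phi> x. m \<in> W \<and> dual_system (base E) (tot E) (pts (tot E)) (proj E) (lin_forms E) W {..<k::nat} \<phi> x"
  if mB: "m \<in> pts (base E)" for m
 proof -
  obtain W k s t where "m \<in> W" and fr: "frame_coframe E W k s t" by (rule vb_frame[OF E mB])
  show ?thesis
   by (rule exI[of _ W], rule exI[of _ k], rule exI[of _ t], rule exI[of _ s])
    (rule conjI[OF \<open>m \<in> W\<close> dual_dual_system[OF E fr]])
 qed
qed (auto simp: algebra_simps)

interpretation D: function_bundle "base E" "tot E" "pts (tot E)" "proj E" "lin_forms E"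
 by (rule dual_function_bundle)

lemma vector_bundle_dual: "vector_bundle (dual E)"
 unfolding dual_def by (rule D.vector_bundle_fun)

lemma fibre_dual_iff: "\<omega> \<in> fibre (dual E) m \<longleftrightarrow> fst \<omega> = m \<and> m \<in> pts (base E) \<and> snd \<omega> \<in> lin_forms E m \<and>
  (\<forall>e. e \<notin> fibre E m \<longrightarrow> snd \<omega> e = 0)"
 unfolding dual_def D.fibre_fun_iff by (auto simp: fibre_def)

lemma dual_fst: "\<omega> \<in> fibre (dual E) m ==> fst \<omega> = m"
 and dual_add: "\<omega> \<in> fibre (dual E) m ==> e \<in> fibre E m ==> e' \<in> fibre E m ==>
  snd \<omega> (add E e e') = snd \<omega> e + snd \<omega> e'"
 and dual_scl: "\<omega> \<in> fibre (dual E) m ==> e \<in> fibre E m ==> snd \<omega> (scl E r e) = r * snd \<omega> e"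
 and dual_off: "\<omega> \<in> fibre (dual E) m ==> e \<notin> fibre E m ==> snd \<omega> e = 0"
 unfolding fibre_dual_iff by blast+

lemma dualI:
 assumes "m \<in> pts (base E)"
  "!!e e'. e \<in> fibre E m ==> e' \<in> fibre E m ==> \<phi> (add E e e') = \<phi> e + \<phi> e'"
  "!!e r. e \<in> fibre E m ==> \<phi> (scl E r e) = r * \<phi> e" "!!e. e \<notin> fibre E m ==> \<phi> e = 0"
 shows "(m, \<phi>) \<in> fibre (dual E) m"
 unfolding fibre_dual_iff using assms by auto

lemma dual_eqI:
 assumes "\<omega> \<in> fibre (dual E) m" "\<eta> \<in> fibre (dual E) m" "!!e. e \<in> fibre E m ==> snd \<omega> e = snd \<eta> e"
 shows "\<omega> = \<eta>"
proof -
 have "snd \<omega> e = snd \<eta> e" for e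
  using assms(3)[of e] dual_off[OF assms(1), of e] dual_off[OF assms(2), of e] by (cases "e \<in> fibre E m") auto
 then show ?thesis using dual_fst[OF assms(1)] dual_fst[OF assms(2)] by (simp add: prod_eq_iff ext)
qed

lemma dual_eval_smooth:
 assumes "pre_manifold L" "smooth_on L Z f (tot (dual E))" "smooth_on L Z g (tot E)"
  "!!z. z \<in> Z ==> proj E (g z) = fst (f z)"
 shows "smooth_real L Z (%z. snd (f z) (g z))"
 by (rule D.smooth_eval[OF assms(1) assms(2)[unfolded dual_def] assms(3)])
  (use assms(4) smooth_on_image_pts[OF assms(1,3)] in auto)

lemma dual_smooth_into:
 assumes "pre_manifold L" "!!z. z \<in> Z ==> f z \<in> fibre (dual E) (b z)" "smooth_on L Z b (base E)"
  "!!W x. openin (mtop (base E)) W ==> smooth_on (base E) W x (tot E) ==>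
   (!!m. m \<in> W ==> x m \<in> fibre E m) ==> smooth_real L {z \<in> Z. b z \<in> W} (%z. snd (f z) (x (b z)))"
 shows "smooth_on L Z f (tot (dual E))"
 unfolding dual_def
 by (rule D.smooth_into_fun[OF assms(1) assms(2)[unfolded dual_def] assms(3)])
  (assumption, rule assms(4), auto simp: fibre_def)

text \<open>The forms of the coframe separate the points of the fibre.\<close>

lemma dual_separates:
 assumes "e \<in> fibre E m" "e' \<in> fibre E m" "!!\<omega>. \<omega> \<in> fibre (dual E) m ==> snd \<omega> e = snd \<omega> e'"
 shows "e = e'"
proof -
 have mB: "m \<in> pts (base E)" by (rule vb_fibre_base[OF E assms(1)])
 obtain W k s t where W: "m \<in> W" and fr: "frame_coframe E W k s t" by (rule vb_frame[OF E mB])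
 have "t i e = t i e'" if i: "i < k" for i
 proof -
  have "(m, %y. if y \<in> fibre E m then t i y else 0) \<in> fibre (dual E) m"
   by (rule dualI[OF mB]) (simp_all add: vb_add_in[OF E] vb_scl_in[OF E] coframe_add[OF E fr i W] coframe_scl[OF E fr i W])
  from assms(3)[OF this] show ?thesis using assms(1,2) by simp
 qed
 then have "vlc E m k (%i. t i e) (%i. s i m) =
   vlc E m k (%i. t i e') (%i. s i m)"
  by (intro lin_comb_cong) auto
 then show ?thesis by (simp only: frame_expand[OF E fr W] assms(1,2))
qed

end

context
 fixes E :: "('e, 'm) vbundle"
 assumes E: "vector_bundle E"
begin

lemma bidual_apply: "\<omega> \<in> fibre (dual E) (proj E e) ==> snd (bidual_map E e) \<omega> = snd \<omega> e"
 by (simp add: bidual_map_def)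

lemma bidual_fst [simp]: "fst (bidual_map E e) = proj E e"
 by (simp add: bidual_map_def)

lemma bidual_in:
 assumes e: "e \<in> fibre E m"
 shows "bidual_map E e \<in> fibre (dual (dual E)) m"
proof -
 note D = vector_bundle_dual[OF E]
 have p: "proj E e = m" using e by (rule fibreD)
 show ?thesis
  unfolding bidual_map_def p
  by (rule dualI[OF D]) (use vb_add_in[OF D, of _ m] vb_scl_in[OF D, of _ m] vb_fibre_base[OF E e] in auto)
qed

lemma bidual_add:
 assumes "e \<in> fibre E m" "e' \<in> fibre E m"
 shows "bidual_map E (add E e e') = add (dual (dual E)) (bidual_map E e) (bidual_map E e')"
 by (simp add: bidual_map_def fibreD(2)[OF vb_add_in[OF E assms]] fibreD(2)[OF assms(1)] fibreD(2)[OF assms(2)]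
   dual_add[OF E _ assms] fun_eq_iff del: split_paired_All)

lemma bidual_scl:
 assumes "e \<in> fibre E m"
 shows "bidual_map E (scl E r e) = scl (dual (dual E)) r (bidual_map E e)"
 by (simp add: bidual_map_def fibreD(2)[OF vb_scl_in[OF E assms]] fibreD(2)[OF assms]
   dual_scl[OF E _ assms] fun_eq_iff del: split_paired_All)

lemma bidual_inj:
 assumes "e \<in> fibre E m" "e' \<in> fibre E m" "bidual_map E e = bidual_map E e'"
 shows "e = e'"
proof (rule dual_separates[OF E assms(1,2)])
 fix \<omega> assume "\<omega> \<in> fibre (dual E) m"
 then show "snd \<omega> e = snd \<omega> e'"
  using bidual_apply[of \<omega> e] bidual_apply[of \<omega> e'] fibreD(2)[OF assms(1)] fibreD(2)[OF assms(2)] assms(3) by simp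
qed

lemma bidual_surj:
 assumes x: "\<xi> \<in> fibre (dual (dual E)) m"
 obtains e where "e \<in> fibre E m" "bidual_map E e = \<xi>"
proof -
 note D = vector_bundle_dual[OF E]
 have mB: "m \<in> pts (base E)" using vb_fibre_base[OF vector_bundle_dual[OF D] x] by simp
 obtain W k s t where W: "m \<in> W" and fr: "frame_coframe E W k s t" by (rule vb_frame[OF E mB])
 interpret fibre_space "fibre E m" "add E" "scl E" "zer E m" by (rule vb_fibre_space[OF E mB])
 interpret d: fibre_space "fibre (dual E) m" "add (dual E)" "scl (dual E)" "zer (dual E) m"
  by (rule vb_fibre_space[OF D]) (simp add: mB)
 define \<tau> where "\<tau> i = (m, %y. if y \<in> fibre E m then t i y else 0)" for i
 have \<tau>: "\<tau> i \<in> fibre (dual E) m" if i: "i < k" for i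
  unfolding \<tau>_def by (rule dualI[OF E mB])
   (simp_all add: vb_add_in[OF E] vb_scl_in[OF E] coframe_add[OF E fr i W] coframe_scl[OF E fr i W])
 define e where "e = lc k (%i. snd \<xi> (\<tau> i)) (%i. s i m)"
 have e: "e \<in> fibre E m" unfolding e_def by (rule lc_in) (rule frame_in[OF E fr _ W])
 have pe: "proj E e = m" by (rule fibreD(2)[OF e])
 have "bidual_map E e = \<xi>"
 proof (rule dual_eqI[OF D bidual_in[OF e] x])
  fix \<omega> assume w: "\<omega> \<in> fibre (dual E) m"
  have "snd (bidual_map E e) \<omega> = snd \<omega> e" by (rule bidual_apply) (simp add: pe w)
  also have "\<dots> = (\<Sum>i<k. snd \<xi> (\<tau> i) * snd \<omega> (s i m))"
   unfolding e_def by (rule lc_real) (use dual_add[OF E w] dual_scl[OF E w] frame_in[OF E fr _ W] in auto)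
  also have "\<dots> = snd \<xi> (d.lc k (%i. snd \<omega> (s i m)) \<tau>)"
  proof -
   have "snd \<xi> (d.lc k (%i. snd \<omega> (s i m)) \<tau>) = (\<Sum>i<k. snd \<omega> (s i m) * snd \<xi> (\<tau> i))"
    by (rule d.lc_real) (rule dual_add[OF D x] dual_scl[OF D x] \<tau>; assumption)+
   then show ?thesis by (simp add: mult.commute)
  qed
  also have "d.lc k (%i. snd \<omega> (s i m)) \<tau> = \<omega>"
  proof (rule dual_eqI[OF E _ w])
   show "d.lc k (%i. snd \<omega> (s i m)) \<tau> \<in> fibre (dual E) m" by (rule d.lc_in) (rule \<tau>)
   fix e' assume e': "e' \<in> fibre E m"
   have "snd (d.lc k (%i. snd \<omega> (s i m)) \<tau>) e' = (\<Sum>i<k. snd \<omega> (s i m) * snd (\<tau> i) e')"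
    by (rule d.lc_real[of "%\<eta>. snd \<eta> e'"]) (auto simp: \<tau>)
   also have "\<dots> = snd \<omega> e'"
    using form_expand[OF E fr W, of "snd \<omega>" e'] w e' by (simp add: \<tau>_def fibre_dual_iff[OF E])
   finally show "snd (d.lc k (%i. snd \<omega> (s i m)) \<tau>) e' = snd \<omega> e'" .
  qed
  finally show "snd (bidual_map E e) \<omega> = snd \<xi> \<omega>" .
 qed
 then show ?thesis using that e by blast
qed

lemma bidual_inv:
 shows "e \<in> fibre E m ==> inv_into (fibre E m) (bidual_map E) (bidual_map E e) = e"
  and "\<omega> \<in> fibre (dual (dual E)) m ==> inv_into (fibre E m) (bidual_map E) \<omega> \<in> fibre E m"
  and "\<omega> \<in> fibre (dual (dual E)) m ==> \<omega>' \<in> fibre (dual (dual E)) m ==>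
   inv_into (fibre E m) (bidual_map E) (add (dual (dual E)) \<omega> \<omega>') =
   add E (inv_into (fibre E m) (bidual_map E) \<omega>) (inv_into (fibre E m) (bidual_map E) \<omega>')"
  and "\<omega> \<in> fibre (dual (dual E)) m ==> inv_into (fibre E m) (bidual_map E) (scl (dual (dual E)) r \<omega>) =
   scl E r (inv_into (fibre E m) (bidual_map E) \<omega>)"
proof -
 let ?i = "inv_into (fibre E m) (bidual_map E)"
 have "inj_on (bidual_map E) (fibre E m)" using bidual_inj by (auto simp: inj_on_def)
 then show i: "?i (bidual_map E e) = e" if "e \<in> fibre E m" for e using that by (rule inv_into_f_f)
 assume w: "\<omega> \<in> fibre (dual (dual E)) m"
 obtain e where e: "e \<in> fibre E m" "bidual_map E e = \<omega>" by (rule bidual_surj[OF w])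
 show "?i \<omega> \<in> fibre E m" "?i (scl (dual (dual E)) r \<omega>) = scl E r (?i \<omega>)"
  unfolding e(2)[symmetric] bidual_scl[OF e(1), symmetric] i[OF e(1)] i[OF vb_scl_in[OF E e(1)]] by (simp_all add: e)
 assume "\<omega>' \<in> fibre (dual (dual E)) m"
 then obtain e' where e': "e' \<in> fibre E m" "bidual_map E e' = \<omega>'" by (rule bidual_surj)
 show "?i (add (dual (dual E)) \<omega> \<omega>') = add E (?i \<omega>) (?i \<omega>')"
  unfolding e(2)[symmetric] e'(2)[symmetric] bidual_add[OF e(1) e'(1), symmetric] i[OF e(1)] i[OF e'(1)]
  by (rule i[OF vb_add_in[OF E e(1) e'(1)]])
qed

lemma bidual_smooth:
 assumes L: "pre_manifold L" and f: "smooth_on L Z f (tot E)"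
 shows "smooth_on L Z (%z. bidual_map E (f z)) (tot (dual (dual E)))"
proof (rule dual_smooth_into[OF vector_bundle_dual[OF E] L])
 have fE: "f z \<in> fibre E (proj E (f z))" if "z \<in> Z" for z
  using smooth_on_image_pts[OF L f that] by (simp add: fibre_def)
 show "bidual_map E (f z) \<in> fibre (dual (dual E)) (proj E (f z))" if "z \<in> Z" for z
  by (rule bidual_in[OF fE[OF that]])
 show pf: "smooth_on L Z (%z. proj E (f z)) (base (dual E))"
  using vb_proj_smooth_compose[OF E L f] by simp
 fix W x assume W: "openin (mtop (base (dual E))) W" and x: "smooth_on (base (dual E)) W x (tot (dual E))"
  "!!m. m \<in> W ==> x m \<in> fibre (dual E) m"
 let ?Z = "{z \<in> Z. proj E (f z) \<in> W}"
 have sub: "?Z \<subseteq> Z" by blast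
 have "smooth_real L ?Z (%z. snd (x (proj E (f z))) (f z))"
 proof (rule dual_eval_smooth[OF E L _ smooth_on_subset[OF f sub]])
  show "smooth_on L ?Z (%z. x (proj E (f z))) (tot (dual E))"
   by (rule smooth_on_compose[OF L vb_base[OF vector_bundle_dual[OF E]] vb_tot[OF vector_bundle_dual[OF E]]
      x(1) smooth_on_subset[OF pf sub]]) blast
  show "proj E (f z) = fst (x (proj E (f z)))" if "z \<in> ?Z" for z
   using dual_fst[OF E x(2)] that by simp
 qed
 then show "smooth_real L ?Z (%z. snd (bidual_map E (f z)) (x (proj E (f z))))"
  by (rule smooth_real_cong) (rule bidual_apply[symmetric], use x(2) in blast)
qed

end


section \<open>Tensor products\<close>

text \<open>Bilinear forms on a pair of fibres, again without a condition off the fibres.\<close>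

definition bilinear_form :: "('e, 'm) vbundle => ('f, 'm) vbundle => 'm => ('e \<times> 'f => real) => bool" where
 "bilinear_form E F m \<theta> \<longleftrightarrow>
   (\<forall>e \<in> fibre E m. \<forall>e' \<in> fibre E m. \<forall>f \<in> fibre F m. \<theta> (add E e e', f) = \<theta> (e, f) + \<theta> (e', f)) \<and>
   (\<forall>e \<in> fibre E m. \<forall>f \<in> fibre F m. \<forall>f' \<in> fibre F m. \<theta> (e, add F f f') = \<theta> (e, f) + \<theta> (e, f')) \<and>
   (\<forall>e \<in> fibre E m. \<forall>f \<in> fibre F m. \<forall>r. \<theta> (scl E r e, f) = r * \<theta> (e, f) \<and> \<theta> (e, scl F r f) = r * \<theta> (e, f))"

lemma bilinear_form_cong:
 assumes E: "vector_bundle E" and F: "vector_bundle F" and \<theta>: "bilinear_form E F m \<theta>"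
  and eq: "!!e f. e \<in> fibre E m ==> f \<in> fibre F m ==> \<theta> (e, f) = \<theta>' (e, f)"
 shows "bilinear_form E F m \<theta>'"
 using \<theta> unfolding bilinear_form_def
 by (simp add: eq vb_add_in[OF E] vb_scl_in[OF E] vb_add_in[OF F] vb_scl_in[OF F])

lemma bilinear_form_expand:
 assumes E: "vector_bundle E" and F: "vector_bundle F"
  and fr: "frame_coframe E W k s t" "frame_coframe F W l s' t'" and m: "m \<in> W"
  and \<theta>: "bilinear_form E F m \<theta>" and e: "e \<in> fibre E m" and f: "f \<in> fibre F m"
 shows "\<theta> (e, f) = (\<Sum>(i, j) \<in> {..<k} \<times> {..<l}. \<theta> (s i m, s' j m) * (t i e * t' j f))"
proof -
 have 1: "\<theta> (e, f) = (\<Sum>i<k. \<theta> (s i m, f) * t i e)"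
  by (rule form_expand[OF E fr(1) m _ e, of "%e. \<theta> (e, f)"]) (use \<theta> f in \<open>auto simp: bilinear_form_def\<close>)
 have 2: "\<theta> (s i m, f) = (\<Sum>j<l. \<theta> (s i m, s' j m) * t' j f)" if i: "i < k" for i
  by (rule form_expand[OF F fr(2) m _ f, of "%f. \<theta> (s i m, f)"])
   (use \<theta> frame_in[OF E fr(1) i m] in \<open>auto simp: bilinear_form_def\<close>)
 have "\<theta> (e, f) = (\<Sum>i<k. \<Sum>j<l. \<theta> (s i m, s' j m) * (t i e * t' j f))"
  unfolding 1 by (intro sum.cong) (auto simp: 2 sum_distrib_right sum_distrib_left mult_ac)
 then show ?thesis by (simp add: sum.cartesian_product)
qed

lemma tensor_simps [simp]:
 "base (tensor U V) = base U" "proj (tensor U V) = fst"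
 "add (tensor U V) p p' = (fst p, %x. snd p x + snd p' x)"
 "scl (tensor U V) r p = (fst p, %x. r * snd p x)"
 "zer (tensor U V) m = (m, %x. 0)"
 by (simp_all add: tensor_def)

context
 fixes U :: "('u, 'm) vbundle" and V :: "('v, 'm) vbundle"
 assumes U: "vector_bundle U" and V: "vector_bundle V" and UV: "base V = base U"
begin

lemma tensor_function_bundle:
 "function_bundle (base U) (prod_manifold (tot (dual U)) (tot (dual V)))
  (fibre_product (dual U) (dual V)) (%p. fst (fst p)) (%m. {\<theta>. bilinear_form (dual U) (dual V) m \<theta>})"
proof
 note DU = vector_bundle_dual[OF U] and DV = vector_bundle_dual[OF V]
 note N = pre_manifold_prod[OF vb_tot[OF DU] vb_tot[OF DV]]
 let ?S = "fibre_product (dual U) (dual V)" and ?N = "prod_manifold (tot (dual U)) (tot (dual V))"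
 show "smooth_manifold (base U)" by (rule vb_base_smooth[OF U])
 show "pre_manifold ?N" by (rule N)
 fix m assume m: "m \<in> pts (base U)"
 obtain W1 k s t where W1: "m \<in> W1" and fr1: "frame_coframe (dual U) W1 k s t"
  by (rule vb_frame[OF DU, of m]) (use m in auto)
 obtain W2 l s' t' where W2: "m \<in> W2" and fr2: "frame_coframe (dual V) W2 l s' t'"
  by (rule vb_frame[OF DV, of m]) (use m UV in auto)
 define W where "W = W1 \<inter> W2"
 have oW: "openin (mtop (base U)) W"
  unfolding W_def using frame_open[OF DU fr1] frame_open[OF DV fr2] UV by (simp add: openin_Int)
 have fr: "frame_coframe (dual U) W k s t" "frame_coframe (dual V) W l s' t'"
  using frame_restrict[OF DU fr1, of W] frame_restrict[OF DV fr2, of W] oW UV by (auto simp: W_def)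
 define \<phi> where "\<phi> = (%(i, j) (\<omega>, \<eta>). t i \<omega> * t' j \<eta>)"
 define x where "x = (%(i, j) m. (s i m, s' j m))"
 have S_sub: "{y \<in> ?S. fst (fst y) \<in> W} \<subseteq> pts (tot (dual U)) \<times> pts (tot (dual V))"
  by (auto simp: fibre_product_def)
 have S_iff: "y \<in> ?S \<and> fst (fst y) = m \<longleftrightarrow> fst y \<in> fibre (dual U) m \<and> snd y \<in> fibre (dual V) m" for y m
  by (auto simp: fibre_product_def fibre_def)
 have "dual_system (base U) ?N ?S (%p. fst (fst p)) (%m. {\<theta>. bilinear_form (dual U) (dual V) m \<theta>})
   W ({..<k} \<times> {..<l}) \<phi> x"
  unfolding dual_system_def
 proof (intro conjI ballI impI)
  fix c assume "c \<in> {..<k} \<times> {..<l}"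
  then obtain i j where c: "c = (i, j)" "i < k" "j < l" by auto
  have "smooth_real ?N {y \<in> ?S. fst (fst y) \<in> W} (%y. t i (fst y) * t' j (snd y))"
   by (intro smooth_real_mult[OF N] coframe_compose[OF DU fr(1) N smooth_on_fst[OF vb_tot[OF DU] vb_tot[OF DV] S_sub] _ c(2)]
     coframe_compose[OF DV fr(2) N smooth_on_snd[OF vb_tot[OF DU] vb_tot[OF DV] S_sub] _ c(3)])
    (auto simp: fibre_product_def)
  then show "smooth_real ?N {y \<in> ?S. fst (fst y) \<in> W} (\<phi> c)"
   by (rule smooth_real_cong) (simp add: \<phi>_def c(1) case_prod_beta)
  show "smooth_on (base U) W (x c) ?N"
   using smooth_on_Pair[OF vb_base[OF U] vb_tot[OF DU] vb_tot[OF DV], of W "s i" "s' j"]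
    frame_smooth[OF DU fr(1) c(2)] frame_smooth[OF DV fr(2) c(3)] UV by (simp add: x_def c(1))
  fix m assume mW: "m \<in> W"
  have "x c m \<in> ?S \<and> fst (fst (x c m)) = m"
   unfolding S_iff using frame_in[OF DU fr(1) c(2) mW] frame_in[OF DV fr(2) c(3) mW] by (simp add: x_def c(1))
  then show "x c m \<in> ?S" "fst (fst (x c m)) = m" by auto
  show "\<phi> c (x d m) = (if c = d then 1 else 0)" if "d \<in> {..<k} \<times> {..<l}" for d
   using that c coframe_frame[OF DU fr(1) c(2) _ mW] coframe_frame[OF DV fr(2) c(3) _ mW]
   by (auto simp: \<phi>_def x_def split: if_splits)
  have 1: "(if y \<in> ?S \<and> fst (fst y) = m then \<phi> c y else 0) = t i (fst y) * t' j (snd y)"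
   if "fst y \<in> fibre (dual U) m" "snd y \<in> fibre (dual V) m" for y
   using that unfolding S_iff by (simp add: \<phi>_def c(1) case_prod_beta)
  have "bilinear_form (dual U) (dual V) m (%y. t i (fst y) * t' j (snd y))"
   unfolding bilinear_form_def
   using coframe_add[OF DU fr(1) c(2) mW] coframe_scl[OF DU fr(1) c(2) mW]
    coframe_add[OF DV fr(2) c(3) mW] coframe_scl[OF DV fr(2) c(3) mW]
   by (simp add: algebra_simps del: dual_simps)
  then have "bilinear_form (dual U) (dual V) m (%y. if y \<in> ?S \<and> fst (fst y) = m then \<phi> c y else 0)"
   by (rule bilinear_form_cong[OF DU DV]) (rule 1[symmetric], simp_all)
  then show "(%y. if y \<in> ?S \<and> fst (fst y) = m then \<phi> c y else 0) \<in> {\<theta>. bilinear_form (dual U) (dual V) m \<theta>}"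
   by simp
 next
  fix m \<theta> y assume mW: "m \<in> W" and \<theta>: "\<theta> \<in> {\<theta>. bilinear_form (dual U) (dual V) m \<theta>}" and
   y: "y \<in> ?S" "fst (fst y) = m"
  have y': "fst y \<in> fibre (dual U) m" "snd y \<in> fibre (dual V) m" using y S_iff by blast+
  have "\<theta> (fst y, snd y) = (\<Sum>(i, j) \<in> {..<k} \<times> {..<l}. \<theta> (s i m, s' j m) * (t i (fst y) * t' j (snd y)))"
   by (rule bilinear_form_expand[OF DU DV fr mW _ y']) (use \<theta> in simp)
  then show "\<theta> y = (\<Sum>c \<in> {..<k} \<times> {..<l}. \<theta> (x c m) * \<phi> c y)"
   by (simp add: \<phi>_def x_def case_prod_beta)
 qed (simp_all add: oW)
 then show "\<exists>W k \<phi> x. m \<in> W \<and> dual_system (base U) ?N ?S (%p. fst (fst p))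
   (%m. {\<theta>. bilinear_form (dual U) (dual V) m \<theta>}) W {..<k::nat} \<phi> x"
  by (rule dual_system_nat[rotated]) (use W1 W2 in \<open>simp add: W_def\<close>)
qed (auto simp: bilinear_form_def algebra_simps)

interpretation T: function_bundle "base U" "prod_manifold (tot (dual U)) (tot (dual V))"
  "fibre_product (dual U) (dual V)" "%p. fst (fst p)" "%m. {\<theta>. bilinear_form (dual U) (dual V) m \<theta>}"
 by (rule tensor_function_bundle)

lemma tensor_eq: "tensor U V = T.B"
 unfolding tensor_def bilinear_form_def ..

lemma vector_bundle_tensor: "vector_bundle (tensor U V)"
 unfolding tensor_eq by (rule T.vector_bundle_fun)

lemma fibre_tensor_iff: "\<theta> \<in> fibre (tensor U V) m \<longleftrightarrow> fst \<theta> = m \<and> m \<in> pts (base U) \<and>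
  bilinear_form (dual U) (dual V) m (snd \<theta>) \<and>
  (\<forall>y. fst y \<notin> fibre (dual U) m \<or> snd y \<notin> fibre (dual V) m \<longrightarrow> snd \<theta> y = 0)"
proof -
 have "y \<notin> fibre_product (dual U) (dual V) \<or> fst (fst y) \<noteq> m \<longleftrightarrow>
   fst y \<notin> fibre (dual U) m \<or> snd y \<notin> fibre (dual V) m" for y
  by (auto simp: fibre_product_def fibre_def)
 then show ?thesis unfolding tensor_eq T.fibre_fun_iff by simp
qed

lemma tensor_eval_smooth:
 assumes L: "pre_manifold L" and f: "smooth_on L Z f (tot (tensor U V))"
  and g: "smooth_on L Z g (tot (dual U))" "smooth_on L Z h (tot (dual V))"
  and gh: "!!z. z \<in> Z ==> fst (g z) = fst (f z)" "!!z. z \<in> Z ==> fst (h z) = fst (f z)"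
 shows "smooth_real L Z (%z. snd (f z) (g z, h z))"
 by (rule T.smooth_eval[OF L f[unfolded tensor_eq]
    smooth_on_Pair[OF L vb_tot[OF vector_bundle_dual[OF U]] vb_tot[OF vector_bundle_dual[OF V]] g]])
  (use gh smooth_on_image_pts[OF L g(1)] smooth_on_image_pts[OF L g(2)] in \<open>auto simp: fibre_product_def\<close>)

end

section \<open>Decomposed double vector bundles and their associated sequence\<close>

text \<open>A decomposition over \<open>W\<close>: mutually inverse smooth maps \<open>d \<mapsto> (q_A d, q_B d, ga d)\<close> and
 \<open>(a, b, c) \<mapsto> mk a b c\<close> between the part of \<open>D\<close> over \<open>W\<close> and the fibre product of \<open>A\<close>, \<open>B\<close> and
 \<open>C\<close>, compatible with both linear structures and with the inclusion \<open>bar\<close> of the core.\<close>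

definition decomposition :: "('d, 'a, 'b, 'm) dvb => ('c, 'm) vbundle => ('c => 'd) => 'm set =>
  ('a => 'b => 'c => 'd) => ('d => 'c) => bool" where
 "decomposition D C bar W mk ga \<longleftrightarrow> openin (mtop (dvb_base D)) W \<and>
  (\<forall>m\<in>W. \<forall>a\<in>fibre (side_A D) m. \<forall>b\<in>fibre (side_B D) m. \<forall>c\<in>fibre C m.
   mk a b c \<in> total D \<and> proj (over_A D) (mk a b c) = a \<and> proj (over_B D) (mk a b c) = b \<and> ga (mk a b c) = c) \<and>
  (\<forall>d\<in>total D. dvb_proj D d \<in> W \<longrightarrow>
   ga d \<in> fibre C (dvb_proj D d) \<and> mk (proj (over_A D) d) (proj (over_B D) d) (ga d) = d) \<and>
  (\<forall>m\<in>W. \<forall>a\<in>fibre (side_A D) m. \<forall>b\<in>fibre (side_B D) m. \<forall>b'\<in>fibre (side_B D) m. \<forall>c\<in>fibre C m. \<forall>c'\<in>fibre C m.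
   add (over_A D) (mk a b c) (mk a b' c') = mk a (add (side_B D) b b') (add C c c')) \<and>
  (\<forall>m\<in>W. \<forall>a\<in>fibre (side_A D) m. \<forall>a'\<in>fibre (side_A D) m. \<forall>b\<in>fibre (side_B D) m. \<forall>c\<in>fibre C m. \<forall>c'\<in>fibre C m.
   add (over_B D) (mk a b c) (mk a' b c') = mk (add (side_A D) a a') b (add C c c')) \<and>
  (\<forall>m\<in>W. \<forall>a\<in>fibre (side_A D) m. \<forall>b\<in>fibre (side_B D) m. \<forall>c\<in>fibre C m. \<forall>r.
   scl (over_A D) r (mk a b c) = mk a (scl (side_B D) r b) (scl C r c) \<and>
   scl (over_B D) r (mk a b c) = mk (scl (side_A D) r a) b (scl C r c)) \<and>
  (\<forall>m\<in>W. \<forall>c\<in>fibre C m. bar c = mk (zer (side_A D) m) (zer (side_B D) m) c) \<and>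
  smooth_on (tot (over_A D)) {d \<in> total D. dvb_proj D d \<in> W} ga (tot C) \<and>
  smooth_on (prod_manifold (tot (side_A D)) (prod_manifold (tot (side_B D)) (tot C)))
   {p. \<exists>m\<in>W. fst p \<in> fibre (side_A D) m \<and> fst (snd p) \<in> fibre (side_B D) m \<and> snd (snd p) \<in> fibre C m}
   (%p. mk (fst p) (fst (snd p)) (snd (snd p))) (tot (over_A D))"

text \<open>Local decompositions are all that the associated sequence needs.  The locale will be applied to a
 double vector bundle with its core, and to its dual over \<open>A\<close> with the dual of \<open>B\<close> in place of the core.\<close>

locale decomposed_dvb =
 fixes D :: "('d, 'a, 'b, 'm) dvb" and C :: "('c, 'm) vbundle" and bar :: "'c => 'd"
 assumes preD: "pre_manifold (tot (over_A D))"
  and A: "vector_bundle (side_A D)" and B: "vector_bundle (side_B D)" and C: "vector_bundle C"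
  and base_B: "base (side_B D) = base (side_A D)" and base_C: "base C = base (side_A D)"
  and projA_smooth: "smooth_on (tot (over_A D)) (total D) (proj (over_A D)) (tot (side_A D))"
  and projB_smooth: "smooth_on (tot (over_A D)) (total D) (proj (over_B D)) (tot (side_B D))"
  and proj_eq: "!!d. d \<in> total D ==> proj (side_B D) (proj (over_B D) d) = proj (side_A D) (proj (over_A D) d)"
  and decomp: "!!m. m \<in> pts (dvb_base D) ==> \<exists>W mk ga. m \<in> W \<and> decomposition D C bar W mk ga"
begin

abbreviation "DA \<equiv> over_A D"
abbreviation "DB \<equiv> over_B D"
abbreviation "XX \<equiv> double_linear_bundle D"
abbreviation "SA \<equiv> side_A D"
abbreviation "SB \<equiv> side_B D"
abbreviation "qA \<equiv> proj DA"
abbreviation "qB \<equiv> proj DB"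
abbreviation "MM \<equiv> base (side_A D)"

lemma preM: "pre_manifold MM" by (rule vb_base[OF A])

lemma slice_A: "d \<in> slice D m ==> qA d \<in> fibre SA m"
 using smooth_on_image_pts[OF preD projA_smooth] by (auto simp: slice_def dvb_proj_def fibre_def)

lemma slice_B: "d \<in> slice D m ==> qB d \<in> fibre SB m"
 using smooth_on_image_pts[OF preD projB_smooth] proj_eq by (auto simp: slice_def dvb_proj_def fibre_def)

lemma slice_total: "d \<in> slice D m ==> d \<in> total D"
 and slice_proj: "d \<in> slice D m ==> dvb_proj D d = m"
 and sliceI: "d \<in> total D ==> dvb_proj D d = m ==> d \<in> slice D m"
 by (auto simp: slice_def)

lemma dvb_proj_smooth: "smooth_on (tot DA) (total D) (dvb_proj D) MM"
 unfolding dvb_proj_def[abs_def] by (rule vb_proj_smooth_compose[OF A preD projA_smooth])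

lemma smooth_zerA: "pre_manifold L ==> smooth_on L Z b MM ==> smooth_on L Z (%z. zer SA (b z)) (tot SA)"
 by (rule vb_smooth_zer[OF A])

lemma smooth_zerB: "pre_manifold L ==> smooth_on L Z b MM ==> smooth_on L Z (%z. zer SB (b z)) (tot SB)"
 by (rule vb_smooth_zer[OF B, unfolded base_B])

lemma smooth_zerC: "pre_manifold L ==> smooth_on L Z b MM ==> smooth_on L Z (%z. zer C (b z)) (tot C)"
 by (rule vb_smooth_zer[OF C, unfolded base_C])

lemma zA: "m \<in> pts MM ==> zer SA m \<in> fibre SA m"
 and zB: "m \<in> pts MM ==> zer SB m \<in> fibre SB m"
 and zC: "m \<in> pts MM ==> zer C m \<in> fibre C m"
 using vb_zer_in[OF A] vb_zer_in[OF B] vb_zer_in[OF C] base_B base_C by auto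

lemma scl_zA: "m \<in> pts MM ==> scl SA r (zer SA m) = zer SA m"
 and scl_zB: "m \<in> pts MM ==> scl SB r (zer SB m) = zer SB m"
 and scl_zC: "m \<in> pts MM ==> scl C r (zer C m) = zer C m"
 using fibre_space.sc_z[OF vb_fibre_space[OF A]] fibre_space.sc_z[OF vb_fibre_space[OF B]]
  fibre_space.sc_z[OF vb_fibre_space[OF C]] base_B base_C by auto

lemma scl0_A: "a \<in> fibre SA m ==> scl SA 0 a = zer SA m"
 by (rule fibre_space.sc_zero[OF vb_fibre_space[OF A vb_fibre_base[OF A]]])

lemma add_zB: "b \<in> fibre SB m ==> add SB b (zer SB m) = b"
 and add_zC: "c \<in> fibre C m ==> add C c (zer C m) = c"
 and zC_add: "c \<in> fibre C m ==> add C (zer C m) c = c"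
 and add_zA: "a \<in> fibre SA m ==> add SA a (zer SA m) = a"
 by (rule fibre_space.pl_z[OF vb_fibre_space[OF B vb_fibre_base[OF B]]]
   fibre_space.pl_z[OF vb_fibre_space[OF C vb_fibre_base[OF C]]]
   fibre_space.z_pl[OF vb_fibre_space[OF C vb_fibre_base[OF C]]]
   fibre_space.pl_z[OF vb_fibre_space[OF A vb_fibre_base[OF A]]]; assumption)+

context
 fixes W mk ga
 assumes dc: "decomposition D C bar W mk ga"
begin

lemma dc_open: "openin (mtop MM) W"
 using dc unfolding decomposition_def by (elim conjE)

lemma dc_W: "m \<in> W ==> m \<in> pts MM"
 using openin_mtop_subset[OF preM dc_open] by blast

lemma
 assumes "m \<in> W" "a \<in> fibre SA m" "b \<in> fibre SB m" "c \<in> fibre C m"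
 shows mk_total: "mk a b c \<in> total D" and mk_A: "qA (mk a b c) = a" and mk_B: "qB (mk a b c) = b"
  and mk_ga: "ga (mk a b c) = c"
  and mk_sclA: "scl DA r (mk a b c) = mk a (scl SB r b) (scl C r c)"
  and mk_sclB: "scl DB r (mk a b c) = mk (scl SA r a) b (scl C r c)"
 using dc assms unfolding decomposition_def by simp_all

lemma
 assumes "m \<in> W" "a \<in> fibre SA m" "a' \<in> fibre SA m" "b \<in> fibre SB m" "b' \<in> fibre SB m"
  "c \<in> fibre C m" "c' \<in> fibre C m"
 shows mk_addA: "add DA (mk a b c) (mk a b' c') = mk a (add SB b b') (add C c c')"
  and mk_addB: "add DB (mk a b c) (mk a' b c') = mk (add SA a a') b (add C c c')"
 using dc assms unfolding decomposition_def by simp_all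

lemma mk_slice:
 assumes "m \<in> W" "a \<in> fibre SA m" "b \<in> fibre SB m" "c \<in> fibre C m"
 shows "mk a b c \<in> slice D m"
 using mk_total[OF assms] mk_A[OF assms] fibreD(2)[OF assms(2)] by (intro sliceI) (simp_all add: dvb_proj_def)

lemma
 assumes "d \<in> slice D m" "m \<in> W"
 shows ga_in: "ga d \<in> fibre C m" and mk_ga_eq: "mk (qA d) (qB d) (ga d) = d"
proof -
 have "\<forall>d\<in>total D. dvb_proj D d \<in> W \<longrightarrow> ga d \<in> fibre C (dvb_proj D d) \<and> mk (qA d) (qB d) (ga d) = d"
  using dc unfolding decomposition_def by (elim conjE)
 then show "ga d \<in> fibre C m" "mk (qA d) (qB d) (ga d) = d"
  using slice_total[OF assms(1)] slice_proj[OF assms(1)] assms(2) by auto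
qed

lemma bar_mk: "m \<in> W ==> c \<in> fibre C m ==> bar c = mk (zer SA m) (zer SB m) c"
 using dc unfolding decomposition_def by simp

lemma ga_smooth: "smooth_on (tot DA) {d \<in> total D. dvb_proj D d \<in> W} ga (tot C)"
 using dc unfolding decomposition_def by (elim conjE)

lemma mk_smooth:
 assumes L: "pre_manifold L" and f: "smooth_on L Z f (tot SA)" "smooth_on L Z g (tot SB)" "smooth_on L Z h (tot C)"
  and W: "!!z. z \<in> Z ==> b z \<in> W" and b: "!!z. z \<in> Z ==> f z \<in> fibre SA (b z)"
  "!!z. z \<in> Z ==> g z \<in> fibre SB (b z)" "!!z. z \<in> Z ==> h z \<in> fibre C (b z)"
 shows "smooth_on L Z (%z. mk (f z) (g z) (h z)) (tot DA)"
proof -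
 let ?N = "prod_manifold (tot SA) (prod_manifold (tot SB) (tot C))"
 let ?S = "{p. \<exists>m\<in>W. fst p \<in> fibre SA m \<and> fst (snd p) \<in> fibre SB m \<and> snd (snd p) \<in> fibre C m}"
 have s: "smooth_on ?N ?S (%p. mk (fst p) (fst (snd p)) (snd (snd p))) (tot DA)"
  using dc unfolding decomposition_def by (elim conjE)
 note N2 = pre_manifold_prod[OF vb_tot[OF B] vb_tot[OF C]]
 note N = pre_manifold_prod[OF vb_tot[OF A] N2]
 have p: "smooth_on L Z (%z. (f z, (g z, h z))) ?N"
  by (rule smooth_on_Pair[OF L vb_tot[OF A] N2 f(1) smooth_on_Pair[OF L vb_tot[OF B] vb_tot[OF C] f(2,3)]])
 have "(f z, (g z, h z)) \<in> ?S" if "z \<in> Z" for z using W[OF that] b[OF that] by auto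
 from smooth_on_compose[OF L N preD s p this] show ?thesis by simp
qed

text \<open>In a decomposition the double-linear functions are the sums of a bilinear form in the components
 in \<open>A\<close> and \<open>B\<close> and a linear form in the component in the core.\<close>

lemma dl_values:
 assumes \<sigma>: "double_linear D m \<sigma>" and m: "m \<in> W"
 shows dl_bilinear: "bilinear_form SA SB m (%p. \<sigma> (mk (fst p) (snd p) (zer C m)))"
  and dl_core: "(%c. \<sigma> (bar c)) \<in> lin_forms C m"
  and dl_eq: "!!a b c. a \<in> fibre SA m ==> b \<in> fibre SB m ==> c \<in> fibre C m ==>
   \<sigma> (mk a b c) = \<sigma> (mk a b (zer C m)) + \<sigma> (bar c)"
proof -
 note mM = dc_W[OF m]
 note z = zA[OF mM] zB[OF mM] zC[OF mM]
 note sl = mk_slice[OF m]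
 have addA: "\<sigma> (add DA d1 d2) = \<sigma> d1 + \<sigma> d2" if "d1 \<in> slice D m" "d2 \<in> slice D m" "qA d1 = qA d2" for d1 d2
  using \<sigma> that unfolding double_linear_def by blast
 have addB: "\<sigma> (add DB d1 d2) = \<sigma> d1 + \<sigma> d2" if "d1 \<in> slice D m" "d2 \<in> slice D m" "qB d1 = qB d2" for d1 d2
  using \<sigma> that unfolding double_linear_def by blast
 have scA: "\<sigma> (scl DA r d) = r * \<sigma> d" and scB: "\<sigma> (scl DB r d) = r * \<sigma> d" if "d \<in> slice D m" for d r
  using \<sigma> that unfolding double_linear_def by blast+
 have mA: "\<sigma> (mk a (add SB b b') (add C c c')) = \<sigma> (mk a b c) + \<sigma> (mk a b' c')"
  if "a \<in> fibre SA m" "b \<in> fibre SB m" "b' \<in> fibre SB m" "c \<in> fibre C m" "c' \<in> fibre C m" for a b b' c c'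
  using addA[OF sl[OF that(1,2,4)] sl[OF that(1,3,5)]] mk_A[OF m that(1,2,4)] mk_A[OF m that(1,3,5)]
   mk_addA[OF m that(1,1-5)] by simp
 have mB: "\<sigma> (mk (add SA a a') b (add C c c')) = \<sigma> (mk a b c) + \<sigma> (mk a' b c')"
  if "a \<in> fibre SA m" "a' \<in> fibre SA m" "b \<in> fibre SB m" "c \<in> fibre C m" "c' \<in> fibre C m" for a a' b c c'
  using addB[OF sl[OF that(1,3,4)] sl[OF that(2,3,5)]] mk_B[OF m that(1,3,4)] mk_B[OF m that(2,3,5)]
   mk_addB[OF m that(1-3,3-5)] by simp
 have sA: "\<sigma> (mk a (scl SB r b) (scl C r c)) = r * \<sigma> (mk a b c)"
  and sB: "\<sigma> (mk (scl SA r a) b (scl C r c)) = r * \<sigma> (mk a b c)"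
  if "a \<in> fibre SA m" "b \<in> fibre SB m" "c \<in> fibre C m" for a b c r
  using scA[OF sl[OF that], of r] scB[OF sl[OF that], of r] mk_sclA[OF m that] mk_sclB[OF m that] by simp_all
 have zz: "add C (zer C m) (zer C m) = zer C m" by (rule add_zC[OF z(3)])
 show "bilinear_form SA SB m (%p. \<sigma> (mk (fst p) (snd p) (zer C m)))"
  unfolding bilinear_form_def
  using mA[OF _ _ _ z(3,3)] mB[OF _ _ _ z(3,3)] sA[OF _ _ z(3)] sB[OF _ _ z(3)] by (simp add: zz scl_zC[OF mM])
 show "(%c. \<sigma> (bar c)) \<in> lin_forms C m"
  using mA[OF z(1,2,2)] sA[OF z(1,2)]
  by (simp add: bar_mk[OF m] vb_add_in[OF C] vb_scl_in[OF C] add_zB[OF z(2)] scl_zB[OF mM])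
 fix a b c assume abc: "a \<in> fibre SA m" "b \<in> fibre SB m" "c \<in> fibre C m"
 have "\<sigma> (mk a b c) = \<sigma> (mk a b (zer C m)) + \<sigma> (mk a (zer SB m) c)"
  using mA[OF abc(1,2) z(2,3) abc(3)] by (simp add: add_zB[OF abc(2)] zC_add[OF abc(3)])
 also have "\<sigma> (mk a (zer SB m) c) = \<sigma> (mk a (zer SB m) (zer C m)) + \<sigma> (mk (zer SA m) (zer SB m) c)"
  using mB[OF abc(1) z(1,2,3) abc(3)] by (simp add: add_zA[OF abc(1)] zC_add[OF abc(3)])
 also have "\<sigma> (mk a (zer SB m) (zer C m)) = 0"
  using sA[OF abc(1) z(2,3), of 0] by (simp add: scl_zB[OF mM] scl_zC[OF mM])
 finally show "\<sigma> (mk a b c) = \<sigma> (mk a b (zer C m)) + \<sigma> (bar c)" by (simp add: bar_mk[OF m abc(3)])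
qed

lemma dl_intro:
 assumes m: "m \<in> W" and \<theta>: "bilinear_form SA SB m \<theta>" and \<kappa>: "\<kappa> \<in> lin_forms C m"
  and eq: "!!d. d \<in> slice D m ==> \<sigma> d = \<theta> (qA d, qB d) + \<kappa> (ga d)"
 shows "double_linear D m \<sigma>"
proof -
 have val: "\<sigma> (mk a b c) = \<theta> (a, b) + \<kappa> c"
  if "a \<in> fibre SA m" "b \<in> fibre SB m" "c \<in> fibre C m" for a b c
  using eq[OF mk_slice[OF m that]] mk_A[OF m that] mk_B[OF m that] mk_ga[OF m that] by simp
 note th = \<theta>[unfolded bilinear_form_def]
 show ?thesis
  unfolding double_linear_def
 proof (intro conjI ballI impI allI)
  fix d1 d2 assume d: "d1 \<in> slice D m" "d2 \<in> slice D m"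
  note i1 = slice_A[OF d(1)] slice_B[OF d(1)] ga_in[OF d(1) m]
  note i2 = slice_A[OF d(2)] slice_B[OF d(2)] ga_in[OF d(2) m]
  note e = mk_ga_eq[OF d(1) m] mk_ga_eq[OF d(2) m]
  show "\<sigma> (add DA d1 d2) = \<sigma> d1 + \<sigma> d2" if q: "qA d1 = qA d2"
  proof -
   have "add DA d1 d2 = mk (qA d1) (add SB (qB d1) (qB d2)) (add C (ga d1) (ga d2))"
    using mk_addA[OF m i1(1,1,2) i2(2) i1(3) i2(3)] e q by simp
   then show ?thesis
    using val[OF i1(1) vb_add_in[OF B i1(2) i2(2)] vb_add_in[OF C i1(3) i2(3)]] th i1 i2 \<kappa> eq d q by simp
  qed
  show "\<sigma> (add DB d1 d2) = \<sigma> d1 + \<sigma> d2" if q: "qB d1 = qB d2"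
  proof -
   have "add DB d1 d2 = mk (add SA (qA d1) (qA d2)) (qB d1) (add C (ga d1) (ga d2))"
    using mk_addB[OF m i1(1) i2(1) i1(2,2) i1(3) i2(3)] e q by simp
   then show ?thesis
    using val[OF vb_add_in[OF A i1(1) i2(1)] i1(2) vb_add_in[OF C i1(3) i2(3)]] th i1 i2 \<kappa> eq d q by simp
  qed
 next
  fix d r assume d: "d \<in> slice D m"
  note i1 = slice_A[OF d] slice_B[OF d] ga_in[OF d m]
  have "scl DA r d = mk (qA d) (scl SB r (qB d)) (scl C r (ga d))"
   "scl DB r d = mk (scl SA r (qA d)) (qB d) (scl C r (ga d))"
   using mk_sclA[OF m i1, of r] mk_sclB[OF m i1, of r] mk_ga_eq[OF d m] by simp_all
  then show "\<sigma> (scl DA r d) = r * \<sigma> d" "\<sigma> (scl DB r d) = r * \<sigma> d"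
   using val[OF i1(1) vb_scl_in[OF B i1(2)] vb_scl_in[OF C i1(3)]]
    val[OF vb_scl_in[OF A i1(1)] i1(2) vb_scl_in[OF C i1(3)]] th i1 \<kappa> eq[OF d]
   by (simp_all add: distrib_left)
 qed
qed

end

lemma decompE:
 assumes "m \<in> pts MM"
 obtains W mk ga where "m \<in> W" "decomposition D C bar W mk ga"
 using decomp[OF assms] by (elim exE conjE)

lemma bar_slice: "c \<in> fibre C m ==> bar c \<in> slice D m"
proof -
 assume c: "c \<in> fibre C m"
 have mM: "m \<in> pts MM" using vb_fibre_base[OF C c] base_C by simp
 obtain W mk ga where W: "m \<in> W" "decomposition D C bar W mk ga" by (rule decompE[OF mM])
 show ?thesis unfolding bar_mk[OF W(2,1) c] by (rule mk_slice[OF W(2,1) zA[OF mM] zB[OF mM] c])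
qed

lemma bar_smooth:
 assumes L: "pre_manifold L" and h: "smooth_on L Z h (tot C)"
 shows "smooth_on L Z (%z. bar (h z)) (tot DA)"
proof (rule smooth_on_local[OF L preD])
 fix p assume p: "p \<in> Z"
 note b = vb_proj_smooth_compose[OF C L h, unfolded base_C]
 obtain W mk ga where W: "proj C (h p) \<in> W" and dc: "decomposition D C bar W mk ga"
  by (rule decompE[OF smooth_on_image_pts[OF L b p]])
 obtain W' where W': "openin (mtop L) W'" "p \<in> W'" "(%z. proj C (h z)) ` (Z \<inter> W') \<subseteq> W"
  by (rule smooth_on_preimage[OF L preM b p dc_open[OF dc] W])
 have sub: "Z \<inter> W' \<subseteq> Z" by blast
 note b' = smooth_on_subset[OF b sub]
 have inW: "proj C (h z) \<in> W" if "z \<in> Z \<inter> W'" for z using W'(3) that by blast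
 have hz: "h z \<in> fibre C (proj C (h z))" if "z \<in> Z \<inter> W'" for z
  using smooth_on_image_pts[OF L h, of z] that by (simp add: fibre_def)
 have "smooth_on L (Z \<inter> W') (%z. mk (zer SA (proj C (h z))) (zer SB (proj C (h z))) (h z)) (tot DA)"
  by (rule mk_smooth[OF dc L smooth_zerA[OF L b'] smooth_zerB[OF L b'] smooth_on_subset[OF h sub]])
   (use inW hz zA[OF dc_W[OF dc inW]] zB[OF dc_W[OF dc inW]] in blast)+
 then have "smooth_on L (Z \<inter> W') (%z. bar (h z)) (tot DA)"
  by (rule smooth_on_cong) (use bar_mk[OF dc inW hz] in simp)
 then show "\<exists>W. openin (mtop L) W \<and> p \<in> W \<and> smooth_on L (Z \<inter> W) (%z. bar (h z)) (tot DA)"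
  using W'(1,2) by blast
qed

text \<open>Frames of \<open>A\<close>, \<open>B\<close> and the core give a dual system: products of coordinates of \<open>A\<close> and \<open>B\<close>, and
 coordinates of the core.\<close>

lemma dl_dual_system:
 assumes dc: "decomposition D C bar W0 mk ga" and WW: "W \<subseteq> W0"
  and frA: "frame_coframe SA W k s t" and frB: "frame_coframe SB W l s' t'" and frC: "frame_coframe C W n s'' t''"
 defines "\<phi> \<equiv> (%c d. case c of Inl (i, j) => t i (qA d) * t' j (qB d) | Inr h => t'' h (ga d))"
  and "x \<equiv> (%c m. case c of Inl (i, j) => mk (s i m) (s' j m) (zer C m)
   | Inr h => mk (zer SA m) (zer SB m) (s'' h m))"
 shows "dual_system MM (tot DA) (total D) (dvb_proj D) (%m. {\<sigma>. double_linear D m \<sigma>})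
  W (({..<k} \<times> {..<l}) <+> {..<n}) \<phi> x"
 unfolding dual_system_def
proof (intro conjI)
 let ?J = "({..<k} \<times> {..<l}) <+> {..<n}" and ?S = "{y \<in> total D. dvb_proj D y \<in> W}"
 show "openin (mtop MM) W" by (rule frame_open[OF A frA])
 show "finite ?J" by simp
 have sub: "?S \<subseteq> total D" by blast
 note W0 = subsetD[OF WW] and dcW = dc_W[OF dc subsetD[OF WW]]
 have SW: "proj SA (qA y) \<in> W" "proj SB (qB y) \<in> W" "proj C (ga y) \<in> W" if "y \<in> ?S" for y
 proof -
  have y: "y \<in> slice D (dvb_proj D y)" "dvb_proj D y \<in> W" using that by (auto intro: sliceI)
  show "proj SA (qA y) \<in> W" "proj SB (qB y) \<in> W" "proj C (ga y) \<in> W"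
   using fibreD(2)[OF slice_A[OF y(1)]] fibreD(2)[OF slice_B[OF y(1)]] fibreD(2)[OF ga_in[OF dc y(1) W0[OF y(2)]]] y(2) by simp_all
 qed
 have WM: "W \<subseteq> pts MM" using dcW by blast
 note idW = smooth_on_id[OF preM WM]
 have J: "P c" if "c \<in> ?J" "!!i j. i < k ==> j < l ==> P (Inl (i, j))" "!!h. h < n ==> P (Inr h)" for P c
  using that by (auto elim!: PlusE)
 show "\<forall>c\<in>?J. smooth_real (tot DA) ?S (\<phi> c)"
 proof
  fix c assume "c \<in> ?J"
  then show "smooth_real (tot DA) ?S (\<phi> c)"
  proof (rule J)
   fix i j assume ij: "i < k" "j < l"
   have "smooth_real (tot DA) ?S (%d. t i (qA d) * t' j (qB d))"
    by (intro smooth_real_mult[OF preD]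
      coframe_compose[OF A frA preD smooth_on_subset[OF projA_smooth sub] SW(1) ij(1)]
      coframe_compose[OF B frB preD smooth_on_subset[OF projB_smooth sub] SW(2) ij(2)])
   then show "smooth_real (tot DA) ?S (\<phi> (Inl (i, j)))" by (simp add: \<phi>_def)
  next
   fix h assume h: "h < n"
   have "smooth_real (tot DA) ?S (%d. t'' h (ga d))"
    by (rule coframe_compose[OF C frC preD smooth_on_subset[OF ga_smooth[OF dc]] SW(3) h]) (use WW in blast)
   then show "smooth_real (tot DA) ?S (\<phi> (Inr h))" by (simp add: \<phi>_def)
  qed
 qed
 show "\<forall>c\<in>?J. smooth_on MM W (x c) (tot DA)"
 proof
  fix c assume "c \<in> ?J"
  then show "smooth_on MM W (x c) (tot DA)"
  proof (rule J)
   fix i j assume ij: "i < k" "j < l"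
   have "smooth_on MM W (%m. mk (s i m) (s' j m) (zer C m)) (tot DA)"
    by (rule mk_smooth[where b = "%m. m", OF dc preM frame_smooth[OF A frA ij(1)] frame_smooth[OF B frB ij(2), unfolded base_B]
       smooth_zerC[OF preM idW]])
     (auto simp: frame_in[OF A frA ij(1)] frame_in[OF B frB ij(2)] zC dcW W0)
   then show "smooth_on MM W (x (Inl (i, j))) (tot DA)" by (simp add: x_def)
  next
   fix h assume h: "h < n"
   have "smooth_on MM W (%m. mk (zer SA m) (zer SB m) (s'' h m)) (tot DA)"
    by (rule mk_smooth[where b = "%m. m", OF dc preM smooth_zerA[OF preM idW] smooth_zerB[OF preM idW]
       frame_smooth[OF C frC h, unfolded base_C]])
     (auto simp: frame_in[OF C frC h] zA zB dcW W0)
   then show "smooth_on MM W (x (Inr h)) (tot DA)" by (simp add: x_def)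
  qed
 qed
 have x1: "s i m \<in> fibre SA m" "s' j m \<in> fibre SB m" "zer C m \<in> fibre C m" if "i < k" "j < l" "m \<in> W" for i j m
  using frame_in[OF A frA that(1,3)] frame_in[OF B frB that(2,3)] zC[OF dcW[OF that(3)]] .
 have x2: "zer SA m \<in> fibre SA m" "zer SB m \<in> fibre SB m" "s'' h m \<in> fibre C m" if "h < n" "m \<in> W" for h m
  using zA[OF dcW[OF that(2)]] zB[OF dcW[OF that(2)]] frame_in[OF C frC that] .
 have xs: "x c m \<in> slice D m" if c: "c \<in> ?J" and m: "m \<in> W" for c m
  using c by (rule J) (simp_all add: x_def mk_slice[OF dc W0[OF m]] x1 x2 m)
 show "\<forall>c\<in>?J. \<forall>m\<in>W. x c m \<in> total D \<and> dvb_proj D (x c m) = m"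
  using xs slice_total slice_proj by blast
 have tz: "t i (zer SA m) = 0" if "i < k" "m \<in> W" for i m
  using coframe_scl[OF A frA that zA[OF dcW[OF that(2)]], of 0] scl_zA[OF dcW[OF that(2)]] by simp
 have tz'': "t'' h (zer C m) = 0" if "h < n" "m \<in> W" for h m
  using coframe_scl[OF C frC that zC[OF dcW[OF that(2)]], of 0] scl_zC[OF dcW[OF that(2)]] by simp
 show "\<forall>c\<in>?J. \<forall>d\<in>?J. \<forall>m\<in>W. \<phi> c (x d m) = (if c = d then 1 else 0)"
 proof (intro ballI)
  fix c d m assume c: "c \<in> ?J" and d: "d \<in> ?J" and m: "m \<in> W"
  have 1: "qA (x (Inl (i, j)) m) = s i m" "qB (x (Inl (i, j)) m) = s' j m" "ga (x (Inl (i, j)) m) = zer C m"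
   if "i < k" "j < l" for i j
   using mk_A[OF dc W0[OF m] x1[OF that m]] mk_B[OF dc W0[OF m] x1[OF that m]] mk_ga[OF dc W0[OF m] x1[OF that m]] by (simp_all add: x_def)
  have 2: "qA (x (Inr h) m) = zer SA m" "qB (x (Inr h) m) = zer SB m" "ga (x (Inr h) m) = s'' h m"
   if "h < n" for h
   using mk_A[OF dc W0[OF m] x2[OF that m]] mk_B[OF dc W0[OF m] x2[OF that m]] mk_ga[OF dc W0[OF m] x2[OF that m]] by (simp_all add: x_def)
  show "\<phi> c (x d m) = (if c = d then 1 else 0)"
   using c
  proof (rule J)
   fix i j assume ij: "i < k" "j < l"
   show "\<phi> (Inl (i, j)) (x d m) = (if Inl (i, j) = d then 1 else 0)"
    using d
    by (rule J) (simp_all add: \<phi>_def 1 2 ij tz m coframe_frame[OF A frA _ _ m] coframe_frame[OF B frB _ _ m])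
  next
   fix h assume h: "h < n"
   show "\<phi> (Inr h) (x d m) = (if Inr h = d then 1 else 0)"
    using d by (rule J) (simp_all add: \<phi>_def 1 2 h tz'' m coframe_frame[OF C frC _ _ m])
  qed
 qed
 show "\<forall>c\<in>?J. \<forall>m\<in>W. (%y. if y \<in> total D \<and> dvb_proj D y = m then \<phi> c y else 0) \<in> {\<sigma>. double_linear D m \<sigma>}"
 proof (intro ballI CollectI)
  fix c m assume c: "c \<in> ?J" and m: "m \<in> W"
  let ?\<sigma> = "%c y. if y \<in> total D \<and> dvb_proj D y = m then \<phi> c y else 0"
  have sl: "?\<sigma> c y = \<phi> c y" if "y \<in> slice D m" for c y using slice_total[OF that] slice_proj[OF that] by simp
  have b0: "bilinear_form SA SB m (%p. 0)" by (simp add: bilinear_form_def)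
  show "double_linear D m (?\<sigma> c)"
   using c
  proof (rule J)
   fix i j assume ij: "i < k" "j < l"
   have "bilinear_form SA SB m (%p. t i (fst p) * t' j (snd p))"
    unfolding bilinear_form_def
    using coframe_add[OF A frA ij(1) m] coframe_scl[OF A frA ij(1) m]
     coframe_add[OF B frB ij(2) m] coframe_scl[OF B frB ij(2) m]
    by (simp add: algebra_simps)
   then show "double_linear D m (?\<sigma> (Inl (i, j)))"
    by (rule dl_intro[OF dc W0[OF m], of _ "%c. 0"]) (simp, simp add: sl, simp add: \<phi>_def)
  next
   fix h assume h: "h < n"
   have "t'' h \<in> lin_forms C m" using coframe_add[OF C frC h m] coframe_scl[OF C frC h m] by simp
   then show "double_linear D m (?\<sigma> (Inr h))"
    by (rule dl_intro[OF dc W0[OF m] b0]) (simp add: sl, simp add: \<phi>_def)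
  qed
 qed
 show "\<forall>m\<in>W. \<forall>f\<in>{\<sigma>. double_linear D m \<sigma>}. \<forall>y\<in>total D. dvb_proj D y = m \<longrightarrow>
   f y = (\<Sum>i\<in>?J. f (x i m) * \<phi> i y)"
 proof (intro ballI impI)
  fix m f y assume m: "m \<in> W" and f: "f \<in> {\<sigma>. double_linear D m \<sigma>}" and y0: "y \<in> total D" "dvb_proj D y = m"
  have f: "double_linear D m f" using f by simp
  have y: "y \<in> slice D m" by (rule sliceI[OF y0])
  note yi = slice_A[OF y] slice_B[OF y] ga_in[OF dc y W0[OF m]]
  have "f y = f (mk (qA y) (qB y) (zer C m)) + f (bar (ga y))"
   using dl_eq[OF dc f W0[OF m] yi] mk_ga_eq[OF dc y W0[OF m]] by simp
  also have "f (mk (qA y) (qB y) (zer C m)) = (\<Sum>(i, j) \<in> {..<k} \<times> {..<l}. f (mk (s i m) (s' j m) (zer C m)) * (t i (qA y) * t' j (qB y)))"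
   using bilinear_form_expand[OF A B frA frB m dl_bilinear[OF dc f W0[OF m]] yi(1,2)] by simp
  also have "f (bar (ga y)) = (\<Sum>h<n. f (bar (s'' h m)) * t'' h (ga y))"
   by (rule form_expand[OF C frC m dl_core[OF dc f W0[OF m]] yi(3)])
  also have "\<dots> = (\<Sum>h<n. f (mk (zer SA m) (zer SB m) (s'' h m)) * t'' h (ga y))"
   using bar_mk[OF dc W0[OF m] frame_in[OF C frC _ m]] by (intro sum.cong) auto
  finally show "f y = (\<Sum>i\<in>?J. f (x i m) * \<phi> i y)"
   by (simp add: sum.Plus \<phi>_def x_def case_prod_beta)
 qed
qed

lemma dl_function_bundle:
 "function_bundle MM (tot DA) (total D) (dvb_proj D) (%m. {\<sigma>. double_linear D m \<sigma>})"
proof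
 show "smooth_manifold MM" by (rule vb_base_smooth[OF A])
 show "pre_manifold (tot DA)" by (rule preD)
 fix m assume m: "m \<in> pts MM"
 obtain W0 mk ga where W0: "m \<in> W0" and dc0: "decomposition D C bar W0 mk ga" by (rule decompE[OF m])
 obtain W1 k s t where W1: "m \<in> W1" and frA: "frame_coframe SA W1 k s t" by (rule vb_frame[OF A m])
 obtain W2 l s' t' where W2: "m \<in> W2" and frB: "frame_coframe SB W2 l s' t'"
  by (rule vb_frame[OF B m[folded base_B]])
 obtain W3 n s'' t'' where W3: "m \<in> W3" and frC: "frame_coframe C W3 n s'' t''"
  by (rule vb_frame[OF C m[folded base_C]])
 define W where "W = W0 \<inter> (W1 \<inter> (W2 \<inter> W3))"
 have mW: "m \<in> W" using W0 W1 W2 W3 by (simp add: W_def)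
 have oW: "openin (mtop MM) W"
  unfolding W_def using dc_open[OF dc0] frame_open[OF A frA] frame_open[OF B frB, unfolded base_B]
   frame_open[OF C frC, unfolded base_C] by (intro openin_Int)
 have WW: "W \<subseteq> W0" "W \<subseteq> W1" "W \<subseteq> W2" "W \<subseteq> W3" by (auto simp: W_def)
 have frA: "frame_coframe SA W k s t" by (rule frame_restrict[OF A frA oW WW(2)])
 have frB: "frame_coframe SB W l s' t'" by (rule frame_restrict[OF B frB _ WW(3)]) (simp add: base_B oW)
 have frC: "frame_coframe C W n s'' t''" by (rule frame_restrict[OF C frC _ WW(4)]) (simp add: base_C oW)
 from dual_system_nat[OF mW dl_dual_system[OF dc0 WW(1) frA frB frC]]
 show "\<exists>W k \<phi> x. m \<in> W \<and> dual_system MM (tot DA) (total D) (dvb_proj D)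
   (%m. {\<sigma>. double_linear D m \<sigma>}) W {..<k::nat} \<phi> x" .
qed (auto simp: double_linear_def algebra_simps)

sublocale X: function_bundle MM "tot DA" "total D" "dvb_proj D" "%m. {\<sigma>. double_linear D m \<sigma>}"
 by (rule dl_function_bundle)

lemma X_eq: "double_linear_bundle D = X.B"
 by (simp add: double_linear_bundle_def)

lemma vector_bundle_X: "vector_bundle XX"
 unfolding X_eq by (rule X.vector_bundle_fun)

lemma X_simps [simp]:
 "base XX = MM" "proj XX = fst"
 "add XX p p' = (fst p, %x. snd p x + snd p' x)"
 "scl XX r p = (fst p, %x. r * snd p x)"
 by (simp_all add: double_linear_bundle_def)

lemma fibre_X_iff: "\<sigma> \<in> fibre XX m \<longleftrightarrow>
  fst \<sigma> = m \<and> m \<in> pts MM \<and> double_linear D m (snd \<sigma>) \<and> (\<forall>d. d \<notin> slice D m \<longrightarrow> snd \<sigma> d = 0)"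
 unfolding X_eq X.fibre_fun_iff by (auto simp: slice_def)

lemma X_eval_smooth:
 assumes "pre_manifold L" "smooth_on L Z f (tot XX)" "smooth_on L Z g (tot DA)"
  "!!z. z \<in> Z ==> g z \<in> slice D (fst (f z))"
 shows "smooth_real L Z (%z. snd (f z) (g z))"
 by (rule X.smooth_eval[OF assms(1) assms(2)[unfolded X_eq] assms(3)])
  (use slice_total[OF assms(4)] slice_proj[OF assms(4)] in blast)

lemma X_smooth_into:
 assumes "pre_manifold L" "!!z. z \<in> Z ==> f z \<in> fibre XX (b z)" "smooth_on L Z b MM"
  "!!W x. openin (mtop MM) W ==> smooth_on MM W x (tot DA) ==>
   (!!m. m \<in> W ==> x m \<in> slice D m) ==> smooth_real L {z \<in> Z. b z \<in> W} (%z. snd (f z) (x (b z)))"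
 shows "smooth_on L Z f (tot XX)"
 unfolding X_eq
 by (rule X.smooth_into_fun[OF assms(1) assms(2)[unfolded X_eq] assms(3)])
  (assumption, rule assms(4), auto simp: slice_def)

lemma vector_bundle_dualA: "vector_bundle (dual SA)" by (rule vector_bundle_dual[OF A])
lemma vector_bundle_dualB: "vector_bundle (dual SB)" by (rule vector_bundle_dual[OF B])
lemma vector_bundle_dualC: "vector_bundle (dual C)" by (rule vector_bundle_dual[OF C])

abbreviation "TT \<equiv> tensor (dual SA) (dual SB)"

lemma vector_bundle_T: "vector_bundle TT"
 by (rule vector_bundle_tensor[OF vector_bundle_dualA vector_bundle_dualB]) (simp add: base_B)

lemma fibre_T_iff: "\<theta> \<in> fibre TT m \<longleftrightarrow> fst \<theta> = m \<and> m \<in> pts MM \<and>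
  bilinear_form (dual (dual SA)) (dual (dual SB)) m (snd \<theta>) \<and>
  (\<forall>y. fst y \<notin> fibre (dual (dual SA)) m \<or> snd y \<notin> fibre (dual (dual SB)) m \<longrightarrow> snd \<theta> y = 0)"
 using fibre_tensor_iff[OF vector_bundle_dualA vector_bundle_dualB] base_B by simp

lemma T_bilinear:
 assumes "\<theta> \<in> fibre TT m"
 shows "bilinear_form SA SB m (%p. snd \<theta> (bidual_map SA (fst p), bidual_map SB (snd p)))"
 using assms bidual_in[OF A] bidual_in[OF B] unfolding fibre_T_iff bilinear_form_def
 by (simp add: bidual_add[OF A] bidual_add[OF B] bidual_scl[OF A] bidual_scl[OF B] del: dual_simps)

lemma seq_i_apply: "d \<in> slice D (fst \<theta>) ==>
  snd (seq_i D \<theta>) d = snd \<theta> (bidual_map SA (qA d), bidual_map SB (qB d))"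
 by (simp add: seq_i_def)

lemma seq_i_in:
 assumes \<theta>: "\<theta> \<in> fibre TT m" shows "seq_i D \<theta> \<in> fibre XX m"
proof -
 have m: "fst \<theta> = m" "m \<in> pts MM" using \<theta> unfolding fibre_T_iff by blast+
 obtain W mk ga where W: "m \<in> W" and dc: "decomposition D C bar W mk ga" by (rule decompE[OF m(2)])
 have "double_linear D m (snd (seq_i D \<theta>))"
  by (rule dl_intro[OF dc W T_bilinear[OF \<theta>], of "%c. 0"]) (use seq_i_apply[of _ \<theta>] m in simp_all)
 then show ?thesis unfolding fibre_X_iff using m by (simp add: seq_i_def)
qed

lemma seq_i_smooth: "smooth_on (tot TT) (pts (tot TT)) (seq_i D) (tot XX)"
proof (rule X_smooth_into)
 note T = vb_tot[OF vector_bundle_T]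
 show "pre_manifold (tot TT)" by (rule T)
 show "seq_i D z \<in> fibre XX (fst z)" if "z \<in> pts (tot TT)" for z
  by (rule seq_i_in) (use that in \<open>simp add: fibre_def\<close>)
 show fs: "smooth_on (tot TT) (pts (tot TT)) fst MM" using vb_proj_smooth[OF vector_bundle_T] by simp
 fix W x assume W: "openin (mtop MM) W" and x: "smooth_on MM W x (tot DA)" "!!m. m \<in> W ==> x m \<in> slice D m"
 let ?Z = "{z \<in> pts (tot TT). fst z \<in> W}"
 have sub: "?Z \<subseteq> pts (tot TT)" by blast
 have xs: "smooth_on (tot TT) ?Z (%z. x (fst z)) (tot DA)"
  by (rule smooth_on_compose[OF T preM preD x(1) smooth_on_subset[OF fs sub]]) blast
 have xD: "x (fst z) \<in> total D" if "z \<in> ?Z" for z using slice_total[OF x(2)] that by blast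
 have "smooth_real (tot TT) ?Z (%z. snd z (bidual_map SA (qA (x (fst z))), bidual_map SB (qB (x (fst z)))))"
 proof (rule tensor_eval_smooth[OF vector_bundle_dualA vector_bundle_dualB _ T smooth_on_id[OF T sub]])
  show "base (dual SB) = base (dual SA)" by (simp add: base_B)
  show "smooth_on (tot TT) ?Z (%z. bidual_map SA (qA (x (fst z)))) (tot (dual (dual SA)))"
   by (rule bidual_smooth[OF A T smooth_on_compose[OF T preD vb_tot[OF A] projA_smooth xs xD]])
  show "smooth_on (tot TT) ?Z (%z. bidual_map SB (qB (x (fst z)))) (tot (dual (dual SB)))"
   by (rule bidual_smooth[OF B T smooth_on_compose[OF T preD vb_tot[OF B] projB_smooth xs xD]])
  show "fst (bidual_map SA (qA (x (fst z)))) = fst z" "fst (bidual_map SB (qB (x (fst z)))) = fst z" if "z \<in> ?Z" for z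
   using fibreD(2)[OF slice_A[OF x(2)]] fibreD(2)[OF slice_B[OF x(2)]] that
   by (simp_all add: bidual_fst[OF A] bidual_fst[OF B])
 qed
 then show "smooth_real (tot TT) ?Z (%z. snd (seq_i D z) (x (fst z)))"
  by (rule smooth_real_cong) (use seq_i_apply[OF x(2)] in simp)
qed

lemma seq_j_in:
 assumes \<sigma>: "\<sigma> \<in> fibre XX m" shows "seq_j C bar \<sigma> \<in> fibre (dual C) m"
proof -
 have m: "fst \<sigma> = m" "m \<in> pts MM" "double_linear D m (snd \<sigma>)" using \<sigma> unfolding fibre_X_iff by blast+
 obtain W mk ga where W: "m \<in> W" and dc: "decomposition D C bar W mk ga" by (rule decompE[OF m(2)])
 show ?thesis
  unfolding seq_j_def m(1)
  by (rule dualI[OF C]) (use dl_core[OF dc m(3) W] vb_add_in[OF C] vb_scl_in[OF C] m(2) base_C in simp_all)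
qed

lemma seq_j_smooth: "smooth_on (tot XX) (pts (tot XX)) (seq_j C bar) (tot (dual C))"
proof (rule dual_smooth_into[OF C])
 let ?X = "double_linear_bundle D"
 note T = vb_tot[OF vector_bundle_X]
 show "pre_manifold (tot ?X)" by (rule T)
 show "seq_j C bar z \<in> fibre (dual C) (fst z)" if "z \<in> pts (tot ?X)" for z
  by (rule seq_j_in) (use that in \<open>simp add: fibre_def\<close>)
 show fs: "smooth_on (tot ?X) (pts (tot ?X)) fst (base C)" using vb_proj_smooth[OF vector_bundle_X] by (simp add: base_C)
 fix W x assume W: "openin (mtop (base C)) W" and x: "smooth_on (base C) W x (tot C)" "!!m. m \<in> W ==> x m \<in> fibre C m"
 let ?Z = "{z \<in> pts (tot ?X). fst z \<in> W}"
 have sub: "?Z \<subseteq> pts (tot ?X)" by blast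
 have xs: "smooth_on (tot ?X) ?Z (%z. x (fst z)) (tot C)"
  by (rule smooth_on_compose[OF T vb_base[OF C] vb_tot[OF C] x(1) smooth_on_subset[OF fs sub]]) blast
 have "smooth_real (tot ?X) ?Z (%z. snd z (bar (x (fst z))))"
  by (rule X_eval_smooth[OF T smooth_on_id[OF T sub] bar_smooth[OF T xs]]) (use bar_slice[OF x(2)] in blast)
 then show "smooth_real (tot ?X) ?Z (%z. snd (seq_j C bar z) (x (fst z)))"
  by (rule smooth_real_cong) (use x(2) in \<open>simp add: seq_j_def\<close>)
qed

lemma zero_bilinear: "bilinear_form SA SB m \<theta> ==> m \<in> pts MM ==> b \<in> fibre SB m ==> \<theta> (zer SA m, b) = 0"
 using zA[of m] scl_zA[of m 0] unfolding bilinear_form_def by (metis mult_zero_left)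

lemma T_off:
 assumes "\<theta> \<in> fibre TT m" "\<omega> \<notin> fibre (dual (dual SA)) m \<or> \<eta> \<notin> fibre (dual (dual SB)) m"
 shows "snd \<theta> (\<omega>, \<eta>) = 0"
proof -
 have "\<forall>y. fst y \<notin> fibre (dual (dual SA)) m \<or> snd y \<notin> fibre (dual (dual SB)) m \<longrightarrow> snd \<theta> y = 0"
  using assms(1) unfolding fibre_T_iff by (elim conjE)
 from this[THEN spec, of "(\<omega>, \<eta>)"] show ?thesis using assms(2) by simp
qed

lemma T_eqI:
 assumes "\<theta> \<in> fibre TT m" "\<theta>' \<in> fibre TT m"
  "!!a b. a \<in> fibre SA m ==> b \<in> fibre SB m ==>
   snd \<theta> (bidual_map SA a, bidual_map SB b) = snd \<theta>' (bidual_map SA a, bidual_map SB b)"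
 shows "\<theta> = \<theta>'"
proof -
 have "snd \<theta> (\<omega>, \<eta>) = snd \<theta>' (\<omega>, \<eta>)" for \<omega> \<eta>
 proof (cases "\<omega> \<in> fibre (dual (dual SA)) m \<and> \<eta> \<in> fibre (dual (dual SB)) m")
  case True
  obtain a where a: "a \<in> fibre SA m" "bidual_map SA a = \<omega>" by (rule bidual_surj[OF A]) (use True in blast)+
  obtain b where b: "b \<in> fibre SB m" "bidual_map SB b = \<eta>" by (rule bidual_surj[OF B]) (use True in blast)+
  show ?thesis using assms(3)[OF a(1) b(1)] a b by simp
 next
  case False
  then show ?thesis using T_off[OF assms(1), of \<omega> \<eta>] T_off[OF assms(2), of \<omega> \<eta>] by auto
 qed
 then have "snd \<theta> = snd \<theta>'" by (intro ext) (metis surj_pair)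
 moreover have "fst \<theta> = fst \<theta>'" using assms(1,2) unfolding fibre_T_iff by simp
 ultimately show ?thesis by (simp add: prod_eq_iff)
qed

lemma seq_i_mk:
 assumes dc: "decomposition D C bar W mk ga" and m: "m \<in> W" and \<theta>: "fst \<theta> = m"
  and abc: "a \<in> fibre SA m" "b \<in> fibre SB m" "c \<in> fibre C m"
 shows "snd (seq_i D \<theta>) (mk a b c) = snd \<theta> (bidual_map SA a, bidual_map SB b)"
 using seq_i_apply[of "mk a b c" \<theta>] mk_slice[OF dc m abc] mk_A[OF dc m abc] mk_B[OF dc m abc] \<theta> by simp

text \<open>An element of the kernel of \<open>j\<close> takes the value \<open>\<sigma> (mk a b 0)\<close> at \<open>mk a b c\<close>, which is
 bilinear in \<open>(a, b)\<close>; hence it is in the image of \<open>i\<close>.\<close>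

lemma kernel_seq_j:
 assumes \<sigma>: "\<sigma> \<in> fibre XX m" and j: "seq_j C bar \<sigma> = (m, %x. 0)"
 shows "\<exists>\<theta>\<in>fibre TT m. seq_i D \<theta> = \<sigma>"
proof -
 have m: "fst \<sigma> = m" "m \<in> pts MM" "double_linear D m (snd \<sigma>)" and off: "!!d. d \<notin> slice D m ==> snd \<sigma> d = 0"
  using \<sigma> unfolding fibre_X_iff by blast+
 obtain W mk ga where W: "m \<in> W" and dc: "decomposition D C bar W mk ga" by (rule decompE[OF m(2)])
 have core0: "snd \<sigma> (bar c) = 0" if "c \<in> fibre C m" for c
  using fun_cong[OF arg_cong[OF j, of snd], of c] that m(1) by (simp add: seq_j_def)
 note bil = dl_bilinear[OF dc m(3) W]
 define ia where "ia = inv_into (fibre SA m) (bidual_map SA)"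
 define ib where "ib = inv_into (fibre SB m) (bidual_map SB)"
 note ia = bidual_inv[OF A, of _ m, folded ia_def] and ib = bidual_inv[OF B, of _ m, folded ib_def]
 define \<theta> where "\<theta> = (m, %y. if fst y \<in> fibre (dual (dual SA)) m \<and> snd y \<in> fibre (dual (dual SB)) m
  then snd \<sigma> (mk (ia (fst y)) (ib (snd y)) (zer C m)) else 0)"
 note vA = vector_bundle_dual[OF vector_bundle_dualA] and vB = vector_bundle_dual[OF vector_bundle_dualB]
 have "bilinear_form (dual (dual SA)) (dual (dual SB)) m (%y. snd \<sigma> (mk (ia (fst y)) (ib (snd y)) (zer C m)))"
  using bil ia(2-4) ib(2-4) unfolding bilinear_form_def by (simp del: dual_simps)
 then have "bilinear_form (dual (dual SA)) (dual (dual SB)) m (snd \<theta>)"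
  by (rule bilinear_form_cong[OF vA vB]) (simp add: \<theta>_def)
 then have \<theta>: "\<theta> \<in> fibre TT m" unfolding fibre_T_iff using m(2) by (auto simp: \<theta>_def)
 have "snd (seq_i D \<theta>) d = snd \<sigma> d" for d
 proof (cases "d \<in> slice D m")
  case True
  note i = slice_A[OF True] slice_B[OF True] ga_in[OF dc True W]
  have "snd (seq_i D \<theta>) d = snd \<sigma> (mk (qA d) (qB d) (zer C m))"
   using seq_i_apply[of d \<theta>] True bidual_in[OF A i(1)] bidual_in[OF B i(2)] ia(1)[OF i(1)] ib(1)[OF i(2)]
   by (simp add: \<theta>_def)
  also have "\<dots> = snd \<sigma> d"
   using dl_eq[OF dc m(3) W i] core0[OF i(3)] mk_ga_eq[OF dc True W] by simp
  finally show ?thesis .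
 next
  case False
  then show ?thesis using off by (simp add: seq_i_def \<theta>_def)
 qed
 then have "seq_i D \<theta> = \<sigma>" using m(1) by (simp add: prod_eq_iff seq_i_def \<theta>_def ext)
 then show ?thesis using \<theta> by blast
qed

lemma seq_j_surj:
 assumes \<kappa>: "\<kappa> \<in> fibre (dual C) m"
 shows "\<exists>\<sigma>\<in>fibre XX m. seq_j C bar \<sigma> = \<kappa>"
proof -
 have m: "m \<in> pts MM" using \<kappa> base_C unfolding fibre_dual_iff[OF C] by simp
 obtain W mk ga where W: "m \<in> W" and dc: "decomposition D C bar W mk ga" by (rule decompE[OF m])
 define \<sigma> where "\<sigma> = (m, %d. if d \<in> slice D m then snd \<kappa> (ga d) else 0)"
 have "double_linear D m (snd \<sigma>)"
  by (rule dl_intro[OF dc W, of "%p. 0" "snd \<kappa>"]) (use \<kappa> in \<open>simp_all add: \<sigma>_def bilinear_form_def fibre_dual_iff[OF C]\<close>)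
 then have \<sigma>: "\<sigma> \<in> fibre XX m" unfolding fibre_X_iff using m by (simp add: \<sigma>_def)
 have "seq_j C bar \<sigma> = \<kappa>"
 proof (rule dual_eqI[OF C seq_j_in[OF \<sigma>] \<kappa>])
  fix c assume c: "c \<in> fibre C m"
  have "ga (bar c) = c" unfolding bar_mk[OF dc W c] by (rule mk_ga[OF dc W zA[OF m] zB[OF m] c])
  then show "snd (seq_j C bar \<sigma>) c = snd \<kappa> c" using bar_slice[OF c] c by (simp add: seq_j_def \<sigma>_def)
 qed
 then show ?thesis using \<sigma> by blast
qed

theorem short_exact_X:
 "short_exact TT XX (dual C) (seq_i D) (seq_j C bar)"
 unfolding short_exact_def
proof (intro conjI)
 let ?X = "double_linear_bundle D"
 show "vector_bundle TT" "vector_bundle ?X" "vector_bundle (dual C)"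
  by (rule vector_bundle_T vector_bundle_X vector_bundle_dualC)+
 show "base TT = base ?X" "base ?X = base (dual C)" by (simp_all add: base_C)
 have idM: "smooth_on MM (pts MM) (%m. m) MM" by (rule smooth_on_id[OF preM subset_refl])
 have ptsT: "\<theta> \<in> fibre TT (fst \<theta>)" if "\<theta> \<in> pts (tot TT)" for \<theta> using that by (simp add: fibre_def)
 have ptsX: "\<sigma> \<in> fibre ?X (fst \<sigma>)" if "\<sigma> \<in> pts (tot ?X)" for \<sigma> using that by (simp add: fibre_def)
 show "vb_morphism TT ?X (seq_i D) (%m. m)"
  unfolding vb_morphism_def
 proof (intro conjI ballI allI seq_i_smooth)
  show "smooth_on (base TT) (pts (base TT)) (%m. m) (base ?X)" using idM by simp
  show "proj ?X (seq_i D e) = proj TT e" for e by (simp add: seq_i_def)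
  show "seq_i D (add TT e e') = add ?X (seq_i D e) (seq_i D e')" if "e \<in> fibre TT m" "e' \<in> fibre TT m" for m e e'
   using that by (simp add: seq_i_def fibre_def fun_eq_iff)
  show "seq_i D (scl TT r e) = scl ?X r (seq_i D e)" for r e by (simp add: seq_i_def fun_eq_iff)
 qed
 show "vb_morphism ?X (dual C) (seq_j C bar) (%m. m)"
  unfolding vb_morphism_def
 proof (intro conjI ballI allI seq_j_smooth)
  show "smooth_on (base ?X) (pts (base ?X)) (%m. m) (base (dual C))" using idM by (simp add: base_C)
  show "proj (dual C) (seq_j C bar e) = proj ?X e" for e by (simp add: seq_j_def)
  show "seq_j C bar (add ?X e e') = add (dual C) (seq_j C bar e) (seq_j C bar e')"
   if "e \<in> fibre ?X m" "e' \<in> fibre ?X m" for m e e'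
   using that by (simp add: seq_j_def fibre_def fun_eq_iff)
  show "seq_j C bar (scl ?X r e) = scl (dual C) r (seq_j C bar e)" for r e by (simp add: seq_j_def fun_eq_iff)
 qed
 show "inj_on (seq_i D) (pts (tot TT))"
 proof (rule inj_onI)
  fix \<theta> \<theta>' assume t: "\<theta> \<in> pts (tot TT)" "\<theta>' \<in> pts (tot TT)" "seq_i D \<theta> = seq_i D \<theta>'"
  have f: "fst \<theta> = fst \<theta>'" using arg_cong[OF t(3), of fst] by (simp add: seq_i_def)
  have m: "fst \<theta> \<in> pts MM" using ptsT[OF t(1)] unfolding fibre_T_iff by blast
  obtain W mk ga where W: "fst \<theta> \<in> W" and dc: "decomposition D C bar W mk ga" by (rule decompE[OF m])
  show "\<theta> = \<theta>'"
  proof (rule T_eqI[OF ptsT[OF t(1)] ptsT[OF t(2), folded f]])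
   fix a b assume ab: "a \<in> fibre SA (fst \<theta>)" "b \<in> fibre SB (fst \<theta>)"
   show "snd \<theta> (bidual_map SA a, bidual_map SB b) = snd \<theta>' (bidual_map SA a, bidual_map SB b)"
    using seq_i_mk[OF dc W refl ab zC[OF m]] seq_i_mk[OF dc W f[symmetric] ab zC[OF m]] t(3) by simp
  qed
 qed
 show "seq_i D ` pts (tot TT) = {\<sigma> \<in> pts (tot ?X). seq_j C bar \<sigma> = zer (dual C) (proj ?X \<sigma>)}"
 proof (rule subset_antisym[OF subsetI subsetI])
  fix \<sigma> assume "\<sigma> \<in> seq_i D ` pts (tot TT)"
  then obtain \<theta> where t: "\<theta> \<in> pts (tot TT)" "\<sigma> = seq_i D \<theta>" by blast
  note T = ptsT[OF t(1)]
  have m: "fst \<theta> \<in> pts MM" using T unfolding fibre_T_iff by blast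
  obtain W mk ga where W: "fst \<theta> \<in> W" and dc: "decomposition D C bar W mk ga" by (rule decompE[OF m])
  have "snd \<sigma> (bar c) = 0" if c: "c \<in> fibre C (fst \<theta>)" for c
   using seq_i_mk[OF dc W refl zA[OF m] zB[OF m] c] bar_mk[OF dc W c]
    zero_bilinear[OF T_bilinear[OF T] m zB[OF m]] t(2) by simp
  then have "seq_j C bar \<sigma> = zer (dual C) (proj ?X \<sigma>)" by (simp add: seq_j_def t(2) seq_i_def fun_eq_iff)
  moreover have "\<sigma> \<in> pts (tot ?X)" using fibreD(1)[OF seq_i_in[OF T]] t(2) by simp
  ultimately show "\<sigma> \<in> {\<sigma> \<in> pts (tot ?X). seq_j C bar \<sigma> = zer (dual C) (proj ?X \<sigma>)}" by blast
 next
  fix \<sigma> assume "\<sigma> \<in> {\<sigma> \<in> pts (tot ?X). seq_j C bar \<sigma> = zer (dual C) (proj ?X \<sigma>)}"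
  then have "\<sigma> \<in> pts (tot ?X)" "seq_j C bar \<sigma> = (fst \<sigma>, %x. 0)" by simp_all
  from kernel_seq_j[OF ptsX[OF this(1)] this(2)] show "\<sigma> \<in> seq_i D ` pts (tot TT)"
   using fibreD(1) by (metis image_eqI)
 qed
 show "seq_j C bar ` pts (tot ?X) = pts (tot (dual C))"
 proof (rule subset_antisym[OF subsetI subsetI])
  fix \<kappa> assume "\<kappa> \<in> seq_j C bar ` pts (tot ?X)"
  then show "\<kappa> \<in> pts (tot (dual C))" using fibreD(1)[OF seq_j_in[OF ptsX]] by blast
 next
  fix \<kappa> assume "\<kappa> \<in> pts (tot (dual C))"
  then have "\<kappa> \<in> fibre (dual C) (fst \<kappa>)" by (simp add: fibre_def)
  from seq_j_surj[OF this] show "\<kappa> \<in> seq_j C bar ` pts (tot ?X)" using fibreD(1) by (metis image_eqI)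
 qed
qed

end

section \<open>The algebra of a double vector bundle\<close>

context
 fixes DA :: "('d, 'a) vbundle" and DB :: "('d, 'b) vbundle" and A :: "('a, 'm) vbundle" and B :: "('b, 'm) vbundle"
 assumes sm: "structure_morphisms DA DB A B"
begin

lemma sm_proj_proj: "d \<in> pts (tot DB) ==> proj A (proj DA d) = proj B (proj DB d)"
 and sm_zer_proj: "a \<in> pts (tot A) ==> proj DB (zer DA a) = zer B (proj A a)"
 and sm_zer_add: "m \<in> pts (base A) ==> a \<in> fibre A m ==> a' \<in> fibre A m ==>
  zer DA (add A a a') = add DB (zer DA a) (zer DA a')"
 and sm_zer_scl: "a \<in> pts (tot A) ==> zer DA (scl A r a) = scl DB r (zer DA a)"
 and sm_scl_proj: "d \<in> pts (tot DB) ==> proj DB (scl DA r d) = scl B r (proj DB d)"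
 and sm_scl_add: "b \<in> pts (base DB) ==> d \<in> fibre DB b ==> d' \<in> fibre DB b ==>
  scl DA r (add DB d d') = add DB (scl DA r d) (scl DA r d')"
 and sm_scl_scl: "d \<in> pts (tot DB) ==> scl DA r (scl DB s d) = scl DB s (scl DA r d)"
 and sm_add_proj: "d \<in> pts (tot DA) ==> d' \<in> pts (tot DA) ==> proj DA d = proj DA d' ==>
  proj DB (add DA d d') = add B (proj DB d) (proj DB d')"
 using sm unfolding structure_morphisms_def vb_morphism_def by simp_all

lemma sm_interchange:
 assumes "d1 \<in> pts (tot DA)" "d2 \<in> pts (tot DA)" "d3 \<in> pts (tot DA)" "d4 \<in> pts (tot DA)"
  "proj DA d1 = proj DA d2" "proj DA d3 = proj DA d4" "proj DB d1 = proj DB d3" "proj DB d2 = proj DB d4"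
 shows "add DB (add DA d1 d2) (add DA d3 d4) = add DA (add DB d1 d3) (add DB d2 d4)"
proof -
 have "\<forall>d1 \<in> pts (tot DA). \<forall>d2 \<in> pts (tot DA). \<forall>d3 \<in> pts (tot DA). \<forall>d4 \<in> pts (tot DA).
    proj DA d1 = proj DA d2 \<and> proj DA d3 = proj DA d4 \<and>
    proj DB d1 = proj DB d3 \<and> proj DB d2 = proj DB d4 \<longrightarrow>
    add DB (add DA d1 d2) (add DA d3 d4) = add DA (add DB d1 d3) (add DB d2 d4)"
  using sm unfolding structure_morphisms_def by (elim conjE)
 then show ?thesis using assms by blast
qed

end

locale dvb =
 fixes D :: "('d, 'a, 'b, 'm) dvb"
 assumes dvb: "double_vector_bundle D"
begin

abbreviation "DA \<equiv> over_A D"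
abbreviation "DB \<equiv> over_B D"
abbreviation "SA \<equiv> side_A D"
abbreviation "SB \<equiv> side_B D"
abbreviation "MM \<equiv> base (side_A D)"

lemma vDA: "vector_bundle DA" and vDB: "vector_bundle DB" and vSA: "vector_bundle SA" and vSB: "vector_bundle SB"
 and totB [simp]: "tot DB = tot DA" and baseDA [simp]: "base DA = tot SA" and baseDB [simp]: "base DB = tot SB"
 and baseB [simp]: "base SB = MM"
 and sm1: "structure_morphisms DA DB SA SB" and sm2: "structure_morphisms DB DA SB SA"
 using dvb unfolding double_vector_bundle_def by simp_all

lemmas preD = vb_tot[OF vDA] and preA = vb_tot[OF vSA] and preB = vb_tot[OF vSB] and preM = vb_base[OF vSA]

text \<open>The elements of \<open>D\<close> over a pair of points of \<open>A\<close> and \<open>B\<close>.\<close>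

definition cell :: "'a => 'b => 'd set" where
 "cell a b = {d \<in> total D. proj DA d = a \<and> proj DB d = b}"

lemma cell_total: "d \<in> cell a b ==> d \<in> total D"
 and cell_A: "d \<in> cell a b ==> proj DA d = a" and cell_B: "d \<in> cell a b ==> proj DB d = b"
 and cell_fA: "d \<in> cell a b ==> d \<in> fibre DA a" and cell_fB: "d \<in> cell a b ==> d \<in> fibre DB b"
 by (simp_all add: cell_def fibre_def)

lemma projA_in: "d \<in> total D ==> proj DA d \<in> pts (tot SA)"
 using vb_proj_in[OF vDA] by simp

lemma projB_in: "d \<in> total D ==> proj DB d \<in> pts (tot SB)"
 using vb_proj_in[OF vDB] by simp

lemma proj_proj: "d \<in> total D ==> proj SB (proj DB d) = proj SA (proj DA d)"
 using sm_proj_proj[OF sm1] by simp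

lemma cell_side:
 assumes "d \<in> cell a b" "a \<in> fibre SA m" shows "b \<in> fibre SB m"
 using assms proj_proj[of d] projB_in[of d] by (auto simp: cell_def fibre_def)

lemma cell_addA: "d \<in> cell a b ==> d' \<in> cell a b' ==> add DA d d' \<in> cell a (add SB b b')"
 using fibreD[OF vb_add_in[OF vDA cell_fA cell_fA]] sm_add_proj[OF sm1]
 by (simp add: cell_def fibre_def)

lemma cell_addB: "d \<in> cell a b ==> d' \<in> cell a' b ==> add DB d d' \<in> cell (add SA a a') b"
 using fibreD[OF vb_add_in[OF vDB cell_fB cell_fB]] sm_add_proj[OF sm2]
 by (simp add: cell_def fibre_def)

lemma cell_sclA: "d \<in> cell a b ==> scl DA r d \<in> cell a (scl SB r b)"
 using fibreD[OF vb_scl_in[OF vDA cell_fA]] sm_scl_proj[OF sm1] by (simp add: cell_def)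

lemma cell_sclB: "d \<in> cell a b ==> scl DB r d \<in> cell (scl SA r a) b"
 using fibreD[OF vb_scl_in[OF vDB cell_fB]] sm_scl_proj[OF sm2] by (simp add: cell_def)

lemma cell_zA: "a \<in> fibre SA m ==> zer DA a \<in> cell a (zer SB m)"
 using fibreD[OF vb_zer_in[OF vDA, of a]] sm_zer_proj[OF sm1, of a] by (simp add: cell_def fibre_def)

lemma cell_zB: "b \<in> fibre SB m ==> zer DB b \<in> cell (zer SA m) b"
 using fibreD[OF vb_zer_in[OF vDB, of b]] sm_zer_proj[OF sm2, of b] by (simp add: cell_def fibre_def)

lemma zer_addA: "a \<in> fibre SA m ==> a' \<in> fibre SA m ==> zer DA (add SA a a') = add DB (zer DA a) (zer DA a')"
 by (rule sm_zer_add[OF sm1 vb_fibre_base[OF vSA]])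

lemma zer_addB: "b \<in> fibre SB m ==> b' \<in> fibre SB m ==> zer DB (add SB b b') = add DA (zer DB b) (zer DB b')"
 by (rule sm_zer_add[OF sm2 vb_fibre_base[OF vSB]])

lemma zer_sclA: "a \<in> fibre SA m ==> zer DA (scl SA r a) = scl DB r (zer DA a)"
 by (rule sm_zer_scl[OF sm1 fibreD(1)])

lemma zer_sclB: "b \<in> fibre SB m ==> zer DB (scl SB r b) = scl DA r (zer DB b)"
 by (rule sm_zer_scl[OF sm2 fibreD(1)])

lemma interchange:
 assumes "d1 \<in> cell a b" "d2 \<in> cell a b'" "d3 \<in> cell a' b" "d4 \<in> cell a' b'"
 shows "add DB (add DA d1 d2) (add DA d3 d4) = add DA (add DB d1 d3) (add DB d2 d4)"
 using assms by (intro sm_interchange[OF sm1]) (simp_all add: cell_def)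

lemma scl_addB: "d \<in> cell a b ==> d' \<in> cell a' b ==> scl DA r (add DB d d') = add DB (scl DA r d) (scl DA r d')"
 using sm_scl_add[OF sm1, of b d d' r] cell_fB vb_fibre_base[OF vDB] by blast

lemma scl_addA: "d \<in> cell a b ==> d' \<in> cell a b' ==> scl DB r (add DA d d') = add DA (scl DB r d) (scl DB r d')"
 using sm_scl_add[OF sm2, of a d d' r] cell_fA vb_fibre_base[OF vDA] by blast

lemma scl_scl: "d \<in> cell a b ==> scl DA r (scl DB s d) = scl DB s (scl DA r d)"
 using sm_scl_scl[OF sm1, of d] cell_total by simp

lemma spA: "d \<in> cell a b ==> fibre_space (fibre DA a) (add DA) (scl DA) (zer DA a)"
 by (rule vb_fibre_space[OF vDA vb_fibre_base[OF vDA cell_fA]])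

lemma spB: "d \<in> cell a b ==> fibre_space (fibre DB b) (add DB) (scl DB) (zer DB b)"
 by (rule vb_fibre_space[OF vDB vb_fibre_base[OF vDB cell_fB]])

lemma spSA: "m \<in> pts MM ==> fibre_space (fibre SA m) (add SA) (scl SA) (zer SA m)"
 by (rule vb_fibre_space[OF vSA])

lemma spSB: "m \<in> pts MM ==> fibre_space (fibre SB m) (add SB) (scl SB) (zer SB m)"
 by (rule vb_fibre_space[OF vSB]) simp

lemma zSA: "m \<in> pts MM ==> zer SA m \<in> fibre SA m" and zSB: "m \<in> pts MM ==> zer SB m \<in> fibre SB m"
 using vb_zer_in[OF vSA] vb_zer_in[OF vSB] by simp_all

lemma zz: "m \<in> pts MM ==> zer DA (zer SA m) = zer DB (zer SB m)"
proof -
 assume m: "m \<in> pts MM"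
 note z = zSA[OF m]
 have "zer DA (zer SA m) = zer DA (scl SA 0 (zer SA m))"
  by (simp only: fibre_space.sc_z[OF spSA[OF m]])
 also have "\<dots> = scl DB 0 (zer DA (zer SA m))" by (rule zer_sclA[OF z])
 also have "\<dots> = zer DB (zer SB m)"
  by (rule fibre_space.sc_zero[OF spB[OF cell_zA[OF z]] cell_fB[OF cell_zA[OF z]]])
 finally show ?thesis .
qed

lemma lc_cellB:
 assumes "b \<in> fibre SB m" "!!i. i < k ==> x i \<in> cell (g i) b"
 shows "vlc DB b k c x \<in> cell (vlc SA m k c g) b"
 using assms(2) by (induction k) (simp_all add: cell_zB[OF assms(1)] cell_addB cell_sclB)

lemma lc_cellA:
 assumes "a \<in> fibre SA m" "!!i. i < k ==> x i \<in> cell a (g i)"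
 shows "vlc DA a k c x \<in> cell a (vlc SB m k c g)"
 using assms(2) by (induction k) (simp_all add: cell_zA[OF assms(1)] cell_addA cell_sclA)

lemma lc_interchange:
 assumes b: "b \<in> fibre SB m" "b' \<in> fibre SB m"
  and "!!i. i < k ==> x i \<in> cell (g i) b" "!!i. i < k ==> y i \<in> cell (g i) b'"
 shows "vlc DB (add SB b b') k c (%i. add DA (x i) (y i)) =
  add DA (vlc DB b k c x) (lin_comb (add DB) (scl DB) (zer DB b') k c y)"
 using assms(3,4)
proof (induction k)
 case 0
 then show ?case by (simp add: zer_addB[OF b])
next
 case (Suc k)
 let ?X = "vlc DB b k c x" and ?Y = "lin_comb (add DB) (scl DB) (zer DB b') k c y"
 note X = lc_cellB[OF b(1), of k x g c] and Y = lc_cellB[OF b(2), of k y g c]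
 have "add DB (add DA ?X ?Y) (scl DB (c k) (add DA (x k) (y k))) =
  add DB (add DA ?X ?Y) (add DA (scl DB (c k) (x k)) (scl DB (c k) (y k)))"
  using scl_addA[OF Suc.prems(1)[OF lessI] Suc.prems(2)[OF lessI]] by simp
 also have "\<dots> = add DA (add DB ?X (scl DB (c k) (x k))) (add DB ?Y (scl DB (c k) (y k)))"
  by (rule interchange[OF X Y cell_sclB[OF Suc.prems(1)[OF lessI]] cell_sclB[OF Suc.prems(2)[OF lessI]]])
   (use Suc.prems in auto)
 finally show ?case using Suc by simp
qed


section \<open>The core\<close>

abbreviation core_fibre :: "'m => 'd set" where
 "core_fibre m \<equiv> cell (zer SA m) (zer SB m)"

lemma dvb_proj_cell: "d \<in> cell a b ==> a \<in> fibre SA m ==> dvb_proj D d = m"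
 by (simp add: dvb_proj_def cell_def fibre_def)

lemma core_proj: "m \<in> pts MM ==> c \<in> core_fibre m ==> dvb_proj D c = m"
 by (rule dvb_proj_cell[OF _ zSA])

lemma core_set_fibre: "m \<in> pts MM ==> {c \<in> core_set D. dvb_proj D c = m} = core_fibre m"
proof (rule subset_antisym[OF subsetI subsetI])
 fix c assume m: "m \<in> pts MM" and c: "c \<in> core_fibre m"
 then show "c \<in> {c \<in> core_set D. dvb_proj D c = m}"
  using core_proj[OF m c] by (auto simp: core_set_def cell_def)
next
 fix c assume m: "m \<in> pts MM" and c: "c \<in> {c \<in> core_set D. dvb_proj D c = m}"
 then obtain m' where m': "m' \<in> pts MM" "c \<in> core_fibre m'" by (auto simp: core_set_def cell_def)
 then show "c \<in> core_fibre m" using core_proj[OF m'] c by simp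
qed

lemma core_set_iff: "c \<in> core_set D \<longleftrightarrow> (\<exists>m\<in>pts MM. c \<in> core_fibre m)"
 by (auto simp: core_set_def cell_def)

context
 fixes m assumes m: "m \<in> pts MM"
begin

lemma core_fA: "c \<in> core_fibre m ==> c \<in> fibre DA (zer SA m)" and core_fB: "c \<in> core_fibre m ==> c \<in> fibre DB (zer SB m)"
 by (rule cell_fA, assumption, rule cell_fB)

lemma core_add: "c \<in> core_fibre m ==> c' \<in> core_fibre m ==> add DA c c' \<in> core_fibre m"
 using cell_addA[of c "zer SA m" "zer SB m" c' "zer SB m"] fibre_space.z_pl[OF spSB[OF m] zSB[OF m]]
 by simp

lemma core_scl: "c \<in> core_fibre m ==> scl DA r c \<in> core_fibre m"
 using cell_sclA[of c "zer SA m" "zer SB m" r] fibre_space.sc_z[OF spSB[OF m]]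
 by simp

lemma core_sclB: "c \<in> core_fibre m ==> scl DB r c \<in> core_fibre m"
 using cell_sclB[of c "zer SA m" "zer SB m" r] fibre_space.sc_z[OF spSA[OF m]]
 by simp

lemma core_zer: "zer DA (zer SA m) \<in> core_fibre m"
 by (rule cell_zA[OF zSA[OF m]])

lemma core_fibre_space: "fibre_space (core_fibre m) (add DA) (scl DA) (zer DA (zer SA m))"
proof -
 interpret F: fibre_space "fibre DA (zer SA m)" "add DA" "scl DA" "zer DA (zer SA m)"
  by (rule spA[OF cell_zA[OF zSA[OF m]]])
 show ?thesis
  by (rule fibre_space.intro, unfold vector_space_laws_def, intro conjI ballI allI;
    (rule core_add core_scl core_zer F.pl_assoc F.pl_comm F.z_pl F.pl_neg F.sc_one F.sc_sc F.sc_add F.sc_pl;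
     ((rule core_fA)?; assumption)))
qed

text \<open>The Eckmann-Hilton argument: both additions have the same zero on the core, and they interchange.\<close>

lemma core_add_eq: 
 assumes "c \<in> core_fibre m" "c' \<in> core_fibre m"
 shows "add DA c c' = add DB c c'"
proof -
 let ?z = "zer DA (zer SA m)"
 note z = core_zer and zB = zz[OF m]
 note sA = spA[OF z] and sB = spB[OF z]
 have "add DB (add DA c ?z) (add DA ?z c') = add DA (add DB c ?z) (add DB ?z c')"
  by (rule interchange) (use assms z in simp_all)
 moreover have "add DA c ?z = c" "add DA ?z c' = c'"
  using fibre_space.pl_z[OF sA core_fA[OF assms(1)]] fibre_space.z_pl[OF sA core_fA[OF assms(2)]] by simp_all
 moreover have "add DB c ?z = c" "add DB ?z c' = c'"
  using fibre_space.pl_z[OF sB core_fB[OF assms(1)]] fibre_space.z_pl[OF sB core_fB[OF assms(2)]] zB by simp_all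
 ultimately show ?thesis by simp
qed

text \<open>The two scalar multiplications agree on the core: both are additive in the scalar for the
 common addition, and an additive differentiable function of a real variable is linear.\<close>

lemma core_scl_eq:
 assumes c: "c \<in> core_fibre m"
 shows "scl DB r c = scl DA r c"
proof -
 let ?z = "zer SA m"
 interpret F: fibre_space "fibre DA ?z" "add DA" "scl DA" "zer DA ?z" by (rule spA[OF cell_zA[OF zSA[OF m]]])
 interpret G: fibre_space "fibre DB (zer SB m)" "add DB" "scl DB" "zer DB (zer SB m)"
  by (rule spB[OF c])
 have zp: "?z \<in> pts (base DA)" using zSA[OF m] fibreD(1) by simp
 obtain O' k f \<tau> where O': "?z \<in> O'" and fr: "frame_coframe DA O' k f \<tau>" by (rule vb_frame[OF vDA zp])
 note cs = pre_manifold_coord_space[of 1]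
 have lin: "\<tau> i (scl DB r c) = r * \<tau> i c" if i: "i < k" for i r
 proof -
  define g where "g r = \<tau> i (scl DB r c)" for r
  have add: "g (r + s) = g r + g s" for r s
  proof -
   have "scl DB (r + s) c = add DA (scl DB r c) (scl DB s c)"
    using G.sc_add[OF core_fB[OF c]] core_add_eq[OF core_sclB[OF c] core_sclB[OF c], of r s] by simp
   then show ?thesis
    unfolding g_def using coframe_add[OF vDA fr i O' core_fA[OF core_sclB[OF c]] core_fA[OF core_sclB[OF c]]] by simp
  qed
  have cD: "c \<in> pts (tot DB)" using core_fA[OF c] fibreD(1) by simp
  then have cc: "smooth_on (coord_space 1) (espace 1) (%u. c) (tot DB)"
   by (intro smooth_on_const[OF cs _ vb_tot[OF vDB]]) simp_all
  have "smooth_on (coord_space 1) (espace 1) (%u. scl DB (u 0) c) (tot DA)"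
   using vb_smooth_scl[OF vDB cs cc smooth_real_coord[OF subset_refl]] by simp
  from coframe_compose[OF vDA fr cs this _ i]
  have "smooth_real (coord_space 1) (espace 1) (%u. g (u 0))"
   unfolding g_def using fibreD(2)[OF core_fA[OF core_sclB[OF c]]] O' by simp
  from smooth_real_imp_Ck[OF openin_espace this, of 1]
  have ck: "Ck_on 1 (Suc 0) (espace 1) (%u. g (u 0))" by simp
  have "\<exists>h. Ck_on 1 0 (espace 1) h \<and> (\<forall>u\<in>espace 1. ((%t. g ((u(0 := t)) 0)) has_real_derivative h u) (at (u 0)))"
   using ck unfolding Ck_on.simps(2) by (elim conjE allE[of _ 0]) simp
  then obtain h where h: "\<forall>u\<in>espace 1. ((%t. g ((u(0 := t)) 0)) has_real_derivative h u) (at (u 0))" by (elim exE conjE) (rule that)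
  have z0: "(%i. 0) \<in> espace 1" by (simp add: topspace_Euclidean_space)
  from bspec[OF h z0] have g0: "(g has_real_derivative h (%i. 0)) (at 0)" by simp
  define d where "d = h (%i. 0)"
  have "(g has_real_derivative d) (at r)" for r
  proof -
   have "((%t. g (t - r)) has_real_derivative d) (at r)"
    using DERIV_shift[of g d r "- r"] g0 by (simp add: d_def)
   from DERIV_add[OF DERIV_const[of "g r"] this]
   have "((%t. g r + g (t - r)) has_real_derivative d) (at r)" by simp
   moreover have "(%t. g r + g (t - r)) = g"
   proof
    fix t
    show "g r + g (t - r) = g t" using add[of r "t - r"] by simp
   qed
   ultimately show ?thesis by (simp only:)
  qed
  then have "((%r. g r - d * r) has_real_derivative 0) (at r)" for r
   using DERIV_diff[OF _ DERIV_cmult_Id[of d r], of g d] by simp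
  then have const: "g r - d * r = g 0 - d * 0" for r by (rule DERIV_isconst_all[rule_format])
  have g0: "g 0 = 0" using add[of 0 0] by simp
  have "g r = r * g 1" using const[of r] const[of 1] g0 by simp
  then show ?thesis by (simp add: g_def G.sc_one[OF core_fB[OF c]])
 qed
 have "vlc DA ?z k (%i. \<tau> i (scl DB r c)) (%i. f i ?z) =
   vlc DA ?z k (%i. \<tau> i (scl DA r c)) (%i. f i ?z)"
  using lin coframe_scl[OF vDA fr _ O' core_fA[OF c]] by (intro lin_comb_cong) auto
 then show ?thesis
  by (simp only: frame_expand[OF vDA fr O'] core_fA[OF core_sclB[OF c]] core_fA[OF core_scl[OF c]])
qed

end

lemma dvb_proj_smooth: "smooth_on (tot DA) (total D) (dvb_proj D) MM"
 unfolding dvb_proj_def[abs_def]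
 using vb_proj_smooth_compose[OF vSA preD, of "total D" "proj DA"] vb_proj_smooth[OF vDA] by simp

lemma smooth_zerSA: "pre_manifold L ==> smooth_on L Z b MM ==> smooth_on L Z (%z. zer SA (b z)) (tot SA)"
 by (rule vb_smooth_zer[OF vSA])

lemma smooth_zerDA: "pre_manifold L ==> smooth_on L Z b (tot SA) ==> smooth_on L Z (%z. zer DA (b z)) (tot DA)"
 by (rule vb_smooth_zer[OF vDA]) simp_all

lemma smooth_zerDB: "pre_manifold L ==> smooth_on L Z b (tot SB) ==> smooth_on L Z (%z. zer DB (b z)) (tot DA)"
 using vb_smooth_zer[OF vDB] by simp

lemma smooth_projB: "pre_manifold L ==> smooth_on L Z f (tot DA) ==> smooth_on L Z (%z. proj DB (f z)) (tot SB)"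
 using vb_proj_smooth_compose[OF vDB] by simp

lemma smooth_projA: "pre_manifold L ==> smooth_on L Z f (tot DA) ==> smooth_on L Z (%z. proj DA (f z)) (tot SA)"
 using vb_proj_smooth_compose[OF vDA] by simp

text \<open>A smooth frame of the core near \<open>m0\<close>: the vectors \<open>0_b\<close> with \<open>b\<close> in a frame of \<open>B\<close> are
 completed by constant vectors \<open>v\<close> to a frame of the fibres of \<open>D\<close> over the zero section of \<open>A\<close>,
 and each \<open>v\<close> is corrected to \<open>v - 0_b\<close> with \<open>b\<close> its projection.\<close>

lemma core_frame:
 assumes m0: "m0 \<in> pts MM"
 obtains W r c t where "m0 \<in> W" "openin (mtop MM) W"
  "!!l. l < r ==> smooth_on MM W (c l) (tot DA)"
  "!!m. m \<in> W ==> fibre_space.basis (core_fibre m) (add DA) (scl DA) (zer DA (zer SA m)) r (%l. c l m)"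
  "!!m e l. m \<in> W ==> e \<in> core_fibre m ==> l < r ==>
   vco DA (zer SA m) r (%l. c l m) e l = t l e"
  "!!l. l < r ==> smooth_real (tot DA) {d \<in> core_set D. dvb_proj D d \<in> W} (t l)"
proof -
 have zp: "zer SA m0 \<in> pts (base DA)" using zSA[OF m0] fibreD(1) by simp
 obtain O' k f \<tau> where O': "zer SA m0 \<in> O'" and fr: "frame_coframe DA O' k f \<tau>" by (rule vb_frame[OF vDA zp])
 have m0B: "m0 \<in> pts (base SB)" using m0 by simp
 obtain W1 q e \<beta> where W1: "m0 \<in> W1" and frB: "frame_coframe SB W1 q e \<beta>" by (rule vb_frame[OF vSB m0B])
 have idM: "smooth_on MM (pts MM) (%m. m) MM" by (rule smooth_on_id[OF preM subset_refl])
 define W2 where "W2 = W1 \<inter> {m \<in> pts MM. zer SA m \<in> O'}"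
 have oO: "openin (mtop (tot SA)) O'" using frame_open[OF vDA fr] by simp
 have oW1: "openin (mtop MM) W1" using frame_open[OF vSB frB] by simp
 have oW2: "openin (mtop MM) W2"
  unfolding W2_def
  by (rule openin_Int[OF oW1 openin_smooth_preimage[OF preM preA openin_mtop_pts[OF preM] smooth_zerSA[OF preM idM] oO]])
 have W2: "m \<in> pts MM" "m \<in> W1" "zer SA m \<in> O'" if "m \<in> W2" for m using that by (auto simp: W2_def)
 have m02: "m0 \<in> W2" using m0 W1 O' by (simp add: W2_def)
 have W2M: "W2 \<subseteq> pts MM" using W2(1) by blast
 have idW2: "smooth_on MM W2 (%m. m) MM" by (rule smooth_on_subset[OF idM W2M])
 have sp: "fibre_space (fibre DA (zer SA m)) (add DA) (scl DA) (zer DA (zer SA m))" if "m \<in> pts MM" for m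
  by (rule spA[OF cell_zA[OF zSA[OF that]]])
 define u where "u j m = zer DB (e j m)" for j m
 have e_in: "e j m \<in> fibre SB m" if "j < q" "m \<in> W1" for j m by (rule frame_in[OF vSB frB that])
 have u_cell: "u j m \<in> cell (zer SA m) (e j m)" if "j < q" "m \<in> W1" for j m
  unfolding u_def by (rule cell_zB[OF e_in[OF that]])
 interpret F0: fibre_space "fibre DA (zer SA m0)" "add DA" "scl DA" "zer DA (zer SA m0)" by (rule sp[OF m0])
 note b0 = frame_basis(1)[OF vDA fr O'] and b0c = frame_basis(2)[OF vDA fr O']
 have projB_lc: "proj DB (vlc DA (zer SA m) n a x) =
   vlc SB m n a (%i. proj DB (x i))"
  if "m \<in> pts MM" "!!i. i < n ==> x i \<in> fibre DA (zer SA m)" for m n a x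
  by (rule cell_B[OF lc_cellA[OF zSA[OF that(1)]]]) (use that(2) in \<open>simp add: cell_def fibre_def\<close>)
 have indep: "\<forall>i<q. a i = 0" if "F0.lc q a (%j. u j m0) = zer DA (zer SA m0)" for a
 proof -
  interpret S0: fibre_space "fibre SB m0" "add SB" "scl SB" "zer SB m0" by (rule spSB[OF m0])
  have "S0.lc q a (%j. e j m0) = S0.lc q a (%j. proj DB (u j m0))"
   using cell_B[OF u_cell[OF _ W1]] by (intro lin_comb_cong) auto
  also have "\<dots> = proj DB (F0.lc q a (%j. u j m0))"
   by (rule projB_lc[OF m0, symmetric]) (rule cell_fA[OF u_cell[OF _ W1]])
  also have "\<dots> = zer SB m0" unfolding that by (rule cell_B[OF cell_zA[OF zSA[OF m0]]])
  finally have 1: "S0.lc q a (%j. e j m0) = zer SB m0" .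
  note fb = frame_basis(1)[OF vSB frB W1]
  have "a i = 0" if i: "i < q" for i
  proof -
   have "a i = vco SB m0 q (%j. e j m0) (S0.lc q a (%j. e j m0)) i"
    by (rule S0.coeffs_lc[OF fb i, symmetric])
   also have "\<dots> = vco SB m0 q (%j. e j m0) (S0.lc q (%j. 0) (%j. e j m0)) i"
    using 1 S0.lc_zero[OF e_in[OF _ W1], of q] by simp
   also have "\<dots> = 0" by (rule S0.coeffs_lc[OF fb i])
   finally show ?thesis .
  qed
  then show ?thesis by blast
 qed
 obtain N w where N: "q \<le> N" "!!i. i < q ==> w i = u i m0" "F0.basis N w"
  by (rule F0.extend_to_basis[OF b0, of q "%j. u j m0", OF cell_fA[OF u_cell[OF _ W1]] indep], assumption, assumption)
   (rule that; assumption)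
 have Nk: "N = k" by (rule F0.basis_card[OF N(3) b0])
 define r where "r = k - q"
 have kr: "k = q + r" using N(1) Nk by (simp add: r_def)
 define v where "v l m = vlc DA (zer SA m) k (%i. \<tau> i (w (q + l))) (%i. f i (zer SA m))" for l m
 have f_in: "f i (zer SA m) \<in> fibre DA (zer SA m)" if "i < k" "m \<in> W2" for i m
  by (rule frame_in[OF vDA fr that(1) W2(3)[OF that(2)]])
 have v_in: "v l m \<in> fibre DA (zer SA m)" if "m \<in> W2" for l m
  unfolding v_def by (rule fibre_space.lc_in[OF sp[OF W2(1)[OF that]]]) (rule f_in[OF _ that])
 have v0: "v l m0 = w (q + l)" if "l < r" for l
  unfolding v_def by (rule frame_expand[OF vDA fr O']) (rule F0.basis_in[OF N(3)], use that kr Nk in simp)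
 define y where "y i m = (if i < q then u i m else v (i - q) m)" for i m
 have y_in: "y i m \<in> fibre DA (zer SA m)" if "m \<in> W2" for i m
  using cell_fA[OF u_cell[OF _ W2(2)[OF that]]] v_in[OF that] by (simp add: y_def)
 have y0: "y i m0 = w i" if "i < k" for i
  using that N(2)[of i] v0[of "i - q"] kr by (simp add: y_def)
 have zW2: "smooth_on MM W2 (%m. zer SA m) (tot SA)" by (rule smooth_zerSA[OF preM idW2])
 have u_smooth: "smooth_on MM W2 (u j) (tot DA)" if "j < q" for j
  unfolding u_def
  by (rule smooth_zerDB[OF preM smooth_on_subset[OF frame_smooth[OF vSB frB that, unfolded baseB]]]) (use W2(2) in blast)
 have v_smooth: "smooth_on MM W2 (v l) (tot DA)" for l
  unfolding v_def
 proof (rule vb_smooth_lin_comb[OF vDA preM])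
  show "smooth_on MM W2 (%m. zer SA m) (base DA)" using zW2 by simp
  fix i assume i: "i < k"
  show "smooth_on MM W2 (%m. f i (zer SA m)) (tot DA)"
   by (rule smooth_on_compose[OF preM preA preD frame_smooth[OF vDA fr i, unfolded baseDA] zW2 W2(3)])
  show "proj DA (f i (zer SA m)) = zer SA m" if "m \<in> W2" for m using fibreD(2)[OF f_in[OF i that]] .
  show "smooth_real MM W2 (%m. \<tau> i (w (q + l)))" by (rule smooth_real_const[OF preM W2M])
 qed
 have y_smooth: "smooth_on MM W2 (y i) (tot DA)" for i
  unfolding y_def using u_smooth[of i] v_smooth[of "i - q"] by (cases "i < q") simp_all
 define a where "a i j m = \<tau> j (y i m)" for i j m
 have a_smooth: "smooth_real MM W2 (a i j)" if "j < k" for i j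
  unfolding a_def
  by (rule coframe_compose[OF vDA fr preM y_smooth _ that]) (use fibreD(2)[OF y_in] W2(3) in simp)
 have "mat_inv k (%i j. a i j m0) (%i j. vco DA (zer SA m0) k w (f i (zer SA m0)) j)"
  unfolding mat_inv_def a_def
 proof (intro allI impI)
  fix i l assume il: "i < k" "l < k"
  have "(\<Sum>j<k. vco DA (zer SA m0) k (%i. f i (zer SA m0)) (w i) j *
    vco DA (zer SA m0) k w (f j (zer SA m0)) l) = (if i = l then 1 else 0)"
   by (rule F0.basis_change[OF b0 N(3)[unfolded Nk] il])
  then show "(\<Sum>j<k. \<tau> j (y i m0) * vco DA (zer SA m0) k w (f j (zer SA m0)) l) =
    (if i = l then 1 else 0)"
   using b0c[OF F0.basis_in[OF N(3)[unfolded Nk] il(1)]] y0[OF il(1)] by simp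
 qed
 note inv0 = this
 obtain W3 where W3: "openin (mtop MM) W3" "m0 \<in> W3"
  "!!m. m \<in> W2 ==> m \<in> W3 ==> \<exists>b. mat_inv k (%i j. a i j m) b"
  by (rule matrix_invertible_near[OF preM W2M a_smooth m02 inv0]) (assumption | rule that; assumption)+
 define W where "W = W2 \<inter> W3"
 have WM: "W \<subseteq> pts MM" and WW2: "W \<subseteq> W2" using W2M by (auto simp: W_def)
 have invW: "\<exists>b. mat_inv k (%i j. a i j m) b" if "m \<in> W" for m using W3(3) that by (simp add: W_def)
 obtain bb where bb: "!!i j. i < k ==> j < k ==> smooth_real MM W (bb i j)"
  "!!m. m \<in> W ==> mat_inv k (%i j. a i j m) (%i j. bb i j m)"
  by (rule smooth_matrix_inverse[OF preM WM smooth_real_subset[OF a_smooth WW2] invW]) (assumption | rule that; assumption)+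
 define c where "c l m = add DA (v l m) (scl DA (- 1) (zer DB (proj DB (v l m))))" for l m
 define t where "t l d = (\<Sum>j<k. \<tau> j d * bb j (q + l) (dvb_proj D d))" for l d
 have vB: "proj DB (v l m) \<in> fibre SB m" if "m \<in> W2" for l m
  by (rule cell_side[OF _ zSA[OF W2(1)[OF that]], of "v l m"]) (use v_in[OF that] in \<open>simp add: cell_def fibre_def\<close>)
 have v_cell: "v l m \<in> cell (zer SA m) (proj DB (v l m))" if "m \<in> W2" for l m
  using v_in[OF that, of l] by (simp add: cell_def fibre_def)
 have c_core: "c l m \<in> core_fibre m" if "m \<in> W2" for l m
  using cell_addA[OF v_cell[OF that, of l] cell_sclA[OF cell_zB[OF vB[OF that, of l]], of "- 1"]]
   fibre_space.pl_neg[OF spSB[OF W2(1)[OF that]] vB[OF that, of l]]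
  unfolding c_def by simp
 have c_smooth: "smooth_on MM W2 (c l) (tot DA)" for l
  unfolding c_def
 proof (rule vb_smooth_add[OF vDA preM v_smooth vb_smooth_scl[OF vDA preM _ smooth_real_const[OF preM W2M]]])
  show "smooth_on MM W2 (%m. zer DB (proj DB (v l m))) (tot DA)"
   by (rule smooth_zerDB[OF preM smooth_projB[OF preM v_smooth]])
  show "proj DA (v l m) = proj DA (scl DA (- 1) (zer DB (proj DB (v l m))))" if "m \<in> W2" for m
   using cell_A[OF v_cell[OF that]] cell_A[OF cell_sclA[OF cell_zB[OF vB[OF that]]]] by simp
 qed
 have y_basis: "vbasis DA (zer SA m) k (%i. y i m)"
  and t_coeffs: "!!d l. d \<in> fibre DA (zer SA m) ==> l < r ==>
   vco DA (zer SA m) k (%i. y i m) d (q + l) = t l d"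
  if mW: "m \<in> W" for m
 proof -
  note m2 = subsetD[OF WW2 mW]
  interpret F: fibre_space "fibre DA (zer SA m)" "add DA" "scl DA" "zer DA (zer SA m)" by (rule sp[OF W2(1)[OF m2]])
  note fb = frame_basis[OF vDA fr W2(3)[OF m2]]
  have mi: "mat_inv k (%i j. vco DA (zer SA m) k (%i. f i (zer SA m)) (y i m) j) (%i j. bb i j m)"
   using bb(2)[OF mW] fb(2)[OF y_in[OF m2]] unfolding mat_inv_def a_def by simp
  show "F.basis k (%i. y i m)" by (rule F.basis_invertible(1)[OF fb(1) y_in[OF m2] mi])
  fix d l assume d: "d \<in> fibre DA (zer SA m)" and l: "l < r"
  have "dvb_proj D d = m" using d zSA[OF W2(1)[OF m2]] by (simp add: dvb_proj_def fibre_def)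
  then show "vco DA (zer SA m) k (%i. y i m) d (q + l) = t l d"
   using F.basis_invertible(2)[OF fb(1) y_in[OF m2] mi d, of "q + l"] l kr fb(2)[OF d] by (simp add: t_def)
 qed
 have zero_B: "zer DB b = vlc DA (zer SA m) k
   (%i. if i < q then \<beta> i b else 0) (%i. y i m)"
  if mW: "m \<in> W" and b: "b \<in> fibre SB m" for m b
 proof -
  note m2 = subsetD[OF WW2 mW]
  interpret F: fibre_space "fibre DA (zer SA m)" "add DA" "scl DA" "zer DA (zer SA m)" by (rule sp[OF W2(1)[OF m2]])
  interpret S: fibre_space "fibre SB m" "add SB" "scl SB" "zer SB m" by (rule spSB[OF W2(1)[OF m2]])
  have "zer DB b = zer DB (S.lc q (%i. \<beta> i b) (%i. e i m))"
   by (simp only: frame_expand[OF vSB frB W2(2)[OF m2] b])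
  also have "\<dots> = F.lc q (%i. \<beta> i b) (%i. u i m)"
   unfolding u_def
   by (rule S.lc_map[OF sp[OF W2(1)[OF m2]]])
    (rule cell_fA[OF cell_zB] zer_addB zer_sclB e_in[OF _ W2(2)[OF m2]]; assumption)+
  also have "\<dots> = F.lc (q + r') (%i. if i < q then \<beta> i b else 0) (%i. y i m)" for r'
  proof (induction r')
   case 0
   then show ?case by (auto intro!: lin_comb_cong simp: y_def)
  next
   case (Suc r')
   have "F.lc (q + r') (%i. if i < q then \<beta> i b else 0) (%i. y i m) \<in> fibre DA (zer SA m)"
    by (rule F.lc_in) (rule y_in[OF m2])
   then show ?case using Suc by (simp add: F.sc_zero[OF y_in[OF m2]] F.pl_z)
  qed
  finally show ?thesis using kr by simp
 qed
 have core_b: "fibre_space.basis (core_fibre m) (add DA) (scl DA) (zer DA (zer SA m)) r (%l. c l m)"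
  and core_c: "!!d l. d \<in> core_fibre m ==> l < r ==>
   vco DA (zer SA m) r (%l. c l m) d l = t l d"
  if mW: "m \<in> W" for m
 proof -
  note m2 = subsetD[OF WW2 mW]
  note mM = W2(1)[OF m2]
  interpret F: fibre_space "fibre DA (zer SA m)" "add DA" "scl DA" "zer DA (zer SA m)" by (rule sp[OF mM])
  interpret K: fibre_space "core_fibre m" "add DA" "scl DA" "zer DA (zer SA m)" by (rule core_fibre_space[OF mM])
  note yb = y_basis[OF mW]
  have tt: "t l d = F.coeffs k (%i. y i m) d (q + l)" if "d \<in> fibre DA (zer SA m)" "l < r" for l d
   by (rule t_coeffs[OF mW that, symmetric])
  have t_add: "t l (add DA d d') = t l d + t l d'" if "l < r" "d \<in> core_fibre m" "d' \<in> core_fibre m" for l d d'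
   using tt core_fA[OF mM] that core_add[OF mM] F.coeffs_add[OF yb] by simp
  have t_scl: "t l (scl DA x d) = x * t l d" if "l < r" "d \<in> core_fibre m" for l d x
   using tt core_fA[OF mM] that core_scl[OF mM] F.coeffs_scale[OF yb] by simp
  have t_zB: "F.coeffs k (%i. y i m) (zer DB b) (q + l) = 0" if "l < r" "b \<in> fibre SB m" for l b
   unfolding zero_B[OF mW that(2)] using F.coeffs_lc[OF yb, of "q + l" "%i. if i < q then \<beta> i b else 0"] that(1) kr by simp
  have zBf: "zer DB (proj DB (v l m)) \<in> fibre DA (zer SA m)" for l by (rule cell_fA[OF cell_zB[OF vB[OF m2]]])
  have t_c: "t l (c j m) = (if l = j then 1 else 0)" if "l < r" "j < r" for l j
  proof -
   have "t l (c j m) = F.coeffs k (%i. y i m) (v j m) (q + l)"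
    using tt[OF core_fA[OF mM c_core[OF m2]] that(1)] t_zB[OF that(1) vB[OF m2, of j]]
    by (simp add: c_def F.coeffs_add[OF yb v_in[OF m2] F.sc_in[OF zBf]] F.coeffs_scale[OF yb zBf])
   also have "v j m = y (q + j) m" by (simp add: y_def)
   finally show ?thesis using F.coeffs_basis[OF yb, of "q + j" "q + l"] that kr by simp
  qed
  have span: "d = K.lc r (%l. t l d) (%l. c l m)" if d: "d \<in> core_fibre m" for d
  proof -
   let ?s = "K.lc r (%l. t l d) (%l. c l m)"
   have s: "?s \<in> core_fibre m" by (rule K.lc_in) (rule c_core[OF m2])
   define x where "x = add DA d (scl DA (- 1) ?s)"
   have x: "x \<in> core_fibre m" unfolding x_def by (rule core_add[OF mM d core_scl[OF mM s]])
   have tx: "t l x = 0" if l: "l < r" for l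
   proof -
    have "t l ?s = (\<Sum>j<r. t j d * t l (c j m))"
     by (rule K.lc_real) (rule t_add[OF l] t_scl[OF l] c_core[OF m2]; assumption?)+
    also have "\<dots> = (\<Sum>j<r. if j = l then t j d else 0)" using l t_c by (intro sum.cong) auto
    finally have "t l ?s = t l d" using l by simp
    then show ?thesis unfolding x_def using t_add[OF l d core_scl[OF mM s]] t_scl[OF l s] by simp
   qed
   \<comment> \<open>All \<open>v\<close>-coefficients of \<open>x\<close> vanish, so \<open>x\<close> is the zero of \<open>D \<rightarrow> B\<close> over its projection.\<close>
   let ?co = "F.coeffs k (%i. y i m) x"
   have co0: "?co i = 0" if "i < k" "\<not> i < q" for i
    using tt[OF core_fA[OF mM x], of "i - q"] tx[of "i - q"] that kr by simp
   interpret S: fibre_space "fibre SB m" "add SB" "scl SB" "zer SB m" by (rule spSB[OF mM])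
   define b where "b = S.lc q ?co (%i. e i m)"
   have b: "b \<in> fibre SB m" unfolding b_def by (rule S.lc_in) (rule e_in[OF _ W2(2)[OF m2]])
   have "\<beta> i b = ?co i" if "i < q" for i
    using frame_basis(2)[OF vSB frB W2(2)[OF m2] b that] S.coeffs_lc[OF frame_basis(1)[OF vSB frB W2(2)[OF m2]] that]
    by (simp add: b_def)
   then have "zer DB b = F.lc k ?co (%i. y i m)"
    unfolding zero_B[OF mW b] using co0 by (intro lin_comb_cong) auto
   then have xb: "x = zer DB b" using F.lc_coeffs[OF yb core_fA[OF mM x]] by simp
   have "b = proj DB x" unfolding xb by (rule cell_B[OF cell_zB[OF b], symmetric])
   also have "\<dots> = zer SB m" using x by (rule cell_B)
   finally have "x = zer DA (zer SA m)" using xb zz[OF mM] by simp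
   then have "add DA ?s x = ?s" using K.pl_z[OF s] by simp
   then show ?thesis using K.pl_diff_eq[OF d s] unfolding x_def by simp
  qed
  show "K.basis r (%l. c l m)" by (rule K.basis_dual(1)[where t = t, OF c_core[OF m2] t_add t_scl t_c span])
  fix d l assume dl: "d \<in> core_fibre m" "l < r"
  show "K.coeffs r (%l. c l m) d l = t l d"
   by (rule K.basis_dual(2)[where t = t, OF c_core[OF m2] t_add t_scl t_c span dl])
 qed
 have t_smooth: "smooth_real (tot DA) {d \<in> core_set D. dvb_proj D d \<in> W} (t l)" (is "smooth_real _ ?Z _")
  if l: "l < r" for l
 proof -
  have Z: "?Z \<subseteq> total D" by (auto simp: core_set_def)
  have FW: "d \<in> core_fibre (dvb_proj D d)" "dvb_proj D d \<in> W" if d: "d \<in> ?Z" for d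
   using d core_set_fibre[of "dvb_proj D d"] WM by blast+
  have sb: "smooth_on (tot DA) ?Z (dvb_proj D) MM" by (rule smooth_on_subset[OF dvb_proj_smooth Z])
  show ?thesis
   unfolding t_def
  proof (intro smooth_real_sum[OF preD Z] smooth_real_mult[OF preD])
   fix j assume j: "j \<in> {..<k}"
   show "smooth_real (tot DA) ?Z (\<tau> j)"
   proof (rule coframe_compose[OF vDA fr preD smooth_on_id[OF preD Z]])
    fix d assume d: "d \<in> ?Z"
    have "dvb_proj D d \<in> W2" using FW(2)[OF d] WW2 by blast
    then show "proj DA d \<in> O'" using FW(1)[OF d] W2(3) by (simp add: cell_def)
   qed (use j in simp)
   show "smooth_real (tot DA) ?Z (%d. bb j (q + l) (dvb_proj D d))"
    by (rule smooth_real_compose[OF preD preM bb(1) sb]) (use j l kr in simp_all)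
  qed
 qed
 show ?thesis
 proof (rule that[of W r c t])
  show "m0 \<in> W" using m02 W3 by (simp add: W_def)
  show "openin (mtop MM) W" unfolding W_def by (rule openin_Int[OF oW2 W3(1)])
  show "smooth_on MM W (c l) (tot DA)" for l by (rule smooth_on_subset[OF c_smooth WW2])
  show "fibre_space.basis (core_fibre m) (add DA) (scl DA) (zer DA (zer SA m)) r (%l. c l m)" if "m \<in> W" for m
   by (rule core_b[OF that])
  show "vco DA (zer SA m) r (%l. c l m) e l = t l e"
   if "m \<in> W" "e \<in> core_fibre m" "l < r" for m e l
   by (rule core_c[OF that])
  show "smooth_real (tot DA) {d \<in> core_set D. dvb_proj D d \<in> W} (t l)" if "l < r" for l
   by (rule t_smooth[OF that])
 qed
qed

end

lemma local_frameI:
 assumes W: "openin (mtop M) W" and sec: "!!i. i < k ==> sec W (s i)"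
  and sp: "!!m. m \<in> W ==> fibre_space {e \<in> P. q e = m} pl sc (z m)"
  and b: "!!m. m \<in> W ==> fibre_space.basis {e \<in> P. q e = m} pl sc (z m) k (%i. s i m)"
 shows "local_frame M P q pl sc z sec W k s"
 unfolding local_frame_def
proof (intro conjI allI impI ballI W)
 fix i m assume "i < k" "m \<in> W"
 then have "s i m \<in> {e \<in> P. q e = m}" using fibre_space.basis_in[OF sp b] by blast
 then show "s i m \<in> P" "q (s i m) = m" by auto
next
 fix e assume e: "e \<in> P" "q e \<in> W"
 interpret fibre_space "{e' \<in> P. q e' = q e}" pl sc "z (q e)" by (rule sp[OF e(2)])
 have "e \<in> {e' \<in> P. q e' = q e}" using e(1) by simp
 then show "\<exists>!c. c \<in> espace k \<and> e = lin_comb pl sc (z (q e)) k c (%i. s i (q e))"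
  using b[OF e(2)] unfolding basis_def by (elim conjE) (rule bspec)
qed (rule sec)

context dvb
begin

abbreviation "core_zero \<equiv> (%m. zer DA (zer SA m))"
abbreviation "core_sec \<equiv> (%W s. smooth_on MM W s (tot DA))"

lemma core_reference:
 assumes m: "m \<in> pts MM"
 obtains W r c t where "m \<in> W" "local_frame MM (core_set D) (dvb_proj D) (add DA) (scl DA) core_zero core_sec W r c"
  "!!l. l < r ==> smooth_on MM W (c l) (tot DA)" "!!l m. l < r ==> m \<in> W ==> c l m \<in> core_fibre m"
  "!!m e l. m \<in> W ==> e \<in> core_fibre m ==> l < r ==>
   vco DA (zer SA m) r (%l. c l m) e l = t l e"
  "!!l. l < r ==> smooth_real (tot DA) {d \<in> core_set D. dvb_proj D d \<in> W} (t l)"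
proof -
 obtain W r c t where W: "m \<in> W" "openin (mtop MM) W"
  and c: "!!l. l < r ==> smooth_on MM W (c l) (tot DA)"
  and b: "!!m. m \<in> W ==> fibre_space.basis (core_fibre m) (add DA) (scl DA) (core_zero m) r (%l. c l m)"
  and co: "!!m e l. m \<in> W ==> e \<in> core_fibre m ==> l < r ==>
   vco DA (zer SA m) r (%l. c l m) e l = t l e"
  and t: "!!l. l < r ==> smooth_real (tot DA) {d \<in> core_set D. dvb_proj D d \<in> W} (t l)"
  by (rule core_frame[OF m]) (rule that; assumption)
 have WM: "m \<in> pts MM" if "m \<in> W" for m using openin_mtop_subset[OF preM W(2)] that by blast
 have lf: "local_frame MM (core_set D) (dvb_proj D) (add DA) (scl DA) core_zero core_sec W r c"
  by (rule local_frameI[where sec = core_sec and s = c, OF W(2) c]) (simp_all add: core_set_fibre[OF WM] core_fibre_space[OF WM] b)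
 have cc: "c l m \<in> core_fibre m" if "l < r" "m \<in> W" for l m
  by (rule fibre_space.basis_in[OF core_fibre_space[OF WM[OF that(2)]] b[OF that(2)] that(1)])
 show ?thesis by (rule that[of W r c t]) (rule W lf c cc co t; assumption?)+
qed

sublocale core: section_bundle MM "core_set D" "dvb_proj D" "add DA" "scl DA" core_zero core_sec
proof
 show "smooth_manifold MM" by (rule vb_base_smooth[OF vSA])
 show "dvb_proj D e \<in> pts MM" if "e \<in> core_set D" for e
 proof -
  obtain m where m: "m \<in> pts MM" "e \<in> core_fibre m"
   by (rule bexE[OF \<open>e \<in> core_set D\<close>[unfolded core_set_iff]]) (rule that; assumption)
  show ?thesis unfolding core_proj[OF m] by (rule m)
 qed
 show "vector_space_laws {e \<in> core_set D. dvb_proj D e = m} (add DA) (scl DA) (core_zero m)" if "m \<in> pts MM" for m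
  unfolding core_set_fibre[OF that] by (rule fibre_space.laws[OF core_fibre_space[OF that]])
 fix m assume m: "m \<in> pts MM"
 obtain W r c t where W: "m \<in> W" and lf: "local_frame MM (core_set D) (dvb_proj D) (add DA) (scl DA) core_zero core_sec W r c"
  and co: "!!m e l. m \<in> W ==> e \<in> core_fibre m ==> l < r ==>
   vco DA (zer SA m) r (%l. c l m) e l = t l e"
  and t: "!!l. l < r ==> smooth_real (tot DA) {d \<in> core_set D. dvb_proj D d \<in> W} (t l)"
  by (rule core_reference[OF m]) (rule that; assumption)
 have oW: "openin (mtop MM) W" using lf unfolding local_frame_def by (rule conjunct1)
 have WM: "m \<in> pts MM" if "m \<in> W" for m using openin_mtop_subset[OF preM oW] that by blast
 have good: "smooth_real MM (W \<inter> W') (%m. vco DA (zer SA m) r (%j. c j m) (s m) i)"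
  if s: "smooth_on MM W' s (tot DA)" "\<forall>m\<in>W'. s m \<in> core_set D \<and> dvb_proj D (s m) = m" and i: "i < r" for W' s i
 proof -
  have "smooth_real MM (W \<inter> W') (%m. t i (s m))"
   by (rule smooth_real_compose[OF preM preD t[OF i] smooth_on_subset[OF s(1)]]) (use s(2) in auto)
  then show ?thesis
  proof (rule smooth_real_cong)
   fix m assume m: "m \<in> W \<inter> W'"
   then have "s m \<in> core_fibre m" using s(2) core_set_fibre[of m] WM[of m] by blast
   with m show "t i (s m) = vco DA (zer SA m) r (%j. c j m) (s m) i"
    using co[OF _ _ i, of m "s m"] by simp
  qed
 qed
 show "\<exists>W k s. m \<in> W \<and> local_frame MM (core_set D) (dvb_proj D) (add DA) (scl DA) core_zero core_sec W k s \<and>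
   (\<forall>W' t. openin (mtop MM) W' \<longrightarrow> smooth_on MM W' t (tot DA) \<longrightarrow> (\<forall>m\<in>W'. t m \<in> core_set D \<and> dvb_proj D (t m) = m) \<longrightarrow>
    (\<forall>i<k. smooth_real MM (W \<inter> W') (%m. vco DA (zer SA m) k (%j. s j m) (t m) i)))"
  by (rule exI[of _ W], rule exI[of _ r], rule exI[of _ c], intro conjI allI impI) (rule W, rule lf, rule good)
qed

lemma core_eq: "core D = core.FB"
 by (simp add: core_def)

lemma vector_bundle_core: "vector_bundle (core D)"
 unfolding core_eq by (rule core.vector_bundle_FB)

lemma core_simps [simp]:
 "base (core D) = MM" "proj (core D) = dvb_proj D" "add (core D) = add DA" "scl (core D) = scl DA"
 "zer (core D) = core_zero"
 by (simp_all add: core_def frame_bundle_def)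

lemma tot_core: "tot (core D) = core.FA"
 by (simp add: core_def frame_bundle_def)

lemma fibre_core_iff: "c \<in> fibre (core D) m \<longleftrightarrow> m \<in> pts MM \<and> c \<in> core_fibre m"
proof
 assume c: "c \<in> fibre (core D) m"
 have m: "m \<in> pts MM" using vb_fibre_base[OF vector_bundle_core c] by simp
 have "c \<in> {c \<in> core_set D. dvb_proj D c = m}" using c unfolding core_eq core.fibre_FB .
 then show "m \<in> pts MM \<and> c \<in> core_fibre m" using m core_set_fibre[OF m] by simp
next
 assume "m \<in> pts MM \<and> c \<in> core_fibre m"
 then show "c \<in> fibre (core D) m" unfolding core_eq core.fibre_FB using core_set_fibre[of m] by blast
qed

text \<open>The core is a submanifold of \<open>D\<close>: a map into it is smooth if and only if it is smooth as a map into \<open>D\<close>.\<close>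

lemma core_smooth_into:
 assumes L: "pre_manifold L" and F: "smooth_on L Z F (tot DA)" and Fc: "!!z. z \<in> Z ==> F z \<in> fibre (core D) (b z)"
 shows "smooth_on L Z F (tot (core D))"
 unfolding tot_core
proof (rule smooth_on_local[OF L core.pre_manifold_FA])
 have Fm: "b z \<in> pts MM" "F z \<in> core_fibre (b z)" "dvb_proj D (F z) = b z" "F z \<in> core_set D" "F z \<in> total D" if "z \<in> Z" for z
 proof -
  show 1: "b z \<in> pts MM" "F z \<in> core_fibre (b z)" using Fc[OF that] fibre_core_iff by auto
  show "dvb_proj D (F z) = b z" by (rule core_proj[OF 1])
  show "F z \<in> core_set D" using 1 core_set_iff by blast
  show "F z \<in> total D" using 1(2) by (rule cell_total)
 qed
 have sb: "smooth_on L Z (%z. dvb_proj D (F z)) MM"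
  by (rule smooth_on_compose[OF L preD preM dvb_proj_smooth F Fm(5)])
 fix p assume p: "p \<in> Z"
 obtain W r c t where W: "b p \<in> W" and lf: "local_frame MM (core_set D) (dvb_proj D) (add DA) (scl DA) core_zero core_sec W r c"
  and co: "!!m e l. m \<in> W ==> e \<in> core_fibre m ==> l < r ==>
   vco DA (zer SA m) r (%l. c l m) e l = t l e"
  and t: "!!l. l < r ==> smooth_real (tot DA) {d \<in> core_set D. dvb_proj D d \<in> W} (t l)"
  by (rule core_reference[OF Fm(1)[OF p]]) (rule that; assumption)
 have "dvb_proj D (F p) \<in> W" using W Fm(3)[OF p] by simp
 from smooth_on_preimage[OF L preM sb p core.frame_open[OF lf] this]
 obtain W' where W': "openin (mtop L) W'" "p \<in> W'" "(%z. dvb_proj D (F z)) ` (Z \<inter> W') \<subseteq> W" by blast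
 have sub: "Z \<inter> W' \<subseteq> Z" by blast
 have inW: "dvb_proj D (F z) \<in> W" if "z \<in> Z \<inter> W'" for z using W'(3) that by blast
 have "smooth_on L (Z \<inter> W') F core.FA"
 proof (rule core.smooth_into_FA[OF L lf])
  show "F z \<in> core_set D" "dvb_proj D (F z) \<in> W" if "z \<in> Z \<inter> W'" for z using Fm(4)[of z] inW[OF that] that by auto
  show "smooth_on L (Z \<inter> W') (%p. dvb_proj D (F p)) MM" by (rule smooth_on_subset[OF sb sub])
  fix i assume i: "i < r"
  have "smooth_real L (Z \<inter> W') (%z. t i (F z))"
   by (rule smooth_real_compose[OF L preD t[OF i] smooth_on_subset[OF F sub]]) (use Fm(4) inW in simp)
  then show "smooth_real L (Z \<inter> W') (%p. core.cf r c (F p) i)"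
  proof (rule smooth_real_cong)
   fix z assume z: "z \<in> Z \<inter> W'"
   then show "t i (F z) = core.cf r c (F z) i" using co[OF inW[OF z] _ i, of "F z"] Fm(2,3)[of z] by simp
  qed
 qed
 then show "\<exists>W. openin (mtop L) W \<and> p \<in> W \<and> smooth_on L (Z \<inter> W) F core.FA" using W'(1,2) by blast
qed

lemma core_smooth_incl:
 assumes L: "pre_manifold L" and F: "smooth_on L Z F (tot (core D))"
 shows "smooth_on L Z F (tot DA)"
proof (rule smooth_on_local[OF L preD])
 note F' = F[unfolded tot_core]
 have FP: "F z \<in> core_set D" if "z \<in> Z" for z using smooth_on_image_pts[OF L F' that] by (simp add: core.pts_FA)
 have sb: "smooth_on L Z (%z. dvb_proj D (F z)) MM"
  by (rule smooth_on_compose[OF L core.pre_manifold_FA preM core.smooth_q F' FP])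
 fix p assume p: "p \<in> Z"
 obtain W r c where W: "dvb_proj D (F p) \<in> W"
  and lf: "local_frame MM (core_set D) (dvb_proj D) (add DA) (scl DA) core_zero core_sec W r c"
  and c: "!!l. l < r ==> smooth_on MM W (c l) (tot DA)" "!!l m. l < r ==> m \<in> W ==> c l m \<in> core_fibre m"
  by (rule core_reference[OF smooth_on_image_pts[OF L sb p]]) (rule that; assumption)
 from smooth_on_preimage[OF L preM sb p core.frame_open[OF lf] W]
 obtain W' where W': "openin (mtop L) W'" "p \<in> W'" "(%z. dvb_proj D (F z)) ` (Z \<inter> W') \<subseteq> W" by blast
 have sub: "Z \<inter> W' \<subseteq> Z" by blast
 have inW: "dvb_proj D (F z) \<in> W" if "z \<in> Z \<inter> W'" for z using W'(3) that by blast
 note sb' = smooth_on_subset[OF sb sub]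
 have "smooth_on L (Z \<inter> W') (%z. lin_comb (add DA) (scl DA) (zer DA (zer SA (dvb_proj D (F z)))) r
   (%i. core.cf r c (F z) i) (%i. c i (dvb_proj D (F z)))) (tot DA)"
 proof (rule vb_smooth_lin_comb[OF vDA L])
  show "smooth_on L (Z \<inter> W') (%z. zer SA (dvb_proj D (F z))) (base DA)" using smooth_zerSA[OF L sb'] by simp
  fix i assume i: "i < r"
  show "smooth_on L (Z \<inter> W') (%z. c i (dvb_proj D (F z))) (tot DA)"
   by (rule smooth_on_compose[OF L preM preD c(1)[OF i] sb' inW])
  show "proj DA (c i (dvb_proj D (F z))) = zer SA (dvb_proj D (F z))" if "z \<in> Z \<inter> W'" for z
   using c(2)[OF i inW[OF that]] by (rule cell_A)
  show "smooth_real L (Z \<inter> W') (%z. core.cf r c (F z) i)"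
   by (rule smooth_real_compose[OF L core.pre_manifold_FA core.smooth_cf[OF lf] smooth_on_subset[OF F' sub]])
    (use FP inW in simp)
 qed
 then have "smooth_on L (Z \<inter> W') F (tot DA)"
  by (rule smooth_on_cong) (rule core.lc_cf[OF lf FP inW], auto)
 then show "\<exists>W. openin (mtop L) W \<and> p \<in> W \<and> smooth_on L (Z \<inter> W) F (tot DA)" using W'(1,2) by blast
qed


section \<open>Local decompositions\<close>

text \<open>Near \<open>m0\<close> there are smooth elements of \<open>D\<close> over all pairs of frame vectors.  For the zero vector
 of \<open>B\<close> the zero section of \<open>D \<rightarrow> A\<close> provides elements over the frame vectors of \<open>A\<close>; extended by
 constant coefficients they still project to a frame of \<open>A\<close> over nearby vectors of \<open>B\<close>, and
 scaling in \<open>B\<close> reaches the given frame of \<open>B\<close>.\<close>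

lemma lifts_near_zero:
 assumes frA: "frame_coframe SA W p s \<alpha>" and m0: "m0 \<in> W"
 obtains O' dd where "openin (mtop (tot SB)) O'" "zer SB m0 \<in> O'" "!!b. b \<in> O' ==> proj SB b \<in> W"
  "!!i. i < p ==> smooth_on (tot SB) O' (dd i) (tot DA)"
  "!!i b. i < p ==> b \<in> O' ==> dd i b \<in> cell (s i (proj SB b)) b"
proof -
 have m0M: "m0 \<in> pts MM" by (rule frame_W[OF vSA frA m0])
 have zB: "zer SB m0 \<in> fibre SB m0" by (rule zSB[OF m0M])
 have "zer SB m0 \<in> pts (base DB)" using fibreD(1)[OF zB] by simp
 then obtain O1 k f \<tau> where O1: "zer SB m0 \<in> O1" and fr: "frame_coframe DB O1 k f \<tau>" by (rule vb_frame[OF vDB])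
 have oO1: "openin (mtop (tot SB)) O1" using frame_open[OF vDB fr] by simp
 define O2 where "O2 = O1 \<inter> over_set SB W"
 have oW: "openin (mtop (base SB)) W" using frame_open[OF vSA frA] by simp
 have oO2: "openin (mtop (tot SB)) O2" unfolding O2_def by (rule openin_Int[OF oO1 vb_over_open[OF vSB oW]])
 have O2: "b \<in> O1" "proj SB b \<in> W" "b \<in> fibre SB (proj SB b)" if "b \<in> O2" for b
  using that by (auto simp: O2_def over_set_def fibre_def)
 have O2p: "O2 \<subseteq> pts (tot SB)" by (rule openin_mtop_subset[OF preB oO2])
 have z2: "zer SB m0 \<in> O2" unfolding O2_def using O1 over_setI[OF zB m0] by blast
 have idO: "smooth_on (tot SB) O2 (%b. b) (tot SB)" by (rule smooth_on_id[OF preB O2p])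
 have pO: "smooth_on (tot SB) O2 (proj SB) MM" using vb_proj_smooth_compose[OF vSB preB idO] by simp
 define \<kappa> where "\<kappa> i l = \<tau> l (zer DA (s i m0))" for i l
 \<comment> \<open>Extend \<open>0_{s_i(m0)}\<close> with constant coefficients in the frame \<open>f\<close> of \<open>D \<rightarrow> B\<close>.\<close>
 define d0 where "d0 i b = vlc DB b k (\<kappa> i) (%l. f l b)" for i b
 have sm0: "s i m0 \<in> fibre SA m0" if "i < p" for i by (rule frame_in[OF vSA frA that m0])
 have f_in: "f l b \<in> fibre DB b" if "l < k" "b \<in> O2" for l b by (rule frame_in[OF vDB fr that(1) O2(1)[OF that(2)]])
 have d0_in: "d0 i b \<in> fibre DB b" if "b \<in> O2" for i b
  unfolding d0_def by (rule fibre_space.lc_in[OF vb_fibre_space[OF vDB]]) (use that O2p f_in in auto)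
 have d0_smooth: "smooth_on (tot SB) O2 (d0 i) (tot DA)" for i
  unfolding d0_def totB[symmetric]
 proof (rule vb_smooth_lin_comb[OF vDB preB])
  show "smooth_on (tot SB) O2 (%x. x) (base DB)" using idO by simp
  fix l assume l: "l < k"
  show "smooth_on (tot SB) O2 (%b. f l b) (tot DB)"
   by (rule smooth_on_subset[OF frame_smooth[OF vDB fr l, unfolded baseDB]]) (use O2 in blast)
  show "proj DB (f l b) = b" if "b \<in> O2" for b by (rule fibreD(2)[OF f_in[OF l that]])
  show "smooth_real (tot SB) O2 (%x. \<kappa> i l)" by (rule smooth_real_const[OF preB O2p])
 qed
 have d0_z: "d0 i (zer SB m0) = zer DA (s i m0)" if "i < p" for i
  unfolding d0_def \<kappa>_def by (rule frame_expand[OF vDB fr O1 cell_fB[OF cell_zA[OF sm0[OF that]]]])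
 have pA_in: "proj DA d \<in> fibre SA (proj SB b)" if "d \<in> fibre DB b" for d b
  using that projA_in[of d] proj_proj[of d] by (simp add: fibre_def)
 define n where "n i j b = \<alpha> j (proj DA (d0 i b))" for i j b
 have n_smooth: "smooth_real (tot SB) O2 (n i j)" if "j < p" for i j
  unfolding n_def
  by (rule coframe_compose[OF vSA frA preB smooth_projA[OF preB d0_smooth] _ that])
   (use fibreD(2)[OF pA_in[OF d0_in]] O2(2) in simp)
 have "mat_inv p (%i j. n i j (zer SB m0)) (%i j. if i = j then 1 else 0)"
 proof -
  have "n i j (zer SB m0) = (if i = j then 1 else 0)" if "i < p" "j < p" for i j
   using coframe_frame[OF vSA frA that(2,1) m0] cell_A[OF cell_zA[OF sm0[OF that(1)]]]
   by (simp add: n_def d0_z[OF that(1)] eq_commute)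
  then show ?thesis unfolding mat_inv_def by (simp add: if_distrib sum.If_cases cong: if_cong)
 qed
 note n0 = this
 obtain O3 where O3: "openin (mtop (tot SB)) O3" "zer SB m0 \<in> O3"
  "!!b. b \<in> O2 ==> b \<in> O3 ==> \<exists>x. mat_inv p (%i j. n i j b) x"
  by (rule matrix_invertible_near[OF preB O2p n_smooth z2 n0]) (assumption | rule that; assumption)+
 define O' where "O' = O2 \<inter> O3"
 have O'2: "O' \<subseteq> O2" and O'p: "O' \<subseteq> pts (tot SB)" using O2p by (auto simp: O'_def)
 have inv': "\<exists>x. mat_inv p (%i j. n i j b) x" if "b \<in> O'" for b using O3(3) that by (simp add: O'_def)
 obtain \<nu> where \<nu>: "!!i j. i < p ==> j < p ==> smooth_real (tot SB) O' (\<nu> i j)"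
  "!!b. b \<in> O' ==> mat_inv p (%i j. n i j b) (%i j. \<nu> i j b)"
  by (rule smooth_matrix_inverse[OF preB O'p smooth_real_subset[OF n_smooth O'2] inv']) (assumption | rule that; assumption)+
 \<comment> \<open>The inverse matrix corrects the projections to \<open>A\<close>, which move away from the frame \<open>s\<close>.\<close>
 define dd where "dd i b = vlc DB b p (%j. \<nu> i j b) (%j. d0 j b)" for i b
 have dd_smooth: "smooth_on (tot SB) O' (dd i) (tot DA)" if i: "i < p" for i
  unfolding dd_def totB[symmetric]
 proof (rule vb_smooth_lin_comb[OF vDB preB])
  show "smooth_on (tot SB) O' (%x. x) (base DB)" using smooth_on_subset[OF idO O'2] by simp
  fix l assume l: "l < p"
  show "smooth_on (tot SB) O' (%b. d0 l b) (tot DB)" using smooth_on_subset[OF d0_smooth O'2] by simp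
  show "proj DB (d0 l b) = b" if "b \<in> O'" for b by (rule fibreD(2)[OF d0_in]) (use that O'2 in blast)
  show "smooth_real (tot SB) O' (\<nu> i l)" by (rule \<nu>(1)[OF i l])
 qed
 have dd_cell: "dd i b \<in> cell (s i (proj SB b)) b" if i: "i < p" and b: "b \<in> O'" for i b
 proof -
  define m where "m = proj SB b"
  have b2: "b \<in> O2" using b O'2 by blast
  have mW: "m \<in> W" and bm: "b \<in> fibre SB m" using O2[OF b2] by (auto simp: m_def)
  have mM: "m \<in> pts MM" by (rule frame_W[OF vSA frA mW])
  interpret S: fibre_space "fibre SA m" "add SA" "scl SA" "zer SA m" by (rule spSA[OF mM])
  have pj: "proj DA (d0 j b) \<in> fibre SA m" for j using pA_in[OF d0_in[OF b2]] by (simp add: m_def)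
  have "d0 j b \<in> cell (proj DA (d0 j b)) b" for j using d0_in[OF b2, of j] by (simp add: cell_def fibre_def)
  then have 1: "dd i b \<in> cell (S.lc p (%j. \<nu> i j b) (%j. proj DA (d0 j b))) b"
   unfolding dd_def by (intro lc_cellB[OF bm])
  have "S.lc p (%j. \<nu> i j b) (%j. proj DA (d0 j b)) = S.lc p (%j. \<nu> i j b) (%j. S.lc p (%l. n j l b) (%l. s l m))"
   unfolding n_def by (rule lin_comb_cong[OF refl]) (rule frame_expand[OF vSA frA mW pj, symmetric])
  also have "\<dots> = S.lc p (%l. \<Sum>j<p. \<nu> i j b * n j l b) (%l. s l m)"
   by (rule S.lc_lc) (rule frame_in[OF vSA frA _ mW])
  also have "\<dots> = S.lc p (%l. if l = i then 1 else 0) (%l. s l m)"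
   using mat_inv_sym[OF \<nu>(2)[OF b]] i unfolding mat_inv_def by (intro lin_comb_cong) auto
  also have "\<dots> = s i m" by (rule S.lc_delta[OF frame_in[OF vSA frA _ mW] i])
  finally show ?thesis using 1 by (simp add: m_def)
 qed
 show ?thesis
 proof (rule that[of O' dd])
  show "openin (mtop (tot SB)) O'" unfolding O'_def by (rule openin_Int[OF oO2 O3(1)])
  show "zer SB m0 \<in> O'" using z2 O3(2) by (simp add: O'_def)
  show "proj SB b \<in> W" if "b \<in> O'" for b using that O'2 O2(2) by blast
 qed (rule dd_smooth dd_cell; assumption)+
qed

text \<open>Scaling is continuous at the scalar 0.\<close>

lemma small_multiple:
 assumes O': "openin (mtop (tot SB)) O'" "zer SB m \<in> O'" and b: "b \<in> fibre SB m"
 obtains \<epsilon> where "\<epsilon> \<noteq> 0" "scl SB \<epsilon> b \<in> O'"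
proof -
 note cs = pre_manifold_coord_space[of 1]
 have m: "m \<in> pts MM" using vb_fibre_base[OF vSB b] by simp
 have bT: "b \<in> pts (tot SB)" by (rule fibreD(1)[OF b])
 have "smooth_on (coord_space 1) (espace 1) (%u. b) (tot SB)"
  by (rule smooth_on_const[OF cs _ preB bT]) simp
 from vb_smooth_scl[OF vSB cs this smooth_real_coord[OF subset_refl]]
 have sm: "smooth_on (coord_space 1) (espace 1) (%u. scl SB (u 0) b) (tot SB)" .
 have oE: "openin (mtop (coord_space 1)) (espace 1)" by (simp only: openin_coord_space openin_espace)
 have "openin (Euclidean_space 1) {u \<in> espace 1. scl SB (u 0) b \<in> O'}"
  using openin_smooth_preimage[OF cs preB oE sm O'(1)] by (simp only: openin_coord_space)
 moreover have "(%i. 0) \<in> {u \<in> espace 1. scl SB (u 0) b \<in> O'}"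
  using O'(2) fibre_space.sc_zero[OF spSB[OF m] b] by (simp add: topspace_Euclidean_space)
 ultimately show ?thesis
 proof (rule openin_espace_box)
  fix \<delta> :: real
  assume \<delta>: "0 < \<delta>"
  "!!v. v \<in> espace 1 ==> (!!j. j < 1 ==> \<bar>v j - 0\<bar> < \<delta>) ==> v \<in> {u \<in> espace 1. scl SB (u 0) b \<in> O'}"
 have "(%i. if i < 1 then \<delta> / 2 else 0) \<in> {u \<in> espace 1. scl SB (u 0) b \<in> O'}"
  by (rule \<delta>(2)) (use \<delta>(1) espace_trunc[of 1 "%_. \<delta> / 2"] in auto)
 then show thesis using \<delta>(1) by (intro that[of "\<delta> / 2"]) auto
 qed
qed

lemma frame_lifts:
 assumes frA: "frame_coframe SA W p s \<alpha>" and frB: "frame_coframe SB W q e \<beta>" and m0: "m0 \<in> W"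
 obtains W' dd where "openin (mtop MM) W'" "m0 \<in> W'" "W' \<subseteq> W"
  "!!i j. i < p ==> j < q ==> smooth_on MM W' (dd i j) (tot DA)"
  "!!i j m. i < p ==> j < q ==> m \<in> W' ==> dd i j m \<in> cell (s i m) (e j m)"
proof -
 obtain O' d where O': "openin (mtop (tot SB)) O'" "zer SB m0 \<in> O'"
  and d: "!!i. i < p ==> smooth_on (tot SB) O' (d i) (tot DA)"
  "!!i b. i < p ==> b \<in> O' ==> d i b \<in> cell (s i (proj SB b)) b"
  by (rule lifts_near_zero[OF frA m0]) (rule that; assumption)
 have "\<exists>\<epsilon>. \<epsilon> \<noteq> 0 \<and> scl SB \<epsilon> (e j m0) \<in> O'" if "j < q" for j
  by (rule small_multiple[OF O' frame_in[OF vSB frB that m0]]) blast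
 then have "\<forall>j. \<exists>\<epsilon>. j < q \<longrightarrow> \<epsilon> \<noteq> 0 \<and> scl SB \<epsilon> (e j m0) \<in> O'" by blast
 from choice[OF this] obtain \<epsilon> where \<epsilon>: "!!j. j < q ==> \<epsilon> j \<noteq> 0" "!!j. j < q ==> scl SB (\<epsilon> j) (e j m0) \<in> O'" by blast
 have oW: "openin (mtop MM) W" by (rule frame_open[OF vSA frA])
 have WM: "W \<subseteq> pts MM" by (rule openin_mtop_subset[OF preM oW])
 define h where "h j m = scl SB (\<epsilon> j) (e j m)" for j m
 have h_smooth: "smooth_on MM W (h j) (tot SB)" if "j < q" for j
  unfolding h_def by (rule vb_smooth_scl[OF vSB preM frame_smooth[OF vSB frB that, unfolded baseB] smooth_real_const[OF preM WM]])
 have h_in: "h j m \<in> fibre SB m" if "j < q" "m \<in> W" for j m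
  unfolding h_def by (rule vb_scl_in[OF vSB frame_in[OF vSB frB that]])
 define W' where "W' = W \<inter> (\<Inter>j\<in>{..<q}. {m \<in> W. h j m \<in> O'})"
 have oW': "openin (mtop MM) W'"
 proof (cases "q = 0")
  case True
  then show ?thesis using oW by (simp add: W'_def)
 next
  case False
  have "openin (mtop MM) (\<Inter> ((%j. {m \<in> W. h j m \<in> O'}) ` {..<q}))"
   using False openin_smooth_preimage[OF preM preB oW h_smooth O'(1)] by (intro openin_Inter) auto
  then show ?thesis unfolding W'_def by (rule openin_Int[OF oW])
 qed
 have W'W: "W' \<subseteq> W" by (auto simp: W'_def)
 have hO: "h j m \<in> O'" if "j < q" "m \<in> W'" for j m using that by (auto simp: W'_def)
 define dd where "dd i j m = scl DA (inverse (\<epsilon> j)) (d i (h j m))" for i j m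
 show ?thesis
 proof (rule that[of W' dd])
  show "openin (mtop MM) W'" "W' \<subseteq> W" by (fact oW' W'W)+
  show "m0 \<in> W'" using m0 \<epsilon>(2) by (simp add: W'_def h_def)
  fix i j assume ij: "i < p" "j < q"
  have "smooth_on MM W' (%m. d i (h j m)) (tot DA)"
   by (rule smooth_on_compose[OF preM preB preD d(1)[OF ij(1)] smooth_on_subset[OF h_smooth[OF ij(2)] W'W] hO[OF ij(2)]])
  then show "smooth_on MM W' (dd i j) (tot DA)"
   unfolding dd_def by (rule vb_smooth_scl[OF vDA preM]) (rule smooth_real_const[OF preM], use W'W WM in blast)
  fix m assume m: "m \<in> W'"
  have mW: "m \<in> W" using m W'W by blast
  have "d i (h j m) \<in> cell (s i m) (h j m)"
   using d(2)[OF ij(1) hO[OF ij(2) m]] fibreD(2)[OF h_in[OF ij(2) mW]] by simp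
  from cell_sclA[OF this, of "inverse (\<epsilon> j)"]
  have "dd i j m \<in> cell (s i m) (scl SB (inverse (\<epsilon> j)) (h j m))" by (simp add: dd_def)
  moreover have "scl SB (inverse (\<epsilon> j)) (h j m) = e j m"
  proof -
   interpret S: fibre_space "fibre SB m" "add SB" "scl SB" "zer SB m" by (rule spSB) (use mW WM in blast)
   show ?thesis using frame_in[OF vSB frB ij(2) mW] \<epsilon>(1)[OF ij(2)] by (simp add: h_def S.sc_sc S.sc_one)
  qed
  ultimately show "dd i j m \<in> cell (s i m) (e j m)" by simp
 qed
qed

context
 fixes W p s \<alpha> q e \<beta> dd
 assumes frA: "frame_coframe SA W p s \<alpha>" and frB: "frame_coframe SB W q e \<beta>"
  and dd_smooth: "!!i j. i < p ==> j < q ==> smooth_on MM W (dd i j) (tot DA)"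
  and dd_cell: "!!i j m. i < p ==> j < q ==> m \<in> W ==> dd i j m \<in> cell (s i m) (e j m)"
begin

text \<open>The lift of \<open>(a, b)\<close>, linear in \<open>a\<close> for \<open>D \<rightarrow> B\<close> and in \<open>b\<close> for \<open>D \<rightarrow> A\<close>, with values \<open>dd i j\<close> on
 pairs of frame vectors.  It is bilinear in the sense of the two structures of \<open>D\<close>.\<close>

definition rowlift :: "nat => 'b => 'd" where
 "rowlift i b = vlc DA (s i (proj SB b)) q (%j. \<beta> j b) (%j. dd i j (proj SB b))"

definition lift :: "'a => 'b => 'd" where
 "lift a b = vlc DB b p (%i. \<alpha> i a) (%i. rowlift i b)"

lemma lift_M: "m \<in> W ==> m \<in> pts MM" by (rule frame_W[OF vSA frA])

lemma rowlift_eq: "b \<in> fibre SB m ==>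
  rowlift i b = vlc DA (s i m) q (%j. \<beta> j b) (%j. dd i j m)"
 unfolding rowlift_def using fibreD(2) by metis

lemma rowlift_cell:
 assumes "i < p" "m \<in> W" "b \<in> fibre SB m" shows "rowlift i b \<in> cell (s i m) b"
proof -
 have "rowlift i b \<in> cell (s i m) (vlc SB m q (%j. \<beta> j b) (%j. e j m))"
  unfolding rowlift_eq[OF assms(3)]
  by (rule lc_cellA[OF frame_in[OF vSA frA assms(1,2)]]) (rule dd_cell[OF assms(1) _ assms(2)])
 then show ?thesis by (simp only: frame_expand[OF vSB frB assms(2,3)])
qed

lemma rowlift_add:
 assumes i: "i < p" and m: "m \<in> W" and b: "b \<in> fibre SB m" "b' \<in> fibre SB m"
 shows "rowlift i (add SB b b') = add DA (rowlift i b) (rowlift i b')"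
proof -
 interpret F: fibre_space "fibre DA (s i m)" "add DA" "scl DA" "zer DA (s i m)" by (rule spA[OF rowlift_cell[OF i m b(1)]])
 have "rowlift i (add SB b b') = F.lc q (%j. \<beta> j b + \<beta> j b') (%j. dd i j m)"
  unfolding rowlift_eq[OF vb_add_in[OF vSB b]]
  by (rule lin_comb_cong[OF _ refl]) (rule coframe_add[OF vSB frB _ m b])
 also have "\<dots> = add DA (rowlift i b) (rowlift i b')"
  unfolding rowlift_eq[OF b(1)] rowlift_eq[OF b(2)] by (rule F.lc_add) (rule cell_fA[OF dd_cell[OF i _ m]])
 finally show ?thesis .
qed

lemma rowlift_scl:
 assumes i: "i < p" and m: "m \<in> W" and b: "b \<in> fibre SB m"
 shows "rowlift i (scl SB r b) = scl DA r (rowlift i b)"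
proof -
 interpret F: fibre_space "fibre DA (s i m)" "add DA" "scl DA" "zer DA (s i m)" by (rule spA[OF rowlift_cell[OF i m b]])
 have "rowlift i (scl SB r b) = F.lc q (%j. r * \<beta> j b) (%j. dd i j m)"
  unfolding rowlift_eq[OF vb_scl_in[OF vSB b]]
  by (rule lin_comb_cong[OF _ refl]) (rule coframe_scl[OF vSB frB _ m b])
 also have "\<dots> = scl DA r (rowlift i b)"
  unfolding rowlift_eq[OF b] by (rule F.lc_scale) (rule cell_fA[OF dd_cell[OF i _ m]])
 finally show ?thesis .
qed

context
 fixes m assumes m: "m \<in> W"
begin

lemma lift_cell:
 assumes "a \<in> fibre SA m" "b \<in> fibre SB m" shows "lift a b \<in> cell a b"
proof -
 have "lift a b \<in> cell (vlc SA m p (%i. \<alpha> i a) (%i. s i m)) b"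
  unfolding lift_def by (rule lc_cellB[OF assms(2)]) (rule rowlift_cell[OF _ m assms(2)])
 then show ?thesis by (simp only: frame_expand[OF vSA frA m assms(1)])
qed

lemma lift_addA:
 assumes a: "a \<in> fibre SA m" "a' \<in> fibre SA m" and b: "b \<in> fibre SB m"
 shows "lift (add SA a a') b = add DB (lift a b) (lift a' b)"
proof -
 interpret F: fibre_space "fibre DB b" "add DB" "scl DB" "zer DB b" by (rule spB[OF lift_cell[OF a(1) b]])
 have "lift (add SA a a') b = F.lc p (%i. \<alpha> i a + \<alpha> i a') (%i. rowlift i b)"
  unfolding lift_def by (rule lin_comb_cong[OF _ refl]) (rule coframe_add[OF vSA frA _ m a])
 also have "\<dots> = add DB (lift a b) (lift a' b)"
  unfolding lift_def by (rule F.lc_add) (rule cell_fB[OF rowlift_cell[OF _ m b]])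
 finally show ?thesis .
qed

lemma lift_sclA:
 assumes a: "a \<in> fibre SA m" and b: "b \<in> fibre SB m"
 shows "lift (scl SA r a) b = scl DB r (lift a b)"
proof -
 interpret F: fibre_space "fibre DB b" "add DB" "scl DB" "zer DB b" by (rule spB[OF lift_cell[OF a b]])
 have "lift (scl SA r a) b = F.lc p (%i. r * \<alpha> i a) (%i. rowlift i b)"
  unfolding lift_def by (rule lin_comb_cong[OF _ refl]) (rule coframe_scl[OF vSA frA _ m a])
 also have "\<dots> = scl DB r (lift a b)"
  unfolding lift_def by (rule F.lc_scale) (rule cell_fB[OF rowlift_cell[OF _ m b]])
 finally show ?thesis .
qed

lemma lift_addB:
 assumes a: "a \<in> fibre SA m" and b: "b \<in> fibre SB m" "b' \<in> fibre SB m"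
 shows "lift a (add SB b b') = add DA (lift a b) (lift a b')"
proof -
 have "lift a (add SB b b') = vlc DB (add SB b b') p (%i. \<alpha> i a)
   (%i. add DA (rowlift i b) (rowlift i b'))"
  unfolding lift_def by (rule lin_comb_cong[OF refl]) (rule rowlift_add[OF _ m b])
 also have "\<dots> = add DA (lift a b) (lift a b')"
  unfolding lift_def by (rule lc_interchange[OF b rowlift_cell[OF _ m b(1)] rowlift_cell[OF _ m b(2)]])
 finally show ?thesis .
qed

lemma lift_sclB:
 assumes a: "a \<in> fibre SA m" and b: "b \<in> fibre SB m"
 shows "lift a (scl SB r b) = scl DA r (lift a b)"
proof -
 interpret F: fibre_space "fibre DB b" "add DB" "scl DB" "zer DB b" by (rule spB[OF lift_cell[OF a b]])
 have rb: "scl SB r b \<in> fibre SB m" by (rule vb_scl_in[OF vSB b])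
 have d: "d \<in> cell (proj DA d) b" if "d \<in> fibre DB b" for d using that by (simp add: cell_def fibre_def)
 have "scl DA r (lift a b) = vlc DB (scl SB r b) p (%i. \<alpha> i a) (%i. scl DA r (rowlift i b))"
  unfolding lift_def
 proof (rule F.lc_map[OF spB[OF lift_cell[OF a rb]]])
  fix x y t assume x: "x \<in> fibre DB b"
  show "scl DA r x \<in> fibre DB (scl SB r b)" by (rule cell_fB[OF cell_sclA[OF d[OF x]]])
  show "scl DA r (scl DB t x) = scl DB t (scl DA r x)" by (rule scl_scl[OF d[OF x]])
  assume y: "y \<in> fibre DB b"
  show "scl DA r (add DB x y) = add DB (scl DA r x) (scl DA r y)" by (rule scl_addB[OF d[OF x] d[OF y]])
 next
  fix i assume "i < p"
  then show "rowlift i b \<in> fibre DB b" by (rule cell_fB[OF rowlift_cell[OF _ m b]])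
 qed
 also have "\<dots> = lift a (scl SB r b)"
  unfolding lift_def by (rule lin_comb_cong[OF refl]) (rule rowlift_scl[OF _ m b, symmetric])
 finally show ?thesis by (rule sym)
qed

lemma lift_zA: "b \<in> fibre SB m ==> lift (zer SA m) b = zer DB b"
proof -
 assume b: "b \<in> fibre SB m"
 note z = zSA[OF lift_M[OF m]]
 have "lift (scl SA 0 (zer SA m)) b = scl DB 0 (lift (zer SA m) b)" by (rule lift_sclA[OF z b])
 then show ?thesis
  using fibre_space.sc_z[OF spSA[OF lift_M[OF m]]] fibre_space.sc_zero[OF spB[OF lift_cell[OF z b]] cell_fB[OF lift_cell[OF z b]]]
  by simp
qed

end

lemma lift_smooth:
 assumes L: "pre_manifold L" and f: "smooth_on L Z f (tot SA)" and g: "smooth_on L Z g (tot SB)"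
  and bW: "!!x. x \<in> Z ==> b x \<in> W" and fb: "!!x. x \<in> Z ==> f x \<in> fibre SA (b x)" and gb: "!!x. x \<in> Z ==> g x \<in> fibre SB (b x)"
 shows "smooth_on L Z (%x. lift (f x) (g x)) (tot DA)"
proof -
 have pb: "proj SA (f x) = b x" "proj SB (g x) = b x" if "x \<in> Z" for x
  using fibreD(2)[OF fb[OF that]] fibreD(2)[OF gb[OF that]] .
 have "smooth_on L Z (%x. proj SB (g x)) MM" using vb_proj_smooth_compose[OF vSB L g] by simp
 then have sb: "smooth_on L Z b MM" by (rule smooth_on_cong) (rule pb(2))
 have row: "smooth_on L Z (%x. rowlift i (g x)) (tot DA)" if i: "i < p" for i
 proof -
  have "smooth_on L Z (%x. vlc DA (s i (b x)) q (%j. \<beta> j (g x)) (%j. dd i j (b x))) (tot DA)"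
  proof (rule vb_smooth_lin_comb[OF vDA L])
   show "smooth_on L Z (%x. s i (b x)) (base DA)"
    using smooth_on_compose[OF L preM preA frame_smooth[OF vSA frA i] sb bW] by simp
   fix j assume j: "j < q"
   show "smooth_on L Z (%x. dd i j (b x)) (tot DA)" by (rule smooth_on_compose[OF L preM preD dd_smooth[OF i j] sb bW])
   show "proj DA (dd i j (b x)) = s i (b x)" if "x \<in> Z" for x by (rule cell_A[OF dd_cell[OF i j bW[OF that]]])
   show "smooth_real L Z (%x. \<beta> j (g x))"
    by (rule coframe_compose[OF vSB frB L g _ j]) (simp add: pb bW)
  qed
  then show ?thesis by (rule smooth_on_cong) (rule rowlift_eq[OF gb, symmetric])
 qed
 have "smooth_on L Z (%x. vlc DB (g x) p (%i. \<alpha> i (f x)) (%i. rowlift i (g x))) (tot DB)"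
 proof (rule vb_smooth_lin_comb[OF vDB L])
  show "smooth_on L Z g (base DB)" using g by simp
  fix i assume i: "i < p"
  show "smooth_on L Z (%x. rowlift i (g x)) (tot DB)" using row[OF i] by simp
  show "proj DB (rowlift i (g x)) = g x" if "x \<in> Z" for x by (rule cell_B[OF rowlift_cell[OF i bW[OF that] gb[OF that]]])
  show "smooth_real L Z (%x. \<alpha> i (f x))" by (rule coframe_compose[OF vSA frA L f _ i]) (simp add: pb bW)
 qed
 then show ?thesis by (simp add: lift_def)
qed

text \<open>The element of \<open>D\<close> over \<open>a\<close> and a zero vector of \<open>B\<close> that a core element determines.\<close>

definition core_shift :: "'a => 'd => 'd" where
 "core_shift a c = add DB (zer DA a) c"

text \<open>The decomposition: every element over \<open>(a, b)\<close> differs from the lift by a unique core element.\<close>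

definition assemble :: "'a => 'b => 'd => 'd" where
 "assemble a b c = add DA (lift a b) (core_shift a c)"

definition core_part :: "'d => 'd" where
 "core_part d = (let d' = add DA d (scl DA (- 1) (lift (proj DA d) (proj DB d)))
  in add DB d' (scl DB (- 1) (zer DA (proj DA d))))"

context
 fixes m assumes m: "m \<in> W"
begin

lemma shift_cell:
 assumes a: "a \<in> fibre SA m" and c: "c \<in> core_fibre m" shows "core_shift a c \<in> cell a (zer SB m)"
 using cell_addB[OF cell_zA[OF a] c] fibre_space.pl_z[OF spSA[OF lift_M[OF m]] a]
 unfolding core_shift_def by simp

lemma assemble_cell:
 assumes a: "a \<in> fibre SA m" and b: "b \<in> fibre SB m" and c: "c \<in> core_fibre m"
 shows "assemble a b c \<in> cell a b"
 using cell_addA[OF lift_cell[OF m a b] shift_cell[OF a c]] fibre_space.pl_z[OF spSB[OF lift_M[OF m]] b]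
 unfolding assemble_def by simp

lemma core_part_in:
 assumes d: "d \<in> cell a b" and a: "a \<in> fibre SA m" shows "core_part d \<in> core_fibre m"
proof -
 have b: "b \<in> fibre SB m" by (rule cell_side[OF d a])
 have "add DA d (scl DA (- 1) (lift a b)) \<in> cell a (zer SB m)"
  using cell_addA[OF d cell_sclA[OF lift_cell[OF m a b], of "- 1"]] fibre_space.pl_neg[OF spSB[OF lift_M[OF m]] b] by simp
 from cell_addB[OF this cell_sclB[OF cell_zA[OF a], of "- 1"]]
 show ?thesis
  unfolding core_part_def
  using cell_A[OF d] cell_B[OF d] fibre_space.pl_neg[OF spSA[OF lift_M[OF m]] a] by simp
qed

lemma assemble_core_part:
 assumes d: "d \<in> cell a b" and a: "a \<in> fibre SA m" shows "assemble a b (core_part d) = d"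
proof -
 have b: "b \<in> fibre SB m" by (rule cell_side[OF d a])
 note l = lift_cell[OF m a b]
 interpret F: fibre_space "fibre DA a" "add DA" "scl DA" "zer DA a" by (rule spA[OF d])
 interpret G: fibre_space "fibre DB (zer SB m)" "add DB" "scl DB" "zer DB (zer SB m)" by (rule spB[OF cell_zA[OF a]])
 have d': "add DA d (scl DA (- 1) (lift a b)) \<in> cell a (zer SB m)"
  using cell_addA[OF d cell_sclA[OF l, of "- 1"]] fibre_space.pl_neg[OF spSB[OF lift_M[OF m]] b] by simp
 show ?thesis
  unfolding assemble_def core_shift_def core_part_def
  using G.pl_diff_eq[OF cell_fB[OF d'] cell_fB[OF cell_zA[OF a]]] F.pl_diff_eq[OF cell_fA[OF d] cell_fA[OF l]]
   cell_A[OF d] cell_B[OF d] by simp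
qed

lemma core_part_assemble:
 assumes a: "a \<in> fibre SA m" and b: "b \<in> fibre SB m" and c: "c \<in> core_fibre m"
 shows "core_part (assemble a b c) = c"
proof -
 note d = assemble_cell[OF a b c] and l = lift_cell[OF m a b] and sh = shift_cell[OF a c]
 interpret F: fibre_space "fibre DA a" "add DA" "scl DA" "zer DA a" by (rule spA[OF d])
 interpret G: fibre_space "fibre DB (zer SB m)" "add DB" "scl DB" "zer DB (zer SB m)" by (rule spB[OF cell_zA[OF a]])
 have "add DA (assemble a b c) (scl DA (- 1) (lift a b)) = core_shift a c"
  unfolding assemble_def by (rule F.diff_pl_eq[OF cell_fA[OF sh] cell_fA[OF l]])
 moreover have "add DB (core_shift a c) (scl DB (- 1) (zer DA a)) = c"
  unfolding core_shift_def by (rule G.diff_pl_eq[OF cell_fB[OF c] cell_fB[OF cell_zA[OF a]]])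
 ultimately show ?thesis unfolding core_part_def using cell_A[OF d] cell_B[OF d] by simp
qed

lemma assemble_addA:
 assumes a: "a \<in> fibre SA m" and b: "b \<in> fibre SB m" "b' \<in> fibre SB m" and c: "c \<in> core_fibre m" "c' \<in> core_fibre m"
 shows "add DA (assemble a b c) (assemble a b' c') = assemble a (add SB b b') (add DA c c')"
proof -
 interpret F: fibre_space "fibre DA a" "add DA" "scl DA" "zer DA a" by (rule spA[OF cell_zA[OF a]])
 note l = cell_fA[OF lift_cell[OF m a b(1)]] cell_fA[OF lift_cell[OF m a b(2)]]
 note sh = cell_fA[OF shift_cell[OF a c(1)]] cell_fA[OF shift_cell[OF a c(2)]]
 have "add DA (core_shift a c) (core_shift a c') = core_shift a (add DA c c')"
  unfolding core_shift_def
  using interchange[OF cell_zA[OF a] cell_zA[OF a] c] F.z_pl[OF cell_fA[OF cell_zA[OF a]]] by simp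
 then show ?thesis
  unfolding assemble_def using F.pl_swap4[OF l(1) sh(1) l(2) sh(2)] lift_addB[OF m a b] by simp
qed

lemma assemble_addB:
 assumes a: "a \<in> fibre SA m" "a' \<in> fibre SA m" and b: "b \<in> fibre SB m" and c: "c \<in> core_fibre m" "c' \<in> core_fibre m"
 shows "add DB (assemble a b c) (assemble a' b c') = assemble (add SA a a') b (add DA c c')"
proof -
 interpret G: fibre_space "fibre DB (zer SB m)" "add DB" "scl DB" "zer DB (zer SB m)" by (rule spB[OF cell_zA[OF a(1)]])
 have "add DB (core_shift a c) (core_shift a' c') = add DB (add DB (zer DA a) (zer DA a')) (add DB c c')"
  unfolding core_shift_def
  by (rule G.pl_swap4) (rule cell_fB[OF cell_zA[OF a(1)]] cell_fB[OF cell_zA[OF a(2)]]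
    cell_fB[OF c(1)] cell_fB[OF c(2)])+
 then have "add DB (core_shift a c) (core_shift a' c') = core_shift (add SA a a') (add DA c c')"
  unfolding core_shift_def by (simp add: zer_addA[OF a] core_add_eq[OF lift_M[OF m] c])
 then show ?thesis
  unfolding assemble_def
  using interchange[OF lift_cell[OF m a(1) b] shift_cell[OF a(1) c(1)] lift_cell[OF m a(2) b] shift_cell[OF a(2) c(2)]]
   lift_addA[OF m a b] by simp
qed

lemma assemble_sclA:
 assumes a: "a \<in> fibre SA m" and b: "b \<in> fibre SB m" and c: "c \<in> core_fibre m"
 shows "scl DA r (assemble a b c) = assemble a (scl SB r b) (scl DA r c)"
proof -
 interpret F: fibre_space "fibre DA a" "add DA" "scl DA" "zer DA a" by (rule spA[OF cell_zA[OF a]])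
 have "scl DA r (core_shift a c) = core_shift a (scl DA r c)"
  unfolding core_shift_def using scl_addB[OF cell_zA[OF a] c] F.sc_z by simp
 then show ?thesis
  unfolding assemble_def using F.sc_pl[OF cell_fA[OF lift_cell[OF m a b]] cell_fA[OF shift_cell[OF a c]]] lift_sclB[OF m a b]
  by simp
qed

lemma assemble_sclB:
 assumes a: "a \<in> fibre SA m" and b: "b \<in> fibre SB m" and c: "c \<in> core_fibre m"
 shows "scl DB r (assemble a b c) = assemble (scl SA r a) b (scl DA r c)"
proof -
 interpret G: fibre_space "fibre DB (zer SB m)" "add DB" "scl DB" "zer DB (zer SB m)" by (rule spB[OF cell_zA[OF a]])
 have "scl DB r (core_shift a c) = core_shift (scl SA r a) (scl DA r c)"
  unfolding core_shift_def
  using G.sc_pl[OF cell_fB[OF cell_zA[OF a]] cell_fB[OF c]] zer_sclA[OF a]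
   core_scl_eq[OF lift_M[OF m] c] by simp
 then show ?thesis
  unfolding assemble_def using scl_addA[OF lift_cell[OF m a b] shift_cell[OF a c]] lift_sclA[OF m a b] by simp
qed

lemma assemble_core:
 assumes c: "c \<in> core_fibre m" shows "assemble (zer SA m) (zer SB m) c = c"
proof -
 note mM = lift_M[OF m]
 note z = zSA[OF mM] zSB[OF mM]
 have "core_shift (zer SA m) c = c"
  unfolding core_shift_def zz[OF mM]
  using fibre_space.z_pl[OF spB[OF c] cell_fB[OF c]] .
 then show ?thesis
  unfolding assemble_def lift_zA[OF m z(2)] zz[OF mM, symmetric]
  using fibre_space.z_pl[OF spA[OF c] cell_fA[OF c]] by simp
qed

end

lemma decomposition_assemble: "decomposition D (core D) (%c. c) W assemble core_part"
proof -
 have oW: "openin (mtop MM) W" by (rule frame_open[OF vSA frA])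
 let ?Z = "{d \<in> total D. dvb_proj D d \<in> W}"
 have Z: "?Z \<subseteq> total D" by blast
 have dm: "d \<in> cell (proj DA d) (proj DB d)" "proj DA d \<in> fibre SA (dvb_proj D d)" "proj DB d \<in> fibre SB (dvb_proj D d)"
  if "d \<in> total D" for d
  using that projA_in[OF that] projB_in[OF that] proj_proj[OF that] by (simp_all add: cell_def fibre_def dvb_proj_def)
 have idZ: "smooth_on (tot DA) ?Z (%d. d) (tot DA)" by (rule smooth_on_id[OF preD Z])
 note sA = smooth_projA[OF preD idZ] and sB = smooth_projB[OF preD idZ]
 have neg: "smooth_real (tot DA) ?Z (%d. - 1)" by (rule smooth_real_const[OF preD Z])
 have sl: "smooth_on (tot DA) ?Z (%d. lift (proj DA d) (proj DB d)) (tot DA)"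
  by (rule lift_smooth[OF preD sA sB, of "dvb_proj D"]) (use dm in auto)
 have s1: "smooth_on (tot DA) ?Z (%d. add DA d (scl DA (- 1) (lift (proj DA d) (proj DB d)))) (tot DA)"
 proof (rule vb_smooth_add[OF vDA preD idZ vb_smooth_scl[OF vDA preD sl neg]])
  fix d assume d: "d \<in> ?Z"
  then have d': "d \<in> total D" "dvb_proj D d \<in> W" by auto
  show "proj DA d = proj DA (scl DA (- 1) (lift (proj DA d) (proj DB d)))"
   using cell_A[OF cell_sclA[OF lift_cell[OF d'(2) dm(2,3)[OF d'(1)]]]] by simp
 qed
 have "smooth_on (tot DA) ?Z core_part (tot DB)"
  unfolding core_part_def[abs_def] Let_def
 proof (rule vb_smooth_add[OF vDB preD])
  show "smooth_on (tot DA) ?Z (%d. add DA d (scl DA (- 1) (lift (proj DA d) (proj DB d)))) (tot DB)" using s1 by simp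
  show "smooth_on (tot DA) ?Z (%d. scl DB (- 1) (zer DA (proj DA d))) (tot DB)"
   by (rule vb_smooth_scl[OF vDB preD _ neg]) (use smooth_zerDA[OF preD sA] in simp)
  fix d assume d: "d \<in> ?Z"
  then have d': "d \<in> total D" "dvb_proj D d \<in> W" by auto
  note i = dm[OF d'(1)]
  show "proj DB (add DA d (scl DA (- 1) (lift (proj DA d) (proj DB d)))) = proj DB (scl DB (- 1) (zer DA (proj DA d)))"
   using cell_B[OF cell_addA[OF i(1) cell_sclA[OF lift_cell[OF d'(2) i(2,3)], of "- 1"]]]
    cell_B[OF cell_sclB[OF cell_zA[OF i(2)], of "- 1"]] fibre_space.pl_neg[OF spSB[OF lift_M[OF d'(2)]] i(3)] by simp
 qed
 then have cp: "smooth_on (tot DA) ?Z core_part (tot DA)" by simp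
 have cpc: "core_part d \<in> fibre (core D) (dvb_proj D d)" if "d \<in> ?Z" for d
  using that core_part_in[of "dvb_proj D d" d] dm[of d] lift_M unfolding fibre_core_iff by blast
 let ?S = "{p. \<exists>m\<in>W. fst p \<in> fibre SA m \<and> fst (snd p) \<in> fibre SB m \<and> snd (snd p) \<in> fibre (core D) m}"
 let ?N = "prod_manifold (tot SA) (prod_manifold (tot SB) (tot (core D)))"
 note vC = vector_bundle_core
 note N2 = pre_manifold_prod[OF preB vb_tot[OF vC]]
 note N = pre_manifold_prod[OF preA N2]
 have Sp: "?S \<subseteq> pts (tot SA) \<times> (pts (tot SB) \<times> pts (tot (core D)))"
  by (auto simp: fibre_def)
 note tr = smooth_triple[OF preA preB vb_tot[OF vC] Sp]
 note f1 = tr(1) and g1 = tr(2) and g2 = tr(3)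
 have g2': "smooth_on ?N ?S (%p. snd (snd p)) (tot DA)" by (rule core_smooth_incl[OF N g2])
 have S: "proj SA (fst p) \<in> W" "fst p \<in> fibre SA (proj SA (fst p))" "fst (snd p) \<in> fibre SB (proj SA (fst p))"
  "snd (snd p) \<in> core_fibre (proj SA (fst p))" if "p \<in> ?S" for p
 proof -
  obtain m where m: "m \<in> W" "fst p \<in> fibre SA m" "fst (snd p) \<in> fibre SB m" "snd (snd p) \<in> fibre (core D) m" using \<open>p \<in> ?S\<close> by blast
  have e: "proj SA (fst p) = m" by (rule fibreD(2)[OF m(2)])
  show "proj SA (fst p) \<in> W" "fst p \<in> fibre SA (proj SA (fst p))" "fst (snd p) \<in> fibre SB (proj SA (fst p))"
   "snd (snd p) \<in> core_fibre (proj SA (fst p))"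
   unfolding e using m fibre_core_iff by simp_all
 qed
 have ls: "smooth_on ?N ?S (%p. lift (fst p) (fst (snd p))) (tot DA)"
  by (rule lift_smooth[OF N f1 g1 S(1) S(2) S(3)])
 have sh: "smooth_on ?N ?S (%p. core_shift (fst p) (snd (snd p))) (tot DA)"
  unfolding core_shift_def totB[symmetric]
 proof (rule vb_smooth_add[OF vDB N])
  show "smooth_on ?N ?S (%p. zer DA (fst p)) (tot DB)" using smooth_zerDA[OF N f1] by simp
  show "smooth_on ?N ?S (%p. snd (snd p)) (tot DB)" using g2' by simp
  show "proj DB (zer DA (fst p)) = proj DB (snd (snd p))" if "p \<in> ?S" for p
   using cell_B[OF cell_zA[OF S(2)[OF that]]] cell_B[OF S(4)[OF that]] by simp
 qed
 have mk: "smooth_on ?N ?S (%p. assemble (fst p) (fst (snd p)) (snd (snd p))) (tot DA)"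
  unfolding assemble_def
 proof (rule vb_smooth_add[OF vDA N ls sh])
  show "proj DA (lift (fst p) (fst (snd p))) = proj DA (core_shift (fst p) (snd (snd p)))" if "p \<in> ?S" for p
   using cell_A[OF lift_cell[OF S(1-3)[OF that]]] cell_A[OF shift_cell[OF S(1,2,4)[OF that]]] by simp
 qed
 show ?thesis
  unfolding decomposition_def core_simps
 proof (intro conjI ballI allI impI)
  fix m a b c assume m: "m \<in> W" and a: "a \<in> fibre SA m" and b: "b \<in> fibre SB m" and c': "c \<in> fibre (core D) m"
  have c: "c \<in> core_fibre m" using c' fibre_core_iff by blast
  note i = assemble_cell[OF m a b c]
  show "assemble a b c \<in> total D" "proj DA (assemble a b c) = a" "proj DB (assemble a b c) = b"
   by (rule cell_total[OF i] cell_A[OF i] cell_B[OF i])+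
  show "core_part (assemble a b c) = c" by (rule core_part_assemble[OF m a b c])
  fix r
  show "scl DA r (assemble a b c) = assemble a (scl SB r b) (scl DA r c)" by (rule assemble_sclA[OF m a b c])
  show "scl DB r (assemble a b c) = assemble (scl SA r a) b (scl DA r c)" by (rule assemble_sclB[OF m a b c])
 next
  fix d assume d: "d \<in> total D" "dvb_proj D d \<in> W"
  show "core_part d \<in> fibre (core D) (dvb_proj D d)" by (rule cpc) (use d in simp)
  show "assemble (proj DA d) (proj DB d) (core_part d) = d" by (rule assemble_core_part[OF d(2) dm(1,2)[OF d(1)]])
 next
  fix m a b b' c c' assume "m \<in> W" "a \<in> fibre SA m" "b \<in> fibre SB m" "b' \<in> fibre SB m" "c \<in> fibre (core D) m" "c' \<in> fibre (core D) m"
  then show "add DA (assemble a b c) (assemble a b' c') = assemble a (add SB b b') (add DA c c')"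
   using fibre_core_iff by (intro assemble_addA) blast+
 next
  fix m a a' b c c' assume "m \<in> W" "a \<in> fibre SA m" "a' \<in> fibre SA m" "b \<in> fibre SB m" "c \<in> fibre (core D) m" "c' \<in> fibre (core D) m"
  then show "add DB (assemble a b c) (assemble a' b c') = assemble (add SA a a') b (add DA c c')"
   using fibre_core_iff by (intro assemble_addB) blast+
 next
  fix m c assume "m \<in> W" "c \<in> fibre (core D) m"
  then show "c = assemble (zer SA m) (zer SB m) c" using assemble_core[of m c] fibre_core_iff by simp
 next
  show "openin (mtop MM) W" by (rule oW)
  show "smooth_on (tot DA) ?Z core_part (tot (core D))" by (rule core_smooth_into[OF preD cp cpc])
  show "smooth_on ?N ?S (%p. assemble (fst p) (fst (snd p)) (snd (snd p))) (tot DA)" by (rule mk)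
 qed
qed

end

lemma decomposition_exists:
 assumes m: "m \<in> pts MM" shows "\<exists>W mk ga. m \<in> W \<and> decomposition D (core D) (%c. c) W mk ga"
proof -
 obtain W1 p s \<alpha> where W1: "m \<in> W1" and frA: "frame_coframe SA W1 p s \<alpha>" by (rule vb_frame[OF vSA m])
 obtain W2 q e \<beta> where W2: "m \<in> W2" and frB: "frame_coframe SB W2 q e \<beta>" by (rule vb_frame[OF vSB m[folded baseB]])
 define W where "W = W1 \<inter> W2"
 have oW: "openin (mtop MM) W"
  unfolding W_def by (rule openin_Int[OF frame_open[OF vSA frA] frame_open[OF vSB frB, unfolded baseB]])
 have frA: "frame_coframe SA W p s \<alpha>" by (rule frame_restrict[OF vSA frA oW]) (simp add: W_def)
 have frB: "frame_coframe SB W q e \<beta>" by (rule frame_restrict[OF vSB frB]) (simp_all add: W_def oW[unfolded W_def])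
 have mW: "m \<in> W" using W1 W2 by (simp add: W_def)
 obtain W' dd where W': "openin (mtop MM) W'" "m \<in> W'" "W' \<subseteq> W"
  and dd: "!!i j. i < p ==> j < q ==> smooth_on MM W' (dd i j) (tot DA)"
  "!!i j m. i < p ==> j < q ==> m \<in> W' ==> dd i j m \<in> cell (s i m) (e j m)"
  by (rule frame_lifts[OF frA frB mW]) (rule that; assumption)
 have frA: "frame_coframe SA W' p s \<alpha>" by (rule frame_restrict[OF vSA frA W'(1,3)])
 have frB: "frame_coframe SB W' q e \<beta>" by (rule frame_restrict[OF vSB frB _ W'(3)]) (simp add: W'(1))
 from conjI[OF W'(2) decomposition_assemble[OF frA frB dd]] show ?thesis by (intro exI)
qed

text \<open>The core is a subset of \<open>D\<close>, so its inclusion is the identity.\<close>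

sublocale dec: decomposed_dvb D "core D" "%c. c"
proof
 show "smooth_on (tot DA) (total D) (proj DA) (tot SA)" "smooth_on (tot DA) (total D) (proj DB) (tot SB)"
  using vb_proj_smooth[OF vDA] vb_proj_smooth[OF vDB] by simp_all
qed (simp_all add: preD vSA vSB vector_bundle_core proj_proj decomposition_exists del: ex_simps)

end

context decomposed_dvb
begin

lemma
 assumes \<sigma>: "\<sigma> \<in> fibre (double_linear_bundle D) m" and d: "d \<in> slice D m"
 shows X_sclA: "snd \<sigma> (scl (over_A D) r d) = r * snd \<sigma> d"
  and X_sclB: "snd \<sigma> (scl (over_B D) r d) = r * snd \<sigma> d"
  and X_addA: "d' \<in> slice D m ==> qA d = qA d' ==> snd \<sigma> (add (over_A D) d d') = snd \<sigma> d + snd \<sigma> d'"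
  and X_addB: "d' \<in> slice D m ==> qB d = qB d' ==> snd \<sigma> (add (over_B D) d d') = snd \<sigma> d + snd \<sigma> d'"
 using \<sigma> d unfolding fibre_X_iff double_linear_def by simp_all

end

lemma dual_zer:
 assumes E: "vector_bundle E" and \<omega>: "\<omega> \<in> fibre (dual E) m"
 shows "snd \<omega> (zer E m) = 0"
proof -
 have m: "m \<in> pts (base E)" using \<omega> unfolding fibre_dual_iff[OF E] by simp
 have "snd \<omega> (scl E 0 (zer E m)) = 0" using dual_scl[OF E \<omega> vb_zer_in[OF E m], of 0] by simp
 then show ?thesis using fibre_space.sc_z[OF vb_fibre_space[OF E m]] by simp
qed

text \<open>The defining condition of \<open>contract\<close> need only be checked on elements \<open>bidual_map E e\<close>.\<close>

lemma contract_eq: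
 assumes E: "vector_bundle E" and \<theta>: "fst \<theta> = m" and u: "u \<in> fibre (dual E) m"
  and eq: "!!e. e \<in> fibre E m ==> snd u e = snd \<theta> (bidual_map E e, v)"
 shows "contract (dual E) v \<theta> = u"
 unfolding contract_def \<theta>
proof (rule the_equality)
 have all: "snd \<omega> u = snd \<theta> (\<omega>, v)" if \<omega>: "\<omega> \<in> fibre (dual (dual E)) m" for \<omega>
 proof -
  obtain e where e: "e \<in> fibre E m" "bidual_map E e = \<omega>" by (rule bidual_surj[OF E \<omega>])
  have "snd \<omega> u = snd u e" using bidual_apply[OF E, of u e] u fibreD(2)[OF e(1)] unfolding e(2) by simp
  then show ?thesis using eq[OF e(1)] e(2) by simp
 qed
 then show "u \<in> fibre (dual E) m \<and> (\<forall>\<omega>\<in>fibre (dual (dual E)) m. snd \<omega> u = snd \<theta> (\<omega>, v))" using u by simp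
 fix u' assume u': "u' \<in> fibre (dual E) m \<and> (\<forall>\<omega>\<in>fibre (dual (dual E)) m. snd \<omega> u' = snd \<theta> (\<omega>, v))"
 show "u' = u"
  by (rule dual_separates[OF vector_bundle_dual[OF E] _ u]) (use u' all in simp_all)
qed

lemma dual_dvb_simps [simp]:
 "over_A (dual_dvb D) = dual (over_A D)" "side_A (dual_dvb D) = side_A D" "side_B (dual_dvb D) = dual (core D)"
 "proj (over_B (dual_dvb D)) = dual_projC D" "add (over_B (dual_dvb D)) = dual_addC D"
 "scl (over_B (dual_dvb D)) = dual_sclC D"
 by (simp_all add: dual_dvb_def)

lemma dvb_proj_dual [simp]: "dvb_proj (dual_dvb D) \<Phi> = proj (side_A D) (fst \<Phi>)"
 by (simp add: dvb_proj_def)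


section \<open>The dual double vector bundle\<close>

context dvb
begin

abbreviation "CC \<equiv> core D"

lemmas vCC = vector_bundle_core

abbreviation "bp \<Phi> \<equiv> proj SA (fst \<Phi>)"

lemma vDS: "vector_bundle (dual DA)" and vSS: "vector_bundle (dual SB)" and vCS: "vector_bundle (dual CC)"
 by (rule vector_bundle_dual, rule vDA vSB vCC)+

lemma slice_fibre: "d \<in> fibre DA a ==> a \<in> fibre SA m ==> d \<in> slice D m"
 by (auto simp: slice_def dvb_proj_def fibre_def)

lemma dual_slice_iff: "\<Phi> \<in> slice (dual_dvb D) m \<longleftrightarrow> \<Phi> \<in> fibre (dual DA) (fst \<Phi>) \<and> fst \<Phi> \<in> fibre SA m"
proof -
 have "fst \<Phi> \<in> pts (tot SA)" if "\<Phi> \<in> fibre (dual DA) (fst \<Phi>)"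
  using vb_fibre_base[OF vDS that] by simp
 then show ?thesis unfolding slice_def dvb_proj_dual by (auto simp: fibre_def)
qed

lemma dual_sliceI: "\<Phi> \<in> fibre (dual DA) a ==> a \<in> fibre SA m ==> \<Phi> \<in> slice (dual_dvb D) m"
 unfolding dual_slice_iff using dual_fst[OF vDA] by simp

lemma projC_smooth: "smooth_on (tot (dual DA)) (pts (tot (dual DA))) (dual_projC D) (tot (dual CC))"
proof -
 let ?L = "tot (dual DA)" and ?P = "pts (tot (dual DA))"
 note L = vb_tot[OF vDS]
 have id: "smooth_on ?L ?P (%\<Phi>. \<Phi>) ?L" by (rule smooth_on_id[OF L subset_refl])
 have fs: "smooth_on ?L ?P (%\<Phi>. fst \<Phi>) (tot SA)"
  using vb_proj_smooth[OF vDS] by simp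
 have b: "smooth_on ?L ?P bp (base CC)"
  using vb_proj_smooth_compose[OF vSA L fs] by simp
 have F: "\<Phi> \<in> fibre (dual DA) (fst \<Phi>)" "fst \<Phi> \<in> fibre SA (bp \<Phi>)" if "\<Phi> \<in> ?P" for \<Phi>
  using that smooth_on_image_pts[OF L fs that] by (simp_all add: fibre_def)
 show ?thesis
 proof (rule dual_smooth_into[OF vCC L _ b])
  fix \<Phi> assume \<Phi>: "\<Phi> \<in> ?P"
  note F = F[OF \<Phi>]
  let ?a = "fst \<Phi>" and ?m = "bp \<Phi>"
  have m: "?m \<in> pts MM" by (rule vb_fibre_base[OF vSA F(2)])
  have cl: "add DB (zer DA ?a) c \<in> cell ?a (zer SB ?m)" if "c \<in> core_fibre ?m" for c
   using cell_addB[OF cell_zA[OF F(2)] that] fibre_space.pl_z[OF spSA[OF m] F(2)] by simp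
  note cA = cell_fA[OF cl]
  have sh: "add DB (zer DA ?a) (add DA c c') = add DA (add DB (zer DA ?a) c) (add DB (zer DA ?a) c')"
   "add DB (zer DA ?a) (scl DA r c) = scl DA r (add DB (zer DA ?a) c)"
   if c: "c \<in> core_fibre ?m" "c' \<in> core_fibre ?m" for c c' r
  proof -
   interpret A: fibre_space "fibre DA ?a" "add DA" "scl DA" "zer DA ?a" by (rule spA[OF cell_zA[OF F(2)]])
   show "add DB (zer DA ?a) (add DA c c') = add DA (add DB (zer DA ?a) c) (add DB (zer DA ?a) c')"
    using interchange[OF cell_zA[OF F(2)] cell_zA[OF F(2)] c]
     A.z_pl[OF cell_fA[OF cell_zA[OF F(2)]]] by simp
   show "add DB (zer DA ?a) (scl DA r c) = scl DA r (add DB (zer DA ?a) c)"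
    using scl_addB[OF cell_zA[OF F(2)] c(1), of r] A.sc_z by simp
  qed
  have p: "dual_projC D \<Phi> = (?m, %c. if c \<in> fibre CC ?m then snd \<Phi> (add DB (zer DA ?a) c) else 0)"
   by (simp add: dual_projC_def Let_def)
  show "dual_projC D \<Phi> \<in> fibre (dual CC) ?m"
   unfolding p
   by (rule dualI[OF vCC])
    (simp_all add: m fibre_core_iff core_add[OF m] core_scl[OF m] sh dual_add[OF vDA F(1) cA cA] dual_scl[OF vDA F(1) cA])
 next
  fix W x assume W: "openin (mtop (base CC)) W" and x: "smooth_on (base CC) W x (tot CC)" and xf: "!!m. m \<in> W ==> x m \<in> fibre CC m"
  let ?Z = "{\<Phi> \<in> ?P. bp \<Phi> \<in> W}"
  let ?v = "%\<Phi>. add DB (zer DA (fst \<Phi>)) (x (bp \<Phi>))"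
  have sub: "?Z \<subseteq> ?P" by blast
  have x': "smooth_on MM W x (tot DA)" using core_smooth_incl[OF preM] x by simp
  have xb: "smooth_on ?L ?Z (%\<Phi>. x (bp \<Phi>)) (tot DA)"
   by (rule smooth_on_compose[OF L preM preD x' smooth_on_subset[OF b[unfolded core_simps] sub]]) simp
  have xc: "x (bp \<Phi>) \<in> cell (zer SA (bp \<Phi>)) (zer SB (bp \<Phi>))" if "\<Phi> \<in> ?Z" for \<Phi>
   using xf[of "bp \<Phi>"] that unfolding fibre_core_iff by simp
  have "smooth_real ?L ?Z (%\<Phi>. snd \<Phi> (?v \<Phi>))"
  proof (rule dual_eval_smooth[OF vDA L smooth_on_subset[OF id sub]])
   have "smooth_on ?L ?Z (%\<Phi>. ?v \<Phi>) (tot DB)"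
   proof (rule vb_smooth_add[OF vDB L])
    show "smooth_on ?L ?Z (%\<Phi>. zer DA (fst \<Phi>)) (tot DB)"
     using smooth_zerDA[OF L smooth_on_subset[OF fs sub]] by simp
    show "smooth_on ?L ?Z (%\<Phi>. x (bp \<Phi>)) (tot DB)" using xb by simp
    fix \<Phi> assume \<Phi>: "\<Phi> \<in> ?Z"
    show "proj DB (zer DA (fst \<Phi>)) = proj DB (x (bp \<Phi>))"
     using cell_B[OF xc[OF \<Phi>]] cell_B[OF cell_zA[OF F(2)]] \<Phi> by simp
   qed
   then show "smooth_on ?L ?Z (%\<Phi>. ?v \<Phi>) (tot DA)" by simp
   fix \<Phi> assume \<Phi>: "\<Phi> \<in> ?Z"
   then have F': "fst \<Phi> \<in> fibre SA (bp \<Phi>)" using F(2) by simp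
   show "proj DA (?v \<Phi>) = fst \<Phi>"
    using cell_A[OF cell_addB[OF cell_zA[OF F'] xc[OF \<Phi>]]] fibre_space.pl_z[OF spSA[OF vb_fibre_base[OF vSA F']] F'] by simp
  qed
  then show "smooth_real ?L ?Z (%\<Phi>. snd (dual_projC D \<Phi>) (x (bp \<Phi>)))"
  proof (rule smooth_real_cong)
   fix \<Phi> assume "\<Phi> \<in> ?Z"
   then show "snd \<Phi> (?v \<Phi>) = snd (dual_projC D \<Phi>) (x (bp \<Phi>))"
    using xf[of "bp \<Phi>"] by (simp add: dual_projC_def Let_def)
  qed
 qed
qed

text \<open>A decomposition \<open>(mk, ga)\<close> of \<open>D\<close> identifies the fibre of \<open>D \<rightarrow> A\<close> over \<open>a\<close> with the sum of the
 fibres of \<open>B\<close> and of the core.  A linear form on it is thus a pair of \<open>\<kappa>\<close> in the dual of the core and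
 \<open>\<psi>\<close> in the dual of \<open>B\<close>: this is a decomposition of the dual over \<open>A\<close>.\<close>

definition dual_mk :: "('d => 'd) => 'a => 'm \<times> ('d => real) => 'm \<times> ('b => real) => 'a \<times> ('d => real)" where
 "dual_mk ga a \<kappa> \<psi> = (a, %d. if d \<in> fibre DA a then snd \<psi> (proj DB d) + snd \<kappa> (ga d) else 0)"

definition dual_ga :: "('a => 'b => 'd => 'd) => 'a \<times> ('d => real) => 'm \<times> ('b => real)" where
 "dual_ga mk \<Phi> = (let m = bp \<Phi> in
  (m, %b. if b \<in> fibre SB m then snd \<Phi> (mk (fst \<Phi>) b (zer CC m)) else 0))"

context
 fixes W mk ga
 assumes dc: "decomposition D CC (%c. c) W mk ga"
begin

lemma mk_fibre: "m \<in> W ==> a \<in> fibre SA m ==> b \<in> fibre SB m ==> c \<in> fibre CC m ==> mk a b c \<in> fibre DA a"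
 by (rule fibreI) (rule dec.mk_total[OF dc] dec.mk_A[OF dc]; assumption)+

lemma fibre_mkE:
 assumes m: "m \<in> W" and a: "a \<in> fibre SA m" and d: "d \<in> fibre DA a"
 obtains b c where "b \<in> fibre SB m" "c \<in> fibre CC m" "d = mk a b c"
proof -
 note s = slice_fibre[OF d a]
 have "d = mk a (proj DB d) (ga d)" using dec.mk_ga_eq[OF dc s m] fibreD(2)[OF d] by simp
 with dec.slice_B[OF s] dec.ga_in[OF dc s m] show ?thesis by (rule that)
qed

lemma zA_mk:
 assumes m: "m \<in> W" and a: "a \<in> fibre SA m"
 shows "zer DA a = mk a (zer SB m) (zer CC m)"
proof -
 note mM = dec.dc_W[OF dc m]
 note z = dec.zB[OF mM] dec.zC[OF mM]
 have "zer DA a = scl DA 0 (mk a (zer SB m) (zer CC m))"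
  by (rule fibre_space.sc_zero[OF spA[OF cell_zA[OF a]] mk_fibre[OF m a z], symmetric])
 then show ?thesis using dec.mk_sclA[OF dc m a z, of 0] dec.scl_zB[OF mM] dec.scl_zC[OF mM] by simp
qed

lemma zB_mk:
 assumes m: "m \<in> W" and b: "b \<in> fibre SB m"
 shows "zer DB b = mk (zer SA m) b (zer CC m)"
proof -
 note mM = dec.dc_W[OF dc m]
 note z = dec.zA[OF mM] dec.zC[OF mM]
 have "mk (zer SA m) b (zer CC m) \<in> fibre DB b"
  using dec.mk_total[OF dc m z(1) b z(2)] dec.mk_B[OF dc m z(1) b z(2)] by (simp add: fibre_def)
 then have "zer DB b = scl DB 0 (mk (zer SA m) b (zer CC m))"
  by (rule fibre_space.sc_zero[OF spB[OF cell_zB[OF b]], symmetric])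
 then show ?thesis using dec.mk_sclB[OF dc m z(1) b z(2), of 0] dec.scl_zA[OF mM] dec.scl_zC[OF mM] by simp
qed

lemma shift_mk:
 assumes m: "m \<in> W" and a: "a \<in> fibre SA m" and c: "c \<in> fibre CC m"
 shows "add DB (zer DA a) c = mk a (zer SB m) c"
proof -
 note mM = dec.dc_W[OF dc m]
 note z = dec.zA[OF mM] dec.zB[OF mM] dec.zC[OF mM]
 have "add DB (zer DA a) c = add DB (mk a (zer SB m) (zer CC m)) (mk (zer SA m) (zer SB m) c)"
  using zA_mk[OF m a] dec.bar_mk[OF dc m c] by simp
 also have "\<dots> = mk (add SA a (zer SA m)) (zer SB m) (add CC (zer CC m) c)"
  by (rule dec.mk_addB[OF dc m a z(1) z(2) z(2) z(3) c])
 finally show ?thesis using dec.add_zA[OF a] dec.zC_add[OF c] by simp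
qed

lemma shiftB_mk:
 assumes m: "m \<in> W" and b: "b \<in> fibre SB m" and c: "c \<in> fibre CC m"
 shows "add DA (zer DB b) c = mk (zer SA m) b c"
proof -
 note mM = dec.dc_W[OF dc m]
 note z = dec.zA[OF mM] dec.zB[OF mM] dec.zC[OF mM]
 have "add DA (zer DB b) c = add DA (mk (zer SA m) b (zer CC m)) (mk (zer SA m) (zer SB m) c)"
  using zB_mk[OF m b] dec.bar_mk[OF dc m c] by simp
 also have "\<dots> = mk (zer SA m) (add SB b (zer SB m)) (add CC (zer CC m) c)"
  by (rule dec.mk_addA[OF dc m z(1) z(1) b z(2) z(3) c])
 finally show ?thesis using dec.add_zB[OF b] dec.zC_add[OF c] by simp
qed

lemma dual_mk_apply:
 assumes m: "m \<in> W" and a: "a \<in> fibre SA m" and bc: "b \<in> fibre SB m" "c \<in> fibre CC m"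
 shows "snd (dual_mk ga a \<kappa> \<psi>) (mk a b c) = snd \<psi> b + snd \<kappa> c"
 using mk_fibre[OF m a bc] dec.mk_B[OF dc m a bc] dec.mk_ga[OF dc m a bc] by (simp add: dual_mk_def)

lemma dual_mk_in:
 assumes m: "m \<in> W" and a: "a \<in> fibre SA m" and \<kappa>: "\<kappa> \<in> fibre (dual CC) m" and \<psi>: "\<psi> \<in> fibre (dual SB) m"
 shows "dual_mk ga a \<kappa> \<psi> \<in> fibre (dual DA) a"
proof -
 note ap = dual_mk_apply[OF m a, of _ _ \<kappa> \<psi>]
 define f where "f = snd (dual_mk ga a \<kappa> \<psi>)"
 have "(a, f) \<in> fibre (dual DA) a"
 proof (rule dualI[OF vDA])
  show "a \<in> pts (base DA)" using fibreD(1)[OF a] by simp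
  fix d assume d: "d \<in> fibre DA a"
  obtain b c where bc: "b \<in> fibre SB m" "c \<in> fibre CC m" and e: "d = mk a b c" by (rule fibre_mkE[OF m a d])
  show "f (scl DA r d) = r * f d" for r
   unfolding e f_def using dec.mk_sclA[OF dc m a bc, of r] ap[OF bc] ap[OF vb_scl_in[OF vSB bc(1)] vb_scl_in[OF vCC bc(2)], of r r]
    dual_scl[OF vSB \<psi> bc(1)] dual_scl[OF vCC \<kappa> bc(2)] by (simp add: algebra_simps)
  fix d' assume d': "d' \<in> fibre DA a"
  obtain b' c' where bc': "b' \<in> fibre SB m" "c' \<in> fibre CC m" and e': "d' = mk a b' c'" by (rule fibre_mkE[OF m a d'])
  show "f (add DA d d') = f d + f d'"
   unfolding e e' f_def using dec.mk_addA[OF dc m a a bc(1) bc'(1) bc(2) bc'(2)] ap[OF bc] ap[OF bc']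
    ap[OF vb_add_in[OF vSB bc(1) bc'(1)] vb_add_in[OF vCC bc(2) bc'(2)]]
    dual_add[OF vSB \<psi> bc(1) bc'(1)] dual_add[OF vCC \<kappa> bc(2) bc'(2)] by simp
 qed (simp add: f_def dual_mk_def)
 then show ?thesis by (simp add: f_def dual_mk_def)
qed

lemma dual_mk_eqI:
 assumes m: "m \<in> W" and a: "a \<in> fibre SA m" and \<kappa>: "\<kappa> \<in> fibre (dual CC) m" and \<psi>: "\<psi> \<in> fibre (dual SB) m"
  and \<Psi>: "\<Psi> \<in> fibre (dual DA) a" "!!b c. b \<in> fibre SB m ==> c \<in> fibre CC m ==> snd \<Psi> (mk a b c) = snd \<psi> b + snd \<kappa> c"
 shows "\<Psi> = dual_mk ga a \<kappa> \<psi>"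
proof (rule dual_eqI[OF vDA \<Psi>(1) dual_mk_in[OF m a \<kappa> \<psi>]])
 fix d assume d: "d \<in> fibre DA a"
 obtain b c where bc: "b \<in> fibre SB m" "c \<in> fibre CC m" and e: "d = mk a b c" by (rule fibre_mkE[OF m a d])
 show "snd \<Psi> d = snd (dual_mk ga a \<kappa> \<psi>) d"
  unfolding e \<Psi>(2)[OF bc] by (rule dual_mk_apply[OF m a bc, symmetric])
qed

lemma form_split:
 assumes m: "m \<in> W" and a: "a \<in> fibre SA m" and \<Phi>: "\<Phi> \<in> fibre (dual DA) a" and bc: "b \<in> fibre SB m" "c \<in> fibre CC m"
 shows "snd \<Phi> (mk a b c) = snd \<Phi> (mk a b (zer CC m)) + snd \<Phi> (mk a (zer SB m) c)"
proof -
 note mM = dec.dc_W[OF dc m]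
 note z = dec.zB[OF mM] dec.zC[OF mM]
 show ?thesis
  using dual_add[OF vDA \<Phi> mk_fibre[OF m a bc(1) z(2)] mk_fibre[OF m a z(1) bc(2)]]
   dec.mk_addA[OF dc m a a bc(1) z(1) z(2) bc(2)] dec.add_zB[OF bc(1)] dec.zC_add[OF bc(2)] by simp
qed

lemma projC_apply:
 assumes m: "m \<in> W" and a: "a \<in> fibre SA m" and \<Phi>: "\<Phi> \<in> fibre (dual DA) a" and c: "c \<in> fibre CC m"
 shows "snd (dual_projC D \<Phi>) c = snd \<Phi> (mk a (zer SB m) c)"
 using shift_mk[OF m a c] dual_fst[OF vDA \<Phi>] fibreD(2)[OF a] c by (simp add: dual_projC_def Let_def)

lemma dual_ga_apply:
 assumes a: "a \<in> fibre SA m" and \<Phi>: "\<Phi> \<in> fibre (dual DA) a" and b: "b \<in> fibre SB m"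
 shows "snd (dual_ga mk \<Phi>) b = snd \<Phi> (mk a b (zer CC m))"
 using dual_fst[OF vDA \<Phi>] fibreD(2)[OF a] b by (simp add: dual_ga_def Let_def)

lemma projC_in:
 assumes a: "a \<in> fibre SA m" and \<Phi>: "\<Phi> \<in> fibre (dual DA) a"
 shows "dual_projC D \<Phi> \<in> fibre (dual CC) m"
 using smooth_on_image_pts[OF vb_tot[OF vDS] projC_smooth fibreD(1)[OF \<Phi>]] dual_fst[OF vDA \<Phi>] fibreD(2)[OF a]
 by (simp add: fibre_def dual_projC_def Let_def)

lemma dual_ga_in:
 assumes m: "m \<in> W" and a: "a \<in> fibre SA m" and \<Phi>: "\<Phi> \<in> fibre (dual DA) a"
 shows "dual_ga mk \<Phi> \<in> fibre (dual SB) m"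
proof -
 note mM = dec.dc_W[OF dc m]
 note z = dec.zC[OF mM]
 note ap = dual_ga_apply[OF a \<Phi>]
 define f where "f = snd (dual_ga mk \<Phi>)"
 have e: "dual_ga mk \<Phi> = (m, f)"
  using dual_fst[OF vDA \<Phi>] fibreD(2)[OF a] by (simp add: f_def dual_ga_def Let_def)
 have "(m, f) \<in> fibre (dual SB) m"
 proof (rule dualI[OF vSB])
  show "m \<in> pts (base SB)" using mM by simp
  fix b assume b: "b \<in> fibre SB m"
  show "f (scl SB r b) = r * f b" for r
   unfolding f_def ap[OF b] ap[OF vb_scl_in[OF vSB b]]
   using dual_scl[OF vDA \<Phi> mk_fibre[OF m a b z], of r] dec.mk_sclA[OF dc m a b z, of r] dec.scl_zC[OF mM] by simp
  fix b' assume b': "b' \<in> fibre SB m"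
  show "f (add SB b b') = f b + f b'"
   unfolding f_def ap[OF b] ap[OF b'] ap[OF vb_add_in[OF vSB b b']]
   using dual_add[OF vDA \<Phi> mk_fibre[OF m a b z] mk_fibre[OF m a b' z]] dec.mk_addA[OF dc m a a b b' z z] dec.add_zC[OF z] by simp
 next
  fix b assume "b \<notin> fibre SB m"
  then show "f b = 0"
   using dual_fst[OF vDA \<Phi>] fibreD(2)[OF a] by (simp add: f_def dual_ga_def Let_def)
 qed
 then show ?thesis using e by simp
qed

lemma dual_mk_ga:
 assumes m: "m \<in> W" and a: "a \<in> fibre SA m" and \<Phi>: "\<Phi> \<in> fibre (dual DA) a"
 shows "dual_mk ga a (dual_projC D \<Phi>) (dual_ga mk \<Phi>) = \<Phi>"
proof (rule dual_mk_eqI[OF m a projC_in[OF a \<Phi>] dual_ga_in[OF m a \<Phi>] \<Phi>, symmetric])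
 fix b c assume bc: "b \<in> fibre SB m" "c \<in> fibre CC m"
 show "snd \<Phi> (mk a b c) = snd (dual_ga mk \<Phi>) b + snd (dual_projC D \<Phi>) c"
  unfolding projC_apply[OF m a \<Phi> bc(2)] dual_ga_apply[OF a \<Phi> bc(1)] by (rule form_split[OF m a \<Phi> bc])
qed

context
 fixes m a \<kappa> \<psi>
 assumes m: "m \<in> W" and a: "a \<in> fibre SA m" and \<kappa>: "\<kappa> \<in> fibre (dual CC) m" and \<psi>: "\<psi> \<in> fibre (dual SB) m"
begin

lemma projC_dual_mk: "dual_projC D (dual_mk ga a \<kappa> \<psi>) = \<kappa>"
proof (rule dual_eqI[OF vCC projC_in[OF a dual_mk_in[OF m a \<kappa> \<psi>]] \<kappa>])
 fix c assume c: "c \<in> fibre CC m"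
 show "snd (dual_projC D (dual_mk ga a \<kappa> \<psi>)) c = snd \<kappa> c"
  unfolding projC_apply[OF m a dual_mk_in[OF m a \<kappa> \<psi>] c]
  using dual_mk_apply[OF m a dec.zB[OF dec.dc_W[OF dc m]] c, of \<kappa> \<psi>] dual_zer[OF vSB \<psi>] by simp
qed

lemma ga_dual_mk: "dual_ga mk (dual_mk ga a \<kappa> \<psi>) = \<psi>"
proof (rule dual_eqI[OF vSB dual_ga_in[OF m a dual_mk_in[OF m a \<kappa> \<psi>]] \<psi>])
 fix b assume b: "b \<in> fibre SB m"
 show "snd (dual_ga mk (dual_mk ga a \<kappa> \<psi>)) b = snd \<psi> b"
  unfolding dual_ga_apply[OF a dual_mk_in[OF m a \<kappa> \<psi>] b]
  using dual_mk_apply[OF m a b dec.zC[OF dec.dc_W[OF dc m]], of \<kappa> \<psi>] dual_zer[OF vCC \<kappa>] by simp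
qed

lemma dual_mk_addC:
 assumes a': "a' \<in> fibre SA m" and \<psi>': "\<psi>' \<in> fibre (dual SB) m"
 shows "dual_addC D (dual_mk ga a \<kappa> \<psi>) (dual_mk ga a' \<kappa> \<psi>') = dual_mk ga (add SA a a') \<kappa> (add (dual SB) \<psi> \<psi>')"
proof -
 note aa = vb_add_in[OF vSA a a'] and pp = vb_add_in[OF vSS \<psi> \<psi>']
 note z = dec.zC[OF dec.dc_W[OF dc m]]
 have f: "fst (dual_mk ga a \<kappa> \<psi>) = a" for a \<psi> by (simp add: dual_mk_def)
 show ?thesis
  unfolding dual_addC_def f
 proof (rule the_equality)
  show "dual_mk ga (add SA a a') \<kappa> (add (dual SB) \<psi> \<psi>') \<in> fibre (dual DA) (add SA a a') \<and>
   (\<forall>d\<in>fibre DA a. \<forall>d'\<in>fibre DA a'. proj DB d = proj DB d' \<longrightarrow>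
    snd (dual_mk ga (add SA a a') \<kappa> (add (dual SB) \<psi> \<psi>')) (add DB d d') =
    snd (dual_mk ga a \<kappa> \<psi>) d + snd (dual_mk ga a' \<kappa> \<psi>') d')"
  proof (intro conjI ballI impI dual_mk_in[OF m aa \<kappa> pp])
   fix d d' assume d: "d \<in> fibre DA a" and d': "d' \<in> fibre DA a'" and eq: "proj DB d = proj DB d'"
   obtain b c where bc: "b \<in> fibre SB m" "c \<in> fibre CC m" and e: "d = mk a b c" by (rule fibre_mkE[OF m a d])
   obtain b' c' where bc': "b' \<in> fibre SB m" "c' \<in> fibre CC m" and e': "d' = mk a' b' c'" by (rule fibre_mkE[OF m a' d'])
   have bb: "b' = b" using eq unfolding e e' dec.mk_B[OF dc m a bc] dec.mk_B[OF dc m a' bc'] by simp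
   show "snd (dual_mk ga (add SA a a') \<kappa> (add (dual SB) \<psi> \<psi>')) (add DB d d') =
    snd (dual_mk ga a \<kappa> \<psi>) d + snd (dual_mk ga a' \<kappa> \<psi>') d'"
    unfolding e e' bb dec.mk_addB[OF dc m a a' bc(1) bc(1) bc(2) bc'(2)]
     dual_mk_apply[OF m aa bc(1) vb_add_in[OF vCC bc(2) bc'(2)]] dual_mk_apply[OF m a bc] dual_mk_apply[OF m a' bc(1) bc'(2)]
     dual_add[OF vCC \<kappa> bc(2) bc'(2)] by simp
  qed
  fix \<Psi> assume \<Psi>: "\<Psi> \<in> fibre (dual DA) (add SA a a') \<and>
   (\<forall>d\<in>fibre DA a. \<forall>d'\<in>fibre DA a'. proj DB d = proj DB d' \<longrightarrow>
    snd \<Psi> (add DB d d') = snd (dual_mk ga a \<kappa> \<psi>) d + snd (dual_mk ga a' \<kappa> \<psi>') d')"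
  show "\<Psi> = dual_mk ga (add SA a a') \<kappa> (add (dual SB) \<psi> \<psi>')"
  proof (rule dual_mk_eqI[OF m aa \<kappa> pp conjunct1[OF \<Psi>]])
   fix b c assume bc: "b \<in> fibre SB m" "c \<in> fibre CC m"
   have "snd \<Psi> (add DB (mk a b c) (mk a' b (zer CC m))) =
     snd (dual_mk ga a \<kappa> \<psi>) (mk a b c) + snd (dual_mk ga a' \<kappa> \<psi>') (mk a' b (zer CC m))"
    by (rule conjunct2[OF \<Psi>, rule_format, OF mk_fibre[OF m a bc] mk_fibre[OF m a' bc(1) z]])
     (simp only: dec.mk_B[OF dc m a bc] dec.mk_B[OF dc m a' bc(1) z])
   then show "snd \<Psi> (mk (add SA a a') b c) = snd (add (dual SB) \<psi> \<psi>') b + snd \<kappa> c"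
    unfolding dec.mk_addB[OF dc m a a' bc(1) bc(1) bc(2) z] dual_mk_apply[OF m a bc] dual_mk_apply[OF m a' bc(1) z]
     dual_zer[OF vCC \<kappa>] dec.add_zC[OF bc(2)] by simp
  qed
 qed
qed

text \<open>The zeros of \<open>dual_zeroC\<close> and the core elements of \<open>dual_core\<close> are both of this form.\<close>

lemma dual_mk_zero:
 assumes v: "!!b c. b \<in> fibre SB m ==> c \<in> fibre CC m ==> v b c = snd \<psi> b + snd \<kappa> c"
 shows "(THE \<Psi>. \<Psi> \<in> fibre (dual DA) (zer SA m) \<and>
  (\<forall>b\<in>fibre SB m. \<forall>c\<in>fibre CC m. snd \<Psi> (add DA (zer DB b) c) = v b c)) = dual_mk ga (zer SA m) \<kappa> \<psi>"
proof (rule the_equality)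
 note z = dec.zA[OF dec.dc_W[OF dc m]]
 show "dual_mk ga (zer SA m) \<kappa> \<psi> \<in> fibre (dual DA) (zer SA m) \<and>
  (\<forall>b\<in>fibre SB m. \<forall>c\<in>fibre CC m. snd (dual_mk ga (zer SA m) \<kappa> \<psi>) (add DA (zer DB b) c) = v b c)"
  using dual_mk_in[OF m z \<kappa> \<psi>] shiftB_mk[OF m] dual_mk_apply[OF m z, of _ _ \<kappa> \<psi>] v by simp
 fix \<Psi> assume \<Psi>: "\<Psi> \<in> fibre (dual DA) (zer SA m) \<and>
  (\<forall>b\<in>fibre SB m. \<forall>c\<in>fibre CC m. snd \<Psi> (add DA (zer DB b) c) = v b c)"
 show "\<Psi> = dual_mk ga (zer SA m) \<kappa> \<psi>"
 proof (rule dual_mk_eqI[OF m z \<kappa> \<psi> conjunct1[OF \<Psi>]])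
  fix b c assume bc: "b \<in> fibre SB m" "c \<in> fibre CC m"
  show "snd \<Psi> (mk (zer SA m) b c) = snd \<psi> b + snd \<kappa> c"
   using conjunct2[OF \<Psi>, rule_format, OF bc] shiftB_mk[OF m bc] v[OF bc] by simp
 qed
qed

end

lemma dual_zeros: "m \<in> W ==> (m, %x. 0) \<in> fibre (dual SB) m" "m \<in> W ==> (m, %x. 0) \<in> fibre (dual CC) m"
 using vb_zer_in[OF vSS] vb_zer_in[OF vCS] dec.dc_W[OF dc] by simp_all

lemma dual_zeroC_mk:
 assumes m: "m \<in> W" and \<kappa>: "\<kappa> \<in> fibre (dual CC) m"
 shows "dual_zeroC D \<kappa> = dual_mk ga (zer SA m) \<kappa> (m, %b. 0)"
 unfolding dual_zeroC_def dual_fst[OF vCC \<kappa>]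
 by (rule dual_mk_zero[OF m dec.zA[OF dec.dc_W[OF dc m]] \<kappa> dual_zeros(1)[OF m]]) simp

lemma dual_core_mk:
 assumes m: "m \<in> W" and \<psi>: "\<psi> \<in> fibre (dual SB) m"
 shows "dual_core D \<psi> = dual_mk ga (zer SA m) (m, %c. 0) \<psi>"
 unfolding dual_core_def dual_fst[OF vSB \<psi>]
 by (rule dual_mk_zero[OF m dec.zA[OF dec.dc_W[OF dc m]] dual_zeros(2)[OF m] \<psi>]) simp

lemma dual_mk_sclC:
 assumes m: "m \<in> W" and a: "a \<in> fibre SA m" and \<kappa>: "\<kappa> \<in> fibre (dual CC) m" and \<psi>: "\<psi> \<in> fibre (dual SB) m"
 shows "dual_sclC D r (dual_mk ga a \<kappa> \<psi>) = dual_mk ga (scl SA r a) \<kappa> (scl (dual SB) r \<psi>)"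
proof (cases "r = 0")
 case True
 then show ?thesis
  using dual_zeroC_mk[OF m \<kappa>] projC_dual_mk[OF m a \<kappa> \<psi>] dec.scl0_A[OF a] dual_fst[OF vSB \<psi>] by (simp add: dual_sclC_def)
next
 case False
 interpret S: fibre_space "fibre SA m" "add SA" "scl SA" "zer SA m" by (rule spSA[OF dec.dc_W[OF dc m]])
 have ra: "scl SA (1 / r) (scl SA r a) = a" using S.sc_sc[OF a] S.sc_one[OF a] False by simp
 note sa = vb_scl_in[OF vSA a, of r]
 have "r * snd (dual_mk ga a \<kappa> \<psi>) (scl DB (1 / r) d) = snd (scl (dual SB) r \<psi>) (proj DB d) + snd \<kappa> (ga d)"
  if d: "d \<in> fibre DA (scl SA r a)" for d
 proof -
  obtain b c where bc: "b \<in> fibre SB m" "c \<in> fibre CC m" and e: "d = mk (scl SA r a) b c" by (rule fibre_mkE[OF m sa d])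
  show ?thesis
   unfolding e dec.mk_sclB[OF dc m sa bc] ra dual_mk_apply[OF m a bc(1) vb_scl_in[OF vCC bc(2)]]
    dual_scl[OF vCC \<kappa> bc(2)] dec.mk_B[OF dc m sa bc] dec.mk_ga[OF dc m sa bc]
   using False by (simp add: algebra_simps)
 qed
 note eq = this
 have f: "fst (dual_mk ga a \<kappa> \<psi>) = a" by (simp add: dual_mk_def)
 show ?thesis
  unfolding dual_sclC_def if_not_P[OF False] Let_def f
  by (subst (2) dual_mk_def) (simp only: eq cong: if_cong)
qed

lemma dual_decomposition: "decomposition (dual_dvb D) (dual SB) (dual_core D) W (dual_mk ga) (dual_ga mk)"
proof -
 let ?Z = "{\<Phi> \<in> pts (tot (dual DA)). bp \<Phi> \<in> W}"
 note L = vb_tot[OF vDS]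
 have Z: "?Z \<subseteq> pts (tot (dual DA))" by blast
 have idZ: "smooth_on (tot (dual DA)) ?Z (%\<Phi>. \<Phi>) (tot (dual DA))" by (rule smooth_on_id[OF L Z])
 have fs: "smooth_on (tot (dual DA)) ?Z (%\<Phi>. fst \<Phi>) (tot SA)"
  using smooth_on_subset[OF vb_proj_smooth[OF vDS] Z] by simp
 have bs: "smooth_on (tot (dual DA)) ?Z bp MM"
  by (rule vb_proj_smooth_compose[OF vSA L fs])
 have F: "bp \<Phi> \<in> W" "fst \<Phi> \<in> fibre SA (bp \<Phi>)" "\<Phi> \<in> fibre (dual DA) (fst \<Phi>)" if "\<Phi> \<in> ?Z" for \<Phi>
  using that smooth_on_image_pts[OF L fs that] by (simp_all add: fibre_def)
 have ga_s: "smooth_on (tot (dual DA)) ?Z (dual_ga mk) (tot (dual SB))"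
 proof (rule dual_smooth_into[OF vSB L, where b = "%\<Phi>. bp \<Phi>"])
  show "dual_ga mk \<Phi> \<in> fibre (dual SB) (bp \<Phi>)" if "\<Phi> \<in> ?Z" for \<Phi> by (rule dual_ga_in[OF F[OF that]])
  show "smooth_on (tot (dual DA)) ?Z bp (base SB)" using bs by simp
  fix W' x assume x: "smooth_on (base SB) W' x (tot SB)" "!!m. m \<in> W' ==> x m \<in> fibre SB m"
  let ?Z' = "{\<Phi> \<in> ?Z. bp \<Phi> \<in> W'}"
  have sub: "?Z' \<subseteq> ?Z" by blast
  note bs' = smooth_on_subset[OF bs sub] and fs' = smooth_on_subset[OF fs sub]
  have F': "\<Phi> \<in> ?Z" "bp \<Phi> \<in> W'" if "\<Phi> \<in> ?Z'" for \<Phi> using that by simp_all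
  have xs: "smooth_on (tot (dual DA)) ?Z' (%\<Phi>. x (bp \<Phi>)) (tot SB)"
   by (rule smooth_on_compose[OF L preM preB x(1)[unfolded baseB] bs' F'(2)])
  have zs: "smooth_on (tot (dual DA)) ?Z' (%\<Phi>. zer CC (bp \<Phi>)) (tot CC)" by (rule dec.smooth_zerC[OF L bs'])
  have mW: "bp \<Phi> \<in> W" "fst \<Phi> \<in> fibre SA (bp \<Phi>)"
   "x (bp \<Phi>) \<in> fibre SB (bp \<Phi>)" "zer CC (bp \<Phi>) \<in> fibre CC (bp \<Phi>)"
   if "\<Phi> \<in> ?Z'" for \<Phi>
   by (rule F(1,2)[OF F'(1)[OF that]] x(2)[OF F'(2)[OF that]] dec.zC[OF dec.dc_W[OF dc F(1)[OF F'(1)[OF that]]]])+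
  have "smooth_real (tot (dual DA)) ?Z' (%\<Phi>. snd \<Phi> (mk (fst \<Phi>) (x (bp \<Phi>)) (zer CC (bp \<Phi>))))"
  proof (rule dual_eval_smooth[OF vDA L smooth_on_subset[OF idZ sub]])
   show "smooth_on (tot (dual DA)) ?Z' (%\<Phi>. mk (fst \<Phi>) (x (bp \<Phi>)) (zer CC (bp \<Phi>))) (tot DA)"
    by (rule dec.mk_smooth[OF dc L fs' xs zs mW])
   show "proj DA (mk (fst \<Phi>) (x (bp \<Phi>)) (zer CC (bp \<Phi>))) = fst \<Phi>" if "\<Phi> \<in> ?Z'" for \<Phi>
    by (rule dec.mk_A[OF dc mW[OF that]])
  qed
  then show "smooth_real (tot (dual DA)) ?Z' (%\<Phi>. snd (dual_ga mk \<Phi>) (x (bp \<Phi>)))"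
   by (rule smooth_real_cong) (rule dual_ga_apply[OF F(2,3)[OF F'(1)] mW(3), symmetric])
 qed
 let ?S = "{p. \<exists>m\<in>W. fst p \<in> fibre SA m \<and> fst (snd p) \<in> fibre (dual CC) m \<and> snd (snd p) \<in> fibre (dual SB) m}"
 let ?N = "prod_manifold (tot SA) (prod_manifold (tot (dual CC)) (tot (dual SB)))"
 note pC = vb_tot[OF vCS] and pB = vb_tot[OF vSS]
 note N2 = pre_manifold_prod[OF pC pB]
 note N = pre_manifold_prod[OF preA N2]
 have S: "proj SA (fst p) \<in> W" "fst p \<in> fibre SA (proj SA (fst p))" "fst (snd p) \<in> fibre (dual CC) (proj SA (fst p))"
  "snd (snd p) \<in> fibre (dual SB) (proj SA (fst p))" if "p \<in> ?S" for p
 proof -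
  obtain m where m: "m \<in> W" "fst p \<in> fibre SA m" "fst (snd p) \<in> fibre (dual CC) m" "snd (snd p) \<in> fibre (dual SB) m"
   using \<open>p \<in> ?S\<close> by blast
  have e: "proj SA (fst p) = m" by (rule fibreD(2)[OF m(2)])
  show "proj SA (fst p) \<in> W" "fst p \<in> fibre SA (proj SA (fst p))" "fst (snd p) \<in> fibre (dual CC) (proj SA (fst p))"
   "snd (snd p) \<in> fibre (dual SB) (proj SA (fst p))"
   unfolding e by (rule m)+
 qed
 have Sp: "?S \<subseteq> pts (tot SA) \<times> (pts (tot (dual CC)) \<times> pts (tot (dual SB)))"
 proof
  fix p assume p: "p \<in> ?S"
  then show "p \<in> pts (tot SA) \<times> (pts (tot (dual CC)) \<times> pts (tot (dual SB)))"
   using fibreD(1)[OF S(2)[OF p]] fibreD(1)[OF S(3)[OF p]] fibreD(1)[OF S(4)[OF p]] by (simp add: mem_Times_iff)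
 qed
 note f1 = smooth_triple(1)[OF preA pC pB Sp] and g1 = smooth_triple(2)[OF preA pC pB Sp] and g2 = smooth_triple(3)[OF preA pC pB Sp]
 have mk_s: "smooth_on ?N ?S (%p. dual_mk ga (fst p) (fst (snd p)) (snd (snd p))) (tot (dual DA))"
 proof (rule dual_smooth_into[OF vDA N, where b = "%p. fst p"])
  show "dual_mk ga (fst p) (fst (snd p)) (snd (snd p)) \<in> fibre (dual DA) (fst p)" if "p \<in> ?S" for p
   by (rule dual_mk_in[OF S[OF that]])
  show "smooth_on ?N ?S (%p. fst p) (base DA)" using f1 by simp
  fix W' x assume x: "smooth_on (base DA) W' x (tot DA)" "!!a. a \<in> W' ==> x a \<in> fibre DA a"
  let ?S' = "{p \<in> ?S. fst p \<in> W'}"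
  have sub: "?S' \<subseteq> ?S" by blast
  have S': "p \<in> ?S" "fst p \<in> W'" if "p \<in> ?S'" for p using that by simp_all
  note xf = x(2)[OF S'(2)]
  have xs: "smooth_on ?N ?S' (%p. x (fst p)) (tot DA)"
   by (rule smooth_on_compose[OF N preA preD x(1)[unfolded baseDA] smooth_on_subset[OF f1 sub] S'(2)])
  have sl: "x (fst p) \<in> slice D (proj SA (fst p))" if "p \<in> ?S'" for p
   by (rule slice_fibre[OF xf[OF that] S(2)[OF S'(1)[OF that]]])
  have gs: "smooth_on ?N ?S' (%p. ga (x (fst p))) (tot CC)"
  proof (rule smooth_on_compose[OF N preD vb_tot[OF vCC] dec.ga_smooth[OF dc] xs])
   fix p assume p: "p \<in> ?S'"
   show "x (fst p) \<in> {d \<in> total D. dvb_proj D d \<in> W}"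
    using sl[OF p] S(1)[OF S'(1)[OF p]] by (simp add: slice_def)
  qed
  have "smooth_real ?N ?S' (%p. snd (snd (snd p)) (proj DB (x (fst p))) + snd (fst (snd p)) (ga (x (fst p))))"
  proof (rule smooth_real_add[OF N])
   show "smooth_real ?N ?S' (%p. snd (snd (snd p)) (proj DB (x (fst p))))"
   proof (rule dual_eval_smooth[OF vSB N smooth_on_subset[OF g2 sub] smooth_projB[OF N xs]])
    fix p assume p: "p \<in> ?S'"
    show "proj SB (proj DB (x (fst p))) = fst (snd (snd p))"
     using fibreD(2)[OF dec.slice_B[OF sl[OF p]]] dual_fst[OF vSB S(4)[OF S'(1)[OF p]]] by simp
   qed
   show "smooth_real ?N ?S' (%p. snd (fst (snd p)) (ga (x (fst p))))"
   proof (rule dual_eval_smooth[OF vCC N smooth_on_subset[OF g1 sub] gs])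
    fix p assume p: "p \<in> ?S'"
    show "proj CC (ga (x (fst p))) = fst (fst (snd p))"
     using fibreD(2)[OF dec.ga_in[OF dc sl[OF p] S(1)[OF S'(1)[OF p]]]] dual_fst[OF vCC S(3)[OF S'(1)[OF p]]] by simp
   qed
  qed
  then show "smooth_real ?N ?S' (%p. snd (dual_mk ga (fst p) (fst (snd p)) (snd (snd p))) (x (fst p)))"
   by (rule smooth_real_cong) (simp add: dual_mk_def xf)
 qed
 show ?thesis
  unfolding decomposition_def dual_dvb_simps dvb_proj_dual
 proof (intro conjI ballI allI impI)
  show "openin (mtop MM) W" by (rule dec.dc_open[OF dc])
  show "smooth_on (tot (dual DA)) ?Z (dual_ga mk) (tot (dual SB))" by (rule ga_s)
  show "smooth_on ?N ?S (%p. dual_mk ga (fst p) (fst (snd p)) (snd (snd p))) (tot (dual DA))" by (rule mk_s)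
 next
  fix m a \<kappa> \<psi> assume h: "m \<in> W" "a \<in> fibre SA m" "\<kappa> \<in> fibre (dual CC) m" "\<psi> \<in> fibre (dual SB) m"
  show "dual_mk ga a \<kappa> \<psi> \<in> pts (tot (dual DA))" by (rule fibreD(1)[OF dual_mk_in[OF h]])
  show "proj (dual DA) (dual_mk ga a \<kappa> \<psi>) = a" by (simp add: dual_mk_def)
  show "dual_projC D (dual_mk ga a \<kappa> \<psi>) = \<kappa>" by (rule projC_dual_mk[OF h])
  show "dual_ga mk (dual_mk ga a \<kappa> \<psi>) = \<psi>" by (rule ga_dual_mk[OF h])
  fix r
  show "dual_sclC D r (dual_mk ga a \<kappa> \<psi>) = dual_mk ga (scl SA r a) \<kappa> (scl (dual SB) r \<psi>)" by (rule dual_mk_sclC[OF h])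
  show "scl (dual DA) r (dual_mk ga a \<kappa> \<psi>) = dual_mk ga a (scl (dual CC) r \<kappa>) (scl (dual SB) r \<psi>)"
   by (auto simp: dual_mk_def algebra_simps)
 next
  fix \<Phi> assume \<Phi>: "\<Phi> \<in> pts (tot (dual DA))" "bp \<Phi> \<in> W"
  then have \<Phi>: "\<Phi> \<in> ?Z" by simp
  show "dual_ga mk \<Phi> \<in> fibre (dual SB) (bp \<Phi>)" by (rule dual_ga_in[OF F[OF \<Phi>]])
  show "dual_mk ga (proj (dual DA) \<Phi>) (dual_projC D \<Phi>) (dual_ga mk \<Phi>) = \<Phi>"
   using dual_mk_ga[OF F[OF \<Phi>]] by simp
 next
  fix m a \<kappa> \<kappa>' \<psi> \<psi>'
  show "add (dual DA) (dual_mk ga a \<kappa> \<psi>) (dual_mk ga a \<kappa>' \<psi>') = dual_mk ga a (add (dual CC) \<kappa> \<kappa>') (add (dual SB) \<psi> \<psi>')"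
   by (auto simp: dual_mk_def)
 next
  fix m a a' \<kappa> \<psi> \<psi>'
  assume "m \<in> W" "a \<in> fibre SA m" "a' \<in> fibre SA m" "\<kappa> \<in> fibre (dual CC) m" "\<psi> \<in> fibre (dual SB) m" "\<psi>' \<in> fibre (dual SB) m"
  then show "dual_addC D (dual_mk ga a \<kappa> \<psi>) (dual_mk ga a' \<kappa> \<psi>') = dual_mk ga (add SA a a') \<kappa> (add (dual SB) \<psi> \<psi>')"
   by (intro dual_mk_addC)
 next
  fix m \<psi> assume "m \<in> W" "\<psi> \<in> fibre (dual SB) m"
  then show "dual_core D \<psi> = dual_mk ga (zer SA m) (zer (dual CC) m) \<psi>" using dual_core_mk by simp
 qed
qed

end

sublocale du: decomposed_dvb "dual_dvb D" "dual SB" "dual_core D"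
proof
 show "pre_manifold (tot (over_A (dual_dvb D)))" using vb_tot[OF vDS] by simp
 show "smooth_on (tot (over_A (dual_dvb D))) (total (dual_dvb D)) (proj (over_A (dual_dvb D))) (tot (side_A (dual_dvb D)))"
  using vb_proj_smooth[OF vDS] by simp
 show "smooth_on (tot (over_A (dual_dvb D))) (total (dual_dvb D)) (proj (over_B (dual_dvb D))) (tot (side_B (dual_dvb D)))"
  using projC_smooth by simp
 show "proj (side_B (dual_dvb D)) (proj (over_B (dual_dvb D)) \<Phi>) = proj (side_A (dual_dvb D)) (proj (over_A (dual_dvb D)) \<Phi>)" for \<Phi>
  by (simp add: dual_projC_def Let_def)
 fix m assume "m \<in> pts (dvb_base (dual_dvb D))"
 then have "m \<in> pts MM" by simp
 then obtain W mk ga where W: "m \<in> W" and dc: "decomposition D CC (%c. c) W mk ga" by (rule dec.decompE)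
 from conjI[OF W dual_decomposition[OF dc]]
 show "\<exists>W mk ga. m \<in> W \<and> decomposition (dual_dvb D) (dual SB) (dual_core D) W mk ga" by (intro exI)
qed (simp_all add: vSA vSS vCS)


section \<open>The pairing\<close>

abbreviation "XX \<equiv> double_linear_bundle D"
abbreviation "YY \<equiv> double_linear_bundle (dual_dvb D)"

text \<open>The restriction of a double-linear function to the fibre of \<open>D \<rightarrow> A\<close> over \<open>a\<close>, a linear form.\<close>

definition restr :: "'m \<times> ('d => real) => 'a => 'a \<times> ('d => real)" where
 "restr \<sigma> a = (a, %d. if d \<in> fibre DA a then snd \<sigma> d else 0)"

context
 fixes m \<sigma> assumes \<sigma>: "\<sigma> \<in> fibre XX m"
begin

lemma restr_in:
 assumes a: "a \<in> fibre SA m" shows "restr \<sigma> a \<in> fibre (dual DA) a"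
 unfolding restr_def
proof (rule dualI[OF vDA])
 show "a \<in> pts (base DA)" using fibreD(1)[OF a] by simp
 fix d assume d: "d \<in> fibre DA a"
 show "(if scl DA r d \<in> fibre DA a then snd \<sigma> (scl DA r d) else 0) = r * (if d \<in> fibre DA a then snd \<sigma> d else 0)" for r
  using dec.X_sclA[OF \<sigma> slice_fibre[OF d a]] d vb_scl_in[OF vDA d] by simp
 fix d' assume d': "d' \<in> fibre DA a"
 show "(if add DA d d' \<in> fibre DA a then snd \<sigma> (add DA d d') else 0) =
   (if d \<in> fibre DA a then snd \<sigma> d else 0) + (if d' \<in> fibre DA a then snd \<sigma> d' else 0)"
  using dec.X_addA[OF \<sigma> slice_fibre[OF d a] slice_fibre[OF d' a]] d d' fibreD(2)[OF d] fibreD(2)[OF d'] vb_add_in[OF vDA d d'] by simp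
qed simp

text \<open>All restrictions of \<open>\<sigma>\<close> lie over the same element of the dual of the core, namely \<open>j(\<sigma>)\<close>; hence they can be
 added in the dual over \<open>A\<close> for its structure over that bundle.\<close>

lemma restr_projC:
 assumes a: "a \<in> fibre SA m" shows "dual_projC D (restr \<sigma> a) = seq_j CC (%c. c) \<sigma>"
proof -
 have m: "m \<in> pts MM" and fm: "fst \<sigma> = m" using \<sigma> unfolding dec.fibre_X_iff by simp_all
 note zc = cell_zA[OF a]
 have z0: "snd \<sigma> (zer DA a) = 0"
  using dec.X_sclA[OF \<sigma> slice_fibre[OF cell_fA[OF zc] a], of 0] fibre_space.sc_z[OF spA[OF zc]] by simp
 have "snd (restr \<sigma> a) (add DB (zer DA a) c) = snd \<sigma> c" if c: "c \<in> fibre CC m" for c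
 proof -
  have c': "c \<in> cell (zer SA m) (zer SB m)" using c unfolding fibre_core_iff by simp
  have "add DB (zer DA a) c \<in> fibre DA a"
   using cell_fA[OF cell_addB[OF zc c']] fibre_space.pl_z[OF spSA[OF m] a] by simp
  then show ?thesis
   using dec.X_addB[OF \<sigma> slice_fibre[OF cell_fA[OF zc] a] slice_fibre[OF cell_fA[OF c'] zSA[OF m]]] z0 cell_B[OF zc] cell_B[OF c']
   by (simp add: restr_def)
 qed
 note eq = this
 have f: "fst (restr \<sigma> a) = a" by (simp add: restr_def)
 show ?thesis
  unfolding dual_projC_def seq_j_def Let_def f fibreD(2)[OF a] fm by (simp only: eq cong: if_cong)
qed

context
 fixes W mk ga
 assumes dc: "decomposition D CC (%c. c) W mk ga" and m: "m \<in> W"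
begin

lemma restr_mk: "a \<in> fibre SA m ==> restr \<sigma> a = dual_mk ga a (seq_j CC (%c. c) \<sigma>) (dual_ga mk (restr \<sigma> a))"
 using dual_mk_ga[OF dc m _ restr_in] restr_projC by simp

lemma ga_restr:
 assumes a: "a \<in> fibre SA m" and b: "b \<in> fibre SB m"
 shows "snd (dual_ga mk (restr \<sigma> a)) b = snd \<sigma> (mk a b (zer CC m))"
 using dual_ga_apply[OF dc a restr_in[OF a] b] mk_fibre[OF dc m a b dec.zC[OF dec.dc_W[OF dc m]]] by (simp add: restr_def)

lemma restr_add:
 assumes a: "a \<in> fibre SA m" "a' \<in> fibre SA m"
 shows "restr \<sigma> (add SA a a') = dual_addC D (restr \<sigma> a) (restr \<sigma> a')"
proof -
 have dl: "double_linear D m (snd \<sigma>)" using \<sigma> unfolding dec.fibre_X_iff by simp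
 note aa = vb_add_in[OF vSA a]
 note g = dual_ga_in[OF dc m _ restr_in]
 have "dual_ga mk (restr \<sigma> (add SA a a')) = add (dual SB) (dual_ga mk (restr \<sigma> a)) (dual_ga mk (restr \<sigma> a'))"
 proof (rule dual_eqI[OF vSB g[OF aa aa] vb_add_in[OF vSS g[OF a(1) a(1)] g[OF a(2) a(2)]]])
  fix b assume b: "b \<in> fibre SB m"
  show "snd (dual_ga mk (restr \<sigma> (add SA a a'))) b = snd (add (dual SB) (dual_ga mk (restr \<sigma> a)) (dual_ga mk (restr \<sigma> a'))) b"
   using dec.dl_bilinear[OF dc dl m] a b unfolding bilinear_form_def dual_simps snd_conv ga_restr[OF aa b] ga_restr[OF a(1) b] ga_restr[OF a(2) b]
   by simp
 qed
 note e = this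
 have j: "seq_j CC (%c. c) \<sigma> \<in> fibre (dual CC) m" by (rule dec.seq_j_in[OF \<sigma>])
 show ?thesis
  using dual_mk_addC[OF dc m a(1) j g[OF a(1) a(1)] a(2) g[OF a(2) a(2)]] restr_mk[OF a(1)] restr_mk[OF a(2)] restr_mk[OF aa] e by simp
qed

lemma restr_scl:
 assumes a: "a \<in> fibre SA m"
 shows "restr \<sigma> (scl SA r a) = dual_sclC D r (restr \<sigma> a)"
proof -
 have dl: "double_linear D m (snd \<sigma>)" using \<sigma> unfolding dec.fibre_X_iff by simp
 note ra = vb_scl_in[OF vSA a]
 note g = dual_ga_in[OF dc m _ restr_in]
 have "dual_ga mk (restr \<sigma> (scl SA r a)) = scl (dual SB) r (dual_ga mk (restr \<sigma> a))"
 proof (rule dual_eqI[OF vSB g[OF ra ra] vb_scl_in[OF vSS g[OF a a]]])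
  fix b assume b: "b \<in> fibre SB m"
  show "snd (dual_ga mk (restr \<sigma> (scl SA r a))) b = snd (scl (dual SB) r (dual_ga mk (restr \<sigma> a))) b"
   using dec.dl_bilinear[OF dc dl m] a b unfolding bilinear_form_def dual_simps snd_conv ga_restr[OF ra b] ga_restr[OF a b]
   by simp
 qed
 note e = this
 have j: "seq_j CC (%c. c) \<sigma> \<in> fibre (dual CC) m" by (rule dec.seq_j_in[OF \<sigma>])
 have "restr \<sigma> (scl SA r a) = dual_mk ga (scl SA r a) (seq_j CC (%c. c) \<sigma>) (scl (dual SB) r (dual_ga mk (restr \<sigma> a)))"
  using restr_mk[OF ra, of r] unfolding e .
 also have "\<dots> = dual_sclC D r (restr \<sigma> a)"
  by (simp only: dual_mk_sclC[OF dc m a j g[OF a a], symmetric] restr_mk[OF a, symmetric])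
 finally show ?thesis .
qed

end

end

text \<open>The pairing of the two double-linear functions \<open>\<epsilon>\<close> and \<open>\<sigma>\<close>: the value of \<open>\<epsilon>\<close> at the restrictions of \<open>\<sigma>\<close>.\<close>

definition pairing ::
 "'m \<times> ('a \<times> ('d => real) => real) => 'm \<times> ('d => real) => 'm \<times> ('a => real)" where
 "pairing \<epsilon> \<sigma> = (fst \<epsilon>, %a. if a \<in> fibre SA (fst \<epsilon>) then snd \<epsilon> (restr \<sigma> a) else 0)"

lemma YY_fst: "\<epsilon> \<in> fibre YY m ==> fst \<epsilon> = m" and XX_fst: "\<sigma> \<in> fibre XX m ==> fst \<sigma> = m"
 unfolding du.fibre_X_iff dec.fibre_X_iff by simp_all

lemma restr_slice: "\<sigma> \<in> fibre XX m ==> a \<in> fibre SA m ==> restr \<sigma> a \<in> slice (dual_dvb D) m"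
 by (rule dual_sliceI[OF restr_in])

lemma pairing_apply: "\<epsilon> \<in> fibre YY m ==> a \<in> fibre SA m ==> snd (pairing \<epsilon> \<sigma>) a = snd \<epsilon> (restr \<sigma> a)"
 using YY_fst by (simp add: pairing_def)

lemma pairing_in:
 assumes \<epsilon>: "\<epsilon> \<in> fibre YY m" and \<sigma>: "\<sigma> \<in> fibre XX m"
 shows "pairing \<epsilon> \<sigma> \<in> fibre (dual SA) m"
proof -
 have m: "m \<in> pts MM" using \<sigma> unfolding dec.fibre_X_iff by simp
 obtain W mk ga where W: "m \<in> W" and dc: "decomposition D CC (%c. c) W mk ga" by (rule dec.decompE[OF m])
 define f where "f = snd (pairing \<epsilon> \<sigma>)"
 have e: "pairing \<epsilon> \<sigma> = (m, f)" using YY_fst[OF \<epsilon>] by (simp add: pairing_def f_def)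
 have "(m, f) \<in> fibre (dual SA) m"
 proof (rule dualI[OF vSA m])
  fix a assume a: "a \<in> fibre SA m"
  note s = restr_slice[OF \<sigma> a]
  show "f (scl SA r a) = r * f a" for r
   unfolding f_def pairing_apply[OF \<epsilon> a] pairing_apply[OF \<epsilon> vb_scl_in[OF vSA a]] restr_scl[OF \<sigma> dc W a]
   using du.X_sclB[OF \<epsilon> s] by simp
  fix a' assume a': "a' \<in> fibre SA m"
  note s' = restr_slice[OF \<sigma> a']
  show "f (add SA a a') = f a + f a'"
   unfolding f_def pairing_apply[OF \<epsilon> a] pairing_apply[OF \<epsilon> a'] pairing_apply[OF \<epsilon> vb_add_in[OF vSA a a']] restr_add[OF \<sigma> dc W a a']
   using du.X_addB[OF \<epsilon> s s'] restr_projC[OF \<sigma> a] restr_projC[OF \<sigma> a'] by simp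
 next
  fix a assume "a \<notin> fibre SA m"
  then show "f a = 0" using YY_fst[OF \<epsilon>] by (simp add: f_def pairing_def)
 qed
 then show ?thesis using e by simp
qed

lemma pairing_smooth:
 "smooth_on (prod_manifold (tot YY) (tot XX)) (fibre_product YY XX) (%(\<epsilon>, \<sigma>). pairing \<epsilon> \<sigma>) (tot (dual SA))"
proof -
 let ?N = "prod_manifold (tot YY) (tot XX)" and ?Z = "fibre_product YY XX"
 note pY = vb_tot[OF du.vector_bundle_X] and pX = vb_tot[OF dec.vector_bundle_X]
 note N = pre_manifold_prod[OF pY pX]
 have ZP: "?Z \<subseteq> pts (tot YY) \<times> pts (tot XX)" by (auto simp: fibre_product_def)
 have Z: "fst p \<in> fibre YY (fst (fst p))" "snd p \<in> fibre XX (fst (fst p))" if "p \<in> ?Z" for p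
  using that by (auto simp: fibre_product_def fibre_def)
 have s1: "smooth_on ?N ?Z (%p. fst p) (tot YY)" by (rule smooth_on_fst[OF pY pX ZP])
 have s2: "smooth_on ?N ?Z (%p. snd p) (tot XX)" by (rule smooth_on_snd[OF pY pX ZP])
 have b: "smooth_on ?N ?Z (%p. fst (fst p)) MM"
  using vb_proj_smooth_compose[OF du.vector_bundle_X N s1] by simp
 have "smooth_on ?N ?Z (%p. pairing (fst p) (snd p)) (tot (dual SA))"
 proof (rule dual_smooth_into[OF vSA N _ b])
  show "pairing (fst p) (snd p) \<in> fibre (dual SA) (fst (fst p))" if "p \<in> ?Z" for p by (rule pairing_in[OF Z[OF that]])
  fix W x assume x: "smooth_on MM W x (tot SA)" "!!m. m \<in> W ==> x m \<in> fibre SA m"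
  let ?Z' = "{p \<in> ?Z. fst (fst p) \<in> W}"
  have sub: "?Z' \<subseteq> ?Z" by blast
  have Z': "p \<in> ?Z" "fst (fst p) \<in> W" if "p \<in> ?Z'" for p using that by simp_all
  note xf = x(2)[OF Z'(2)] and ZX = Z(2)[OF Z'(1)]
  have xs: "smooth_on ?N ?Z' (%p. x (fst (fst p))) (tot SA)"
   by (rule smooth_on_compose[OF N preM preA x(1) smooth_on_subset[OF b sub] Z'(2)])
  have rs: "smooth_on ?N ?Z' (%p. restr (snd p) (x (fst (fst p)))) (tot (dual DA))"
  proof (rule dual_smooth_into[OF vDA N, where b = "%p. x (fst (fst p))"])
   show "restr (snd p) (x (fst (fst p))) \<in> fibre (dual DA) (x (fst (fst p)))" if "p \<in> ?Z'" for p
    by (rule restr_in[OF ZX[OF that] xf[OF that]])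
   show "smooth_on ?N ?Z' (%p. x (fst (fst p))) (base DA)" using xs by simp
   fix W' y assume y: "smooth_on (base DA) W' y (tot DA)" "!!a. a \<in> W' ==> y a \<in> fibre DA a"
   let ?Z2 = "{p \<in> ?Z'. x (fst (fst p)) \<in> W'}"
   have sub2: "?Z2 \<subseteq> ?Z'" by blast
   have Z2: "p \<in> ?Z'" "x (fst (fst p)) \<in> W'" if "p \<in> ?Z2" for p using that by simp_all
   have "smooth_real ?N ?Z2 (%p. snd (snd p) (y (x (fst (fst p)))))"
   proof (rule dec.X_eval_smooth[OF N smooth_on_subset[OF s2 subset_trans[OF sub2 sub]]])
    show "smooth_on ?N ?Z2 (%p. y (x (fst (fst p)))) (tot DA)"
     by (rule smooth_on_compose[OF N preA preD y(1)[unfolded baseDA] smooth_on_subset[OF xs sub2] Z2(2)])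
    show "y (x (fst (fst p))) \<in> slice D (fst (snd p))" if "p \<in> ?Z2" for p
     using slice_fibre[OF y(2)[OF Z2(2)[OF that]] xf[OF Z2(1)[OF that]]] XX_fst[OF ZX[OF Z2(1)[OF that]]] by simp
   qed
   then show "smooth_real ?N ?Z2 (%p. snd (restr (snd p) (x (fst (fst p)))) (y (x (fst (fst p)))))"
    by (rule smooth_real_cong) (simp add: restr_def y(2))
  qed
  have "smooth_real ?N ?Z' (%p. snd (fst p) (restr (snd p) (x (fst (fst p)))))"
  proof (rule du.X_eval_smooth[OF N smooth_on_subset[OF s1 sub]])
   show "smooth_on ?N ?Z' (%p. restr (snd p) (x (fst (fst p)))) (tot (over_A (dual_dvb D)))" using rs by simp
   show "restr (snd p) (x (fst (fst p))) \<in> slice (dual_dvb D) (fst (fst p))" if "p \<in> ?Z'" for p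
    by (rule restr_slice[OF ZX[OF that] xf[OF that]])
  qed
  then show "smooth_real ?N ?Z' (%p. snd (pairing (fst p) (snd p)) (x (fst (fst p))))"
   by (rule smooth_real_cong) (rule pairing_apply[OF Z(1)[OF Z'(1)] xf, symmetric])
 qed
 then show ?thesis by (simp only: case_prod_unfold)
qed

lemma pairing_bilinear: "bilinear_pairing YY XX (dual SA) pairing"
 unfolding bilinear_pairing_def
proof (intro conjI ballI allI pairing_smooth)
 fix m \<epsilon> \<sigma> assume \<epsilon>: "\<epsilon> \<in> fibre YY m" and \<sigma>: "\<sigma> \<in> fibre XX m"
 note i = pairing_in[OF \<epsilon> \<sigma>]
 show "pairing \<epsilon> \<sigma> \<in> fibre (dual SA) m" by (rule i)
 show "pairing (add YY \<epsilon> \<epsilon>') \<sigma> = add (dual SA) (pairing \<epsilon> \<sigma>) (pairing \<epsilon>' \<sigma>)" if \<epsilon>': "\<epsilon>' \<in> fibre YY m" for \<epsilon>'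
  using YY_fst[OF \<epsilon>] YY_fst[OF \<epsilon>'] by (auto simp: pairing_def)
 show "pairing (scl YY r \<epsilon>) \<sigma> = scl (dual SA) r (pairing \<epsilon> \<sigma>)" for r
  by (auto simp: pairing_def)
 show "pairing \<epsilon> (add XX \<sigma> \<sigma>') = add (dual SA) (pairing \<epsilon> \<sigma>) (pairing \<epsilon> \<sigma>')" if \<sigma>': "\<sigma>' \<in> fibre XX m" for \<sigma>'
 proof (rule dual_eqI[OF vSA pairing_in[OF \<epsilon> vb_add_in[OF dec.vector_bundle_X \<sigma> \<sigma>']]
    vb_add_in[OF vector_bundle_dual[OF vSA] i pairing_in[OF \<epsilon> \<sigma>']]])
  fix a assume a: "a \<in> fibre SA m"
  have "restr (add XX \<sigma> \<sigma>') a = add (dual DA) (restr \<sigma> a) (restr \<sigma>' a)" by (auto simp: restr_def)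
  then show "snd (pairing \<epsilon> (add XX \<sigma> \<sigma>')) a = snd (add (dual SA) (pairing \<epsilon> \<sigma>) (pairing \<epsilon> \<sigma>')) a"
   using du.X_addA[OF \<epsilon> restr_slice[OF \<sigma> a] restr_slice[OF \<sigma>' a]]
   by (simp add: pairing_apply[OF \<epsilon> a] restr_def)
 qed
 show "pairing \<epsilon> (scl XX r \<sigma>) = scl (dual SA) r (pairing \<epsilon> \<sigma>)" for r
 proof (rule dual_eqI[OF vSA pairing_in[OF \<epsilon> vb_scl_in[OF dec.vector_bundle_X \<sigma>]] vb_scl_in[OF vector_bundle_dual[OF vSA] i]])
  fix a assume a: "a \<in> fibre SA m"
  have "restr (scl XX r \<sigma>) a = scl (dual DA) r (restr \<sigma> a)" by (auto simp: restr_def)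
  then show "snd (pairing \<epsilon> (scl XX r \<sigma>)) a = snd (scl (dual SA) r (pairing \<epsilon> \<sigma>)) a"
   using du.X_sclA[OF \<epsilon> restr_slice[OF \<sigma> a], of r]
   by (simp add: pairing_apply[OF \<epsilon> a])
 qed
qed

text \<open>The restriction of \<open>i(\<theta>)\<close> to the fibre over \<open>a\<close> is the sum of the zero form and the core element given by
 \<open>\<theta>(a, -)\<close>.\<close>

lemma pairing_i:
 assumes \<epsilon>: "\<epsilon> \<in> fibre YY m" and \<theta>: "\<theta> \<in> fibre (tensor (dual SA) (dual SB)) m"
 shows "pairing \<epsilon> (seq_i D \<theta>) = contract (dual SA) (seq_j (dual SB) (dual_core D) \<epsilon>) \<theta>"
proof (rule contract_eq[OF vSA _ pairing_in[OF \<epsilon> dec.seq_i_in[OF \<theta>]], symmetric])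
 show f\<theta>: "fst \<theta> = m" using \<theta> unfolding dec.fibre_T_iff by simp
 fix a assume a: "a \<in> fibre SA m"
 have m: "m \<in> pts MM" by (rule vb_fibre_base[OF vSA a])
 obtain W mk ga where W: "m \<in> W" and dc: "decomposition D CC (%c. c) W mk ga" by (rule dec.decompE[OF m])
 note dd = dual_decomposition[OF dc]
 define \<psi> where "\<psi> = (m, %b. if b \<in> fibre SB m then snd \<theta> (bidual_map SA a, bidual_map SB b) else 0)"
 have bl: "bilinear_form SA SB m (%p. snd \<theta> (bidual_map SA (fst p), bidual_map SB (snd p)))" by (rule dec.T_bilinear[OF \<theta>])
 have \<psi>: "\<psi> \<in> fibre (dual SB) m"
  unfolding \<psi>_def
 proof (rule dualI[OF vSB])
  show "m \<in> pts (base SB)" using m by simp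
 qed (use bl a vb_add_in[OF vSB] vb_scl_in[OF vSB] in \<open>simp_all add: bilinear_form_def\<close>)
 note z0 = dual_zeros(2)[OF dc W] and z1 = dual_zeros(1)[OF dc W]
 have eq: "snd (seq_i D \<theta>) d = snd \<psi> (proj DB d)" if d: "d \<in> fibre DA a" for d
  using dec.seq_i_apply[of d \<theta>] slice_fibre[OF d a] dec.slice_B[OF slice_fibre[OF d a]] fibreD(2)[OF d] f\<theta> by (simp add: \<psi>_def)
 have r: "restr (seq_i D \<theta>) a = dual_mk ga a (m, %c. 0) \<psi>"
  unfolding restr_def dual_mk_def by (simp add: eq cong: if_cong)
 have dl: "double_linear (dual_dvb D) m (snd \<epsilon>)" using \<epsilon> unfolding du.fibre_X_iff by simp
 have zz: "snd \<epsilon> (dual_mk ga a (m, %c. 0) (m, %b. 0)) = 0"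
 proof -
  have "scl (dual DA) 0 (dual_mk ga a (m, %c. 0) (m, %b. 0)) = dual_mk ga a (m, %c. 0) (m, %b. 0)"
   by (simp add: dual_mk_def cong: if_cong)
  then show ?thesis
   using du.X_sclA[OF \<epsilon> dual_sliceI[OF dual_mk_in[OF dc W a z0 z1] a], of 0] by simp
 qed
 have "snd (pairing \<epsilon> (seq_i D \<theta>)) a = snd \<epsilon> (dual_mk ga a (m, %c. 0) \<psi>)"
  unfolding pairing_apply[OF \<epsilon> a] r ..
 also have "\<dots> = snd \<epsilon> (dual_mk ga a (m, %c. 0) (m, %b. 0)) + snd \<epsilon> (dual_core D \<psi>)"
  using du.dl_eq[OF dd dl W, of a "(m, %c. 0)" \<psi>] a z0 \<psi> by simp
 also have "\<dots> = snd (seq_j (dual SB) (dual_core D) \<epsilon>) \<psi>"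
  using zz \<psi> YY_fst[OF \<epsilon>] by (simp add: seq_j_def)
 also have "\<dots> = snd \<theta> (bidual_map SA a, seq_j (dual SB) (dual_core D) \<epsilon>)"
 proof -
  obtain b where b: "b \<in> fibre SB m" "bidual_map SB b = seq_j (dual SB) (dual_core D) \<epsilon>"
   by (rule bidual_surj[OF vSB du.seq_j_in[OF \<epsilon>]])
  have "snd (bidual_map SB b) \<psi> = snd \<psi> b" by (rule bidual_apply[OF vSB]) (use \<psi> fibreD(2)[OF b(1)] in simp)
  then show ?thesis using b by (simp add: \<psi>_def)
 qed
 finally show "snd (pairing \<epsilon> (seq_i D \<theta>)) a = snd \<theta> (bidual_map SA a, seq_j (dual SB) (dual_core D) \<epsilon>)" .
qed

lemma pairing_e:
 assumes \<kappa>: "\<kappa> \<in> fibre (tensor (dual SA) (dual (dual CC))) m" and \<sigma>: "\<sigma> \<in> fibre XX m"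
 shows "pairing (seq_i (dual_dvb D) \<kappa>) \<sigma> = contract (dual SA) (bidual_map (dual CC) (seq_j CC (%c. c) \<sigma>)) \<kappa>"
proof -
 have \<kappa>': "\<kappa> \<in> fibre du.TT m" using \<kappa> by simp
 note i = du.seq_i_in[OF \<kappa>']
 have f\<kappa>: "fst \<kappa> = m" using \<kappa>' unfolding du.fibre_T_iff by simp
 show ?thesis
 proof (rule contract_eq[OF vSA f\<kappa> pairing_in[OF i \<sigma>], symmetric])
  fix a assume a: "a \<in> fibre SA m"
  show "snd (pairing (seq_i (dual_dvb D) \<kappa>) \<sigma>) a = snd \<kappa> (bidual_map SA a, bidual_map (dual CC) (seq_j CC (%c. c) \<sigma>))"
   unfolding pairing_apply[OF i a]
   using du.seq_i_apply[of "restr \<sigma> a" \<kappa>] restr_slice[OF \<sigma> a] f\<kappa> restr_projC[OF \<sigma> a] by (simp add: restr_def)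
 qed
qed

theorem sequences_in_duality:
 "in_duality (dual SA) (dual SB) (dual CC) XX (seq_i D) (seq_j CC (%c. c))
  YY (seq_i (dual_dvb D)) (seq_j (dual SB) (dual_core D))"
 unfolding in_duality_def
proof (intro conjI vector_bundle_dual[OF vSA] vSS vCS exI[of _ pairing] pairing_bilinear ballI)
 show "short_exact (tensor (dual SA) (dual SB)) XX (dual CC) (seq_i D) (seq_j CC (%c. c))" by (rule dec.short_exact_X)
 show "short_exact (tensor (dual SA) (dual (dual CC))) YY (dual (dual SB)) (seq_i (dual_dvb D)) (seq_j (dual SB) (dual_core D))"
  using du.short_exact_X by simp
qed (simp_all add: pairing_i pairing_e)

end

theorem theorem4p10:
  fixes D :: "('d, 'a, 'b, 'm) dvb"
  assumes "double_vector_bundle D"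
  shows "in_duality (dual (side_A D)) (dual (side_B D)) (dual (core D))
    (double_linear_bundle D) (seq_i D) (seq_j (core D) (\<lambda>c. c))
    (double_linear_bundle (dual_dvb D)) (seq_i (dual_dvb D))
    (seq_j (dual (side_B D)) (dual_core D))"
  by (rule dvb.sequences_in_duality) (unfold_locales, rule assms)

end
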